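(* There is a non-polynomial function $\mathcal{T}=\mathcal{T}(x,v)$ (unique up to multiplication by nonzero constants and addition of polynomials), which solves the problem below for some polynomial right-hand side and satisfies $\mathcal{T}(\lambda^3x,\lambda v)=\lambda^5\mathcal{T}(x,v)$ for all $\lambda>0$, such that the following holds. Let $\beta\ge0$, let $p$ be any polynomial in $t,x,v$, and let $f$ be any weak solution of $$\partial_tf+v\cdot\nabla_xf-\Delta_vf=p\quad\text{in }\mathbb{R}\times\{x_n>0\}\times\mathbb{R}^n,$$ $$f(t,x,v)=f(t,x,\mathcal{R}_xv)\quad\text{on }\mathbb{R}\times\{x_n=0\}\times\mathbb{R}^n,$$ satisfying, for some constant $C$, the growth condition $$|f(t,x,v)|\le C\big(1+|t|^{1/2}+|x|^{1/3}+|v|\big)^\beta.$$ (1) If $\beta<5$, then $f$ is a polynomial. (2) If $\beta=5$, then $f$ is a linear combination of a polynomial and $\mathcal{T}$.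
   Context: Here $t\in\mathbb{R}$, $x,v\in\mathbb{R}^n$, $v=(v',v_n)$, and $\mathcal{R}_xv=(v',-v_n)$ is the reflection of $v$ in the boundary hyperplane. Weak solution, with $D=\mathbb{R}\times\{x_n>0\}\times\mathbb{R}^n$: $f,\nabla_vf\in L^2_{loc}(\overline D)$ and $\int_D[-f(\partial_t\varphi+v\cdot\nabla_x\varphi)+\nabla_vf\cdot\nabla_v\varphi-p\varphi]\,dt\,dx\,dv=0$ for all $\varphi\in C^1_c(\mathbb{R}^{1+2n})$ with $\varphi(t,x,\mathcal{R}_xv)=\varphi(t,x,v)$ on $\{x_n=0\}$. *)

theory Defs
  imports "HOL-Analysis.Analysis"
begin

text \<open>
  Points \<open>(t, x, v)\<close> of phase space have type \<open>real \<times> (real^'n) \<times> (real^'n)\<close>.  The coordinate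
  written \<open>x\<^sub>n\<close> in the literature is \<open>x $ k\<close> for an arbitrary fixed index \<open>k :: 'n\<close>, since
  \<open>'n\<close> carries no order that would single out a last index.
\<close>

definition reflect :: "'n::finite \<Rightarrow> real^'n \<Rightarrow> real^'n" where
  "reflect k v = (\<chi> i. if i = k then - (v $ i) else v $ i)"

definition half_domain :: "'n::finite \<Rightarrow> (real \<times> (real^'n) \<times> (real^'n)) set" where
  "half_domain k = {(t, x, v). x $ k > 0}"

definition L2_loc :: "'a::euclidean_space set \<Rightarrow> ('a \<Rightarrow> 'b::euclidean_space) \<Rightarrow> bool" where
  "L2_loc S f \<longleftrightarrow> set_borel_measurable lebesgue S f \<and>
     (\<forall>K. compact K \<and> K \<subseteq> S \<longrightarrow> set_integrable lebesgue K (\<lambda>z. (norm (f z))\<^sup>2))"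

text \<open>
  \<open>\<phi>\<close> is a compactly supported function of class \<open>C\<^sup>1\<close> on the whole space, and \<open>G\<close>
  is its gradient.
\<close>

definition C1c_with_gradient :: "('a::euclidean_space \<Rightarrow> real) \<Rightarrow> ('a \<Rightarrow> 'a) \<Rightarrow> bool" where
  "C1c_with_gradient \<phi> G \<longleftrightarrow>
     (\<forall>z. GDERIV \<phi> z :> G z) \<and> continuous_on UNIV G \<and> compact (closure {z. \<phi> z \<noteq> 0})"

text \<open>
  \<open>g\<close> is the distributional gradient of \<open>f\<close> in the velocity variable, in the open set \<open>D\<close>.
  The gradient of \<open>\<phi>\<close> has the components \<open>(\<partial>\<^sub>t\<phi>, \<nabla>\<^sub>x\<phi>, \<nabla>\<^sub>v\<phi>)\<close>, so \<open>snd (snd (G z))\<close>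
  is \<open>\<nabla>\<^sub>v\<phi>\<close>; the identity is one between vectors, i.e. it holds for every component.
\<close>

definition weak_v_gradient ::
  "(real \<times> (real^'n) \<times> (real^'n)) set \<Rightarrow> (real \<times> (real^'n) \<times> (real^'n) \<Rightarrow> real)
     \<Rightarrow> (real \<times> (real^'n) \<times> (real^'n) \<Rightarrow> real^'n::finite) \<Rightarrow> bool" where
  "weak_v_gradient D f g \<longleftrightarrow>
     (\<forall>\<phi> G. C1c_with_gradient \<phi> G \<and> closure {z. \<phi> z \<noteq> 0} \<subseteq> D \<longrightarrow>
        (LINT z:D|lebesgue. f z *\<^sub>R snd (snd (G z))) = - (LINT z:D|lebesgue. \<phi> z *\<^sub>R g z))"

text \<open>
  Weak solutions of \<open>\<partial>\<^sub>tf + v \<bullet> \<nabla>\<^sub>xf - \<Delta>\<^sub>vf = p\<close> in \<open>{x $ k > 0}\<close> with specular reflection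
  on \<open>{x $ k = 0}\<close>.  The boundary condition is encoded in the class of test functions, which
  need not vanish on the boundary.  Here \<open>g\<close> is \<open>\<nabla>\<^sub>vf\<close> and \<open>G (t, x, v) = (a, X, V)\<close> is
  \<open>(\<partial>\<^sub>t\<phi>, \<nabla>\<^sub>x\<phi>, \<nabla>\<^sub>v\<phi>)\<close>.
\<close>

definition weak_solution ::
  "'n::finite \<Rightarrow> (real \<times> (real^'n) \<times> (real^'n) \<Rightarrow> real)
     \<Rightarrow> (real \<times> (real^'n) \<times> (real^'n) \<Rightarrow> real) \<Rightarrow> bool" where
  "weak_solution k p f \<longleftrightarrow>
     L2_loc (closure (half_domain k)) f \<and>
     (\<exists>g. weak_v_gradient (half_domain k) f g \<and> L2_loc (closure (half_domain k)) g \<and>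
       (\<forall>\<phi> G. C1c_with_gradient \<phi> G \<and>
              (\<forall>t x v. x $ k = 0 \<longrightarrow> \<phi> (t, x, reflect k v) = \<phi> (t, x, v)) \<longrightarrow>
          (LINT z:half_domain k|lebesgue.
             (case z of (t, x, v) \<Rightarrow> case G z of (a, X, V) \<Rightarrow>
                - f z * (a + v \<bullet> X) + g z \<bullet> V - p z * \<phi> z)) = 0))"

text \<open>
  Weak solutions are determined only up to null sets, so bounds and identities for them are
  required almost everywhere in the half-domain.
\<close>

definition growth_bound ::
  "'n::finite \<Rightarrow> real \<Rightarrow> (real \<times> (real^'n) \<times> (real^'n) \<Rightarrow> real) \<Rightarrow> bool" where
  "growth_bound k \<beta> f \<longleftrightarrow>
     (\<exists>C. AE (t, x, v) in lebesgue. x $ k > 0 \<longrightarrow>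
        \<bar>f (t, x, v)\<bar> \<le> C * (1 + \<bar>t\<bar> powr (1/2) + norm x powr (1/3) + norm v) powr \<beta>)"

text \<open>
  Non-polynomial stationary weak solutions, for some polynomial right-hand side, that are
  homogeneous of degree 5 under the kinetic scaling.
\<close>

definition homogeneous_profile ::
  "'n::finite \<Rightarrow> (real^'n \<Rightarrow> real^'n \<Rightarrow> real) \<Rightarrow> bool" where
  "homogeneous_profile k T \<longleftrightarrow>
     \<not> (\<exists>q. real_polynomial_function q \<and>
            (AE (x, v) in lebesgue. x $ k > 0 \<longrightarrow> T x v = q (x, v))) \<and>
     (\<exists>p. real_polynomial_function p \<and> weak_solution k p (\<lambda>(t, x, v). T x v)) \<and>
     (\<forall>r>0. \<forall>x v. x $ k > 0 \<longrightarrow> T (r^3 *\<^sub>R x) (r *\<^sub>R v) = r^5 * T x v)"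

end

theory Submission
  imports Defs
begin

text \<open>
  In kinetic coordinates the equation is invariant under the non-commutative translations \<open>kmul\<close> and
  the scaling \<open>kscale\<close>.  The profile is an explicit integral \<open>Tric\<close> in the two variables
  \<open>x $ k\<close>, \<open>v $ k\<close>, even under \<open>(x, v) \<mapsto> (- x, - v)\<close>, with right-hand side a multiple of \<open>\<bar>x $ k\<bar>\<close> and
  equal to a multiple of \<open>\<bar>v $ k\<bar> ^ 5\<close> on the boundary.

  The growth condition forces the right-hand side of a solution to have kinetic degree at most \<open>\<beta> - 2\<close>.
  Such a right-hand side is matched by a polynomial that satisfies the boundary condition, up to a multiple
  of \<open>x $ k\<close> that occurs only in degree 3 and is matched by the profile.  The difference
  is a homogeneous solution; its extension by \<open>krefl\<close>, the reflection of both position and velocity,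
  solves the equation in the whole space in the sense of distributions.  Averaging against a Gaussian
  kernel, with scale-independent averages, gives a mean value formula.  Hence the solution is
  smooth, and each derivative along a generator of the translations lowers the polynomial growth rate, so the solution is a polynomial.
\<close>

text \<open>Reflecting position and velocity together leaves the operator invariant and agrees on
  the boundary with specular reflection, so it is the extension under which the boundary disappears.
  Its price is that a polynomial right-hand side becomes piecewise polynomial. The first essential
  obstruction is \<open>x $ k\<close>, which turns into its absolute value; it has kinetic degree 3,
  and the operator lowers degrees by 2, whence the threshold 5. The profile is the formal solution
  with this source: the time integral over s of the expectation of |x - s v + noise|, where the
  noise is Gaussian of variance 2 s^3 / 3, the position of Kolmogorov's process run backwards. This
  integral diverges for large s; subtracting the polynomial terms of the expansion at infinity makes
  it converge. The substitution s = r^2 makes all arguments rational in r. The mean value formula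
  rests on one fact: the integral of a solution against a time slice of the backward Kolmogorov
  kernel does not formally depend on the slice. Averaging over a bump in time turns this into an
  exact identity between scales, and letting the scale tend to 0 recovers the solution.\<close>

section \<open>Differentiation under the integral sign and integrable weights\<close>

lemma has_real_derivative_integral:
 fixes F :: "real => 'a => real"
 assumes int: "!!h. \<bar>h\<bar> <= 1 ==> integrable M (F h)"
  and der: "AE w in M. ((%h. F h w) has_real_derivative F' w) (at 0)"
  and bnd: "AE w in M. \<forall>h. \<bar>h\<bar> <= 1 --> \<bar>F h w - F 0 w\<bar> <= \<bar>h\<bar> * B w"
  and B: "integrable M B" and F': "F' \<in> borel_measurable M"
 shows "integrable M F'"
  and "((%h. \<integral>w. F h w \<partial>M) has_real_derivative (\<integral>w. F' w \<partial>M)) (at 0)"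
proof -
 define Q where "Q h w = (F h w - F 0 w) / h" for h w
 have key: "integrable M F' \<and> (%i. \<integral>w. Q (X i) w \<partial>M) \<longlonglongrightarrow> (\<integral>w. F' w \<partial>M)"
  if X: "!!i. X i \<noteq> 0" "!!i. \<bar>X i\<bar> <= 1" "X \<longlonglongrightarrow> 0" for X :: "nat => real"
 proof -
  have meas: "Q (X i) \<in> borel_measurable M" for i
   unfolding Q_def using int[OF X(2)[of i]] int[of 0] by auto
  have lim: "AE w in M. (%i. Q (X i) w) \<longlonglongrightarrow> F' w"
   using der
  proof eventually_elim
   case (elim w)
   have "((%h. (F h w - F 0 w) / h) \<longlongrightarrow> F' w) (at 0)"
    using elim by (simp add: has_field_derivative_iff)
   moreover have "filterlim X (at 0) sequentially"
    using X by (intro filterlim_atI) auto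
   ultimately show ?case
    unfolding Q_def by (rule filterlim_compose)
  qed
  have bd: "AE w in M. norm (Q (X i) w) <= B w" for i
   using bnd
  proof eventually_elim
   case (elim w)
   have "\<bar>F (X i) w - F 0 w\<bar> <= \<bar>X i\<bar> * B w" using elim X by blast
   then show ?case using X(1)[of i] by (simp add: Q_def field_simps abs_divide)
  qed
  show ?thesis
   using integrable_dominated_convergence[OF F' meas B lim bd]
    integral_dominated_convergence[OF F' meas B lim bd] by blast
 qed
 show "integrable M F'"
 proof -
  have "(%i. 1 / real (Suc i)) \<longlonglongrightarrow> 0" using LIMSEQ_inverse_real_of_nat by (simp add: inverse_eq_divide)
  then show ?thesis using key[of "%i. 1 / real (Suc i)"] by (auto simp: divide_simps)
 qed
 show "((%h. \<integral>w. F h w \<partial>M) has_real_derivative (\<integral>w. F' w \<partial>M)) (at 0)"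
  unfolding has_field_derivative_iff
 proof (subst tendsto_at_iff_sequentially, safe)
  fix X :: "nat => real" assume X: "\<forall>i. X i \<in> UNIV - {0}" "X \<longlonglongrightarrow> 0"
  have "eventually (%i. \<bar>X i\<bar> < 1) sequentially"
   using tendsto_rabs[OF X(2)] by (rule order_tendstoD) auto
  then obtain N where N: "!!i. i \<ge> N ==> \<bar>X i\<bar> < 1" by (auto simp: eventually_sequentially)
  have "(%i. \<integral>w. Q (X (i + N)) w \<partial>M) \<longlonglongrightarrow> (\<integral>w. F' w \<partial>M)"
   using key[of "%i. X (i + N)"] X N LIMSEQ_ignore_initial_segment[OF X(2), of N]
   by (simp add: less_imp_le)
  then have "(%i. \<integral>w. Q (X i) w \<partial>M) \<longlonglongrightarrow> (\<integral>w. F' w \<partial>M)"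
   by (rule LIMSEQ_offset)
  moreover have "eventually (%i. (\<integral>w. Q (X i) w \<partial>M) =
    (((\<integral>w. F (X i) w \<partial>M) - (\<integral>w. F 0 w \<partial>M)) / (X i - 0))) sequentially"
   unfolding eventually_sequentially
   using N int by (intro exI[of _ N]) (auto simp: Q_def[abs_def] less_imp_le)
  ultimately show "((%y. ((\<integral>w. F y w \<partial>M) - (\<integral>w. F 0 w \<partial>M)) / (y - 0)) \<circ> X) \<longlonglongrightarrow> (\<integral>w. F' w \<partial>M)"
   unfolding o_def by (rule Lim_transform_eventually)
 qed
qed

lemma integrable_inverse_1_plus_square:
 "integrable lborel (%x::real. 1 / (1 + x\<^sup>2))"
proof -
 have 1: "- (pi / 2) < x ==> x * 2 < pi ==> (tan has_real_derivative 1 + (tan x)\<^sup>2) (at x)" for x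
  using cos_gt_zero_pi[of x] by (subst tan_sec) (auto intro!: DERIV_tan simp: power_inverse)
 have 2: "- (pi / 2) < x ==> x * 2 < pi ==> isCont (%x. 1 + (tan x)\<^sup>2) x" for x
  using cos_gt_zero_pi[of x] by auto
 have 3: "\<lbrakk>- (pi / 2) < x; x * 2 < pi\<rbrakk>  \<Longrightarrow> isCont (\<lambda>x. inverse (1 + x\<^sup>2)) (tan x)" for x
  by (rule continuous_intros | simp add: add_nonneg_eq_0_iff)+
 have "set_integrable lborel (einterval (-\<infinity>) \<infinity>) (%x::real. inverse (1 + x^2))"
  by (subst interval_integral_substitution_nonneg[of "-pi/2" "pi/2" tan "%x. 1 + (tan x)^2"])
    (auto intro: derivative_eq_intros 1 2 3 filterlim_tan_at_right
       simp add: ereal_tendsto_simps filterlim_tan_at_left add_nonneg_eq_0_iff set_integrable_def)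
 then show ?thesis by (simp add: set_integrable_def einterval_def inverse_eq_divide)
qed

text \<open>Each factor 1 + (w . b)^2 is at most (1 + norm w)^2, so the weight lies below a product
  of the one-dimensional functions 1 / (1 + s^2), one for each basis vector.\<close>

lemma integrable_weight:
 "integrable lborel (%w::'a::euclidean_space. 1 / (1 + norm w) ^ (2 * DIM('a)))"
proof -
 interpret product_sigma_finite "%_::'a. lborel :: real measure" ..
 have [measurable]: "(%f::'a=>real. \<Sum>b\<in>Basis. f b *\<^sub>R b) \<in> (\<Pi>\<^sub>M b\<in>(Basis::'a set). lborel) \<rightarrow>\<^sub>M borel"
  by measurable
 have "integrable (\<Pi>\<^sub>M b\<in>(Basis::'a set). lborel) (%f. \<Prod>b\<in>Basis. 1 / (1 + (f b)\<^sup>2) :: real)"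
  by (rule product_integrable_prod) (auto intro: integrable_inverse_1_plus_square)
 moreover have "integrable (\<Pi>\<^sub>M b\<in>(Basis::'a set). lborel)
   (%f. (%w. \<Prod>b\<in>Basis. 1 / (1 + (w \<bullet> b)\<^sup>2) :: real) (\<Sum>b\<in>Basis. f b *\<^sub>R b)) \<longleftrightarrow>
   integrable (\<Pi>\<^sub>M b\<in>(Basis::'a set). lborel) (%f. \<Prod>b\<in>Basis. 1 / (1 + (f b)\<^sup>2) :: real)"
  by (intro Bochner_Integration.integrable_cong refl prod.cong) (simp_all add: inner_sum_left inner_Basis if_distrib cong: if_cong)
 ultimately have "integrable (lborel::'a measure) (%w. \<Prod>b\<in>Basis. 1 / (1 + (w \<bullet> b)\<^sup>2) :: real)"
  by (subst lborel_eq, subst integrable_distr_eq) simp_all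
 then show ?thesis
 proof (rule Bochner_Integration.integrable_bound)
  show "AE w::'a in lborel. norm (1 / (1 + norm w) ^ (2 * DIM('a)) :: real) <= norm (\<Prod>b\<in>Basis. 1 / (1 + (w \<bullet> b)\<^sup>2) :: real)"
  proof (intro AE_I2)
   fix w :: 'a
   have "(\<Prod>b\<in>Basis. 1 + (w \<bullet> b)\<^sup>2) <= (\<Prod>b\<in>(Basis::'a set). (1 + norm w)\<^sup>2)"
   proof (intro prod_mono conjI)
    fix b :: 'a assume "b \<in> Basis"
    have "(w \<bullet> b)\<^sup>2 <= (norm w)\<^sup>2" using Basis_le_norm[OF \<open>b \<in> Basis\<close>, of w]
     by (metis abs_le_square_iff abs_norm_cancel)
    then show "1 + (w \<bullet> b)\<^sup>2 <= (1 + norm w)\<^sup>2"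
     by (simp add: power2_sum) (smt (verit) norm_ge_zero)
   qed auto
   also have "\<dots> = (1 + norm w) ^ (2 * DIM('a))" by (simp add: power_mult)
   finally have le: "(\<Prod>b\<in>Basis. 1 + (w \<bullet> b)\<^sup>2) <= (1 + norm w) ^ (2 * DIM('a))" .
   have pos: "0 < (\<Prod>b\<in>Basis. 1 + (w \<bullet> b)\<^sup>2)" by (intro prod_pos) (auto intro: add_pos_nonneg)
   have "1 / (1 + norm w) ^ (2 * DIM('a)) <= 1 / (\<Prod>b\<in>Basis. 1 + (w \<bullet> b)\<^sup>2)"
    using le pos by (intro divide_left_mono mult_pos_pos) (auto intro: less_le_trans)
   also have "\<dots> = (\<Prod>b\<in>Basis. 1 / (1 + (w \<bullet> b)\<^sup>2))" by (simp add: prod_dividef)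
   finally show "norm (1 / (1 + norm w) ^ (2 * DIM('a)) :: real) <= norm (\<Prod>b\<in>Basis. 1 / (1 + (w \<bullet> b)\<^sup>2) :: real)"
    by (simp add: abs_prod)
  qed
 qed measurable
qed

section \<open>Changes of variables with constant Jacobian\<close>

text \<open>\<open>J\<close> is the absolute Jacobian determinant. As a pushforward identity the
  property composes, transfers null sets as well as integrals, and can be checked fibre by fibre
  without any derivative of \<open>S\<close>.\<close>

definition vol_scaling :: "real => ('a::euclidean_space => 'a) => bool" where
 "vol_scaling J S \<longleftrightarrow> J > 0 \<and> S \<in> borel \<rightarrow>\<^sub>M borel \<and>
   lborel = density (distr lborel borel S) (%_. ennreal J)"

lemma vol_scalingI:
 assumes J: "J > 0" and [measurable]: "S \<in> borel \<rightarrow>\<^sub>M borel"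
  and "!!f::'a::euclidean_space => ennreal. f \<in> borel_measurable borel ==>
    (\<integral>\<^sup>+w. f w \<partial>lborel) = ennreal J * (\<integral>\<^sup>+w. f (S w) \<partial>lborel)"
 shows "vol_scaling J S"
 unfolding vol_scaling_def
proof (intro conjI)
 show "lborel = density (distr lborel borel S) (%_. ennreal J)"
 proof (rule measure_eqI)
  fix A assume "A \<in> sets (lborel :: 'a measure)"
  then have A[measurable]: "A \<in> sets borel" by simp
  have "emeasure (density (distr lborel borel S) (%_. ennreal J)) A
    = (\<integral>\<^sup>+w. ennreal J * indicator A w \<partial>distr lborel borel S)"
   by (subst emeasure_density) auto
  also have "\<dots> = (\<integral>\<^sup>+w. ennreal J * indicator A (S w) \<partial>lborel)" by (subst nn_integral_distr) auto
  also have "\<dots> = ennreal J * (\<integral>\<^sup>+w. indicator A (S w) \<partial>lborel)" by (rule nn_integral_cmult) measurable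
  also have "\<dots> = (\<integral>\<^sup>+w. indicator A w \<partial>lborel)" by (rule assms(3)[symmetric]) simp
  finally show "emeasure lborel A = emeasure (density (distr lborel borel S) (%_. ennreal J)) A" by simp
 qed simp
qed fact+

lemma vol_scaling_nn:
 assumes "vol_scaling J S" and [measurable]: "f \<in> borel_measurable borel"
 shows "(\<integral>\<^sup>+w. f w \<partial>lborel) = ennreal J * (\<integral>\<^sup>+w. f (S w) \<partial>lborel)"
proof -
 have [measurable]: "S \<in> borel \<rightarrow>\<^sub>M borel" using assms by (simp add: vol_scaling_def)
 have "(\<integral>\<^sup>+w. f w \<partial>lborel) = (\<integral>\<^sup>+w. f w \<partial>density (distr lborel borel S) (%_. ennreal J))"
  using assms by (simp add: vol_scaling_def)
 also have "\<dots> = ennreal J * (\<integral>\<^sup>+w. f (S w) \<partial>lborel)"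
  by (subst nn_integral_density) (auto simp: nn_integral_distr nn_integral_cmult)
 finally show ?thesis .
qed

lemma vol_scaling_integral:
 fixes f :: "'a::euclidean_space => real"
 assumes "vol_scaling J S" and [measurable]: "f \<in> borel_measurable borel"
 shows "(\<integral>w. f w \<partial>lborel) = J * (\<integral>w. f (S w) \<partial>lborel)"
  and "integrable lborel (%w. f (S w)) \<longleftrightarrow> integrable lborel f"
proof -
 have [measurable]: "S \<in> borel \<rightarrow>\<^sub>M borel" and d: "density (distr lborel borel S) (%_. ennreal J) = lborel"
  and J: "J > 0"
  using assms by (auto simp add: vol_scaling_def)
 have "(\<integral>w. f w \<partial>lborel) = (\<integral>w. f w \<partial>density (distr lborel borel S) (%_. ennreal J))"
  using d by simp
 also have "\<dots> = (\<integral>w. J * f w \<partial>(distr lborel borel S))"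
  using J by (subst integral_density) auto
 also have "\<dots> = (\<integral>w. J * f (S w) \<partial>lborel)" by (subst integral_distr) auto
 finally show "(\<integral>w. f w \<partial>lborel) = J * (\<integral>w. f (S w) \<partial>lborel)" by simp
 have "integrable lborel f \<longleftrightarrow> integrable (density (distr lborel borel S) (%_. ennreal J)) f"
  using d by simp
 also have "\<dots> \<longleftrightarrow> integrable (distr lborel borel S) (%w. J * f w)"
  using J by (subst integrable_density) auto
 also have "\<dots> \<longleftrightarrow> integrable lborel (%w. f (S w))"
  using J by (subst integrable_distr_eq) auto
 finally show "integrable lborel (%w. f (S w)) \<longleftrightarrow> integrable lborel f" by simp
qed

lemma vol_scaling_AE:
 assumes "vol_scaling J S" and P: "AE w in lborel. P w"
 shows "AE w in lborel. P (S w)"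
proof -
 have S[measurable]: "S \<in> borel \<rightarrow>\<^sub>M borel" and d: "density (distr lborel borel S) (%_. ennreal J) = lborel"
  and J: "J > 0"
  using assms by (auto simp add: vol_scaling_def)
 have "AE w in density (distr lborel borel S) (%_. ennreal J). P w" unfolding d by (fact P)
 then have "AE w in distr lborel borel S. P w" using J by (simp add: AE_density)
 then show ?thesis by (rule AE_distrD[rotated]) simp
qed

lemma vol_scaling_comp:
 assumes "vol_scaling J S" "vol_scaling J' T" shows "vol_scaling (J * J') (%w. S (T w))"
proof (rule vol_scalingI)
 have [measurable]: "S \<in> borel \<rightarrow>\<^sub>M borel" "T \<in> borel \<rightarrow>\<^sub>M borel" and J: "J > 0" "J' > 0"
  using assms by (auto simp add: vol_scaling_def)
 show "(%w. S (T w)) \<in> borel \<rightarrow>\<^sub>M borel" "J * J' > 0" using J by simp_all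
 fix f :: "'a => ennreal" assume [measurable]: "f \<in> borel_measurable borel"
 show "(\<integral>\<^sup>+w. f w \<partial>lborel) = ennreal (J * J') * (\<integral>\<^sup>+w. f (S (T w)) \<partial>lborel)"
  using vol_scaling_nn[OF assms(2), of "%w. f (S w)"] vol_scaling_nn[OF assms(1), of f] J
  by (simp add: ennreal_mult mult.assoc)
qed

lemma vol_scaling_scaleR: "c \<noteq> 0 ==> vol_scaling (\<bar>c\<bar> ^ DIM('a)) (%w::'a::euclidean_space. c *\<^sub>R w)"
 unfolding vol_scaling_def using lborel_affine[of c "0::'a"] by simp

lemma vol_scaling_translation: "vol_scaling 1 (%w::'a::euclidean_space. c + w)"
 unfolding vol_scaling_def by (auto simp: lborel_distr_plus density_1)

text \<open>Tonelli: every fibre is scaled by the same \<open>J\<close>. Shears become fibrewise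
  translations, and the kinetic maps are composed from such pieces.\<close>

lemma vol_scaling_snd:
 fixes S :: "'a::euclidean_space => 'b::euclidean_space => 'b"
 assumes [measurable]: "(%(a, b). (a, S a b)) \<in> borel \<rightarrow>\<^sub>M borel"
  and S: "!!a. vol_scaling J (S a)"
 shows "vol_scaling J (%(a, b). (a, S a b))"
proof (rule vol_scalingI)
 show J: "J > 0" using S by (simp add: vol_scaling_def)
 fix f :: "'a \<times> 'b => ennreal" assume [measurable]: "f \<in> borel_measurable borel"
 have [measurable]: "f \<in> borel_measurable (borel \<Otimes>\<^sub>M borel)" by (simp add: borel_prod)
 have m: "(%w. f ((%(a, b). (a, S a b)) w)) \<in> borel_measurable (lborel \<Otimes>\<^sub>M lborel)"
  unfolding lborel_prod by simp
 have m2: "f \<in> borel_measurable (lborel \<Otimes>\<^sub>M lborel)"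
  unfolding lborel_prod by simp
 have m3: "(%a. \<integral>\<^sup>+b. f (a, S a b) \<partial>lborel) \<in> borel_measurable lborel"
  using lborel.borel_measurable_nn_integral_fst[OF m] by simp
 have "(\<integral>\<^sup>+w. f w \<partial>lborel) = (\<integral>\<^sup>+w. f w \<partial>(lborel \<Otimes>\<^sub>M lborel))"
  by (simp add: lborel_prod)
 also have "\<dots> = (\<integral>\<^sup>+a. \<integral>\<^sup>+b. f (a, b) \<partial>lborel \<partial>lborel)"
  using lborel.nn_integral_fst[OF m2] by simp
 also have "\<dots> = (\<integral>\<^sup>+a. ennreal J * \<integral>\<^sup>+b. f (a, S a b) \<partial>lborel \<partial>lborel)"
  by (intro nn_integral_cong vol_scaling_nn[OF S]) simp
 also have "\<dots> = ennreal J * (\<integral>\<^sup>+a. \<integral>\<^sup>+b. f (a, S a b) \<partial>lborel \<partial>lborel)"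
  by (rule nn_integral_cmult[OF m3])
 also have "\<dots> = ennreal J * (\<integral>\<^sup>+w. f ((%(a, b). (a, S a b)) w) \<partial>(lborel \<Otimes>\<^sub>M lborel))"
  using lborel.nn_integral_fst[OF m] by simp
 finally show "(\<integral>\<^sup>+w. f w \<partial>lborel) = ennreal J * (\<integral>\<^sup>+w. f ((%(a, b). (a, S a b)) w) \<partial>lborel)"
  by (simp add: lborel_prod)
qed fact

lemma vol_scaling_fst:
 fixes S :: "'b::euclidean_space => 'a::euclidean_space => 'a"
 assumes [measurable]: "(%(a, b). (S b a, b)) \<in> borel \<rightarrow>\<^sub>M borel"
  and S: "!!b. vol_scaling J (S b)"
 shows "vol_scaling J (%(a, b). (S b a, b))"
proof (rule vol_scalingI)
 show J: "J > 0" using S by (simp add: vol_scaling_def)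
 fix f :: "'a \<times> 'b => ennreal" assume [measurable]: "f \<in> borel_measurable borel"
 have [measurable]: "f \<in> borel_measurable (borel \<Otimes>\<^sub>M borel)" by (simp add: borel_prod)
 have m: "(%w. f ((%(a, b). (S b a, b)) w)) \<in> borel_measurable (lborel \<Otimes>\<^sub>M lborel)"
  unfolding lborel_prod by simp
 have m2: "f \<in> borel_measurable (lborel \<Otimes>\<^sub>M lborel)"
  unfolding lborel_prod by simp
 have m3: "(%b. \<integral>\<^sup>+a. f (S b a, b) \<partial>lborel) \<in> borel_measurable lborel"
  using lborel.borel_measurable_nn_integral_fst[OF measurable_pair_swap[OF m]] by simp
 have "(\<integral>\<^sup>+w. f w \<partial>lborel) = (\<integral>\<^sup>+w. f w \<partial>(lborel \<Otimes>\<^sub>M lborel))"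
  by (simp add: lborel_prod)
 also have "\<dots> = (\<integral>\<^sup>+b. \<integral>\<^sup>+a. f (a, b) \<partial>lborel \<partial>lborel)"
  using lborel_pair.nn_integral_snd[OF m2] by simp
 also have "\<dots> = (\<integral>\<^sup>+b. ennreal J * \<integral>\<^sup>+a. f (S b a, b) \<partial>lborel \<partial>lborel)"
  by (intro nn_integral_cong vol_scaling_nn[OF S]) simp
 also have "\<dots> = ennreal J * (\<integral>\<^sup>+b. \<integral>\<^sup>+a. f (S b a, b) \<partial>lborel \<partial>lborel)"
  by (rule nn_integral_cmult[OF m3])
 also have "\<dots> = ennreal J * (\<integral>\<^sup>+w. f ((%(a, b). (S b a, b)) w) \<partial>(lborel \<Otimes>\<^sub>M lborel))"
  using lborel_pair.nn_integral_snd[OF m] by simp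
 finally show "(\<integral>\<^sup>+w. f w \<partial>lborel) = ennreal J * (\<integral>\<^sup>+w. f ((%(a, b). (S b a, b)) w) \<partial>lborel)"
  by (simp add: lborel_prod)
qed fact

section \<open>The kinetic group: translations, dilations and reflections\<close>

type_synonym 'n kin = "real \<times> (real^'n) \<times> (real^'n)"

definition kscale :: "real => 'n::finite kin => 'n kin" where
 "kscale r = (%(t, x, v). (r\<^sup>2 * t, r ^ 3 *\<^sub>R x, r *\<^sub>R v))"

text \<open>The Galilean group law: \<open>t *\<^sub>R v'\<close> is the drift during time
  \<open>t\<close> of a frame moving with velocity \<open>v'\<close>. Multiplication from the left
  commutes with the kinetic operator.\<close>

definition kmul :: "'n::finite kin => 'n kin => 'n kin" where
 "kmul = (%(t', x', v') (t, x, v). (t' + t, x' + x + t *\<^sub>R v', v' + v))"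

definition kinv :: "'n::finite kin => 'n kin" where
 "kinv = (%(t, x, v). (- t, t *\<^sub>R v - x, - v))"

definition krefl :: "'n::finite => 'n kin => 'n kin" where
 "krefl k = (%(t, x, v). (t, reflect k x, reflect k v))"

definition vrefl :: "'n::finite => 'n kin => 'n kin" where
 "vrefl k = (%(t, x, v). (t, x, reflect k v))"

lemma kmul_assoc: "kmul (kmul a b) c = kmul a (kmul b c)"
 by (cases a; cases b; cases c) (simp add: kmul_def algebra_simps)

lemma kmul_inv [simp]: "kmul a (kmul (kinv a) b) = b" "kmul (kinv a) (kmul a b) = b"
 "kmul (kmul b a) (kinv a) = b"
 by (cases a; cases b; simp add: kmul_def kinv_def algebra_simps)+

lemma kscale_mul: "kscale r (kmul a b) = kmul (kscale r a) (kscale r b)"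
 by (cases a; cases b) (simp add: kmul_def kscale_def algebra_simps power2_eq_square power3_eq_cube)

lemma kscale_kscale: "kscale r (kscale s a) = kscale (r * s) a"
 by (cases a) (simp add: kscale_def power_mult_distrib)

lemma kscale_1 [simp]: "kscale 1 a = a"
 by (cases a) (simp add: kscale_def)

lemma continuous_on_kscale [continuous_intros]:
 "continuous_on S f ==> continuous_on S (%w. kscale r (f w))"
 unfolding kscale_def case_prod_beta by (intro continuous_intros)

lemma continuous_on_kscale' [continuous_intros]:
 "continuous_on S g ==> continuous_on S f ==> continuous_on S (%w. kscale (g w) (f w))"
 unfolding kscale_def case_prod_beta by (intro continuous_intros)

lemma continuous_on_kmul [continuous_intros]:
 "continuous_on S f ==> continuous_on S g ==> continuous_on S (%w. kmul (f w) (g w))"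
 unfolding kmul_def case_prod_beta by (intro continuous_intros)

lemma continuous_on_kinv [continuous_intros]:
 "continuous_on S f ==> continuous_on S (%w. kinv (f w))"
 unfolding kinv_def case_prod_beta by (intro continuous_intros)

lemma continuous_on_reflect [continuous_intros]:
 "continuous_on S f ==> continuous_on S (%w. reflect k (f w))"
 unfolding reflect_def
 by (rule continuous_on_vec_lambda, rename_tac i, case_tac "i = k") (auto intro!: continuous_intros)

lemma continuous_on_krefl [continuous_intros]:
 "continuous_on S f ==> continuous_on S (%w. krefl k (f w))"
 "continuous_on S f ==> continuous_on S (%w. vrefl k (f w))"
 unfolding krefl_def vrefl_def case_prod_beta by (intro continuous_intros; assumption)+

lemma kin_measurable [measurable]:
 "kscale r \<in> borel \<rightarrow>\<^sub>M borel" "kmul z \<in> borel \<rightarrow>\<^sub>M borel" "(%w. kmul w z) \<in> borel \<rightarrow>\<^sub>M borel"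
 "kinv \<in> borel \<rightarrow>\<^sub>M borel" "krefl k \<in> borel \<rightarrow>\<^sub>M borel" "vrefl k \<in> borel \<rightarrow>\<^sub>M borel" "reflect k \<in> borel \<rightarrow>\<^sub>M borel"
 by (intro borel_measurable_continuous_onI continuous_intros; fail)+

lemma reflect_reflect [simp]: "reflect k (reflect k x) = x"
 by (simp add: reflect_def vec_eq_iff)

lemma norm_reflect [simp]: "norm (reflect k x) = norm x"
proof -
 have "(norm (if i = k then - (x $ i) else x $ i))\<^sup>2 = (norm (x $ i))\<^sup>2" for i by simp
 then show ?thesis unfolding norm_vec_def L2_set_def reflect_def by (simp only: vec_lambda_beta)
qed

lemma vol_scaling_reflect: "vol_scaling 1 (reflect k :: real^'n => real^'n::finite)"
proof -
 let ?c = "%b::real^'n. if b = axis k 1 then -1 else (1::real)"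
 have eq: "(%x::real^'n. 0 + (\<Sum>j\<in>Basis. (?c j * (x \<bullet> j)) *\<^sub>R j)) = reflect k"
 proof (rule ext, subst euclidean_eq_iff, rule ballI)
  fix x b :: "real^'n" assume b: "b \<in> Basis"
  then obtain i where i: "b = axis i 1" by (auto simp: Basis_vec_def)
  show "(0 + (\<Sum>j\<in>Basis. (?c j * (x \<bullet> j)) *\<^sub>R j)) \<bullet> b = reflect k x \<bullet> b"
   using b by (simp add: inner_sum_left inner_Basis if_distrib cong: if_cong)
    (auto simp: i reflect_def inner_axis axis_eq_axis)
 qed
 have "(\<Prod>j\<in>(Basis::(real^'n) set). \<bar>?c j\<bar>) = 1" by (intro prod.neutral) auto
 then show ?thesis
  unfolding vol_scaling_def using lborel_affine_euclidean[of ?c "0::real^'n"] eq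
  by simp
qed

lemma vol_scaling_kmul: "vol_scaling 1 (kmul z :: 'n::finite kin => _)"
proof -
 obtain t' x' v' where z: "z = (t', x', v')" by (cases z) auto
 have s: "vol_scaling 1 (%(t::real, p::(real^'n)\<times>(real^'n)). (t, (t *\<^sub>R v', 0) + p))"
  by (rule vol_scaling_snd)
   (auto simp: case_prod_beta intro!: borel_measurable_continuous_onI continuous_intros vol_scaling_translation)
 have "kmul z = (%w. z + (%(t::real, p::(real^'n)\<times>(real^'n)). (t, (t *\<^sub>R v', 0) + p)) w)"
  by (auto simp: fun_eq_iff kmul_def z algebra_simps)
 then show ?thesis
  using vol_scaling_comp[OF vol_scaling_translation[of z] s] by simp
qed

text \<open>A right translation is again a shear followed by a translation, so the volume is
  invariant on both sides. This version moves a small right translation from a function without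
  regularity to the indicator of a box.\<close>

lemma vol_scaling_kmul_right: "vol_scaling 1 (%w :: 'n::finite kin. kmul w z)"
proof -
 obtain t' x' v' where z: "z = (t', x', v')" by (cases z) auto
 have s1: "vol_scaling 1 (%(x::real^'n, v::real^'n). (t' *\<^sub>R v + x, v))"
  by (rule vol_scaling_fst)
   (auto simp: case_prod_beta intro!: borel_measurable_continuous_onI continuous_intros vol_scaling_translation)
 have s: "vol_scaling 1 (%(t::real, p::(real^'n)\<times>(real^'n)). (t, (%(x::real^'n, v::real^'n). (t' *\<^sub>R v + x, v)) p))"
  by (rule vol_scaling_snd[OF _ s1])
   (auto simp: case_prod_beta intro!: borel_measurable_continuous_onI continuous_intros)
 have "(%w. kmul w z) = (%w. z + (%(t::real, p::(real^'n)\<times>(real^'n)). (t, (%(x::real^'n, v::real^'n). (t' *\<^sub>R v + x, v)) p)) w)"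
  by (auto simp: fun_eq_iff kmul_def z algebra_simps)
 then show ?thesis
  using vol_scaling_comp[OF vol_scaling_translation[of z] s] by simp
qed

lemma vol_scaling_vrefl: "vol_scaling 1 (vrefl k)"
 and vol_scaling_krefl: "vol_scaling 1 (krefl (k::'n::finite))"
proof -
 have s1: "vol_scaling 1 (%(x::real^'n, v::real^'n). (x, reflect k v))"
  by (rule vol_scaling_snd[OF _ vol_scaling_reflect])
   (auto simp: case_prod_beta intro!: borel_measurable_continuous_onI continuous_intros)
 have s2: "vol_scaling 1 (%(x::real^'n, v::real^'n). (reflect k x, v))"
  by (rule vol_scaling_fst[OF _ vol_scaling_reflect])
   (auto simp: case_prod_beta intro!: borel_measurable_continuous_onI continuous_intros)
 have "vol_scaling 1 (%(t::real, p::(real^'n)\<times>(real^'n)). (t, (%(x::real^'n, v::real^'n). (x, reflect k v)) p))"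
  by (rule vol_scaling_snd[OF _ s1])
   (auto simp: case_prod_beta intro!: borel_measurable_continuous_onI continuous_intros)
 moreover have "vrefl k = (%(t::real, p::(real^'n)\<times>(real^'n)). (t, (%(x::real^'n, v::real^'n). (x, reflect k v)) p))"
  by (auto simp: fun_eq_iff vrefl_def)
 ultimately show 1: "vol_scaling 1 (vrefl k)" by simp
 have "vol_scaling 1 (%(t::real, p::(real^'n)\<times>(real^'n)). (t, (%(x::real^'n, v::real^'n). (reflect k x, v)) p))"
  by (rule vol_scaling_snd[OF _ s2])
   (auto simp: case_prod_beta intro!: borel_measurable_continuous_onI continuous_intros)
 from vol_scaling_comp[OF this 1]
 show "vol_scaling 1 (krefl k)"
  by (simp add: vrefl_def krefl_def case_prod_beta')
qed

text \<open>The exponent is the homogeneous dimension: 2 from time, 3 n from position and n from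
  velocity.\<close>

lemma vol_scaling_kscale:
 assumes r: "r > 0"
 shows "vol_scaling (r ^ (2 + 4 * CARD('n))) (kscale r :: 'n::finite kin => _)"
proof -
 have s1: "vol_scaling (r ^ CARD('n)) (%(x::real^'n, v::real^'n). (x, r *\<^sub>R v))"
  by (rule vol_scaling_snd, use vol_scaling_scaleR[of r, where 'a="real^'n"] r in \<open>auto simp: case_prod_beta intro!: borel_measurable_continuous_onI continuous_intros\<close>)
 have s2: "vol_scaling ((r^3) ^ CARD('n)) (%(x::real^'n, v::real^'n). (r^3 *\<^sub>R x, v))"
  by (rule vol_scaling_fst, use vol_scaling_scaleR[of "r^3", where 'a="real^'n"] r in \<open>auto simp: case_prod_beta intro!: borel_measurable_continuous_onI continuous_intros\<close>)
 have s3: "vol_scaling (r ^ CARD('n)) (%(t::real, p::(real^'n)\<times>(real^'n)). (t, (%(x::real^'n, v::real^'n). (x, r *\<^sub>R v)) p))"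
  by (rule vol_scaling_snd[OF _ s1])
   (auto simp: case_prod_beta intro!: borel_measurable_continuous_onI continuous_intros)
 have s4: "vol_scaling ((r^3) ^ CARD('n)) (%(t::real, p::(real^'n)\<times>(real^'n)). (t, (%(x::real^'n, v::real^'n). (r^3 *\<^sub>R x, v)) p))"
  by (rule vol_scaling_snd[OF _ s2])
   (auto simp: case_prod_beta intro!: borel_measurable_continuous_onI continuous_intros)
 have s5: "vol_scaling (r^2) (%(t::real, p::(real^'n)\<times>(real^'n)). (r\<^sup>2 * t, p))"
  by (rule vol_scaling_fst, use vol_scaling_scaleR[of "r\<^sup>2", where 'a="real"] r in \<open>auto simp: case_prod_beta intro!: borel_measurable_continuous_onI continuous_intros\<close>)
 have "r ^ 2 * (((r^3) ^ CARD('n)) * (r ^ CARD('n))) = r ^ (2 + 4 * CARD('n))"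
  by (simp flip: power_mult power_add add: power2_eq_square algebra_simps)
 then show ?thesis
  using vol_scaling_comp[OF s5 vol_scaling_comp[OF s4 s3]]
  by (auto simp: kscale_def case_prod_beta')
qed

section \<open>Gaussian primitives and their Taylor remainders\<close>

text \<open>A rescaled error function. The constant 3/4 comes from the variance 2 s^3 / 3 of the
  position at time s, whose density has exponent - 3 (x - s v)^2 / (4 s^3).\<close>

definition gaussJ :: "real => real" where
 "gaussJ = (SOME J. J 0 = 0 \<and> (\<forall>y. (J has_real_derivative exp (- 3/4 * y\<^sup>2)) (at y)))"

lemma gaussJ_0 [simp]: "gaussJ 0 = 0"
 and gaussJ_deriv: "(gaussJ has_real_derivative exp (- 3/4 * y\<^sup>2)) (at y)"
proof -
 have "\<exists>J. J 0 = 0 \<and> (\<forall>y. (J has_real_derivative exp (- 3/4 * y\<^sup>2)) (at y))"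
 proof -
  have "\<exists>F::real=>real. \<forall>x::real. -\<infinity> < ereal x --> ereal x < \<infinity> --> (F has_vector_derivative exp (- 3/4 * x\<^sup>2)) (at x)"
   by (rule einterval_antiderivative) (auto intro!: continuous_intros)
  then obtain F :: "real => real" where F: "!!x. (F has_real_derivative exp (- 3/4 * x\<^sup>2)) (at x)"
   by (auto simp: has_real_derivative_iff_has_vector_derivative)
  then have "((%x. F x - F 0) has_real_derivative exp (- 3/4 * x\<^sup>2)) (at x)" for x
   by (auto intro!: derivative_eq_intros)
  then show ?thesis by (intro exI[of _ "%x. F x - F 0"]) auto
 qed
 from someI_ex[OF this] show "gaussJ 0 = 0" "(gaussJ has_real_derivative exp (- 3/4 * y\<^sup>2)) (at y)"
  unfolding gaussJ_def by auto
qed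

lemmas gaussJ_deriv' [derivative_intros] = DERIV_chain2[OF gaussJ_deriv]

lemma gaussJ_odd [simp]: "gaussJ (- y) = - gaussJ y"
proof -
 have "((%y. gaussJ (- y) + gaussJ y) has_real_derivative 0) (at y)" for y
  by (auto intro!: derivative_eq_intros)
 from DERIV_isconst_all[OF allI[OF this], of y 0] show ?thesis by simp
qed

text \<open>This is half the convolution of the absolute value with exp (- 3/4 y^2): both functions
  are even, have this Gaussian as second derivative and take the value 2/3 at 0.\<close>

definition gaussK :: "real => real" where
 "gaussK y = 2/3 * exp (- 3/4 * y\<^sup>2) + y * gaussJ y"

lemma gaussK_even [simp]: "gaussK (- y) = gaussK y"
 by (simp add: gaussK_def)

lemma gaussK_deriv: "(gaussK has_real_derivative gaussJ y) (at y)"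
 unfolding gaussK_def[abs_def] by (auto intro!: derivative_eq_intros)

lemmas gaussK_deriv' [derivative_intros] = DERIV_chain2[OF gaussK_deriv]

lemma gaussJ_mono: "x <= y ==> gaussJ x <= gaussJ y"
 by (rule DERIV_nonneg_imp_nondecreasing) (auto intro!: gaussJ_deriv exI)

lemma gaussJ_nonneg: "y \<ge> 0 ==> gaussJ y \<ge> 0"
 using gaussJ_mono[of 0 y] by simp

lemma nonneg_from_deriv:
 fixes f :: "real => real"
 assumes "f 0 \<ge> 0" "!!y. y \<ge> 0 ==> (f has_real_derivative f' y) (at y)" "!!y. y \<ge> 0 ==> f' y \<ge> 0" "y \<ge> 0"
 shows "f y \<ge> 0"
 using DERIV_nonneg_imp_nondecreasing[of 0 y f] assms by force

text \<open>Comparison of derivatives: exp u is at least 1 + u, so the Gaussian is at most 4/3 times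
  the derivative of arctan. This yields boundedness without evaluating the Gaussian
  integral.\<close>

lemma gaussJ_le: "y \<ge> 0 ==> gaussJ y <= 4/3 * arctan y"
proof -
 assume y: "y \<ge> 0"
 have "4/3 * arctan y - gaussJ y \<ge> 0"
 proof (rule nonneg_from_deriv[OF _ _ _ y])
  fix z :: real assume "z \<ge> 0"
  show "((%y. 4/3 * arctan y - gaussJ y) has_real_derivative 4/3 * inverse (1 + z\<^sup>2) - exp (- 3/4 * z\<^sup>2)) (at z)"
   by (auto intro!: derivative_eq_intros)
  have "1 + 3/4 * z\<^sup>2 <= exp (3/4 * z\<^sup>2)" by (rule exp_ge_add_one_self)
  then have "3/4 * (1 + z\<^sup>2) <= exp (3/4 * z\<^sup>2)" by (rule order_trans[rotated]) simp
  then have "inverse (exp (3/4 * z\<^sup>2)) <= inverse (3/4 * (1 + z\<^sup>2))"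
   by (intro le_imp_inverse_le) (auto intro!: add_pos_nonneg)
  also have "\<dots> = 4/3 * inverse (1 + z\<^sup>2)" by (subst inverse_mult_distrib) simp
  finally show "4/3 * inverse (1 + z\<^sup>2) - exp (- 3/4 * z\<^sup>2) \<ge> 0"
   by (simp add: exp_minus)
 qed simp
 then show ?thesis by simp
qed

lemma gaussJ_bound: "\<bar>gaussJ y\<bar> <= 3"
proof -
 have *: "\<bar>gaussJ y\<bar> <= 3" if "y \<ge> 0" for y
  using gaussJ_le[OF that] gaussJ_nonneg[OF that] arctan_ubound[of y] pi_less_4 by linarith
 show ?thesis using *[of y] *[of "- y"] by (cases "y \<ge> 0") auto
qed

text \<open>The half-line integral of the Gaussian, that is sqrt (pi / 3). As a supremum of a
  monotone bounded function it is at once the limit at infinity.\<close>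

definition Jinf :: real where "Jinf = (SUP y. gaussJ y)"

lemma gaussJ_bdd: "bdd_above (range gaussJ)"
 using gaussJ_bound by (auto intro!: bdd_aboveI[of _ 3] simp: abs_le_iff)

lemma gaussJ_tendsto: "(gaussJ \<longlongrightarrow> Jinf) at_top"
proof (rule increasing_tendsto)
 show "eventually (%n. gaussJ n <= Jinf) at_top"
  unfolding Jinf_def by (intro always_eventually allI cSUP_upper gaussJ_bdd) auto
 fix x assume "x < Jinf"
 then obtain y where "x < gaussJ y" unfolding Jinf_def using less_cSUP_iff[OF _ gaussJ_bdd] by auto
 then show "eventually (%n. x < gaussJ n) at_top"
  by (intro eventually_mono[OF eventually_ge_at_top[of y]]) (use gaussJ_mono in \<open>auto intro: less_le_trans\<close>)
qed

text \<open>These bounds are integrated once for \<open>gaussJ\<close> and once more for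
  \<open>gaussK\<close>. The size of the remainders gives convergence of the profile integral at
  infinity; their sign gives its positivity at (0, 1).\<close>

lemma Taylor_e:
 fixes y :: real
 shows "0 <= exp (- 3/4 * y\<^sup>2) - 1 + 3/4 * y\<^sup>2" "exp (- 3/4 * y\<^sup>2) - 1 + 3/4 * y\<^sup>2 <= y ^ 4"
proof -
 show "0 <= exp (- 3/4 * y\<^sup>2) - 1 + 3/4 * y\<^sup>2" using exp_ge_add_one_self[of "- 3/4 * y\<^sup>2"] by simp
 have "u\<^sup>2 - (exp (- u) - 1 + u) \<ge> 0" if "u \<ge> 0" for u :: real
 proof (rule nonneg_from_deriv[OF _ _ _ that])
  fix z :: real assume "z \<ge> 0"
  show "((%u. u\<^sup>2 - (exp (- u) - 1 + u)) has_real_derivative 2 * z + exp (- z) - 1) (at z)"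
   by (auto intro!: derivative_eq_intros)
  show "0 <= 2 * z + exp (- z) - 1" using exp_ge_add_one_self[of "-z"] \<open>z \<ge> 0\<close> by simp
 qed simp
 from this[of "3/4 * y\<^sup>2"] have "exp (- 3/4 * y\<^sup>2) - 1 + 3/4 * y\<^sup>2 <= (3/4 * y\<^sup>2)\<^sup>2" by simp
 also have "\<dots> = 9/16 * y ^ 4" by (simp add: power_mult_distrib power2_eq_square eval_nat_numeral)
 also have "\<dots> <= y ^ 4" by simp
 finally show "exp (- 3/4 * y\<^sup>2) - 1 + 3/4 * y\<^sup>2 <= y ^ 4" .
qed

lemma Taylor_e_pos: "y > 0 ==> 0 < exp (- 3/4 * y\<^sup>2) - 1 + 3/4 * (y::real)\<^sup>2"
 using exp_minus_greater[of "3/4 * y\<^sup>2"] by simp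

lemma Taylor_J:
 shows "\<bar>gaussJ y - y + y ^ 3 / 4\<bar> <= \<bar>y\<bar> ^ 5" and "y > 0 ==> 0 < gaussJ y - y + y ^ 3 / 4"
proof -
 have d: "((%y. gaussJ y - y + y ^ 3 / 4) has_real_derivative exp (- 3/4 * z\<^sup>2) - 1 + 3/4 * z\<^sup>2) (at z)" for z
  by (auto intro!: derivative_eq_intros)
 have 0: "gaussJ y - y + y ^ 3 / 4 \<ge> 0" if "y \<ge> 0" for y
  by (rule nonneg_from_deriv[OF _ d Taylor_e(1) that]) simp
 have 1: "y ^ 5 - (gaussJ y - y + y ^ 3 / 4) \<ge> 0" if "y \<ge> 0" for y
 proof (rule nonneg_from_deriv[OF _ _ _ that])
  fix z :: real
  show "((%y. y ^ 5 - (gaussJ y - y + y ^ 3 / 4)) has_real_derivative 5 * z ^ 4 - (exp (- 3/4 * z\<^sup>2) - 1 + 3/4 * z\<^sup>2)) (at z)"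
   by (auto intro!: derivative_eq_intros)
  show "5 * z ^ 4 - (exp (- 3/4 * z\<^sup>2) - 1 + 3/4 * z\<^sup>2) \<ge> 0"
   using Taylor_e(2)[of z] zero_le_even_power'[of z 2] by (simp only: mult_2_right numeral_plus_numeral add_num_simps)
 qed simp
 have *: "\<bar>gaussJ y - y + y ^ 3 / 4\<bar> <= \<bar>y\<bar> ^ 5" if "y \<ge> 0" for y
  using 0[OF that] 1[OF that] that by simp
 show "\<bar>gaussJ y - y + y ^ 3 / 4\<bar> <= \<bar>y\<bar> ^ 5"
 proof (cases "y \<ge> 0")
  case False
  have "\<bar>gaussJ y - y + y ^ 3 / 4\<bar> = \<bar>gaussJ (-y) - (-y) + (-y) ^ 3 / 4\<bar>"
   by (simp add: power3_eq_cube) 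
  then show ?thesis using *[of "-y"] False by simp
 qed (rule *)
 show "0 < gaussJ y - y + y ^ 3 / 4" if "y > 0"
  using DERIV_pos_imp_increasing_open[OF that, of "%y. gaussJ y - y + y ^ 3 / 4"] d Taylor_e_pos
   DERIV_continuous_on[OF has_field_derivative_at_within[OF d], of "{0..y}"] by force
qed

lemma Taylor_K:
 shows "\<bar>gaussK y - 2/3 - y\<^sup>2 / 2 + y ^ 4 / 16\<bar> <= y ^ 6" and "y \<noteq> 0 ==> 0 < gaussK y - 2/3 - y\<^sup>2 / 2 + y ^ 4 / 16"
proof -
 define f where "f y = gaussK y - 2/3 - y\<^sup>2 / 2 + y ^ 4 / 16" for y
 have f0: "f 0 = 0" by (simp add: f_def gaussK_def)
 have fe: "f (- y) = f y" for y by (simp add: f_def)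
 have d: "(f has_real_derivative gaussJ z - z + z ^ 3 / 4) (at z)" for z
  unfolding f_def[abs_def] by (auto intro!: derivative_eq_intros)
 have pos: "0 < f y" if "y > 0" for y
  using DERIV_pos_imp_increasing_open[OF that, of f] d Taylor_J(2) f0
   DERIV_continuous_on[OF has_field_derivative_at_within[OF d], of "{0..y}"] by force
 have up: "y ^ 6 - f y \<ge> 0" if "y \<ge> 0" for y
 proof (rule nonneg_from_deriv[OF _ _ _ that])
  fix z :: real assume z: "z \<ge> 0"
  show "((%y. y ^ 6 - f y) has_real_derivative 6 * z ^ 5 - (gaussJ z - z + z ^ 3 / 4)) (at z)"
   by (auto intro!: derivative_eq_intros d)
  show "6 * z ^ 5 - (gaussJ z - z + z ^ 3 / 4) \<ge> 0"
   using Taylor_J(1)[of z] z zero_le_power[of z 5] unfolding abs_of_nonneg[OF z] by linarith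
 qed (simp add: f0)
 have *: "\<bar>f y\<bar> <= y ^ 6" if "y \<ge> 0" for y
  using pos[of y] up[OF that] that f0 by (cases "y = 0") auto
 show "\<bar>gaussK y - 2/3 - y\<^sup>2 / 2 + y ^ 4 / 16\<bar> <= y ^ 6"
  using *[of y] *[of "-y"] unfolding fe by (cases "y \<ge> 0") (auto simp: f_def)
 show "0 < gaussK y - 2/3 - y\<^sup>2 / 2 + y ^ 4 / 16" if "y \<noteq> 0"
  using pos[of y] pos[of "-y"] that unfolding fe by (cases "y > 0") (auto simp: f_def)
qed

section \<open>The integrand of the profile\<close>

text \<open>With s = r^2 this is x - s v divided by s^(3/2), the order of the standard deviation of
  the noise in the position.\<close>

definition Targ :: "real => real => real => real" where "Targ r x v = x / r ^ 3 - v / r"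

text \<open>The term \<open>2 * r ^ 4 * gaussK y\<close> is, up to the factor \<open>Jinf\<close>,
  the expectation of |x - s v + noise| times ds / dr = 2 r. The other terms remove everything that
  does not decay as r grows: expanding \<open>gaussK\<close> to fourth order leaves 4/3 r^4, then
  r^4 y^2, which contributes r^2 v^2 - 2 x v, and - r^4 y^4 / 8, which contributes - v^4 /
  8.\<close>

definition TF :: "real => real => real => real" where
 "TF r x v = 2 * r ^ 4 * (gaussK (Targ r x v) - 2/3) - r\<^sup>2 * v\<^sup>2 + 2 * x * v + v ^ 4 / 8"

definition TFx :: "real => real => real => real" where
 "TFx r x v = 2 * r * gaussJ (Targ r x v) + 2 * v"

definition TFv :: "real => real => real => real" where
 "TFv r x v = - 2 * r ^ 3 * gaussJ (Targ r x v) - 2 * r\<^sup>2 * v + 2 * x + v ^ 3 / 2"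

definition TFvv :: "real => real => real => real" where
 "TFvv r x v = 2 * r\<^sup>2 * exp (- 3/4 * (Targ r x v)\<^sup>2) - 2 * r\<^sup>2 + 3/2 * v\<^sup>2"

lemma TF_x_deriv: "r > 0 ==> ((%x. TF r x v) has_real_derivative TFx r x v) (at x)"
 unfolding TF_def TFx_def Targ_def
 by (auto intro!: derivative_eq_intros simp: field_simps eval_nat_numeral)

lemma TF_v_deriv: "r > 0 ==> ((%v. TF r x v) has_real_derivative TFv r x v) (at v)"
 unfolding TF_def TFv_def Targ_def
 by (auto intro!: derivative_eq_intros simp: field_simps eval_nat_numeral)

lemma TFv_v_deriv: "r > 0 ==> ((%v. TFv r x v) has_real_derivative TFvv r x v) (at v)"
 unfolding TFvv_def TFv_def Targ_def
 by (auto intro!: derivative_eq_intros simp: field_simps eval_nat_numeral)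

section \<open>Integrable majorants for the integrand and its derivatives\<close>

text \<open>Merges a bound near r = 0 and a decay rate at infinity into a single integrable
  majorant, since min (1, 1 / r^2) is at most 2 / (1 + r^2).\<close>

lemma div_one_plus_bound:
 fixes r :: real
 assumes "r > 0" "r <= 1 ==> \<bar>f\<bar> <= C" "r \<ge> 1 ==> \<bar>f\<bar> <= C / r\<^sup>2"
 shows "\<bar>f\<bar> <= 2 * C / (1 + r\<^sup>2)"
proof (cases "r <= 1")
 case True
 then have "r\<^sup>2 <= 1" using assms(1) by (simp add: power_le_one)
 moreover have "\<bar>f\<bar> * r\<^sup>2 <= C * 1" using assms(2)[OF True] \<open>r\<^sup>2 <= 1\<close> by (intro mult_mono) auto
 ultimately show ?thesis using assms(2)[OF True] by (simp add: field_simps add_pos_nonneg)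
next
 case False
 then have r: "r \<ge> 1" by simp
 have "\<bar>f\<bar> * r\<^sup>2 <= C" using assms(3)[OF r] assms(1) by (simp add: field_simps)
 moreover have "\<bar>f\<bar> * 1 <= \<bar>f\<bar> * r\<^sup>2" using r by (intro mult_left_mono) auto
 ultimately show ?thesis by (simp add: field_simps add_pos_nonneg)
qed

context
 fixes M r x v :: real
 assumes M: "M \<ge> 1" and r: "r > 0" and x: "\<bar>x\<bar> <= M" and v: "\<bar>v\<bar> <= M"
begin

private lemma pw: "M <= M ^ 6" "M\<^sup>2 <= M ^ 6" "M ^ 3 <= M ^ 6" "M ^ 4 <= M ^ 6" "M ^ 5 <= M ^ 6" "1 <= M ^ 6"
 using M power_increasing[of 1 6 M] by (auto intro: power_increasing)

private lemma vpow: "\<bar>v ^ k\<bar> <= M ^ k"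
 unfolding power_abs using v by (intro power_mono) auto

private lemma e1: "0 <= exp (- 3/4 * y\<^sup>2)" "exp (- 3/4 * y\<^sup>2) <= 1" for y :: real
 by auto

context assumes r1: "r <= 1"
begin

private lemma rpow: "r ^ k <= 1" "0 <= r ^ k"
 using r r1 by (auto intro: power_le_one)

private lemma rle: "\<bar>r ^ k * z\<bar> <= \<bar>z\<bar>"
 using rpow[of k] by (simp add: abs_mult mult_left_le_one_le)

private lemma rle2: "\<bar>r ^ k * gaussJ y\<bar> <= 3"
 using rle[of k "gaussJ y"] gaussJ_bound[of y] by linarith

private lemma vv: "v\<^sup>2 <= M\<^sup>2" "\<bar>v ^ 3\<bar> <= M ^ 3" "\<bar>v ^ 4\<bar> <= M ^ 4" "\<bar>x * v\<bar> <= M\<^sup>2"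
 using vpow[of 2] vpow[of 3] vpow[of 4] mult_mono[OF x v] M by (auto simp: abs_mult power2_eq_square)

lemma TF_small: "\<bar>TF r x v\<bar> <= 200 * M ^ 6"
proof -
 define y where "y = Targ r x v"
 \<comment> \<open>As r tends to 0 the argument y may blow up, but r^4 y does not; this controls the
   term y J (y) of \<open>gaussK\<close>.\<close>
 have ry: "r ^ 4 * y = r * x - r ^ 3 * v" using r by (simp add: y_def Targ_def field_simps eval_nat_numeral)
 have "\<bar>r ^ 4 * y * gaussJ y\<bar> <= (2 * M) * 3"
  unfolding ry abs_mult[of "r * x - r ^ 3 * v"] using gaussJ_bound[of y] rle[of 1 x] rle[of 3 v] x v M
  by (intro mult_mono; simp; linarith)
 moreover have "\<bar>r ^ 4 * exp (- 3/4 * y\<^sup>2)\<bar> <= 1" using rle[of 4 "exp (- 3/4 * y\<^sup>2)"] e1[of y] by linarith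
 moreover have "\<bar>r\<^sup>2 * v\<^sup>2\<bar> <= M\<^sup>2" using rle[of 2 "v\<^sup>2"] vv(1) by simp
 moreover have "TF r x v = 4/3 * (r ^ 4 * exp (- 3/4 * y\<^sup>2)) + 2 * (r ^ 4 * y * gaussJ y) - 4/3 * r ^ 4 - r\<^sup>2 * v\<^sup>2 + 2 * (x * v) + v ^ 4 / 8"
  unfolding TF_def gaussK_def y_def[symmetric] by (simp add: algebra_simps)
 moreover have "\<bar>4/3 * e + 2 * j - 4/3 * s - p + 2 * q + w / 8\<bar> <= 200 * m"
  if "\<bar>e\<bar> <= 1" "\<bar>j\<bar> <= 2 * M * 3" "s <= 1" "0 <= s" "\<bar>p\<bar> <= M\<^sup>2" "\<bar>q\<bar> <= M\<^sup>2" "\<bar>w\<bar> <= M ^ 4"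
   "M <= m" "M\<^sup>2 <= m" "M ^ 4 <= m" "1 <= m" for e j s p q w m :: real
  using that by linarith
 ultimately show ?thesis using rpow[of 4] vv pw by metis
qed

lemma TFx_small: "\<bar>TFx r x v\<bar> <= 200 * M ^ 6"
proof -
 have "TFx r x v = 2 * (r ^ 1 * gaussJ (Targ r x v)) + 2 * v" by (simp add: TFx_def)
 moreover have "\<bar>2 * j + 2 * v\<bar> <= 200 * m" if "\<bar>j\<bar> <= 3" "M <= m" "1 <= m" for j m :: real
  using that v by linarith
 ultimately show ?thesis using rle2[of 1 "Targ r x v"] pw by metis
qed

lemma TFv_small: "\<bar>TFv r x v\<bar> <= 200 * M ^ 6"
proof -
 have "TFv r x v = - 2 * (r ^ 3 * gaussJ (Targ r x v)) - 2 * (r\<^sup>2 * v) + 2 * x + v ^ 3 / 2" by (simp add: TFv_def)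
 moreover have "\<bar>- 2 * j - 2 * q + 2 * x + c / 2\<bar> <= 200 * m"
  if "\<bar>j\<bar> <= 3" "\<bar>q\<bar> <= \<bar>v\<bar>" "\<bar>c\<bar> <= M ^ 3" "M <= m" "1 <= m" "M ^ 3 <= m" for j q c m :: real
  using that v x by linarith
 ultimately show ?thesis using rle2[of 3 "Targ r x v"] rle[of 2 v] pw vv(2) by metis
qed

lemma TFvv_small: "\<bar>TFvv r x v\<bar> <= 200 * M ^ 6"
proof -
 have "TFvv r x v = 2 * (r\<^sup>2 * exp (- 3/4 * (Targ r x v)\<^sup>2)) - 2 * r\<^sup>2 + 3/2 * v\<^sup>2" by (simp add: TFvv_def)
 moreover have "\<bar>2 * j - 2 * q + 3/2 * c\<bar> <= 200 * m"
  if "\<bar>j\<bar> <= \<bar>e\<bar>" "0 <= e" "e <= 1" "0 <= q" "q <= 1" "0 <= c" "c <= M\<^sup>2" "1 <= m" "M\<^sup>2 <= m" for j q c e m :: real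
  using that by linarith
 ultimately show ?thesis
  using rle[of 2 "exp (- 3/4 * (Targ r x v)\<^sup>2)"] e1[of "Targ r x v"] rpow[of 2] pw vv(1) zero_le_power2[of v] by metis
qed

end

context assumes r1: "r \<ge> 1"
begin

private definition "y = Targ r x v"
text \<open>The small quantity for large r: it is of order r^(-2) and r y = a - v. After the
  cancellations every surviving term carries either a factor \<open>a\<close> or a Taylor
  remainder.\<close>

private definition "a = x / r\<^sup>2"

private lemma ry: "r * y = a - v" and xa: "x = r\<^sup>2 * a"
 using r by (simp_all add: y_def a_def Targ_def field_simps eval_nat_numeral)

private lemma a: "\<bar>a\<bar> <= M / r\<^sup>2" "\<bar>a\<bar> <= M"
proof -
 show 1: "\<bar>a\<bar> <= M / r\<^sup>2" using x r by (simp add: a_def abs_divide divide_right_mono)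
 have "M / r\<^sup>2 <= M / 1" using r1 M by (intro divide_left_mono) auto
 then show "\<bar>a\<bar> <= M" using 1 by simp
qed

private lemma ypow: "\<bar>y\<bar> ^ k <= (2 * M) ^ k / r ^ k"
proof -
 have "\<bar>y\<bar> = \<bar>a - v\<bar> / r" using ry r by (metis abs_divide abs_of_pos nonzero_mult_div_cancel_left less_irrefl)
 also have "\<dots> <= 2 * M / r" using a v r by (intro divide_right_mono) auto
 finally have "\<bar>y\<bar> ^ k <= (2 * M / r) ^ k" by (intro power_mono) auto
 then show ?thesis by (simp add: power_divide)
qed

private lemma ypow': "2 <= j ==> r ^ i * \<bar>y\<bar> ^ (i + j) <= (2 * M) ^ (i + j) / r\<^sup>2"
proof -
 assume j: "2 <= j"
 have "r ^ i * \<bar>y\<bar> ^ (i + j) <= r ^ i * ((2 * M) ^ (i + j) / r ^ (i + j))"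
  using r by (intro mult_left_mono ypow) auto
 also have "\<dots> = (2 * M) ^ (i + j) / r ^ j" using r by (simp add: power_add field_simps)
 also have "\<dots> <= (2 * M) ^ (i + j) / r\<^sup>2" using r1 j M by (intro divide_left_mono power_increasing) auto
 finally show ?thesis .
qed

private lemma a_times: "\<bar>z\<bar> <= K ==> \<bar>a * z\<bar> <= K * M / r\<^sup>2"
 using mult_mono[OF a(1), of "\<bar>z\<bar>" K] M by (simp add: abs_mult mult_ac)

text \<open>The subtracted terms cancel the fourth-order Taylor polynomial of \<open>gaussK\<close>
  up to multiples of \<open>a\<close>, and the remainder is at most r^4 y^6, which is of order
  r^(-2).\<close>

lemma TF_large: "\<bar>TF r x v\<bar> <= 200 * M ^ 6 / r\<^sup>2"
proof -
 have "\<bar>r ^ 4 * (gaussK y - 2/3 - y\<^sup>2 / 2 + y ^ 4 / 16)\<bar> <= 64 * M ^ 6 / r\<^sup>2"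
 proof -
  have "r ^ 4 * \<bar>gaussK y - 2/3 - y\<^sup>2 / 2 + y ^ 4 / 16\<bar> <= r ^ 4 * \<bar>y\<bar> ^ (4 + 2)"
   using Taylor_K(1)[of y] r by (intro mult_left_mono) (auto simp: power_even_abs)
  also have "\<dots> <= (2 * M) ^ (4 + 2) / r\<^sup>2" by (rule ypow') simp
  finally show ?thesis using r by (simp add: abs_mult power_mult_distrib)
 qed
 moreover have "\<bar>a * x\<bar> <= M ^ 6 / r\<^sup>2"
 proof -
  have "M * M / r\<^sup>2 <= M ^ 6 / r\<^sup>2" using pw(2) by (intro divide_right_mono) (auto simp: power2_eq_square)
  then show ?thesis using a_times[OF x] by linarith
 qed
 moreover have "\<bar>a * ((a - 2 * v) * ((a - v)\<^sup>2 + v\<^sup>2))\<bar> <= 15 * M ^ 6 / r\<^sup>2"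
 proof -
  have "\<bar>(a - v)\<^sup>2\<bar> <= (2 * M)\<^sup>2" unfolding power_abs using a v by (intro power_mono) auto
  then have "\<bar>(a - v)\<^sup>2 + v\<^sup>2\<bar> <= 5 * M\<^sup>2" using vpow[of 2] by (simp add: power_mult_distrib)
  moreover have "\<bar>a - 2 * v\<bar> <= 3 * M" using a v by linarith
  ultimately have "\<bar>(a - 2 * v) * ((a - v)\<^sup>2 + v\<^sup>2)\<bar> <= (3 * M) * (5 * M\<^sup>2)"
   unfolding abs_mult using M by (intro mult_mono) auto
  from a_times[OF this] have "\<bar>a * ((a - 2 * v) * ((a - v)\<^sup>2 + v\<^sup>2))\<bar> <= 15 * M ^ 4 / r\<^sup>2"
   by (simp add: eval_nat_numeral)
  also have "\<dots> <= 15 * M ^ 6 / r\<^sup>2" using pw by (intro divide_right_mono) auto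
  finally show ?thesis .
 qed
 \<comment> \<open>The difference (a - v)^4 - v^4 factors as a (a - 2 v) ((a - v)^2 + v^2), which
   exhibits the factor \<open>a\<close>.\<close>
 moreover have "TF r x v = 2 * (r ^ 4 * (gaussK y - 2/3 - y\<^sup>2 / 2 + y ^ 4 / 16)) + a * x
   - (a * ((a - 2 * v) * ((a - v)\<^sup>2 + v\<^sup>2))) / 8"
 proof -
  have 1: "r ^ 4 * y\<^sup>2 = r\<^sup>2 * (a - v)\<^sup>2" "r ^ 4 * y ^ 4 = (a - v) ^ 4"
   unfolding ry[symmetric] by (simp_all add: power_mult_distrib eval_nat_numeral)
  have e0: "2 * r ^ 4 * (gaussK y - 2/3) = 2 * (r ^ 4 * (gaussK y - 2/3 - y\<^sup>2 / 2 + y ^ 4 / 16)) + r ^ 4 * y\<^sup>2 - r ^ 4 * y ^ 4 / 8"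
   by (simp add: field_simps)
  have gen: "2 * g + r\<^sup>2 * (a' - v)\<^sup>2 - (a' - v) ^ 4 / 8 - r\<^sup>2 * v\<^sup>2 + 2 * x' * v + v ^ 4 / 8
    = 2 * g + a' * x' - (a' * ((a' - 2 * v) * ((a' - v)\<^sup>2 + v\<^sup>2))) / 8" if "x' = r\<^sup>2 * a'" for a' x' g
   unfolding that by (simp add: eval_nat_numeral field_simps)
  show ?thesis
   using e0 gen[OF xa] unfolding TF_def y_def[symmetric] 1 by (simp only:)
 qed
 moreover have "\<bar>2 * p + q - s / 8\<bar> <= 200 * m" if "\<bar>p\<bar> <= 64 * m" "\<bar>q\<bar> <= m" "\<bar>s\<bar> <= 15 * m" for p q s m :: real
  using that by linarith
 ultimately show ?thesis unfolding times_divide_eq_right[symmetric] by (simp only:)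
qed

lemma TFx_large: "\<bar>TFx r x v\<bar> <= 200 * M ^ 6 / r\<^sup>2"
proof -
 have 1: "\<bar>r * (gaussJ y - y + y ^ 3 / 4)\<bar> * r\<^sup>2 <= 32 * M ^ 5"
 proof -
  have "r ^ 1 * \<bar>gaussJ y - y + y ^ 3 / 4\<bar> <= r ^ 1 * \<bar>y\<bar> ^ (1 + 4)"
   using Taylor_J(1)[of y] r by (intro mult_left_mono) auto
  also have "\<dots> <= (2 * M) ^ (1 + 4) / r\<^sup>2" by (rule ypow') simp
  finally show ?thesis unfolding abs_mult abs_of_pos[OF r] using r by (simp add: pos_le_divide_eq power_mult_distrib)
 qed
 have 2: "\<bar>a * r\<^sup>2\<bar> <= M" using a r by (simp add: field_simps abs_mult)
 have 3: "\<bar>(a - v) ^ 3\<bar> <= 8 * M ^ 3"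
  using power_mono[of "\<bar>a - v\<bar>" "2 * M" 3] a v by (simp add: power_abs power_mult_distrib)
 have eq: "TFx r x v * r\<^sup>2 = 2 * (r * (gaussJ y - y + y ^ 3 / 4) * r\<^sup>2) + 2 * (a * r\<^sup>2) - (a - v) ^ 3 / 2"
 proof -
  have "(2 * r * J + 2 * v') * r\<^sup>2 = 2 * (r * (J - y' + y' ^ 3 / 4) * r\<^sup>2) + 2 * (a' * r\<^sup>2) - (a' - v') ^ 3 / 2"
   if "r * y' = a' - v'" for a' v' y' J
  proof -
   have v': "a' = r * y' + v'" using that by simp
   show ?thesis unfolding v' by (simp add: field_simps eval_nat_numeral)
  qed
  from this[OF ry] show ?thesis unfolding TFx_def y_def[symmetric] by (simp only:)
 qed
 have "\<bar>2 * p + 2 * q - c / 2\<bar> <= 200 * m"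
  if "\<bar>p\<bar> <= 32 * M ^ 5" "\<bar>q\<bar> <= M" "\<bar>c\<bar> <= 8 * M ^ 3" "M <= m" "M ^ 5 <= m" "M ^ 3 <= m" for p q c m :: real
  using that by linarith
 then have "\<bar>TFx r x v * r\<^sup>2\<bar> <= 200 * M ^ 6"
  unfolding eq using 1 2 3 pw by (simp add: abs_mult)
 then show ?thesis using r by (simp add: field_simps abs_mult)
qed

lemma TFv_large: "\<bar>TFv r x v\<bar> <= 200 * M ^ 6 / r\<^sup>2"
proof -
 have "\<bar>r ^ 3 * (gaussJ y - y + y ^ 3 / 4)\<bar> <= 32 * M ^ 5 / r\<^sup>2"
 proof -
  have "r ^ 3 * \<bar>gaussJ y - y + y ^ 3 / 4\<bar> <= r ^ 3 * \<bar>y\<bar> ^ (3 + 2)"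
   using Taylor_J(1)[of y] r by (intro mult_left_mono) auto
  also have "\<dots> <= (2 * M) ^ (3 + 2) / r\<^sup>2" by (rule ypow') simp
  finally show ?thesis using r by (simp add: abs_mult power_mult_distrib)
 qed
 also have "\<dots> <= 32 * M ^ 6 / r\<^sup>2" using pw by (intro divide_right_mono) auto
 finally have 1: "\<bar>r ^ 3 * (gaussJ y - y + y ^ 3 / 4)\<bar> <= 32 * M ^ 6 / r\<^sup>2" .
 have 2: "\<bar>a * ((a - v)\<^sup>2 - (a - v) * v + v\<^sup>2)\<bar> <= 7 * M ^ 6 / r\<^sup>2"
 proof -
  have "\<bar>(a - v)\<^sup>2\<bar> <= (2 * M)\<^sup>2" unfolding power_abs using a v by (intro power_mono) auto
  moreover have gen7: "\<bar>s - q + c\<bar> <= 7 * m" if "\<bar>s\<bar> <= 4 * m" "\<bar>q\<bar> <= 2 * m" "\<bar>c\<bar> <= m" for s q c m :: real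
   using that by linarith
  moreover have "\<bar>(a - v) * v\<bar> <= (2 * M) * M" unfolding abs_mult using a v M by (intro mult_mono) auto
  ultimately have "\<bar>(a - v)\<^sup>2 - (a - v) * v + v\<^sup>2\<bar> <= 7 * M\<^sup>2"
   using vpow[of 2] by (intro gen7) (simp_all add: power_mult_distrib power2_eq_square)
  from a_times[OF this] have "\<bar>a * ((a - v)\<^sup>2 - (a - v) * v + v\<^sup>2)\<bar> <= 7 * M ^ 3 / r\<^sup>2"
   by (simp add: eval_nat_numeral)
  also have "\<dots> <= 7 * M ^ 6 / r\<^sup>2" using pw by (intro divide_right_mono) auto
  finally show ?thesis .
 qed
 have "TFv r x v = - 2 * (r ^ 3 * (gaussJ y - y + y ^ 3 / 4)) + (a * ((a - v)\<^sup>2 - (a - v) * v + v\<^sup>2)) / 2"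
 proof -
  have 1: "r ^ 3 * y = r\<^sup>2 * (a - v)" "r ^ 3 * y ^ 3 = (a - v) ^ 3"
   unfolding ry[symmetric] by (simp_all add: power_mult_distrib eval_nat_numeral)
  have e0: "- 2 * r ^ 3 * gaussJ y = - 2 * (r ^ 3 * (gaussJ y - y + y ^ 3 / 4)) - 2 * (r ^ 3 * y) + (r ^ 3 * y ^ 3) / 2"
   by (simp add: field_simps)
  have gen: "- 2 * g - 2 * (r\<^sup>2 * (a' - v)) + (a' - v) ^ 3 / 2 - 2 * r\<^sup>2 * v + 2 * x' + v ^ 3 / 2
    = - 2 * g + (a' * ((a' - v)\<^sup>2 - (a' - v) * v + v\<^sup>2)) / 2" if "x' = r\<^sup>2 * a'" for a' x' g
   unfolding that by (simp add: eval_nat_numeral field_simps)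
  show ?thesis
   using e0 gen[OF xa] unfolding TFv_def y_def[symmetric] 1 by (simp only:)
 qed
 moreover have "\<bar>- 2 * p + q / 2\<bar> <= 200 * m" if "\<bar>p\<bar> <= 32 * m" "\<bar>q\<bar> <= 7 * m" for p q m :: real
  using that by linarith
 ultimately show ?thesis using 1 2 unfolding times_divide_eq_right[symmetric] by (simp only:)
qed

lemma TFvv_large: "\<bar>TFvv r x v\<bar> <= 200 * M ^ 6 / r\<^sup>2"
proof -
 have e: "\<bar>exp (- 3/4 * y\<^sup>2) - 1 + 3/4 * y\<^sup>2\<bar> <= \<bar>y\<bar> ^ 4" using Taylor_e[of y] by (simp add: power_even_abs)
 have "\<bar>r\<^sup>2 * (exp (- 3/4 * y\<^sup>2) - 1 + 3/4 * y\<^sup>2)\<bar> <= 16 * M ^ 4 / r\<^sup>2"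
 proof -
  have "r\<^sup>2 * \<bar>exp (- 3/4 * y\<^sup>2) - 1 + 3/4 * y\<^sup>2\<bar> <= r\<^sup>2 * \<bar>y\<bar> ^ (2 + 2)"
   using e r by (intro mult_left_mono) auto
  also have "\<dots> <= (2 * M) ^ (2 + 2) / r\<^sup>2" by (rule ypow') simp
  finally show ?thesis using r by (simp add: abs_mult power_mult_distrib)
 qed
 also have "\<dots> <= 16 * M ^ 6 / r\<^sup>2" using pw by (intro divide_right_mono) auto
 finally have 1: "\<bar>r\<^sup>2 * (exp (- 3/4 * y\<^sup>2) - 1 + 3/4 * y\<^sup>2)\<bar> <= 16 * M ^ 6 / r\<^sup>2" .
 have 2: "\<bar>a * (a - 2 * v)\<bar> <= 3 * M ^ 6 / r\<^sup>2"
 proof -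
  have "\<bar>a - 2 * v\<bar> <= 3 * M" using a v by linarith
  from a_times[OF this] have "\<bar>a * (a - 2 * v)\<bar> <= 3 * M\<^sup>2 / r\<^sup>2"
   by (simp add: eval_nat_numeral)
  also have "\<dots> <= 3 * M ^ 6 / r\<^sup>2" using pw by (intro divide_right_mono) auto
  finally show ?thesis .
 qed
 have "TFvv r x v = 2 * (r\<^sup>2 * (exp (- 3/4 * y\<^sup>2) - 1 + 3/4 * y\<^sup>2)) - 3/2 * (a * (a - 2 * v))"
 proof -
  have 1: "r\<^sup>2 * y\<^sup>2 = (a - v)\<^sup>2"
   unfolding ry[symmetric] by (simp_all add: power_mult_distrib)
  have "2 * r\<^sup>2 * exp (- 3/4 * y\<^sup>2) = 2 * (r\<^sup>2 * (exp (- 3/4 * y\<^sup>2) - 1 + 3/4 * y\<^sup>2)) + 2 * r\<^sup>2 - 3/2 * (r\<^sup>2 * y\<^sup>2)"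
   by (simp add: field_simps)
  moreover have "2 * g + 2 * r\<^sup>2 - 3/2 * (a' - v)\<^sup>2 - 2 * r\<^sup>2 + 3/2 * v\<^sup>2
    = 2 * g - 3/2 * (a' * (a' - 2 * v))" for a' g
   by (simp add: eval_nat_numeral field_simps)
  ultimately show ?thesis
   unfolding TFvv_def y_def[symmetric] 1 by (simp only:)
 qed
 moreover have "\<bar>2 * p - 3/2 * q\<bar> <= 200 * m" if "\<bar>p\<bar> <= 16 * m" "\<bar>q\<bar> <= 3 * m" for p q m :: real
  using that by linarith
 ultimately show ?thesis using 1 2 unfolding times_divide_eq_right[symmetric] by (simp only:)
qed

end

lemma TF_bounds:
 "\<bar>TF r x v\<bar> <= 2 * (200 * M ^ 6) / (1 + r\<^sup>2)" "\<bar>TFx r x v\<bar> <= 2 * (200 * M ^ 6) / (1 + r\<^sup>2)"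
 "\<bar>TFv r x v\<bar> <= 2 * (200 * M ^ 6) / (1 + r\<^sup>2)" "\<bar>TFvv r x v\<bar> <= 2 * (200 * M ^ 6) / (1 + r\<^sup>2)"
 by (intro div_one_plus_bound r TF_small TFx_small TFv_small TFvv_small TF_large TFx_large TFv_large TFvv_large; assumption)+

end

section \<open>The profile as a parameter integral\<close>

definition Tint :: "(real => real => real => real) => real => real => real" where
 "Tint \<Phi> x v = (\<integral>r. indicator {0<..} r * \<Phi> r x v \<partial>lborel)"

text \<open>The majorant is uniform for (x, v) in a bounded square, so the same condition serves
  both continuity and differentiation under the integral.\<close>

definition dominated :: "(real => real => real => real) => bool" where
 "dominated \<Phi> \<longleftrightarrow> (%(r, x, v). \<Phi> r x v) \<in> borel_measurable borel \<and>
   (\<forall>r>0. continuous_on UNIV (%(x, v). \<Phi> r x v)) \<and>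
   (\<forall>M\<ge>1. \<forall>r>0. \<forall>x v. \<bar>x\<bar> <= M \<and> \<bar>v\<bar> <= M --> \<bar>\<Phi> r x v\<bar> <= 2 * (200 * M ^ 6) / (1 + r\<^sup>2))"

lemma gauss_continuous [continuous_intros]:
 "continuous_on S f ==> continuous_on S (%x. gaussJ (f x))"
 "continuous_on S f ==> continuous_on S (%x. gaussK (f x))"
 using continuous_on_compose2[of UNIV gaussJ S f] continuous_on_compose2[of UNIV gaussK S f]
  DERIV_continuous_on[OF has_field_derivative_at_within[OF gaussJ_deriv], of UNIV]
  DERIV_continuous_on[OF has_field_derivative_at_within[OF gaussK_deriv], of UNIV] by auto

lemma gauss_measurable [measurable]: "gaussJ \<in> borel_measurable borel" "gaussK \<in> borel_measurable borel"
 by (intro borel_measurable_continuous_onI continuous_intros)+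

lemma dominated_TF: "dominated TF" "dominated TFx" "dominated TFv" "dominated TFvv"
 unfolding dominated_def
 by (intro conjI allI impI TF_bounds; (elim conjE)?; (assumption)?;
   unfold TF_def[abs_def] TFx_def[abs_def] TFv_def[abs_def] TFvv_def[abs_def] Targ_def case_prod_beta borel_prod[symmetric];
   (measurable; fail)?; auto intro!: continuous_intros simp: case_prod_beta)+

lemma dominated_integrable:
 assumes "dominated \<Phi>"
 shows "integrable lborel (%r. indicator {0<..} r * \<Phi> r x v)"
proof -
 have "(%r. (%(r, x, v). \<Phi> r x v) (r, x, v)) \<in> borel_measurable borel"
  by (rule measurable_compose[where N=borel]) (use assms in \<open>auto simp: dominated_def intro!: borel_measurable_continuous_onI continuous_intros\<close>)
 then have [measurable]: "(%r. \<Phi> r x v) \<in> borel_measurable borel" by simp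
 define M where "M = 1 + \<bar>x\<bar> + \<bar>v\<bar>"
 have "M \<ge> 1" "\<bar>x\<bar> <= M" "\<bar>v\<bar> <= M" by (auto simp: M_def)
 then have b: "r > 0 ==> \<bar>\<Phi> r x v\<bar> <= 2 * (200 * M ^ 6) / (1 + r\<^sup>2)" for r
  using assms unfolding dominated_def by blast
 show ?thesis
 proof (rule Bochner_Integration.integrable_bound)
  show "integrable lborel (%r::real. 2 * (200 * M ^ 6) * (1 / (1 + r\<^sup>2)))"
   by (intro integrable_mult_right integrable_inverse_1_plus_square)
  show "AE r in lborel. norm (indicator {0<..} r * \<Phi> r x v) <= norm (2 * (200 * M ^ 6) * (1 / (1 + r\<^sup>2)))"
   using b by (auto simp: indicator_def intro!: AE_I2 order_trans[OF _ abs_ge_self])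
 qed simp
qed

lemma Tint_continuous:
 assumes d: "dominated \<Phi>"
 shows "continuous_on UNIV (%(x, v). Tint \<Phi> x v)"
proof -
 have "continuous_on {p. norm p < M} (%(x, v). Tint \<Phi> x v)" if M: "M \<ge> 1" for M
  unfolding Tint_def case_prod_beta
 proof (rule continuous_on_sequentiallyI)
  fix u :: "nat => real \<times> real" and a assume u: "\<forall>n. u n \<in> {p. norm p < M}" "a \<in> {p. norm p < M}" "u \<longlonglongrightarrow> a"
  have le: "\<bar>fst p\<bar> <= M" "\<bar>snd p\<bar> <= M" if "norm p < M" for p :: "real \<times> real"
   using norm_fst_le[of "fst p" "snd p"] norm_snd_le[of "snd p" "fst p"] that by auto
  show "(%n. \<integral>r. indicator {0<..} r * \<Phi> r (fst (u n)) (snd (u n)) \<partial>lborel)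
    \<longlonglongrightarrow> (\<integral>r. indicator {0<..} r * \<Phi> r (fst a) (snd a) \<partial>lborel)"
  proof (rule integral_dominated_convergence)
   show "integrable lborel (%r::real. 2 * (200 * M ^ 6) * (1 / (1 + r\<^sup>2)))"
    by (intro integrable_mult_right integrable_inverse_1_plus_square)
   show "AE r in lborel. norm (indicator {0<..} r * \<Phi> r (fst (u n)) (snd (u n))) <= 2 * (200 * M ^ 6) * (1 / (1 + r\<^sup>2))" for n
   proof (rule AE_I2)
    fix r :: real
    show "norm (indicator {0<..} r * \<Phi> r (fst (u n)) (snd (u n))) <= 2 * (200 * M ^ 6) * (1 / (1 + r\<^sup>2))"
     using d M u(1) le[of "u n"] M by (cases "r > 0") (auto simp: dominated_def)
   qed
   show "AE r in lborel. (%n. indicator {0<..} r * \<Phi> r (fst (u n)) (snd (u n))) \<longlonglongrightarrow> indicator {0<..} r * \<Phi> r (fst a) (snd a)"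
   proof (rule AE_I2)
    fix r :: real
    show "(%n. indicator {0<..} r * \<Phi> r (fst (u n)) (snd (u n))) \<longlonglongrightarrow> indicator {0<..} r * \<Phi> r (fst a) (snd a)"
    proof (cases "r > 0")
     case True
     then have "continuous_on UNIV (%p. \<Phi> r (fst p) (snd p))"
      using d unfolding dominated_def by (auto simp: case_prod_beta)
     then have "(%n. \<Phi> r (fst (u n)) (snd (u n))) \<longlonglongrightarrow> \<Phi> r (fst a) (snd a)"
      using continuous_on_tendsto_compose[of UNIV "%p. \<Phi> r (fst p) (snd p)" u a sequentially] u(3) by simp
     then show ?thesis by (intro tendsto_intros)
    qed simp
   qed
  qed (use dominated_integrable[OF d] in \<open>auto intro!: borel_measurable_integrable\<close>)
 qed
 moreover have "open {p::real\<times>real. norm p < M}" for M by (intro open_Collect_less continuous_intros)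
 ultimately have "isCont (%(x, v). Tint \<Phi> x v) p" for p
  by (subst continuous_on_interior[of "{q. norm q < norm p + 1}"]) (auto simp: interior_open)
 then show ?thesis by (simp add: continuous_at_imp_continuous_on)
qed

lemma mvt_line:
 fixes f :: "real => real"
 assumes "!!s. \<bar>s\<bar> <= \<bar>h\<bar> ==> (f has_real_derivative f' s) (at s)" "!!s. \<bar>s\<bar> <= \<bar>h\<bar> ==> \<bar>f' s\<bar> <= B"
 shows "\<bar>f h - f 0\<bar> <= \<bar>h\<bar> * B"
proof -
 have "norm (f h - f 0) <= B * norm (h - 0)"
 proof (rule field_differentiable_bound[where f'=f' and S="{-\<bar>h\<bar>..\<bar>h\<bar>}"])
  fix s assume "s \<in> {-\<bar>h\<bar>..\<bar>h\<bar>}"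
  then have "\<bar>s\<bar> <= \<bar>h\<bar>" by auto
  then show "(f has_real_derivative f' s) (at s within {-\<bar>h\<bar>..\<bar>h\<bar>})" "norm (f' s) <= B"
   using assms by (auto intro: has_field_derivative_at_within)
 qed auto
 then show ?thesis by (simp add: mult.commute)
qed

text \<open>A general direction (a, b) covers the x- and the v-derivative at once. Its components
  are at most 1, so for |h| <= 1 the segment stays inside the square of size
  \<open>M\<close>.\<close>

lemma Tint_deriv:
 assumes \<Phi>: "dominated \<Phi>" and \<Phi>': "dominated \<Phi>'"
  and ab: "\<bar>a\<bar> <= 1" "\<bar>b\<bar> <= 1"
  and der: "!!r h. r > 0 ==> ((%h. \<Phi> r (x + h * a) (v + h * b)) has_real_derivative \<Phi>' r (x + h * a) (v + h * b)) (at h)"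
 shows "((%h. Tint \<Phi> (x + h * a) (v + h * b)) has_real_derivative Tint \<Phi>' x v) (at 0)"
proof -
 define M where "M = 1 + \<bar>x\<bar> + \<bar>v\<bar>"
 have M: "M \<ge> 1" by (auto simp: M_def)
 have b: "\<bar>\<Phi>' r (x + s * a) (v + s * b)\<bar> <= 2 * (200 * M ^ 6) / (1 + r\<^sup>2)" if "r > 0" "\<bar>s\<bar> <= 1" for r s
 proof -
  have "\<bar>s * a\<bar> <= 1 * 1" "\<bar>s * b\<bar> <= 1 * 1" unfolding abs_mult using ab that by (intro mult_mono; simp)+
  then have "\<bar>x + s * a\<bar> <= M" "\<bar>v + s * b\<bar> <= M" by (auto simp: M_def)
  then show ?thesis using \<Phi>' M that unfolding dominated_def by blast
 qed
 show ?thesis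
  unfolding Tint_def
 proof (rule has_real_derivative_integral[where B="%r. 2 * (200 * M ^ 6) * (1 / (1 + r\<^sup>2))"])
  show "integrable lborel (%r. indicator {0<..} r * \<Phi> r (x + h * a) (v + h * b))" for h
   by (rule dominated_integrable[OF \<Phi>])
  show "AE r in lborel. ((%h. indicator {0<..} r * \<Phi> r (x + h * a) (v + h * b)) has_real_derivative indicator {0<..} r * \<Phi>' r x v) (at 0)"
  proof (rule AE_I2)
   fix r :: real
   show "((%h. indicator {0<..} r * \<Phi> r (x + h * a) (v + h * b)) has_real_derivative indicator {0<..} r * \<Phi>' r x v) (at 0)"
    using DERIV_cmult[OF der[of r 0], of "indicator {0<..} r"] by (cases "r > 0") auto
  qed
  show "AE r in lborel. \<forall>h. \<bar>h\<bar> <= 1 --> \<bar>indicator {0<..} r * \<Phi> r (x + h * a) (v + h * b)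
    - indicator {0<..} r * \<Phi> r (x + 0 * a) (v + 0 * b)\<bar> <= \<bar>h\<bar> * (2 * (200 * M ^ 6) * (1 / (1 + r\<^sup>2)))"
  proof (intro AE_I2 allI impI)
   fix r h :: real assume h: "\<bar>h\<bar> <= 1"
   show "\<bar>indicator {0<..} r * \<Phi> r (x + h * a) (v + h * b)
    - indicator {0<..} r * \<Phi> r (x + 0 * a) (v + 0 * b)\<bar> <= \<bar>h\<bar> * (2 * (200 * M ^ 6) * (1 / (1 + r\<^sup>2)))"
    using mvt_line[of h "%h. \<Phi> r (x + h * a) (v + h * b)" _ "2 * (200 * M ^ 6) / (1 + r\<^sup>2)", OF der b[of r]] h
    by (cases "r > 0") auto
  qed
  show "integrable lborel (%r::real. 2 * (200 * M ^ 6) * (1 / (1 + r\<^sup>2)))"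
   by (intro integrable_mult_right integrable_inverse_1_plus_square)
 qed (use dominated_integrable[OF \<Phi>'] in \<open>auto intro!: borel_measurable_integrable\<close>)
qed

abbreviation "Tx \<equiv> Tint TFx"
abbreviation "Tv \<equiv> Tint TFv"
abbreviation "Tvv \<equiv> Tint TFvv"

definition Tric :: "real => real => real" where "Tric = Tint TF"

lemma Tric_continuous: "continuous_on UNIV (%(x, v). Tric x v)" "continuous_on UNIV (%(x, v). Tx x v)"
 "continuous_on UNIV (%(x, v). Tv x v)" "continuous_on UNIV (%(x, v). Tvv x v)"
 unfolding Tric_def by (intro Tint_continuous dominated_TF)+

lemma Tric_x_deriv: "((%h. Tric (x + h) v) has_real_derivative Tx x v) (at 0)"
proof -
 have "((%h. Tint TF (x + h * 1) (v + h * 0)) has_real_derivative Tx x v) (at 0)"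
 proof (rule Tint_deriv[OF dominated_TF(1,2)])
  fix r h :: real assume "r > 0"
  show "((%h. TF r (x + h * 1) (v + h * 0)) has_real_derivative TFx r (x + h * 1) (v + h * 0)) (at h)"
   using TF_x_deriv[OF \<open>r > 0\<close>, of v "h + x"] DERIV_shift[of "%x. TF r x v" "TFx r (h + x) v" h x] by (simp add: add.commute)
 qed auto
 then show ?thesis by (simp add: Tric_def)
qed

lemma Tric_v_deriv: "((%h. Tric x (v + h)) has_real_derivative Tv x v) (at 0)"
proof -
 have "((%h. Tint TF (x + h * 0) (v + h * 1)) has_real_derivative Tv x v) (at 0)"
 proof (rule Tint_deriv[OF dominated_TF(1,3)])
  fix r h :: real assume "r > 0"
  show "((%h. TF r (x + h * 0) (v + h * 1)) has_real_derivative TFv r (x + h * 0) (v + h * 1)) (at h)"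
   using TF_v_deriv[OF \<open>r > 0\<close>, of x "h + v"] DERIV_shift[of "%v. TF r x v" "TFv r x (h + v)" h v] by (simp add: add.commute)
 qed auto
 then show ?thesis by (simp add: Tric_def)
qed

lemma Tv_v_deriv: "((%h. Tv x (v + h)) has_real_derivative Tvv x v) (at 0)"
proof -
 have "((%h. Tint TFv (x + h * 0) (v + h * 1)) has_real_derivative Tvv x v) (at 0)"
 proof (rule Tint_deriv[OF dominated_TF(3,4)])
  fix r h :: real assume "r > 0"
  show "((%h. TFv r (x + h * 0) (v + h * 1)) has_real_derivative TFvv r (x + h * 0) (v + h * 1)) (at h)"
   using TFv_v_deriv[OF \<open>r > 0\<close>, of x "h + v"] DERIV_shift[of "%v. TFv r x v" "TFvv r x (h + v)" h v] by (simp add: add.commute)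
 qed auto
 then show ?thesis by simp
qed

lemma Tric_even: "Tric (- x) (- v) = Tric x v"
proof -
 have "Targ r (- x) (- v) = - Targ r x v" for r by (simp add: Targ_def)
 then show ?thesis by (simp add: Tric_def Tint_def TF_def)
qed

lemma Tric_homogeneous:
 assumes l: "l > 0"
 shows "Tric (l ^ 3 * x) (l * v) = l ^ 5 * Tric x v"
proof -
 have "Tric (l ^ 3 * x) (l * v) = l * (\<integral>r. indicator {0<..} (0 + l * r) * TF (0 + l * r) (l ^ 3 * x) (l * v) \<partial>lborel)"
  unfolding Tric_def Tint_def using lborel_integral_real_affine[of l "%r. indicator {0<..} r * TF r (l ^ 3 * x) (l * v)" 0] l
  by simp
 also have "\<dots> = l * (\<integral>r. l ^ 4 * (indicator {0<..} r * TF r x v) \<partial>lborel)"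
 proof -
  have "indicator {0<..} (0 + l * r) * TF (0 + l * r) (l ^ 3 * x) (l * v) = l ^ 4 * (indicator {0<..} r * TF r x v)" for r
  proof (cases "r > 0")
   case True
   have "Targ (l * r) (l ^ 3 * x) (l * v) = Targ r x v"
    using l True by (simp add: Targ_def power_mult_distrib)
   then have "TF (l * r) (l ^ 3 * x) (l * v) = l ^ 4 * TF r x v"
    by (simp add: TF_def power_mult_distrib algebra_simps eval_nat_numeral)
   then show ?thesis using True l by (simp add: zero_less_mult_iff)
  qed (use l in \<open>auto simp: zero_less_mult_iff indicator_def\<close>)
  then show ?thesis by simp
 qed
 also have "\<dots> = l ^ 5 * Tric x v" by (simp add: Tric_def Tint_def eval_nat_numeral)
 finally show ?thesis .
qed

text \<open>At x = 0, v = 1 the subtracted terms are exactly the Taylor polynomial of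
  \<open>gaussK\<close>, so the integrand is 2 r^4 times its positive remainder. A nonzero trace on
  the boundary is what later excludes polynomials.\<close>

lemma Tric_0_pos: "Tric 0 1 > 0"
proof -
 have pos: "indicator {0<..} r * TF r 0 1 > 0" if "r > 0" for r :: real
 proof -
  have "Targ r 0 1 = - (1 / r)" by (simp add: Targ_def)
  moreover have "2 * r ^ 4 * ((1 / r)\<^sup>2 / 2) = r\<^sup>2" "2 * r ^ 4 * ((1 / r) ^ 4 / 16) = 1 / 8"
   using that by (simp_all add: field_simps eval_nat_numeral)
  ultimately have "TF r 0 1 = 2 * r ^ 4 * (gaussK (1 / r) - 2/3 - (1 / r)\<^sup>2 / 2 + (1 / r) ^ 4 / 16)"
   unfolding TF_def by (simp only: gaussK_even) (simp only: right_diff_distrib distrib_left, simp)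
  then show ?thesis using Taylor_K(2)[of "1 / r"] that by simp
 qed
 have int: "integrable lborel (%r. indicator {0<..} r * TF r 0 1)" by (rule dominated_integrable[OF dominated_TF(1)])
 have nn: "AE r in lborel. 0 <= indicator {0<..} r * TF r 0 1"
  using pos by (intro AE_I2) (metis indicator_simps(2) greaterThan_iff less_imp_le mult_zero_left order_refl)
 have "Tint TF 0 1 \<noteq> 0"
 proof
  assume "Tint TF 0 1 = 0"
  then have "AE r in lborel. indicator {0<..} r * TF r 0 1 = 0"
   unfolding Tint_def using integral_nonneg_eq_0_iff_AE[OF int nn] by simp
  then have "AE r in lborel. \<not> (0 < r \<and> r < (1::real))" by eventually_elim (use pos in force)
  then have "{0<..<1::real} \<in> null_sets lborel"
   by (subst AE_iff_null_sets) auto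
  then have "emeasure lborel {0<..<1::real} = 0" by (rule null_setsD1)
  then show False by simp
 qed
 moreover have "Tint TF 0 1 \<ge> 0" unfolding Tint_def by (rule integral_nonneg_AE[OF nn])
 ultimately show ?thesis by (simp add: Tric_def)
qed

text \<open>For x > 0 the argument tends to infinity, and r^3 y J (y) = (x - r^2 v) J (y) tends to x
  times the limit of J; the remaining terms vanish. Here the source term of the profile is
  born.\<close>

lemma gauss_primitive_at_0:
 assumes x: "x > 0"
 shows "((%r. r ^ 3 * gaussK (Targ r x v) - 2/3 * r ^ 3 - r * v\<^sup>2 / 2) \<longlongrightarrow> x * Jinf) (at_right 0)"
proof -
 have arg: "filterlim (%r. Targ r x v) at_top (at_right 0)"
 proof -
  have "filterlim (%r. (x - r\<^sup>2 * v) * (inverse r) ^ 3) at_top (at_right 0)"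
  proof (rule filterlim_tendsto_pos_mult_at_top)
   show "((%r. x - r\<^sup>2 * v) \<longlongrightarrow> x - 0\<^sup>2 * v) (at_right 0)" by (intro tendsto_intros)
   show "filterlim (%r::real. inverse r ^ 3) at_top (at_right 0)"
    by (intro filterlim_pow_at_top filterlim_inverse_at_top_right) auto
  qed (use x in auto)
  moreover have "eventually (%r. (x - r\<^sup>2 * v) * (inverse r) ^ 3 = Targ r x v) (at_right 0)"
   using eventually_at_right_less[of 0]
   by eventually_elim (simp add: Targ_def field_simps eval_nat_numeral)
  ultimately show ?thesis by (rule filterlim_mono_eventually[OF _ order_refl order_refl])
 qed
 have J: "((%r. gaussJ (Targ r x v)) \<longlongrightarrow> Jinf) (at_right 0)"
  by (rule filterlim_compose[OF gaussJ_tendsto arg])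
 have e: "((%r. r ^ 3 * exp (- 3/4 * (Targ r x v)\<^sup>2)) \<longlongrightarrow> 0) (at_right 0)"
 proof (rule Lim_null_comparison)
  show "((%r::real. r ^ 3) \<longlongrightarrow> 0) (at_right 0)" by (auto intro!: tendsto_eq_intros)
  show "eventually (%r. norm (r ^ 3 * exp (- 3/4 * (Targ r x v)\<^sup>2)) <= r ^ 3) (at_right 0)"
   using eventually_at_right_less[of 0]
   by eventually_elim (auto simp: abs_mult intro!: mult_left_le)
 qed
 have "((%r. 2/3 * (r ^ 3 * exp (- 3/4 * (Targ r x v)\<^sup>2)) + (x - r\<^sup>2 * v) * gaussJ (Targ r x v)
   - 2/3 * r ^ 3 - r * v\<^sup>2 / 2) \<longlongrightarrow> 2/3 * 0 + (x - 0\<^sup>2 * v) * Jinf - 2/3 * 0 ^ 3 - 0 * v\<^sup>2 / 2) (at_right 0)"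
  by (intro tendsto_intros e J) simp
 then show ?thesis
  unfolding zero_power2 mult_zero_left mult_zero_right diff_0_right add_0_left power_zero_numeral div_0
 proof (rule Lim_transform_eventually)
  show "eventually (%r. 2/3 * (r ^ 3 * exp (- 3/4 * (Targ r x v)\<^sup>2)) + (x - r\<^sup>2 * v) * gaussJ (Targ r x v)
   - 2/3 * r ^ 3 - r * v\<^sup>2 / 2 = r ^ 3 * gaussK (Targ r x v) - 2/3 * r ^ 3 - r * v\<^sup>2 / 2) (at_right 0)"
   using eventually_at_right_less[of 0]
  proof eventually_elim
   case (elim r)
   then have "r ^ 3 * Targ r x v = x - r\<^sup>2 * v" by (simp add: Targ_def field_simps eval_nat_numeral)
   then show ?case by (simp add: gaussK_def distrib_left mult.assoc[symmetric])
  qed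
 qed
qed

lemma gauss_primitive_at_top:
 "((%r. r ^ 3 * gaussK (Targ r x v) - 2/3 * r ^ 3 - r * v\<^sup>2 / 2) \<longlongrightarrow> 0) at_top"
proof -
 define M where "M = 1 + \<bar>x\<bar> + \<bar>v\<bar>"
 show ?thesis
 proof (rule Lim_null_comparison)
  show "((%r::real. (M + M\<^sup>2 + M ^ 6 + M ^ 4) * 100 * (1 / r)) \<longlongrightarrow> 0) at_top"
   by (intro tendsto_mult_right_zero tendsto_divide_0[OF tendsto_const] filterlim_at_top_imp_at_infinity filterlim_ident)
  show "eventually (%r. norm (r ^ 3 * gaussK (Targ r x v) - 2/3 * r ^ 3 - r * v\<^sup>2 / 2) <= (M + M\<^sup>2 + M ^ 6 + M ^ 4) * 100 * (1 / r)) at_top"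
   using eventually_ge_at_top[of 1]
  proof eventually_elim
   case (elim r)
   have r: "r > 0" using elim by simp
   have M: "M \<ge> 1" "\<bar>x\<bar> <= M" "\<bar>v\<bar> <= M" by (auto simp: M_def)
   have tb: "\<bar>TF r x v\<bar> <= 200 * M ^ 6 / r\<^sup>2" by (rule TF_large[OF M(1) r M(2,3) elim])
   have eq: "r ^ 3 * gaussK (Targ r x v) - 2/3 * r ^ 3 - r * v\<^sup>2 / 2 = (TF r x v - 2 * (x * v) - v ^ 4 / 8) / (2 * r)"
    unfolding TF_def using r by (simp add: field_simps eval_nat_numeral)
   have "200 * M ^ 6 / r\<^sup>2 <= 200 * M ^ 6 / 1" using elim M by (intro divide_left_mono) auto
   then have "\<bar>TF r x v\<bar> <= 200 * M ^ 6" using tb by simp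
   moreover have "\<bar>x * v\<bar> <= M\<^sup>2" unfolding abs_mult power2_eq_square using M by (intro mult_mono) auto
   moreover have "\<bar>p - 2 * q - w / 8\<bar> <= 2 * ((a + b + c + d) * 100)"
    if "\<bar>p\<bar> <= 200 * c" "\<bar>q\<bar> <= b" "\<bar>w\<bar> <= d" "0 <= a" for p q w a b c d :: real
   proof -
    have "2 * ((a + b + c + d) * 100) = 200 * a + 200 * b + 200 * c + 200 * d" by simp
    moreover have "0 <= b" "0 <= d" using that by auto
    ultimately show ?thesis using that unfolding abs_le_iff by linarith
   qed
   moreover have "\<bar>v ^ 4\<bar> <= M ^ 4" unfolding power_abs using M by (intro power_mono) auto
   ultimately have "\<bar>TF r x v - 2 * (x * v) - v ^ 4 / 8\<bar> <= 2 * ((M + M\<^sup>2 + M ^ 6 + M ^ 4) * 100)"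
    using M by simp
   then show ?case unfolding eq using r by (simp add: abs_divide divide_simps mult_ac)
  qed
 qed
qed

text \<open>The operator turns the integrand into an exact derivative in r, the counterpart of the
  backward Kolmogorov equation in time. Hence only the two boundary values of the primitive
  remain.\<close>

lemma Tric_pde:
 assumes x: "x > 0"
 shows "v * Tx x v - Tvv x v = Jinf * x"
proof -
 let ?W = "%r. - (r ^ 3 * gaussK (Targ r x v) - 2/3 * r ^ 3 - r * v\<^sup>2 / 2)"
 let ?g = "%r. v * TFx r x v - TFvv r x v"
 have intg: "integrable lborel (%r. indicator {0<..} r * ?g r)"
  using Bochner_Integration.integrable_diff[OF integrable_mult_right[OF dominated_integrable[OF dominated_TF(2), of x v], of v]
    dominated_integrable[OF dominated_TF(4), of x v]]
  by (simp add: algebra_simps)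
 have e: "einterval 0 \<infinity> = {0::real<..}" by (auto simp: einterval_def zero_ereal_def)
 have "(LBINT r=0..\<infinity>. ?g r) = 0 - (- (x * Jinf))"
 proof (rule interval_integral_FTC_integrable)
  fix r :: real assume "0 < ereal r"
  then have r: "r > 0" by (simp add: zero_ereal_def)
  \<comment> \<open>The derivative of \<open>Targ\<close> in r, rewritten so that r^3 d involves
    only \<open>Targ\<close> itself and v.\<close>
  define d where "d = - 3 * Targ r x v / r - 2 * v / r\<^sup>2"
  have d: "((%r. Targ r x v) has_real_derivative d) (at r)"
   unfolding Targ_def d_def using r
   by (auto intro!: derivative_eq_intros simp: field_simps eval_nat_numeral)
  have rd: "r ^ 3 * d = - 3 * r\<^sup>2 * Targ r x v - 2 * r * v"
   using r by (simp add: d_def field_simps eval_nat_numeral)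
  have "(?W has_real_derivative - (3 * r\<^sup>2 * gaussK (Targ r x v) + gaussJ (Targ r x v) * (r ^ 3 * d) - 2 * r\<^sup>2 - v\<^sup>2 / 2)) (at r)"
   by (auto intro!: derivative_eq_intros d simp: algebra_simps)
  moreover have "- (3 * r\<^sup>2 * gaussK (Targ r x v) + gaussJ (Targ r x v) * (r ^ 3 * d) - 2 * r\<^sup>2 - v\<^sup>2 / 2) = ?g r"
   unfolding rd gaussK_def TFx_def TFvv_def by (simp add: algebra_simps power2_eq_square)
  ultimately have "(?W has_real_derivative ?g r) (at r)" by (simp only:)
  then show "(?W has_vector_derivative ?g r) (at r)"
   by (simp add: has_real_derivative_iff_has_vector_derivative)
  have "continuous_on {0<..} ?g"
   unfolding TFx_def TFvv_def Targ_def by (intro continuous_intros) auto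
  then show "isCont ?g r" using r by (simp add: continuous_on_eq_continuous_at)
 next
  show "set_integrable lborel (einterval 0 \<infinity>) ?g"
   using intg by (simp add: e set_integrable_def)
  show "((?W \<circ> real_of_ereal) \<longlongrightarrow> - (x * Jinf)) (at_right 0)"
   using tendsto_minus[OF gauss_primitive_at_0[OF x, of v]] by (simp add: zero_ereal_def ereal_tendsto_simps)
  show "((?W \<circ> real_of_ereal) \<longlongrightarrow> 0) (at_left \<infinity>)"
   using tendsto_minus[OF gauss_primitive_at_top[of x v]] by (simp add: ereal_tendsto_simps)
 qed simp
 moreover have "(LBINT r=0..\<infinity>. ?g r) = (\<integral>r. indicator {0<..} r * ?g r \<partial>lborel)"
  by (simp add: interval_lebesgue_integral_0_infty set_lebesgue_integral_def)
 moreover have "\<dots> = v * Tx x v - Tvv x v"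
  unfolding Tint_def
  using Bochner_Integration.integral_diff[OF integrable_mult_right[OF dominated_integrable[OF dominated_TF(2), of x v], of v]
    dominated_integrable[OF dominated_TF(4), of x v]]
  by (simp add: algebra_simps)
 ultimately show ?thesis by simp
qed

text \<open>Homogeneity fixes the trace for v > 0, and evenness reflects it to v < 0. The absolute
  value is therefore forced by the symmetry.\<close>

lemma Tric_at_0: "Tric 0 v = Tric 0 1 * \<bar>v\<bar> ^ 5"
proof -
 have *: "Tric 0 v = Tric 0 1 * v ^ 5" if "v > 0" for v
  using Tric_homogeneous[OF that, of 0 1] by simp
 have 0: "Tric 0 0 = 0" using Tric_homogeneous[of 2 0 0] by simp
 show ?thesis
  using *[of v] *[of "- v"] Tric_even[of 0 v] 0 by (cases v "0::real" rule: linorder_cases) auto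
qed

lemma Jinf_pos: "Jinf > 0"
proof -
 have "0 < gaussJ (1/2)" using Taylor_J(2)[of "1/2"] gaussJ_mono[of 0 "1/2"] by (simp add: eval_nat_numeral)
 also have "\<dots> <= Jinf" unfolding Jinf_def by (intro cSUP_upper gaussJ_bdd) auto
 finally show ?thesis .
qed

section \<open>Polynomials as lists of monomials\<close>

definition mon :: "'a::euclidean_space list => 'a => real" where
 "mon l w = (\<Prod>b\<leftarrow>l. w \<bullet> b)"

text \<open>An explicit syntax for polynomials: a monomial is the list of its factors with
  repetition, so a kinetic degree can be read off and used for filtering.\<close>

definition lincomb :: "(real \<times> 'a::euclidean_space list) list => 'a => real" where
 "lincomb L w = (\<Sum>(c, l)\<leftarrow>L. c * mon l w)"

lemma mon_simps [simp]: "mon [] w = 1" "mon (b # l) w = (w \<bullet> b) * mon l w"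
 by (simp_all add: mon_def)

lemma mon_append: "mon (l @ m) w = mon l w * mon m w"
 by (induction l) auto

lemma lincomb_simps [simp]: "lincomb [] w = 0" "lincomb ((c, l) # L) w = c * mon l w + lincomb L w"
 by (simp_all add: lincomb_def)

lemma lincomb_append: "lincomb (L @ M) w = lincomb L w + lincomb M w"
 by (simp add: lincomb_def)

lemma lincomb_mult:
 "lincomb (concat (map (%(c, l). map (%(d, m). (c * d, l @ m)) M) L)) w = lincomb L w * lincomb M w"
proof (induction L)
 case Nil
 show ?case by simp
next
 case (Cons a L)
 obtain c l where a: "a = (c, l)" by (cases a)
 have "lincomb (map (%(d, m). (c * d, l @ m)) N) w = c * mon l w * lincomb N w" for N
 proof (induction N)
  case (Cons b N)
  obtain d m where "b = (d, m)" by (cases b)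
  then show ?case using Cons.IH by (simp add: mon_append distrib_left mult_ac)
 qed simp
 then show ?case using Cons.IH by (simp add: a lincomb_append distrib_right)
qed

lemma linear_lincomb:
 fixes f :: "'a::euclidean_space => real"
 assumes "bounded_linear f"
 shows "\<exists>L. (\<forall>a \<in> set L. set (snd a) \<subseteq> Basis) \<and> f = lincomb L"
proof -
 interpret bounded_linear f by fact
 obtain xs where xs: "set xs = (Basis :: 'a set)" "distinct xs" using finite_distinct_list[OF finite_Basis] by blast
 have lf: "f w = (\<Sum>b\<in>Basis. f b * (w \<bullet> b))" for w
 proof -
  have "f w = f (\<Sum>b\<in>Basis. (w \<bullet> b) *\<^sub>R b)" by (simp only: euclidean_representation)
  also have "\<dots> = (\<Sum>b\<in>Basis. (w \<bullet> b) *\<^sub>R f b)" by (simp only: sum scaleR)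
  finally show ?thesis by (simp only: mult.commute real_scaleR_def)
 qed
 have ls: "lincomb (map (%b. (g b, [b])) ys) w = (\<Sum>b\<leftarrow>ys. g b * (w \<bullet> b))" for g ys w
  by (induction ys) auto
 have "f w = lincomb (map (%b. (f b, [b])) xs) w" for w
  unfolding ls using lf[of w] sum_list_distinct_conv_sum_set[OF xs(2), of "%b. f b * (w \<bullet> b)"] by (simp only: xs(1))
 then have "f = lincomb (map (%b. (f b, [b])) xs)" by (rule ext)
 moreover have "\<forall>a \<in> set (map (%b. (f b, [b])) xs). set (snd a) \<subseteq> Basis" using xs by auto
 ultimately show ?thesis by blast
qed

lemma mult_lincomb:
 assumes "\<forall>a \<in> set L. set (snd a) \<subseteq> S" "\<forall>a \<in> set M. set (snd a) \<subseteq> S"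
 shows "\<exists>N. (\<forall>a \<in> set N. set (snd a) \<subseteq> S) \<and> (%w. lincomb L w * lincomb M w) = lincomb N"
proof (intro exI conjI)
 let ?N = "concat (map (%(c, l). map (%(d, m). (c * d, l @ m)) M) L)"
 show "\<forall>a \<in> set ?N. set (snd a) \<subseteq> S" using assms by fastforce
 show "(%w. lincomb L w * lincomb M w) = lincomb ?N"
  by (rule ext) (rule lincomb_mult[symmetric])
qed

lemma polynomial_lincomb_ex:
 fixes p :: "'a::euclidean_space => real"
 assumes "real_polynomial_function p"
 shows "\<exists>L. (\<forall>a \<in> set L. set (snd a) \<subseteq> Basis) \<and> p = lincomb L"
 using assms
proof induction
 case (linear f)
 then show ?case by (rule linear_lincomb)
next
 case (const c)
 have "(%x::'a. c) = lincomb [(c, [])]" by (rule ext) simp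
 then show ?case by (intro exI[of _ "[(c, [])]"] conjI) auto
next
 case (add f g)
 then obtain L M where *: "\<forall>a \<in> set L. set (snd a) \<subseteq> Basis" "f = lincomb L"
  "\<forall>a \<in> set M. set (snd a) \<subseteq> Basis" "g = lincomb M" by (elim exE conjE)
 have "(%x. f x + g x) = lincomb (L @ M)" unfolding * by (rule ext) (simp add: lincomb_append)
 then show ?case using *(1,3) by (intro exI[of _ "L @ M"] conjI) auto
next
 case (mult f g)
 then obtain L M where *: "\<forall>a \<in> set L. set (snd a) \<subseteq> Basis" "f = lincomb L"
  "\<forall>a \<in> set M. set (snd a) \<subseteq> Basis" "g = lincomb M" by (elim exE conjE)
 show ?case unfolding *(2,4) by (rule mult_lincomb[OF *(1,3)])
qed

lemma polynomial_lincombE: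
 fixes p :: "'a::euclidean_space => real"
 assumes "real_polynomial_function p"
 obtains L where "!!c l. (c, l) \<in> set L ==> set l \<subseteq> Basis" "p = lincomb L"
proof -
 from polynomial_lincomb_ex[OF assms] obtain L
  where L: "\<forall>a \<in> set L. set (snd a) \<subseteq> Basis" "p = lincomb L" by (elim exE conjE)
 show ?thesis
 proof (rule that)
  show "set l \<subseteq> Basis" if "(c, l) \<in> set L" for c l using bspec[OF L(1) that] by simp
 qed fact
qed

lemma polynomial_inner [intro]: "real_polynomial_function (%w. w \<bullet> b)"
 by (rule real_polynomial_function.intros(1)) (rule bounded_linear_inner_left)

lemma polynomial_mon [intro]: "real_polynomial_function (mon l)"
proof (induction l)
 case (Cons b l)
 have "mon (b # l) = (%w. (w \<bullet> b) * mon l w)" by auto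
 then show ?case using Cons by (auto intro: real_polynomial_function.intros(4) polynomial_inner)
qed (auto simp: mon_def[abs_def] real_polynomial_function.intros(2))

lemma polynomial_lincomb [intro]: "real_polynomial_function (lincomb L)"
proof (induction L)
 case (Cons a L)
 obtain c l where a: "a = (c, l)" by (cases a)
 have "lincomb (a # L) = (%w. c * mon l w + lincomb L w)" by (auto simp: a)
 then show ?case using Cons by (auto intro!: real_polynomial_function.intros(2-) polynomial_mon)
qed (auto simp: lincomb_def[abs_def] real_polynomial_function.intros(2))

lemma polynomial_growth:
 fixes p :: "'a::euclidean_space => real"
 assumes "real_polynomial_function p"
 obtains C N where "C \<ge> 0" "!!w. \<bar>p w\<bar> <= C * (1 + norm w) ^ N"
proof -
 have "\<exists>C N. C \<ge> 0 \<and> (\<forall>w. \<bar>p w\<bar> <= C * (1 + norm w) ^ N)"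
  using assms
 proof induction
  case (linear f)
  then obtain K where K: "K \<ge> 0" "!!x. \<bar>f x\<bar> <= norm x * K"
   using bounded_linear.nonneg_bounded[OF linear] by auto
  have "\<bar>f x\<bar> <= K * (1 + norm x) ^ 1" for x
   using K(2)[of x] K(1) by (simp add: algebra_simps)
  then show ?case using K(1) by blast
 next
  case (const c)
  show ?case by (intro exI[of _ "\<bar>c\<bar>"] exI[of _ 0]) auto
 next
  case (add f g)
  then obtain C N D M where 1: "C \<ge> 0" "!!w. \<bar>f w\<bar> <= C * (1 + norm w) ^ N"
   "D \<ge> 0" "!!w. \<bar>g w\<bar> <= D * (1 + norm w) ^ M" by blast
  have "\<bar>f w + g w\<bar> <= (C + D) * (1 + norm w) ^ (N + M)" for w
  proof -
   have "C * (1 + norm w) ^ N <= C * (1 + norm w) ^ (N + M)"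
    "D * (1 + norm w) ^ M <= D * (1 + norm w) ^ (N + M)"
    using 1 by (auto intro!: mult_left_mono power_increasing)
   then show ?thesis using 1(2)[of w] 1(4)[of w] by (simp add: algebra_simps)
  qed
  then show ?case using 1 by (intro exI[of _ "C + D"] exI[of _ "N + M"]) auto
 next
  case (mult f g)
  then obtain C N D M where 1: "C \<ge> 0" "!!w. \<bar>f w\<bar> <= C * (1 + norm w) ^ N"
   "D \<ge> 0" "!!w. \<bar>g w\<bar> <= D * (1 + norm w) ^ M" by blast
  have "\<bar>f w * g w\<bar> <= (C * D) * (1 + norm w) ^ (N + M)" for w
   using mult_mono[OF 1(2)[of w] 1(4)[of w]] 1 by (simp add: abs_mult power_add mult_ac)
  then show ?case using 1 by (intro exI[of _ "C * D"] exI[of _ "N + M"]) auto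
 qed
 then show ?thesis using that by blast
qed

lemma polynomial_antiderivative:
 fixes p :: "'a::euclidean_space => real"
 assumes "real_polynomial_function p" and b: "b \<in> Basis"
 obtains q where "real_polynomial_function q"
  "!!w. ((%s. q (w + s *\<^sub>R b)) has_real_derivative p w) (at 0)"
proof -
 have mon: "\<exists>q. real_polynomial_function q \<and> (\<forall>w. ((%s. q (w + s *\<^sub>R b)) has_real_derivative mon l w) (at 0))"
  if l: "set l \<subseteq> Basis" for l
 proof -
  \<comment> \<open>Splitting off the full power of the coordinate in direction \<open>b\<close>
    leaves a factor that is constant along \<open>b\<close>, so only the power has to be
    integrated.\<close>
  have "\<exists>j m. set m \<subseteq> Basis - {b} \<and> (\<forall>w. mon l w = (w \<bullet> b) ^ j * mon m w)"
   using l
  proof (induction l)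
   case Nil
   show ?case by (intro exI[of _ 0] exI[of _ "[]"]) auto
  next
   case (Cons c l)
   then obtain j m where jm: "set m \<subseteq> Basis - {b}" "\<forall>w. mon l w = (w \<bullet> b) ^ j * mon m w" by auto
   show ?case
   proof (cases "c = b")
    case True
    then show ?thesis using jm by (intro exI[of _ "Suc j"] exI[of _ m]) auto
   next
    case False
    then show ?thesis using jm Cons.prems by (intro exI[of _ j] exI[of _ "c # m"]) auto
   qed
  qed
  then obtain j m where m: "set m \<subseteq> Basis - {b}" and jm: "!!w. mon l w = (w \<bullet> b) ^ j * mon m w" by blast
  have inv: "mon m (w + s *\<^sub>R b) = mon m w" for w s
   using m
  proof (induction m)
   case (Cons c m)
   then have "b \<bullet> c = 0" using b by (auto simp: inner_Basis)
   then show ?case using Cons by (auto simp: inner_add_left)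
  qed simp
  define q where "q w = (w \<bullet> b) ^ Suc j / Suc j * mon m w" for w
  have "real_polynomial_function q"
   unfolding q_def[abs_def]
   by (intro real_polynomial_function.intros(4) polynomial_mon real_polynomial_function_divide
     real_polynomial_function_power polynomial_inner)
  moreover have "((%s. q (w + s *\<^sub>R b)) has_real_derivative mon l w) (at 0)" for w
  proof -
   have "((%s. (w \<bullet> b + s) ^ Suc j / Suc j * mon m w) has_real_derivative (w \<bullet> b) ^ j * mon m w) (at 0)"
    by (rule derivative_eq_intros refl | simp)+
   then show ?thesis using b by (simp add: q_def inv jm inner_add_left)
  qed
  ultimately show ?thesis by blast
 qed
 obtain L where L: "!!c l. (c, l) \<in> set L ==> set l \<subseteq> Basis" "p = lincomb L"
  using polynomial_lincombE[OF assms(1)] by metis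
 have "\<exists>q. real_polynomial_function q \<and> (\<forall>w. ((%s. q (w + s *\<^sub>R b)) has_real_derivative lincomb L w) (at 0))"
  using L(1)
 proof (induction L)
  case Nil
  show ?case by (intro exI[of _ "%_. 0"]) (auto simp: real_polynomial_function.intros(2))
 next
  case (Cons a L)
  obtain c l where a: "a = (c, l)" by (cases a)
  have "set l \<subseteq> Basis" using Cons.prems[of c l] a by auto
  from mon[OF this] obtain q1 where q1: "real_polynomial_function q1"
   "!!w. ((%s. q1 (w + s *\<^sub>R b)) has_real_derivative mon l w) (at 0)" by blast
  have "\<exists>q. real_polynomial_function q \<and> (\<forall>w. ((%s. q (w + s *\<^sub>R b)) has_real_derivative lincomb L w) (at 0))"
   using Cons.prems by (intro Cons.IH) auto
  then obtain q2 where q2: "real_polynomial_function q2"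
   "!!w. ((%s. q2 (w + s *\<^sub>R b)) has_real_derivative lincomb L w) (at 0)" by blast
  have "((%s. c * q1 (w + s *\<^sub>R b) + q2 (w + s *\<^sub>R b)) has_real_derivative c * mon l w + lincomb L w) (at 0)" for w
   by (intro DERIV_add DERIV_cmult q1 q2)
  then show ?case
   using q1(1) q2(1) by (intro exI[of _ "%w. c * q1 w + q2 w"])
    (auto simp: a intro!: real_polynomial_function.intros(2-))
 qed
 then show ?thesis using that L(2) by blast
qed

section \<open>Kinetic degree\<close>

lemma Basis_kin:
 "(b :: 'n::finite kin) \<in> Basis \<longleftrightarrow>
   b = (1, 0, 0) \<or> (\<exists>i. b = (0, axis i 1, 0)) \<or> (\<exists>i. b = (0, 0, axis i 1))"
 unfolding Basis_prod_def Basis_vec_def zero_prod_def Basis_real_def by blast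

definition weight :: "'n::finite kin => nat" where
 "weight b = (if fst b \<noteq> 0 then 2 else if fst (snd b) \<noteq> 0 then 3 else 1)"

lemma mon_kscale:
 "set l \<subseteq> Basis ==> mon l (kscale r w) = r ^ (\<Sum>b\<leftarrow>l. weight b) * mon l w"
proof (induction l)
 case (Cons b l)
 have "kscale r w \<bullet> b = r ^ weight b * (w \<bullet> b)"
  using Cons.prems by (cases w) (auto simp: Basis_kin weight_def kscale_def inner_axis axis_eq_0_iff)
 then show ?case using Cons by (simp add: power_add mult_ac)
qed simp

lemma polynomial_compose:
 "real_polynomial_function p ==> polynomial_function g ==> real_polynomial_function (%x. p (g x))"
 using real_polynomial_function_compose[of g p] by (simp add: o_def)

lemma polynomial_borel [measurable]:
 fixes p :: "'a::euclidean_space => real"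
 shows "real_polynomial_function p ==> p \<in> borel_measurable borel"
 by (intro borel_measurable_continuous_onI continuous_on_polymonial_function)
  (simp add: real_polynomial_function_eq)

text \<open>Dividing by R^d, with d the true degree, the sum tends to its leading coefficient, while
  the bound forces the limit 0 as soon as d exceeds \<beta>.\<close>

lemma polynomial_bounded_imp_zero:
 fixes c :: "nat => real"
 assumes bnd: "!!R. R \<ge> 1 ==> \<bar>\<Sum>j\<le>m. c j * R ^ j\<bar> <= C * R powr \<beta>" and j: "j <= m" "real j > \<beta>"
 shows "c j = 0"
proof (rule ccontr)
 assume "c j \<noteq> 0"
 define d where "d = Max {i. i <= m \<and> c i \<noteq> 0}"
 have fin: "finite {i. i <= m \<and> c i \<noteq> 0}" by simp
 have d: "d <= m" "c d \<noteq> 0" using Max_in[OF fin] \<open>c j \<noteq> 0\<close> j unfolding d_def by blast+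
 have jd: "j <= d" unfolding d_def using \<open>c j \<noteq> 0\<close> j fin by (intro Max_ge) auto
 have z: "c i = 0" if "i <= m" "i > d" for i
  using Max_ge[OF fin, of i] that unfolding d_def[symmetric] by force
 have lim1: "((%R. (\<Sum>i\<le>m. c i * R ^ i) / R ^ d) \<longlongrightarrow> (\<Sum>i\<le>m. if i = d then c d else 0)) at_top"
 proof (rule Lim_transform_eventually)
  show "((%R. \<Sum>i\<le>m. c i * (R ^ i / R ^ d)) \<longlongrightarrow> (\<Sum>i\<le>m. if i = d then c d else 0)) at_top"
  proof (intro tendsto_sum)
   fix i assume i: "i \<in> {..m}"
   consider "i = d" | "i < d" | "i > d" by linarith
   then show "((%R. c i * (R ^ i / R ^ d)) \<longlongrightarrow> (if i = d then c d else 0)) at_top"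
   proof cases
    case 1
    have "eventually (%R::real. c i = c i * (R ^ i / R ^ d)) at_top"
     using eventually_gt_at_top[of 0] by eventually_elim (simp add: 1)
    then show ?thesis using 1 by (auto intro: Lim_transform_eventually[OF tendsto_const])
   next
    case 2
    have "((%R::real. c i * (1 / R ^ (d - i))) \<longlongrightarrow> c i * 0) at_top"
     using 2 by (intro tendsto_intros tendsto_divide_0[OF tendsto_const]
       filterlim_at_top_imp_at_infinity filterlim_pow_at_top filterlim_ident) auto
    moreover have "eventually (%R::real. c i * (1 / R ^ (d - i)) = c i * (R ^ i / R ^ d)) at_top"
     using eventually_gt_at_top[of 0] by eventually_elim (use 2 in \<open>simp add: power_diff field_simps\<close>)
    ultimately show ?thesis using 2 by (auto intro: Lim_transform_eventually)
   next
    case 3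
    then show ?thesis using z[of i] i by simp
   qed
  qed
 qed (simp add: sum_divide_distrib)
 have lim2: "((%R. (\<Sum>i\<le>m. c i * R ^ i) / R ^ d) \<longlongrightarrow> 0) at_top"
 proof (rule Lim_null_comparison)
  show "((%R. C * R powr (\<beta> - d)) \<longlongrightarrow> 0) at_top"
   using j jd by (intro tendsto_mult_right_zero tendsto_neg_powr filterlim_ident) auto
  show "eventually (%R. norm ((\<Sum>i\<le>m. c i * R ^ i) / R ^ d) <= C * R powr (\<beta> - d)) at_top"
   using eventually_ge_at_top[of 1]
  proof eventually_elim
   case (elim R)
   then have "\<bar>\<Sum>i\<le>m. c i * R ^ i\<bar> / R ^ d <= C * R powr \<beta> / R ^ d"
    using bnd[of R] by (intro divide_right_mono) auto
   then show ?case using elim by (simp add: powr_diff powr_realpow abs_divide)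
  qed
 qed
 have "(\<Sum>i\<le>m. if i = d then c d else 0) = 0" using tendsto_unique[OF _ lim1 lim2] by simp
 then show False using d by simp
qed

section \<open>Directional derivatives and integration over the half-domain\<close>

definition dir_deriv :: "'a::euclidean_space => ('a => real) => ('a => real) => bool" where
 "dir_deriv b f f' \<longleftrightarrow> continuous_on UNIV f \<and> continuous_on UNIV f' \<and>
   (\<forall>w. ((%h. f (w + h *\<^sub>R b)) has_real_derivative f' w) (at 0))"

lemma dir_derivD: "dir_deriv b f f' ==> ((%h. f (w + h *\<^sub>R b)) has_real_derivative f' w) (at 0)"
 unfolding dir_deriv_def by blast

lemma dir_deriv_line:
 assumes "dir_deriv b f f'"
 shows "((%h. f (w + h *\<^sub>R b)) has_real_derivative f' (w + s *\<^sub>R b)) (at s)"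
proof -
 have "((%h. f ((w + s *\<^sub>R b) + h *\<^sub>R b)) has_real_derivative f' (w + s *\<^sub>R b)) (at 0)"
  using assms by (simp add: dir_deriv_def)
 then have "((%h. f (w + (h + s) *\<^sub>R b)) has_real_derivative f' (w + s *\<^sub>R b)) (at 0)"
  by (simp add: algebra_simps)
 then show ?thesis using DERIV_shift[of "%h. f (w + h *\<^sub>R b)" _ 0 s] by simp
qed

lemma dir_deriv_const: "dir_deriv b (%_. c) (%_. 0)"
 by (auto simp: dir_deriv_def)

lemma dir_deriv_inner: "dir_deriv b (%w. w \<bullet> c) (%_. b \<bullet> c)"
 unfolding dir_deriv_def inner_add_left inner_scaleR_left
 by (auto intro!: continuous_intros derivative_eq_intros)

lemma dir_deriv_add: "dir_deriv b f f' ==> dir_deriv b g g' ==> dir_deriv b (%w. f w + g w) (%w. f' w + g' w)"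
 unfolding dir_deriv_def by (auto intro!: continuous_intros DERIV_add)

lemma dir_deriv_mult: "dir_deriv b f f' ==> dir_deriv b g g' ==>
  dir_deriv b (%w. f w * g w) (%w. f w * g' w + f' w * g w)"
proof -
 assume a: "dir_deriv b f f'" "dir_deriv b g g'"
 have "((%h. f (w + h *\<^sub>R b) * g (w + h *\<^sub>R b)) has_real_derivative f w * g' w + f' w * g w) (at 0)" for w
  using DERIV_mult[of "%h. f (w + h *\<^sub>R b)" "f' w" 0 UNIV "%h. g (w + h *\<^sub>R b)" "g' w"] a
  by (simp add: dir_deriv_def mult.commute add.commute)
 then show ?thesis using a unfolding dir_deriv_def by (auto intro!: continuous_intros)
qed

lemma dir_deriv_cmult: "dir_deriv b f f' ==> dir_deriv b (%w. c * f w) (%w. c * f' w)"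
 using dir_deriv_mult[OF dir_deriv_const[of b c], of f f'] by simp

lemma dir_deriv_cong: "dir_deriv b f f' ==> (!!w. f w = g w) ==> (!!w. f' w = g' w) ==> dir_deriv b g g'"
 by (simp add: dir_deriv_def)

lemma C1c_dir_deriv:
 assumes "C1c_with_gradient \<phi> G"
 shows "dir_deriv b \<phi> (%w. G w \<bullet> b)"
proof -
 have g: "(\<phi> has_derivative (%h. h \<bullet> G w)) (at w)" for w
  using assms by (simp add: C1c_with_gradient_def gderiv_def)
 have "((%h. \<phi> (w + h *\<^sub>R b)) has_real_derivative G w \<bullet> b) (at 0)" for w
 proof -
  have l: "((%h::real. w + h *\<^sub>R b) has_derivative (%h. h *\<^sub>R b)) (at 0)"
   by (auto intro!: derivative_eq_intros)
  have "((%h. \<phi> (w + h *\<^sub>R b)) has_derivative (%h. (h *\<^sub>R b) \<bullet> G w)) (at 0)"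
   using has_derivative_compose[OF l, of \<phi> "%h. h \<bullet> G w"] g[of w] by simp
  then show ?thesis
   unfolding has_field_derivative_def by (rule has_derivative_eq_rhs) (auto simp: inner_commute)
 qed
 moreover have "continuous_on UNIV \<phi>"
  using g by (intro has_derivative_continuous_on[of UNIV]) (auto intro: has_derivative_at_withinI)
 moreover have "continuous_on UNIV (%w. G w \<bullet> b)"
  using assms by (auto simp: C1c_with_gradient_def intro!: continuous_intros)
 ultimately show ?thesis by (simp add: dir_deriv_def)
qed

lemma C1c_support:
 assumes "C1c_with_gradient \<phi> G"
 obtains \<rho> where "!!w. norm w > \<rho> ==> \<phi> w = 0" "!!w. norm w > \<rho> ==> G w = 0"
proof -
 have "bounded (closure {z. \<phi> z \<noteq> 0})" using assms by (simp add: C1c_with_gradient_def compact_imp_bounded)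
 then obtain \<rho> where "!!w. w \<in> closure {z. \<phi> z \<noteq> 0} ==> norm w <= \<rho>" by (auto simp: bounded_iff)
 then have 1: "norm w > \<rho> ==> \<phi> w = 0" for w using closure_subset[of "{z. \<phi> z \<noteq> 0}"] by force
 have "G w = 0" if w: "norm w > \<rho>" for w
 proof -
  have "(\<phi> has_derivative (%h. h \<bullet> G w)) (at w)"
   using assms by (simp add: C1c_with_gradient_def gderiv_def)
  moreover have "((%_. 0) has_derivative (%h. 0)) (at w)" by simp
  then have "(\<phi> has_derivative (%h. 0)) (at w)"
  proof (rule has_derivative_transform_within_open)
   show "open {w. norm w > \<rho>}" by (intro open_Collect_less continuous_intros)
  qed (use w 1 in auto)
  ultimately have "(%h. h \<bullet> G w) = (%h. 0)" by (rule has_derivative_unique)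
  then have "G w \<bullet> G w = 0" by metis
  then show ?thesis by simp
 qed
 then show ?thesis using that 1 by blast
qed

lemma integrable_compact_support:
 fixes g :: "'a::euclidean_space => 'b::euclidean_space"
 assumes g: "continuous_on UNIV g" and supp: "!!w. norm w > \<rho> ==> g w = 0" and D: "D \<in> sets borel"
 shows "integrable lborel (%w. indicator D w *\<^sub>R g w)"
proof -
 have "integrable lborel (%w. indicator (cball 0 \<rho>) w *\<^sub>R g w)"
  by (rule borel_integrable_compact) (auto intro: continuous_on_subset[OF g])
 moreover have "(%w. indicator (cball 0 \<rho>) w *\<^sub>R g w) = g"
  using supp by (fastforce simp: indicator_def)
 ultimately have i: "integrable lborel g" by (simp only:)
 have "integrable lborel (%w. indicator D w *\<^sub>R g w) \<longleftrightarrow> set_integrable lborel D g" by (simp add: set_integrable_def)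
 moreover have "set_integrable lborel D g"
  using set_integrable_subset[of lborel UNIV g D] i D by (simp add: set_integrable_def)
 ultimately show ?thesis by simp
qed

definition xk :: "'n::finite => 'n kin => real" where "xk k w = fst (snd w) $ k"

lemma half_domain_xk: "half_domain k = {w. xk k w > 0}"
 by (auto simp: half_domain_def xk_def)

lemma xk_linear [simp]: "xk k (w + h *\<^sub>R b) = xk k w + h * xk k b"
 by (simp add: xk_def)

lemma xk_continuous [continuous_intros]: "continuous_on S f ==> continuous_on S (%w. xk k (f w))"
 unfolding xk_def by (intro continuous_intros)

lemma xk_measurable [measurable]: "xk k \<in> borel_measurable borel"
 by (intro borel_measurable_continuous_onI continuous_intros)

lemma half_domain_open: "open (half_domain k)"
 unfolding half_domain_xk by (intro open_Collect_less continuous_intros)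

lemma half_domain_borel [measurable]: "half_domain k \<in> sets borel"
 by (rule borel_open[OF half_domain_open])

lemma AE_xk_nonzero: "AE w in lborel. xk k w \<noteq> 0"
proof -
 let ?a = "(0, axis k 1, 0) :: 'a kin"
 have eq: "{w. xk k w = 0} = {w. ?a \<bullet> w = 0}" by (auto simp: xk_def inner_prod_def inner_axis')
 have "negligible {w. xk k w = 0}"
  unfolding eq by (rule negligible_hyperplane) (auto simp: zero_prod_def axis_eq_0_iff)
 then have "{w. xk k w = 0} \<in> null_sets (completion lborel)" by (simp add: negligible_iff_null_sets)
 then have "{w. xk k w = 0} \<in> null_sets lborel" by (subst (asm) null_sets_completion_iff) measurable
 from AE_not_in[OF this] show ?thesis by simp
qed

text \<open>Instead of a divergence theorem: the integral of the translated function does not depend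
  on the translation, and differentiating at 0 under the integral gives the claim. Either the
  translation preserves the half-domain or \<open>W\<close> vanishes on its boundary; both make the
  truncated function Lipschitz along \<open>b\<close>.\<close>

lemma integral_half_domain_dir_deriv:
 assumes W: "dir_deriv b W W'" and supp: "!!w. norm w > \<rho> ==> W w = 0"
  and bd: "xk k b = 0 \<or> (\<forall>w. xk k w = 0 --> W w = 0)"
 shows "integrable lborel (%w. indicator (half_domain k) w * W' w)"
  and "(\<integral>w. indicator (half_domain k) w * W' w \<partial>lborel) = 0"
proof -
 let ?D = "half_domain k"
 define F where "F h w = indicator ?D (w + h *\<^sub>R b) * W (w + h *\<^sub>R b)" for h w
 have cW: "continuous_on UNIV W" and cW': "continuous_on UNIV W'" using W by (auto simp: dir_deriv_def)
 have [measurable]: "W \<in> borel_measurable borel" "W' \<in> borel_measurable borel"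
  using cW cW' by (auto intro: borel_measurable_continuous_onI)
 have W'0: "W' w = 0" if "norm w > \<rho>" for w
 proof -
  have "((%h. W (w + h *\<^sub>R b)) has_real_derivative W' w) (at 0)" by (rule dir_derivD[OF W])
  moreover have "((%h. W (w + h *\<^sub>R b)) has_real_derivative 0) (at 0)"
  proof (rule has_field_derivative_transform_within_open[of "%_. 0"])
   show "open {h. norm (w + h *\<^sub>R b) > \<rho>}" by (intro open_Collect_less continuous_intros)
  qed (use that supp in auto)
  ultimately show ?thesis by (rule DERIV_unique)
 qed
 have "bounded (W' ` cball 0 \<rho>)"
  by (intro compact_imp_bounded compact_continuous_image continuous_on_subset[OF cW']) auto
 then obtain M where "\<forall>y\<in>W' ` cball 0 \<rho>. norm y <= M" unfolding bounded_iff by blast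
 then have M: "\<bar>W' w\<bar> <= M" if "w \<in> cball 0 \<rho>" for w using that by (metis imageI real_norm_def)
 define M' where "M' = max M 0"
 have M': "\<bar>W' w\<bar> <= M'" "M' \<ge> 0" for w
  using M[of w] W'0[of w] by (cases "norm w > \<rho>"; force simp: M'_def)+
 have lip: "\<bar>W (w + h *\<^sub>R b) - W w\<bar> <= \<bar>h\<bar> * M'" for w h
  using mvt_line[of h "%h. W (w + h *\<^sub>R b)" "%s. W' (w + s *\<^sub>R b)" M', OF dir_deriv_line[OF W]] M' by simp
 have intF: "integrable lborel (F 0)"
  using integrable_compact_support[OF cW supp half_domain_borel[of k]] by (simp add: F_def[abs_def])
 have shift: "integrable lborel (F h) \<and> (\<integral>w. F h w \<partial>lborel) = (\<integral>w. F 0 w \<partial>lborel)" for h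
  using vol_scaling_integral[OF vol_scaling_translation[of "h *\<^sub>R b"], of "F 0"] intF
  by (simp add: F_def[abs_def] add.commute)
 have lipF: "\<bar>F h w - F 0 w\<bar> <= \<bar>h\<bar> * M'" for h w
 proof -
  consider "w \<in> ?D" "w + h *\<^sub>R b \<in> ?D" | "w \<notin> ?D" "w + h *\<^sub>R b \<notin> ?D"
   | "w \<in> ?D \<longleftrightarrow> w + h *\<^sub>R b \<notin> ?D" by blast
  then show ?thesis
  proof cases
   case 1 then show ?thesis using lip by (simp add: F_def)
  next
   case 2 then show ?thesis using M' by (simp add: F_def)
  next
   \<comment> \<open>Exactly one endpoint lies in the half-domain, so the segment meets the boundary
     at parameter \<open>s\<close>, where \<open>W\<close> vanishes; the Lipschitz bound from there
     controls the endpoint that counts.\<close>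
   case 3
   then have b0: "xk k b \<noteq> 0" by (auto simp: half_domain_xk)
   then have z: "!!w. xk k w = 0 ==> W w = 0" using bd by blast
   define s where "s = - xk k w / xk k b"
   have s0: "W (w + s *\<^sub>R b) = 0" using b0 by (intro z) (simp only: xk_linear, simp add: s_def)
   have s: "\<bar>s\<bar> <= \<bar>h\<bar>" "\<bar>h - s\<bar> <= \<bar>h\<bar>"
   proof -
    have "xk k w = - s * xk k b" using b0 by (simp add: s_def)
    then have "(0 < - s * xk k b) \<noteq> (0 < (h - s) * xk k b)" using 3 by (simp add: half_domain_xk algebra_simps)
    then have "(0 <= s \<and> s <= h) \<or> (h <= s \<and> s <= 0)"
     unfolding zero_less_mult_iff using b0 by linarith
    then show "\<bar>s\<bar> <= \<bar>h\<bar>" "\<bar>h - s\<bar> <= \<bar>h\<bar>" by auto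
   qed
   have "\<bar>W w\<bar> <= \<bar>h\<bar> * M'" using lip[of w s] s0 mult_right_mono[OF s(1) M'(2)] by simp
   moreover have "\<bar>W (w + h *\<^sub>R b)\<bar> <= \<bar>h\<bar> * M'"
   proof -
    have e: "(w + s *\<^sub>R b) + (h - s) *\<^sub>R b = w + h *\<^sub>R b" by (simp add: algebra_simps)
    show ?thesis using lip[of "w + s *\<^sub>R b" "h - s"] s0 mult_right_mono[OF s(2) M'(2)] unfolding e by simp
   qed
   ultimately show ?thesis using 3 by (auto simp: F_def indicator_def)
  qed
 qed
 have F0: "F h w = F 0 w" if "norm w > \<rho> + norm b" "\<bar>h\<bar> <= 1" for h w
 proof -
  have "norm (h *\<^sub>R b) <= norm b" using that by (simp add: mult_left_le_one_le)
  then have "norm (w + h *\<^sub>R b) > \<rho>" using that norm_triangle_ineq2[of w "- (h *\<^sub>R b)"] by simp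
  moreover have "norm w > \<rho>" using that norm_ge_zero[of b] by linarith
  ultimately show ?thesis by (simp add: F_def supp)
 qed
 have p1: "AE w in lborel. ((%h. F h w) has_real_derivative indicator ?D w * W' w) (at 0)"
   using AE_xk_nonzero[of k]
  proof eventually_elim
   case (elim w)
   have d: "((%h. W (w + h *\<^sub>R b)) has_real_derivative W' w) (at 0)" by (rule dir_derivD[OF W])
   show ?case
   proof (cases "xk k w > 0")
    case True
    have "((%h. F h w) has_real_derivative W' w) (at 0)"
    proof (rule has_field_derivative_transform_within_open[OF d])
     show "open {h. xk k (w + h *\<^sub>R b) > 0}" by (intro open_Collect_less continuous_intros)
    qed (use True in \<open>auto simp: F_def half_domain_xk\<close>)
    then show ?thesis using True by (simp add: half_domain_xk)
   next
    case False
    then have n: "xk k w < 0" using elim by simp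
    have "((%h. F h w) has_real_derivative 0) (at 0)"
    proof (rule has_field_derivative_transform_within_open[of "%_. 0"])
     show "open {h. xk k (w + h *\<^sub>R b) < 0}" by (intro open_Collect_less continuous_intros)
    qed (use n in \<open>auto simp: F_def half_domain_xk\<close>)
    then show ?thesis using False by (simp add: half_domain_xk)
   qed
  qed
 have p2: "AE w in lborel. \<forall>h. \<bar>h\<bar> <= 1 --> \<bar>F h w - F 0 w\<bar> <= \<bar>h\<bar> * (M' * indicator (cball 0 (\<rho> + norm b)) w)"
 proof (intro AE_I2 allI impI)
  fix w and h :: real assume h: "\<bar>h\<bar> <= 1"
  show "\<bar>F h w - F 0 w\<bar> <= \<bar>h\<bar> * (M' * indicator (cball 0 (\<rho> + norm b)) w)"
  proof (cases "norm w > \<rho> + norm b")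
   case True
   show ?thesis unfolding F0[OF True h] using M'(2) by simp
  next
   case False
   then show ?thesis using lipF[of h w] by simp
  qed
 qed
 have p3: "integrable lborel (%w::'a kin. M' * indicator (cball 0 (\<rho> + norm b)) w)"
   by (intro integrable_mult_right integrable_real_indicator emeasure_lborel_cball_finite) auto
 have p4: "(%w. indicator ?D w * W' w) \<in> borel_measurable lborel" by measurable
 note key = has_real_derivative_integral[OF _ p1 p2 p3 p4, OF conjunct1[OF shift]]
 show "integrable lborel (%w. indicator ?D w * W' w)" by (rule key)
 have "(%h. \<integral>w. F h w \<partial>lborel) = (%_. \<integral>w. F 0 w \<partial>lborel)"
  using shift by (intro ext) blast
 then have "((%h. \<integral>w. F h w \<partial>lborel) has_real_derivative 0) (at 0)"
  by (simp only: DERIV_const)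
 then show "(\<integral>w. indicator ?D w * W' w \<partial>lborel) = 0"
  using DERIV_unique[OF key(2)] by simp
qed

section \<open>Classical solutions are weak solutions\<close>

text \<open>\<open>H\<close> holds the pure second velocity derivatives, one per component, so the
  sum of its components is the velocity Laplacian.\<close>

definition classical :: "('n::finite kin => real) => ('n kin => real) => ('n kin => real^'n) =>
  ('n kin => real^'n) => ('n kin => real^'n) => bool" where
 "classical f A X V H \<longleftrightarrow> dir_deriv (1, 0, 0) f A \<and>
   (\<forall>i. dir_deriv (0, axis i 1, 0) f (%w. X w $ i)) \<and>
   (\<forall>i. dir_deriv (0, 0, axis i 1) f (%w. V w $ i)) \<and>
   (\<forall>i. dir_deriv (0, 0, axis i 1) (%w. V w $ i) (%w. H w $ i))"

definition kop :: "('n::finite kin => real) => ('n kin => real^'n) => ('n kin => real^'n) => 'n kin => real" where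
 "kop A X H w = A w + snd (snd w) \<bullet> X w - (\<Sum>i\<in>UNIV. H w $ i)"

lemma classical_const: "classical (%_. c) (%_. 0) (%_. 0) (%_. 0) (%_. 0)"
 by (simp add: classical_def dir_deriv_const)

lemma classical_t: "classical fst (%_. 1) (%_. 0) (%_. 0) (%_. 0)"
proof -
 have "dir_deriv b fst (%_. fst b)" for b :: "'a kin"
  by (rule dir_deriv_cong[OF dir_deriv_inner[of b "(1, 0, 0)"]]) (auto simp: inner_prod_def)
 from this[of "(1, 0, 0)"] this[of "(0, _, _)"] show ?thesis by (simp add: classical_def dir_deriv_const)
qed

lemma classical_x: "classical (%w. fst (snd w) $ j) (%_. 0) (%_. axis j 1) (%_. 0) (%_. 0)"
proof -
 have "dir_deriv b (%w. fst (snd w) $ j) (%_. fst (snd b) $ j)" for b :: "'a kin"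
  by (rule dir_deriv_cong[OF dir_deriv_inner[of b "(0, axis j 1, 0)"]]) (auto simp: inner_prod_def inner_axis)
 from this[of "(1, 0, 0)"] this[of "(0, axis _ 1, 0)"] this[of "(0, 0, axis _ 1)"]
 show ?thesis by (simp add: classical_def dir_deriv_const axis_def eq_commute)
qed

lemma classical_v: "classical (%w. snd (snd w) $ j) (%_. 0) (%_. 0) (%_. axis j 1) (%_. 0)"
proof -
 have "dir_deriv b (%w. snd (snd w) $ j) (%_. snd (snd b) $ j)" for b :: "'a kin"
  by (rule dir_deriv_cong[OF dir_deriv_inner[of b "(0, 0, axis j 1)"]]) (auto simp: inner_prod_def inner_axis)
 from this[of "(1, 0, 0)"] this[of "(0, axis _ 1, 0)"] this[of "(0, 0, axis _ 1)"]
 show ?thesis by (simp add: classical_def dir_deriv_const axis_def eq_commute)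
qed

lemma classical_add:
 assumes "classical f A X V H" "classical f' A' X' V' H'"
 shows "classical (%w. f w + f' w) (%w. A w + A' w) (%w. X w + X' w) (%w. V w + V' w) (%w. H w + H' w)"
 using assms by (auto simp: classical_def intro!: dir_deriv_add)

lemma classical_mult:
 assumes "classical f A X V H" "classical f' A' X' V' H'"
 shows "classical (%w. f w * f' w) (%w. f w * A' w + A w * f' w) (%w. f w *\<^sub>R X' w + f' w *\<^sub>R X w)
  (%w. f w *\<^sub>R V' w + f' w *\<^sub>R V w)
  (%w. f w *\<^sub>R H' w + f' w *\<^sub>R H w + (\<chi> i. 2 * (V w $ i * V' w $ i)))"
 unfolding classical_def
proof (intro conjI allI)
 show "dir_deriv (1, 0, 0) (%w. f w * f' w) (%w. f w * A' w + A w * f' w)"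
  using assms by (intro dir_deriv_mult) (auto simp: classical_def)
 fix i
 have 1: "dir_deriv (0, axis i 1, 0) f (%w. X w $ i)" "dir_deriv (0, axis i 1, 0) f' (%w. X' w $ i)"
  "dir_deriv (0, 0, axis i 1) f (%w. V w $ i)" "dir_deriv (0, 0, axis i 1) f' (%w. V' w $ i)"
  "dir_deriv (0, 0, axis i 1) (%w. V w $ i) (%w. H w $ i)" "dir_deriv (0, 0, axis i 1) (%w. V' w $ i) (%w. H' w $ i)"
  using assms by (auto simp: classical_def)
 show "dir_deriv (0, axis i 1, 0) (%w. f w * f' w) (%w. (f w *\<^sub>R X' w + f' w *\<^sub>R X w) $ i)"
  by (rule dir_deriv_cong[OF dir_deriv_mult[OF 1(1,2)]]) auto
 show "dir_deriv (0, 0, axis i 1) (%w. f w * f' w) (%w. (f w *\<^sub>R V' w + f' w *\<^sub>R V w) $ i)"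
  by (rule dir_deriv_cong[OF dir_deriv_mult[OF 1(3,4)]]) auto
 show "dir_deriv (0, 0, axis i 1) (%w. (f w *\<^sub>R V' w + f' w *\<^sub>R V w) $ i)
   (%w. (f w *\<^sub>R H' w + f' w *\<^sub>R H w + (\<chi> i. 2 * (V w $ i * V' w $ i))) $ i)"
  by (rule dir_deriv_cong[OF dir_deriv_add[OF dir_deriv_mult[OF 1(3,6)] dir_deriv_mult[OF 1(4,5)]]]) auto
qed

lemma classical_cmult:
 "classical f A X V H ==> classical (%w. c * f w) (%w. c * A w) (%w. c *\<^sub>R X w) (%w. c *\<^sub>R V w) (%w. c *\<^sub>R H w)"
 by (auto simp: classical_def intro!: dir_deriv_cmult)

lemma classical_Tric:
 "classical (%(t, x, v). Tric (x $ k) (v $ k)) (%_. 0) (%(t, x, v). axis k (Tx (x $ k) (v $ k)))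
   (%(t, x, v). axis k (Tv (x $ k) (v $ k))) (%(t, x, v). axis k (Tvv (x $ k) (v $ k)))"
proof -
 have c: "continuous_on UNIV (%w::'a kin. f (fst (snd w) $ k) (snd (snd w) $ k))"
  if "continuous_on UNIV (%(x, v). f x v)" for f :: "real => real => real"
 proof -
  have "continuous_on UNIV (%w::'a kin. (fst (snd w) $ k, snd (snd w) $ k))"
   by (intro continuous_intros)
  from continuous_on_compose2[OF that this] show ?thesis by simp
 qed
 note cs = Tric_continuous[THEN c]
 show ?thesis
  unfolding classical_def dir_deriv_def case_prod_beta
  using cs Tric_x_deriv Tric_v_deriv Tv_v_deriv
  by (auto simp: axis_def intro: continuous_on_const)
qed

lemma L2_loc_continuous:
 fixes f :: "'a::euclidean_space => 'b::euclidean_space"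
 assumes f: "continuous_on UNIV f" and S: "closed S"
 shows "L2_loc S f"
 unfolding L2_loc_def
proof (intro conjI allI impI)
 have [measurable]: "f \<in> borel_measurable borel" using f by (rule borel_measurable_continuous_onI)
 have [measurable]: "S \<in> sets borel" using S by (rule borel_closed)
 have "(%x. indicator S x *\<^sub>R f x) \<in> borel_measurable lborel" by measurable
 then show "set_borel_measurable lebesgue S f"
  unfolding set_borel_measurable_def by (rule measurable_completion)
 fix K :: "'a set" assume K: "compact K \<and> K \<subseteq> S"
 have "integrable lborel (%x. indicator K x *\<^sub>R ((norm (f x))\<^sup>2))"
  using K by (intro borel_integrable_compact) (auto intro!: continuous_intros continuous_on_subset[OF f])
 then show "set_integrable lebesgue K (%z. (norm (f z))\<^sup>2)"
  unfolding set_integrable_def by (intro integrable_completion[THEN iffD2]) (auto dest: borel_measurable_integrable)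
qed

lemma set_integral_lebesgue_lborel:
 fixes g :: "'a::euclidean_space => 'b::euclidean_space"
 assumes g: "continuous_on UNIV g" and D: "D \<in> sets borel" and eq: "!!w. w \<in> D ==> f w = g w"
 shows "(LINT w:D|lebesgue. f w) = (\<integral>w. indicator D w *\<^sub>R g w \<partial>lborel)"
proof -
 have [measurable]: "g \<in> borel_measurable borel" using g by (rule borel_measurable_continuous_onI)
 have "(LINT w:D|lebesgue. f w) = (\<integral>w. indicator D w *\<^sub>R g w \<partial>lebesgue)"
  unfolding set_lebesgue_integral_def by (intro Bochner_Integration.integral_cong) (auto simp: indicator_def eq)
 also have "\<dots> = (\<integral>w. indicator D w *\<^sub>R g w \<partial>lborel)"
 proof (rule integral_completion)
  note [measurable] = D
  have "(%w. indicator D w *\<^sub>R g w) \<in> borel_measurable borel" by measurable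
  then show "(%w. indicator D w *\<^sub>R g w) \<in> borel_measurable lborel" by simp
 qed
 finally show ?thesis .
qed

lemma C1c_continuous: "C1c_with_gradient \<phi> G ==> continuous_on UNIV \<phi>" "C1c_with_gradient \<phi> G ==> continuous_on UNIV G"
 using C1c_dir_deriv[of \<phi> G 0] by (auto simp: dir_deriv_def C1c_with_gradient_def)

lemma classical_continuous:
 assumes "classical f A X V H"
 shows "continuous_on UNIV f" "continuous_on UNIV A" "continuous_on UNIV X" "continuous_on UNIV V" "continuous_on UNIV H"
proof -
 have v: "continuous_on UNIV Y" if "!!i. continuous_on UNIV (%w. Y w $ i)" for Y :: "'n kin => real^'n"
 proof -
  have "continuous_on UNIV (%w. \<chi> i. Y w $ i)" by (intro continuous_on_vec_lambda that)
  then show ?thesis by simp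
 qed
 show "continuous_on UNIV f" "continuous_on UNIV A" "continuous_on UNIV X" "continuous_on UNIV V" "continuous_on UNIV H"
  using assms by (auto simp: classical_def dir_deriv_def intro!: v)
qed

lemma classical_weak_v_gradient:
 fixes f :: "'n::finite kin => real"
 assumes c: "classical f A X V H"
 shows "weak_v_gradient (half_domain k) f V"
 unfolding weak_v_gradient_def
proof (intro allI impI, elim conjE)
 fix \<phi> :: "'n kin => real" and G assume \<phi>: "C1c_with_gradient \<phi> G"
 note cc = classical_continuous[OF c] C1c_continuous[OF \<phi>]
 obtain \<rho> where \<rho>: "!!w. norm w > \<rho> ==> \<phi> w = 0" "!!w. norm w > \<rho> ==> G w = 0" using C1c_support[OF \<phi>] by blast
 let ?D = "half_domain k"
 have c1: "continuous_on UNIV (%z. f z *\<^sub>R snd (snd (G z)))" and c2: "continuous_on UNIV (%z. \<phi> z *\<^sub>R V z)"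
  using cc by (auto intro!: continuous_intros)
 have i1: "integrable lborel (%w. indicator ?D w *\<^sub>R (f w *\<^sub>R snd (snd (G w))))"
  using \<rho> by (intro integrable_compact_support[OF c1, of \<rho>]) auto
 have i2: "integrable lborel (%w. indicator ?D w *\<^sub>R (\<phi> w *\<^sub>R V w))"
  using \<rho> by (intro integrable_compact_support[OF c2, of \<rho>]) auto
 have "(\<integral>w. indicator ?D w *\<^sub>R (f w *\<^sub>R snd (snd (G w))) + indicator ?D w *\<^sub>R (\<phi> w *\<^sub>R V w) \<partial>lborel) = 0"
 proof (subst vec_eq_iff, rule allI)
  fix i
  have d: "dir_deriv (0, 0, axis i 1) (%w. f w * \<phi> w) (%w. f w * (G w \<bullet> (0, 0, axis i 1)) + V w $ i * \<phi> w)"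
   using c by (intro dir_deriv_mult C1c_dir_deriv[OF \<phi>]) (auto simp: classical_def)
  have "(\<integral>w. indicator ?D w *\<^sub>R (f w *\<^sub>R snd (snd (G w))) + indicator ?D w *\<^sub>R (\<phi> w *\<^sub>R V w) \<partial>lborel) $ i
    = (\<integral>w. (indicator ?D w *\<^sub>R (f w *\<^sub>R snd (snd (G w))) + indicator ?D w *\<^sub>R (\<phi> w *\<^sub>R V w)) $ i \<partial>lborel)"
   by (rule integral_bounded_linear[OF bounded_linear_vec_nth, symmetric]) (intro Bochner_Integration.integrable_add i1 i2)
  also have "\<dots> = (\<integral>w. indicator ?D w * (f w * (G w \<bullet> (0, 0, axis i 1)) + V w $ i * \<phi> w) \<partial>lborel)"
   by (intro Bochner_Integration.integral_cong refl) (auto simp: algebra_simps inner_prod_def inner_axis)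
  also have "\<dots> = 0"
   using integral_half_domain_dir_deriv(2)[OF d, of \<rho> k] \<rho> by (simp add: xk_def)
  finally show "(\<integral>w. indicator ?D w *\<^sub>R (f w *\<^sub>R snd (snd (G w))) + indicator ?D w *\<^sub>R (\<phi> w *\<^sub>R V w) \<partial>lborel) $ i = 0 $ i" by simp
 qed
 then have "(\<integral>w. indicator ?D w *\<^sub>R (f w *\<^sub>R snd (snd (G w))) \<partial>lborel) + (\<integral>w. indicator ?D w *\<^sub>R (\<phi> w *\<^sub>R V w) \<partial>lborel) = 0"
  using i1 i2 by simp
 then show "(LINT z:?D|lebesgue. f z *\<^sub>R snd (snd (G z))) = - (LINT z:?D|lebesgue. \<phi> z *\<^sub>R V z)"
  using set_integral_lebesgue_lborel[OF c1 half_domain_borel[of k]] set_integral_lebesgue_lborel[OF c2 half_domain_borel[of k]]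
  by (simp add: eq_neg_iff_add_eq_0)
qed

lemma vrefl_vrefl [simp]: "vrefl k (vrefl k w) = w"
 by (cases w) (simp add: vrefl_def)

lemma xk_vrefl [simp]: "xk k (vrefl k w) = xk k w"
 by (cases w) (simp add: vrefl_def xk_def)

lemma dir_deriv_vrefl:
 fixes b :: "real^'a::finite"
 assumes "dir_deriv (0, b, 0) W W'"
 shows "dir_deriv (0, b, 0) (%w. W (vrefl k w)) (%w. W' (vrefl k w))"
proof -
 have v: "vrefl k (w + h *\<^sub>R (0, b, 0)) = vrefl k w + h *\<^sub>R (0, b, 0)" for w h
  by (cases w) (simp add: vrefl_def)
 have c: "continuous_on UNIV (vrefl k :: 'a kin => _)"
  using continuous_on_krefl(2)[OF continuous_on_id, of UNIV k] by simp
 have "((%h. W (vrefl k (w + h *\<^sub>R (0, b, 0)))) has_real_derivative W' (vrefl k w)) (at 0)" for w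
  unfolding v by (rule dir_derivD[OF assms])
 moreover have "continuous_on UNIV W" "continuous_on UNIV W'" using assms by (simp_all add: dir_deriv_def)
 ultimately show ?thesis
  unfolding dir_deriv_def
  using continuous_on_compose2[of UNIV W UNIV "vrefl k"] continuous_on_compose2[of UNIV W' UNIV "vrefl k"] c by blast
qed

text \<open>The sum of \<open>W\<close> and its velocity reflection vanishes on the boundary, so its
  derivative integrates to 0. Velocity reflection preserves the half-domain and the measure, so the
  two summands have equal integrals, and each of them is 0.\<close>

lemma integral_half_domain_reflected:
 assumes W: "dir_deriv (0, b, 0) W W'" and supp: "!!w. norm w > \<rho> ==> W w = 0" 
  and odd: "!!w. xk k w = 0 ==> W (vrefl k w) = - W w" and W': "!!w. norm w > \<rho> ==> W' w = 0"
 shows "(\<integral>w. indicator (half_domain k) w * W' w \<partial>lborel) = 0"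
proof -
 let ?D = "half_domain k"
 have nv: "norm (vrefl k w) = norm w" for w by (cases w) (simp add: vrefl_def norm_Pair)
 have cW': "continuous_on UNIV W'" using W by (simp add: dir_deriv_def)
 have m[measurable]: "W' \<in> borel_measurable borel" using cW' by (rule borel_measurable_continuous_onI)
 have i1: "integrable lborel (%w. indicator ?D w * W' w)"
  using integrable_compact_support[OF cW' W' half_domain_borel[of k]] by simp
 have D: "indicator ?D (vrefl k w) = (indicator ?D w :: real)" for w by (simp add: indicator_def half_domain_xk)
 have i2: "integrable lborel (%w. indicator ?D w * W' (vrefl k w))"
  using vol_scaling_integral(2)[OF vol_scaling_vrefl, of "%w. indicator ?D w * W' w" k] i1 by (simp add: D)
 have e: "(\<integral>w. indicator ?D w * W' (vrefl k w) \<partial>lborel) = (\<integral>w. indicator ?D w * W' w \<partial>lborel)"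
  using vol_scaling_integral(1)[OF vol_scaling_vrefl, of "%w. indicator ?D w * W' w" k] by (simp add: D)
 have "(\<integral>w. indicator ?D w * (W' w + W' (vrefl k w)) \<partial>lborel) = 0"
  by (rule integral_half_domain_dir_deriv(2)[OF dir_deriv_add[OF W dir_deriv_vrefl[OF W]], of \<rho>])
   (use supp odd nv in auto)
 then have "(\<integral>w. indicator ?D w * W' w \<partial>lborel) + (\<integral>w. indicator ?D w * W' (vrefl k w) \<partial>lborel) = 0"
  using i1 i2 by (simp add: distrib_left)
 then show ?thesis unfolding e by simp
qed

text \<open>Only the flux in direction x_k sees the boundary. Its factor v_k is odd under velocity
  reflection, while f and the test function are even on the boundary, so the flux is odd there and
  its derivative integrates to 0.\<close>

lemma classical_weak_solution:
 fixes f :: "'n::finite kin => real"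
 assumes c: "classical f A X V H"
  and p: "!!w. xk k w > 0 ==> kop A X H w = p w"
  and bd: "!!w. xk k w = 0 ==> f (vrefl k w) = f w"
 shows "weak_solution k p f"
 unfolding weak_solution_def
proof (intro conjI exI[of _ V] allI impI, goal_cases)
 case 1
 show ?case by (rule L2_loc_continuous[OF classical_continuous(1)[OF c]]) simp
next
 case 2
 show ?case by (rule classical_weak_v_gradient[OF c])
next
 case 3
 show ?case by (rule L2_loc_continuous[OF classical_continuous(4)[OF c]]) simp
next
 case (4 \<phi> G)
 then have \<phi>: "C1c_with_gradient \<phi> G" and sym: "!!w. xk k w = 0 ==> \<phi> (vrefl k w) = \<phi> w"
  by (auto simp: xk_def vrefl_def)
 note cc = classical_continuous[OF c] C1c_continuous[OF \<phi>]
 obtain \<rho> where \<rho>: "!!w. norm w > \<rho> ==> \<phi> w = 0" "!!w. norm w > \<rho> ==> G w = 0" using C1c_support[OF \<phi>] by blast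
 let ?D = "half_domain k"
 let ?v = "%(w::'n kin) i. snd (snd w) $ i"
 define It where "It w = f w * (G w \<bullet> (1, 0, 0)) + A w * \<phi> w" for w
 define Ix where "Ix i w = ?v w i * (f w * (G w \<bullet> (0, axis i 1, 0)) + X w $ i * \<phi> w)" for i w
 define Iv where "Iv i w = V w $ i * (G w \<bullet> (0, 0, axis i 1)) + H w $ i * \<phi> w" for i w
 have dt: "dir_deriv (1, 0, 0) (%w. f w * \<phi> w) It"
  unfolding It_def[abs_def] using c by (intro dir_deriv_mult C1c_dir_deriv[OF \<phi>]) (auto simp: classical_def)
 have dv: "dir_deriv (0, 0, axis i 1) (%w. V w $ i * \<phi> w) (Iv i)" for i
  unfolding Iv_def[abs_def] using c by (intro dir_deriv_mult C1c_dir_deriv[OF \<phi>]) (auto simp: classical_def)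
 have dx: "dir_deriv (0, axis i 1, 0) (%w. ?v w i * (f w * \<phi> w)) (Ix i)" for i
 proof -
  have 1: "dir_deriv (0, axis i 1, 0) (%w. f w * \<phi> w) (%w. f w * (G w \<bullet> (0, axis i 1, 0)) + X w $ i * \<phi> w)"
   using c by (intro dir_deriv_mult C1c_dir_deriv[OF \<phi>]) (auto simp: classical_def)
  have 2: "dir_deriv (0, axis i 1, 0) (%w. ?v w i) (%_. 0)"
   using classical_v[of i] by (simp add: classical_def)
  show ?thesis by (rule dir_deriv_cong[OF dir_deriv_mult[OF 2 1]]) (auto simp: Ix_def)
 qed
 have zt: "(\<integral>w. indicator ?D w * It w \<partial>lborel) = 0" "integrable lborel (%w. indicator ?D w * It w)"
  using integral_half_domain_dir_deriv[OF dt, of \<rho> k] \<rho> by (auto simp: xk_def)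
 have zv: "(\<integral>w. indicator ?D w * Iv i w \<partial>lborel) = 0" "integrable lborel (%w. indicator ?D w * Iv i w)" for i
  using integral_half_domain_dir_deriv[OF dv, of \<rho> i k] \<rho> by (auto simp: xk_def)
 have Ix0: "norm w > \<rho> ==> Ix i w = 0" for i w using \<rho> by (simp add: Ix_def)
 have zx: "integrable lborel (%w. indicator ?D w * Ix i w)" for i
  using integrable_compact_support[of "Ix i" \<rho> ?D] dx[of i] Ix0 by (simp add: dir_deriv_def)
 have zx0: "(\<integral>w. indicator ?D w * Ix i w \<partial>lborel) = 0" for i
 proof (cases "i = k")
  case False
  then have "xk k (0, axis i 1, 0) = 0" by (simp add: xk_def axis_def)
  then show ?thesis
   using integral_half_domain_dir_deriv(2)[OF dx, of \<rho> i k] \<rho> by auto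
 next
  case True
  show ?thesis
  proof (rule integral_half_domain_reflected[OF dx _ _ Ix0])
   fix w :: "'n kin" assume w: "xk k w = 0"
   have "?v (vrefl k w) i = - ?v w i" using True by (cases w) (simp add: vrefl_def reflect_def)
   then show "?v (vrefl k w) i * (f (vrefl k w) * \<phi> (vrefl k w)) = - (?v w i * (f w * \<phi> w))"
    using sym[OF w] bd[OF w] by simp
  qed (use \<rho> in auto)
 qed
 define J where "J w = - It w - (\<Sum>i\<in>UNIV. Ix i w) + (\<Sum>i\<in>UNIV. Iv i w)" for w
 have cJ: "continuous_on UNIV J"
  unfolding J_def[abs_def] using dt dx dv by (intro continuous_intros) (auto simp: dir_deriv_def)
 have "(LINT z:?D|lebesgue. case z of (t, x, v) => case G z of (a, Xa, Va) => - f z * (a + v \<bullet> Xa) + V z \<bullet> Va - p z * \<phi> z)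
   = (\<integral>w. indicator ?D w *\<^sub>R J w \<partial>lborel)"
 proof (rule set_integral_lebesgue_lborel[OF cJ half_domain_borel])
  fix w assume w: "w \<in> ?D"
  obtain t x v where wt: "w = (t, x, v)" by (cases w) auto
  obtain a Xa Va where g: "G w = (a, Xa, Va)" by (cases "G w") auto
  have pw: "p w = A w + v \<bullet> X w - (\<Sum>i\<in>UNIV. H w $ i)" using p[of w] w by (simp add: half_domain_xk kop_def wt)
  have "J w = - (f w * a + A w * \<phi> w) - (\<Sum>i\<in>UNIV. v $ i * (f w * Xa $ i + X w $ i * \<phi> w))
    + (\<Sum>i\<in>UNIV. V w $ i * Va $ i + H w $ i * \<phi> w)"
   unfolding J_def It_def Ix_def Iv_def g by (simp add: wt inner_prod_def inner_axis)
  also have "\<dots> = - f w * (a + v \<bullet> Xa) + V w \<bullet> Va - p w * \<phi> w"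
   unfolding pw inner_vec_def
   by (simp add: sum.distrib sum_distrib_left sum_distrib_right sum_subtractf sum_negf algebra_simps)
  finally show "(case w of (t, x, v) => case G w of (a, Xa, Va) => - f w * (a + v \<bullet> Xa) + V w \<bullet> Va - p w * \<phi> w) = J w"
   by (simp add: wt g[unfolded wt])
 qed
 also have "\<dots> = (\<integral>w. - (indicator ?D w * It w) - (\<Sum>i\<in>UNIV. indicator ?D w * Ix i w) + (\<Sum>i\<in>UNIV. indicator ?D w * Iv i w) \<partial>lborel)"
  by (intro Bochner_Integration.integral_cong refl) (simp add: J_def sum_distrib_left algebra_simps)
 also have "\<dots> = 0"
 proof -
  have "(\<integral>w. - a w - (\<Sum>i\<in>UNIV. b i w) + (\<Sum>i\<in>UNIV. c i w) \<partial>lborel) = 0"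
   if "integrable lborel a" "(\<integral>w. a w \<partial>lborel) = 0"
    "!!i. integrable lborel (b i)" "!!i. (\<integral>w. b i w \<partial>lborel) = 0"
    "!!i. integrable lborel (c i)" "!!i. (\<integral>w. c i w \<partial>lborel) = 0"
   for a :: "'n kin => real" and b c :: "'n => 'n kin => real"
   using that by simp
  from this[OF zt(2,1) zx zx0 zv(2,1)] show ?thesis .
 qed
 finally show ?case .
qed

section \<open>Polynomial solutions up to a multiple of x_k\<close>

text \<open>The velocity gradient stays visible because the operator applied to a product produces
  the cross term - 2 V . V'; the other derivatives can be hidden.\<close>

definition csol :: "('n::finite kin => real) => ('n kin => real^'n) => ('n kin => real) => bool" where
 "csol f V p \<longleftrightarrow> (\<exists>A X H. classical f A X V H \<and> (\<forall>w. kop A X H w = p w))"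

lemma csol_cong: "csol f V p ==> (!!w. p w = p' w) ==> csol f V p'"
 unfolding csol_def by metis

lemma csol_const: "csol (%_. c) (%_. 0) (%_. 0)"
 unfolding csol_def using classical_const[of c] by (intro exI conjI) (auto simp: kop_def)

lemma csol_t: "csol fst (%_. 0) (%_. 1)"
 unfolding csol_def using classical_t by (intro exI conjI) (auto simp: kop_def)

lemma csol_x: "csol (%w. fst (snd w) $ j) (%_. 0) (%w. snd (snd w) $ j)"
 unfolding csol_def using classical_x[of j] by (intro exI conjI) (auto simp: kop_def inner_axis)

lemma csol_v: "csol (%w. snd (snd w) $ j) (%_. axis j 1) (%w. 0)"
 unfolding csol_def using classical_v[of j] by (intro exI conjI) (auto simp: kop_def)

lemma csol_add: "csol f V p ==> csol f' V' p' ==> csol (%w. f w + f' w) (%w. V w + V' w) (%w. p w + p' w)"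
 unfolding csol_def
proof (elim exE conjE)
 fix A X H A' X' H'
 assume a: "classical f A X V H" "\<forall>w. kop A X H w = p w" "classical f' A' X' V' H'" "\<forall>w. kop A' X' H' w = p' w"
 show "\<exists>A X H. classical (%w. f w + f' w) A X (%w. V w + V' w) H \<and> (\<forall>w. kop A X H w = p w + p' w)"
 proof (intro exI conjI allI, rule classical_add[OF a(1,3)])
  fix w
  show "kop (%w. A w + A' w) (%w. X w + X' w) (%w. H w + H' w) w = p w + p' w"
   using a(2)[rule_format, of w] a(4)[rule_format, of w]
   by (simp add: kop_def inner_add_right sum.distrib)
 qed
qed

lemma csol_cmult: "csol f V p ==> csol (%w. c * f w) (%w. c *\<^sub>R V w) (%w. c * p w)"
 unfolding csol_def
proof (elim exE conjE)
 fix A X H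
 assume a: "classical f A X V H" "\<forall>w. kop A X H w = p w"
 show "\<exists>A X H. classical (%w. c * f w) A X (%w. c *\<^sub>R V w) H \<and> (\<forall>w. kop A X H w = c * p w)"
 proof (intro exI conjI allI, rule classical_cmult[OF a(1)])
  fix w
  show "kop (%w. c * A w) (%w. c *\<^sub>R X w) (%w. c *\<^sub>R H w) w = c * p w"
   unfolding a(2)[rule_format, of w, symmetric]
   by (simp add: kop_def right_diff_distrib distrib_left sum_distrib_left)
 qed
qed

lemma csol_mult:
 assumes "csol f V p" "csol f' V' p'"
 shows "csol (%w. f w * f' w) (%w. f w *\<^sub>R V' w + f' w *\<^sub>R V w) (%w. f w * p' w + f' w * p w - 2 * (V w \<bullet> V' w))"
 using assms unfolding csol_def
proof (elim exE conjE)
 fix A X H A' X' H'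
 assume a: "classical f A X V H" "\<forall>w. kop A X H w = p w" "classical f' A' X' V' H'" "\<forall>w. kop A' X' H' w = p' w"
 show "\<exists>A X H. classical (%w. f w * f' w) A X (%w. f w *\<^sub>R V' w + f' w *\<^sub>R V w) H \<and>
  (\<forall>w. kop A X H w = f w * p' w + f' w * p w - 2 * (V w \<bullet> V' w))"
 proof (intro exI conjI allI, rule classical_mult[OF a(1,3)])
  fix w
  show "kop (%w. f w * A' w + A w * f' w) (%w. f w *\<^sub>R X' w + f' w *\<^sub>R X w)
    (%w. f w *\<^sub>R H' w + f' w *\<^sub>R H w + (\<chi> i. 2 * (V w $ i * V' w $ i))) w =
    f w * p' w + f' w * p w - 2 * (V w \<bullet> V' w)"
   unfolding a(2)[rule_format, of w, symmetric] a(4)[rule_format, of w, symmetric]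
   by (simp add: kop_def inner_add_right sum.distrib inner_vec_def sum_distrib_left algebra_simps)
 qed
qed

text \<open>The number \<open>c\<close> measures the obstruction: \<open>x $ k\<close> itself is
  passed on as a defect to be matched by the profile, not by a polynomial.\<close>

definition solvable :: "'n::finite => ('n kin => real) => real => bool" where
 "solvable k p c \<longleftrightarrow> (\<exists>q V. csol q V (%w. p w + c * xk k w) \<and> real_polynomial_function q \<and>
   (\<forall>w. xk k w = 0 --> q (vrefl k w) = q w))"

lemma solvableI:
 assumes "csol q V p'" "!!w. p' w = p w + c * xk k w" "real_polynomial_function q"
  "!!w. xk k w = 0 ==> q (vrefl k w) = q w"
 shows "solvable k p c"
 unfolding solvable_def using csol_cong[OF assms(1), of "%w. p w + c * xk k w"] assms by blast

lemma polynomial_coords [intro]: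
 "real_polynomial_function (fst :: 'n::finite kin => real)"
 "real_polynomial_function (%w::'n kin. fst (snd w) $ i)"
 "real_polynomial_function (%w::'n kin. snd (snd w) $ i)"
 by (intro real_polynomial_function.intros(1) bounded_linear_fst;
   intro bounded_linear_compose[OF bounded_linear_vec_nth] bounded_linear_compose[OF bounded_linear_fst]
    bounded_linear_compose[OF bounded_linear_snd] bounded_linear_fst bounded_linear_snd)+

lemmas polynomial_intros = real_polynomial_function.intros(2-4) polynomial_coords real_polynomial_function_diff
 real_polynomial_function_divide

lemma vrefl_coords [simp]:
 "fst (vrefl k w) = fst w" "fst (snd (vrefl k w)) = fst (snd w)"
 "snd (snd (vrefl k w)) $ i = (if i = k then - (snd (snd w) $ i) else snd (snd w) $ i)"
 by (cases w; simp add: vrefl_def reflect_def)+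

lemma solvable_add: "solvable k p c ==> solvable k p' c' ==> solvable k (%w. p w + p' w) (c + c')"
 unfolding solvable_def
proof (elim exE conjE)
 fix q V q' V'
 assume a: "csol q V (%w. p w + c * xk k w)" "real_polynomial_function q" "\<forall>w. xk k w = 0 --> q (vrefl k w) = q w"
  "csol q' V' (%w. p' w + c' * xk k w)" "real_polynomial_function q'" "\<forall>w. xk k w = 0 --> q' (vrefl k w) = q' w"
 have "csol (%w. q w + q' w) (%w. V w + V' w) (%w. p w + p' w + (c + c') * xk k w)"
  by (rule csol_cong[OF csol_add[OF a(1,4)]]) (simp add: algebra_simps)
 then show "\<exists>q V. csol q V (%w. p w + p' w + (c + c') * xk k w) \<and> real_polynomial_function q \<and>
   (\<forall>w. xk k w = 0 --> q (vrefl k w) = q w)"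
  using a by (intro exI[of _ "%w. q w + q' w"] exI[of _ "%w. V w + V' w"]) (auto intro!: polynomial_intros)
qed

lemma solvable_cmult: "solvable k p c ==> solvable k (%w. d * p w) (d * c)"
 unfolding solvable_def
proof (elim exE conjE)
 fix q V
 assume a: "csol q V (%w. p w + c * xk k w)" "real_polynomial_function q" "\<forall>w. xk k w = 0 --> q (vrefl k w) = q w"
 have "csol (%w. d * q w) (%w. d *\<^sub>R V w) (%w. d * p w + (d * c) * xk k w)"
  by (rule csol_cong[OF csol_cmult[OF a(1)]]) (simp add: algebra_simps)
 then show "\<exists>q V. csol q V (%w. d * p w + d * c * xk k w) \<and> real_polynomial_function q \<and>
   (\<forall>w. xk k w = 0 --> q (vrefl k w) = q w)"
  using a by (intro exI[of _ "%w. d * q w"] exI[of _ "%w. d *\<^sub>R V w"]) (auto intro!: polynomial_intros)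
qed

lemma solvable_cong: "solvable k p c ==> (!!w. p w = p' w) ==> solvable k p' c"
 by (metis ext)

lemma solvable_1: "solvable k (%w. 1) 0"
 by (rule solvableI[OF csol_t]) (auto intro!: polynomial_intros)

lemma solvable_v: "solvable k (%w. snd (snd w) $ i) 0"
 by (rule solvableI[OF csol_x[of i]]) (auto intro!: polynomial_intros)

lemma solvable_t: "solvable k fst 0"
 by (rule solvableI[OF csol_mult[OF csol_const[of "1/2"] csol_mult[OF csol_t csol_t]]]) (auto intro!: polynomial_intros)

text \<open>Applying the operator to x_i v_j gives v_i v_j. The candidate satisfies the boundary
  condition when x_i vanishes there or v_j is even, and for every pair one of the two orders has
  this property.\<close>

lemma solvable_vv: "solvable k (%w. snd (snd w) $ i * snd (snd w) $ j) 0"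
proof -
 have *: "solvable k (%w. snd (snd w) $ i * snd (snd w) $ j) 0" if "i = k \<or> j \<noteq> k" for i j
  by (rule solvableI[OF csol_mult[OF csol_x[of i] csol_v[of j]]]) (use that in \<open>auto intro!: polynomial_intros simp: xk_def\<close>)
 show ?thesis
  using *[of i j] solvable_cong[OF *[of j i], of "%w. snd (snd w) $ i * snd (snd w) $ j"]
  by (cases "i = k \<or> j \<noteq> k") auto
qed

lemma solvable_x: obtains c where "solvable k (%w. fst (snd w) $ i) c"
proof (cases "i = k")
 case True
 \<comment> \<open>The zero polynomial solves the equation with right-hand side x_k - x_k: the whole
   term is left as a defect.\<close>
 have "solvable k (%w. fst (snd w) $ i) (-1)"
  by (rule solvableI[OF csol_const[of 0]]) (auto simp: True xk_def intro!: polynomial_intros)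
 then show ?thesis by (rule that)
next
 case False
 have "solvable k (%w. fst (snd w) $ i) 0"
  by (rule solvableI[OF csol_add[OF csol_mult[OF csol_t csol_x[of i]]
     csol_mult[OF csol_const[of "-1/2"] csol_mult[OF csol_t csol_mult[OF csol_t csol_v[of i]]]]]])
   (auto simp: False intro!: polynomial_intros)
 then show ?thesis by (rule that)
qed

lemma solvable_tv: obtains c where "solvable k (%w. fst w * snd (snd w) $ i) c"
proof (cases "i = k")
 case True
 have "solvable k (%w. fst w * snd (snd w) $ i) 1"
  by (rule solvableI[OF csol_mult[OF csol_t csol_x[of i]]]) (auto simp: True xk_def intro!: polynomial_intros)
 then show ?thesis by (rule that)
next
 case False
 have "solvable k (%w. fst w * snd (snd w) $ i) 0"
  by (rule solvableI[OF csol_mult[OF csol_const[of "1/2"] csol_mult[OF csol_t csol_mult[OF csol_t csol_v[of i]]]]])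
   (auto simp: False intro!: polynomial_intros)
 then show ?thesis by (rule that)
qed

text \<open>The candidate x_i v_j v_l produces v_i v_j v_l, and also - 2 x_i when j = l. That
  correction has degree 3 again and is handled by \<open>solvable_x\<close>, which may contribute a
  defect.\<close>

lemma solvable_vvv: "\<exists>c. solvable k (%w. snd (snd w) $ i * (snd (snd w) $ j * snd (snd w) $ l)) c"
proof -
 have *: "\<exists>c. solvable k (%w. snd (snd w) $ i * (snd (snd w) $ j * snd (snd w) $ l)) c"
  if "i = k \<or> (j \<noteq> k \<and> l \<noteq> k)" for i j l
 proof -
  define d where "d = 2 * (axis j 1 \<bullet> (axis l 1 :: real^'a))"
  have 1: "solvable k (%w. snd (snd w) $ i * (snd (snd w) $ j * snd (snd w) $ l) + - d * fst (snd w) $ i) 0"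
   by (rule solvableI[OF csol_mult[OF csol_x[of i] csol_mult[OF csol_v[of j] csol_v[of l]]]])
    (use that in \<open>auto intro!: polynomial_intros simp: xk_def d_def\<close>)
  obtain c where "solvable k (%w. fst (snd w) $ i) c" by (rule solvable_x)
  from solvable_add[OF 1 solvable_cmult[OF this, of d]]
  have "solvable k (%w. snd (snd w) $ i * (snd (snd w) $ j * snd (snd w) $ l)) (0 + d * c)"
   by (rule solvable_cong) simp
  then show ?thesis by blast
 qed
 \<comment> \<open>The monomial is symmetric, so a factor v_k, if there is one, can be taken as the
   one replaced by x_k, which vanishes on the boundary.\<close>
 consider "i = k \<or> (j \<noteq> k \<and> l \<noteq> k)" | "j = k" | "l = k" by blast
 then show ?thesis
 proof cases
  case 1 then show ?thesis by (rule *)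
 next
  case 2
  then obtain c where "solvable k (%w. snd (snd w) $ j * (snd (snd w) $ i * snd (snd w) $ l)) c" using *[of j i l] by blast
  then show ?thesis by (intro exI[of _ c]) (erule solvable_cong, simp)
 next
  case 3
  then obtain c where "solvable k (%w. snd (snd w) $ l * (snd (snd w) $ i * snd (snd w) $ j)) c" using *[of l i j] by blast
  then show ?thesis by (intro exI[of _ c]) (erule solvable_cong, simp)
 qed
qed

lemma weight_pos: "weight b \<ge> 1"
 by (simp add: weight_def)

lemma mon_solvable:
 assumes "set l \<subseteq> Basis" "(\<Sum>b\<leftarrow>l. weight b) <= 3"
 shows "\<exists>c. solvable k (mon l) c \<and> ((\<Sum>b\<leftarrow>l. weight b) <= 2 --> c = 0)"
proof -
 have wt: "weight (1, 0, 0) = 2" "weight (0, axis i 1, 0) = 3" "weight (0, 0, axis i 1) = 1" for i :: 'a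
  by (auto simp: weight_def axis_eq_0_iff)
 have ip: "w \<bullet> (1, 0, 0) = fst w" "w \<bullet> (0, axis i 1, 0) = fst (snd w) $ i" "w \<bullet> (0, 0, axis i 1) = snd (snd w) $ i"
  for w :: "'a kin" and i by (auto simp: inner_prod_def inner_axis)
 have two: "(\<Sum>b\<leftarrow>m. weight b) \<ge> length m" for m :: "'a kin list"
 proof (induction m)
  case (Cons a m)
  then show ?case using weight_pos[of a] by simp
 qed simp
 \<comment> \<open>Every factor has weight at least 1, so degree at most 3 leaves at most three
   factors. The last alternative is there only to be refuted.\<close>
 consider "l = []" | b where "l = [b]" "b \<in> Basis" | b c where "l = [b, c]" "b \<in> Basis" "c \<in> Basis"
  | b c d where "l = [b, c, d]" "b \<in> Basis" "c \<in> Basis" "d \<in> Basis" | "length l > 3"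
  using assms(1) by (cases l rule: list.exhaust, simp, rename_tac a1 l1, case_tac l1, simp, rename_tac a2 l2, case_tac l2, simp,
    rename_tac a3 l3, case_tac l3, simp_all)
 then show ?thesis
 proof cases
  case 1
  show ?thesis using solvable_cong[OF solvable_1[of k], of "mon l"] 1 by (intro exI[of _ 0]) auto
 next
  case 2
  from 2(2) consider "b = (1,0,0)" | i where "b = (0, axis i 1, 0)" | i where "b = (0, 0, axis i 1)" by (auto simp: Basis_kin)
  then show ?thesis
  proof cases
   case 1
   show ?thesis by (rule exI[of _ 0], rule conjI, rule solvable_cong[OF solvable_t[of k]]) (auto simp: 2(1) 1 ip)
  next
   case (2 i)
   obtain c where "solvable k (%w. fst (snd w) $ i) c" by (rule solvable_x)
   then show ?thesis by (intro exI[of _ c] conjI, elim solvable_cong) (auto simp: \<open>l = [b]\<close> 2 ip wt)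
  next
   case (3 i)
   show ?thesis by (rule exI[of _ 0], rule conjI, rule solvable_cong[OF solvable_v[of k i]]) (auto simp: \<open>l = [b]\<close> 3 ip)
  qed
 next
  case 3
  have w: "weight b + weight c <= 3" using assms(2) by (simp add: 3(1))
  from 3(2,3) w consider i where "b = (1,0,0)" "c = (0, 0, axis i 1)" | i where "c = (1,0,0)" "b = (0, 0, axis i 1)"
   | i j where "b = (0, 0, axis i 1)" "c = (0, 0, axis j 1)" by (auto simp: Basis_kin wt)
  then show ?thesis
  proof cases
   case (1 i)
   obtain e where "solvable k (%w. fst w * snd (snd w) $ i) e" by (rule solvable_tv)
   then show ?thesis by (intro exI[of _ e] conjI, elim solvable_cong) (auto simp: 3(1) 1 ip wt)
  next
   case (2 i)
   obtain e where "solvable k (%w. fst w * snd (snd w) $ i) e" by (rule solvable_tv)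
   then show ?thesis by (intro exI[of _ e] conjI, elim solvable_cong) (auto simp: 3(1) 2 ip wt)
  next
   case (3 i j)
   show ?thesis by (rule exI[of _ 0], rule conjI, rule solvable_cong[OF solvable_vv[of k i j]]) (auto simp: \<open>l = [b, c]\<close> 3 ip)
  qed
 next
  case 4
  have w: "weight b + weight c + weight d <= 3" using assms(2) by (simp add: 4(1))
  from 4(2-4) w obtain i j m where e: "b = (0, 0, axis i 1)" "c = (0, 0, axis j 1)" "d = (0, 0, axis m 1)"
   by (auto simp: Basis_kin wt)
  obtain c0 where "solvable k (%w. snd (snd w) $ i * (snd (snd w) $ j * snd (snd w) $ m)) c0" using solvable_vvv by blast
  then show ?thesis by (intro exI[of _ c0] conjI, elim solvable_cong) (auto simp: 4(1) e ip wt)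
 next
  case 5
  then show ?thesis using two[of l] assms(2) by simp
 qed
qed

lemma lincomb_solvable:
 assumes "!!c l. (c, l) \<in> set L ==> set l \<subseteq> Basis" "!!c l. (c, l) \<in> set L ==> (\<Sum>b\<leftarrow>l. weight b) <= 3"
 shows "\<exists>c. solvable k (lincomb L) c \<and> ((\<forall>(c, l)\<in>set L. (\<Sum>b\<leftarrow>l. weight b) <= 2) --> c = 0)"
 using assms
proof (induction L)
 case Nil
 have "solvable k (lincomb []) 0" by (rule solvableI[OF csol_const[of 0]]) (auto intro!: polynomial_intros)
 then show ?case by blast
next
 case (Cons a L)
 obtain d l where a: "a = (d, l)" by (cases a)
 obtain c1 where c1: "solvable k (lincomb L) c1" "(\<forall>(c, l)\<in>set L. (\<Sum>b\<leftarrow>l. weight b) <= 2) --> c1 = 0"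
  using Cons.IH Cons.prems by (meson list.set_intros(2))
 obtain c2 where c2: "solvable k (mon l) c2" "(\<Sum>b\<leftarrow>l. weight b) <= 2 --> c2 = 0"
  using mon_solvable[of l k] Cons.prems[of d l] a by auto
 have "solvable k (lincomb (a # L)) (d * c2 + c1)"
  by (rule solvable_cong[OF solvable_add[OF solvable_cmult[OF c2(1), of d] c1(1)]]) (simp add: a)
 moreover have "(\<forall>(c, l)\<in>set (a # L). (\<Sum>b\<leftarrow>l. weight b) <= 2) --> d * c2 + c1 = 0"
  using c1(2) c2(2) unfolding a by simp
 ultimately show ?case by blast
qed

section \<open>Test functions for the adjoint operator\<close>

lemma DERIV_max0_power:
 "((%s::real. max 0 s ^ Suc (Suc n)) has_real_derivative real (Suc (Suc n)) * max 0 s ^ Suc n) (at s)"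
proof -
 consider "s > 0" | "s < 0" | "s = 0" by linarith
 then show ?thesis
 proof cases
  case 1
  have "((%s::real. s ^ Suc (Suc n)) has_real_derivative real (Suc (Suc n)) * max 0 s ^ Suc n) (at s)"
   by (rule DERIV_cong[OF DERIV_pow]) (use 1 in auto)
  then show ?thesis
   by (rule has_field_derivative_transform_within_open[where S="{0<..}"]) (use 1 in auto)
 next
  case 2
  have "((%s::real. 0) has_real_derivative real (Suc (Suc n)) * max 0 s ^ Suc n) (at s)" using 2 by simp
  then show ?thesis
   by (rule has_field_derivative_transform_within_open[where S="{..<0}"]) (use 2 in auto)
 next
  case 3
  have "((%h::real. max 0 h ^ Suc (Suc n) / h) \<longlongrightarrow> 0) (at 0)"
  proof (rule Lim_null_comparison)
   show "((%h::real. \<bar>h\<bar> ^ Suc n) \<longlongrightarrow> 0) (at 0)" by (auto intro!: tendsto_eq_intros)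
   show "eventually (%h::real. norm (max 0 h ^ Suc (Suc n) / h) <= \<bar>h\<bar> ^ Suc n) (at 0)"
   proof (intro always_eventually allI)
    fix h :: real
    show "norm (max 0 h ^ Suc (Suc n) / h) <= \<bar>h\<bar> ^ Suc n"
     by (cases "h > 0") (auto simp: max_def simp del: power_Suc, simp)
   qed
  qed
  then show ?thesis by (simp add: 3 has_field_derivative_iff)
 qed
qed

lemma C1c_intro_bounded:
 assumes "!!w. GDERIV \<phi> w :> G w" "continuous_on UNIV G" "!!w. norm w > \<rho> ==> \<phi> w = 0"
 shows "C1c_with_gradient \<phi> G"
proof -
 have "{z. \<phi> z \<noteq> 0} \<subseteq> cball 0 \<rho>" using assms(3) by (force simp: not_le[symmetric])
 then have "bounded {z. \<phi> z \<noteq> 0}" by (rule bounded_subset[OF bounded_cball])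
 then show ?thesis using assms by (simp add: C1c_with_gradient_def)
qed

lemma C1c_GDERIV: "C1c_with_gradient \<phi> G ==> GDERIV \<phi> w :> G w"
 by (simp only: C1c_with_gradient_def)

lemma C1c_mult:
 assumes \<phi>: "C1c_with_gradient \<phi> G" and \<eta>: "!!w. GDERIV \<eta> w :> X w" "continuous_on UNIV X"
 shows "C1c_with_gradient (%w. \<phi> w * \<eta> w) (%w. \<phi> w *\<^sub>R X w + \<eta> w *\<^sub>R G w)"
proof -
 obtain \<rho> where \<rho>: "!!w. norm w > \<rho> ==> \<phi> w = 0" using C1c_support[OF \<phi>] by metis
 have c: "continuous_on UNIV \<eta>"
  using \<eta>(1) by (intro has_derivative_continuous_on[of UNIV]) (auto simp: gderiv_def intro: has_derivative_at_withinI)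
 show ?thesis
  by (rule C1c_intro_bounded[of _ _ \<rho>], rule GDERIV_mult[OF C1c_GDERIV[OF \<phi>] \<eta>(1)])
   (auto intro!: continuous_intros C1c_continuous[OF \<phi>] \<eta>(2) c simp: \<rho>)
qed

lemma C1c_add:
 assumes \<phi>: "C1c_with_gradient \<phi> G" and \<eta>: "C1c_with_gradient \<eta> X"
 shows "C1c_with_gradient (%w. \<phi> w + \<eta> w) (%w. G w + X w)"
proof -
 obtain \<rho> \<rho>' where \<rho>: "!!w. norm w > \<rho> ==> \<phi> w = 0" "!!w. norm w > \<rho>' ==> \<eta> w = 0"
  using C1c_support[OF \<phi>] C1c_support[OF \<eta>] by metis
 show ?thesis
  by (rule C1c_intro_bounded[of _ _ "max \<rho> \<rho>'"], rule GDERIV_add[OF C1c_GDERIV[OF \<phi>] C1c_GDERIV[OF \<eta>]])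
   (auto intro!: continuous_intros C1c_continuous[OF \<phi>] C1c_continuous[OF \<eta>] simp: \<rho>)
qed

lemma C1c_cmult:
 assumes \<phi>: "C1c_with_gradient \<phi> G"
 shows "C1c_with_gradient (%w. c * \<phi> w) (%w. c *\<^sub>R G w)"
 using C1c_mult[OF \<phi>, of "%_. c" "%_. 0"] by (simp add: mult.commute GDERIV_const)

text \<open>\<open>Ls\<close> is the adjoint of the derivative of \<open>L\<close>, which does not
  depend on the point; the continuous left inverse \<open>M\<close> keeps the support
  compact.\<close>

lemma C1c_compose:
 assumes \<phi>: "C1c_with_gradient \<phi> G" and L: "!!w. (L has_derivative L') (at w)"
  and adj: "!!h g. L' h \<bullet> g = h \<bullet> Ls g" and Ls: "continuous_on UNIV Ls"
  and inv: "!!w. M (L w) = w" "continuous_on UNIV M"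
 shows "C1c_with_gradient (%w. \<phi> (L w)) (%w. Ls (G (L w)))"
proof -
 have cL: "continuous_on UNIV L"
  using L by (intro has_derivative_continuous_on[of UNIV]) (auto intro: has_derivative_at_withinI)
 have "GDERIV (%w. \<phi> (L w)) w :> Ls (G (L w))" for w
 proof -
  have "(\<phi> has_derivative (%h. h \<bullet> G (L w))) (at (L w))" using C1c_GDERIV[OF \<phi>] by (simp add: gderiv_def)
  from has_derivative_compose[OF L this] show ?thesis unfolding gderiv_def adj .
 qed
 moreover have "continuous_on UNIV (%w. Ls (G (L w)))"
  using continuous_on_compose2[OF Ls continuous_on_compose2[OF C1c_continuous(2)[OF \<phi>] cL]] by simp
 moreover have "bounded {w. \<phi> (L w) \<noteq> 0}"
 proof (rule bounded_subset)
  have "compact (closure {z. \<phi> z \<noteq> 0})" using \<phi> by (simp add: C1c_with_gradient_def)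
  then show "bounded (M ` closure {z. \<phi> z \<noteq> 0})"
   by (intro compact_imp_bounded compact_continuous_image continuous_on_subset[OF inv(2)]) auto
  show "{w. \<phi> (L w) \<noteq> 0} \<subseteq> M ` closure {z. \<phi> z \<noteq> 0}"
  proof
   fix w assume "w \<in> {w. \<phi> (L w) \<noteq> 0}"
   then have "L w \<in> closure {z. \<phi> z \<noteq> 0}" by (intro subsetD[OF closure_subset]) simp
   from imageI[OF this, of M] show "w \<in> M ` closure {z. \<phi> z \<noteq> 0}" by (simp only: inv(1))
  qed
 qed
 ultimately show ?thesis by (simp add: C1c_with_gradient_def)
qed

text \<open>\<psi> is the time derivative of \<phi> plus transport plus velocity Laplacian, the
  adjoint operator with reversed sign. Two layers of \<open>C1c_with_gradient\<close> make \<phi>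
  admissible in the weak formulation and each velocity derivative of \<phi> admissible in the
  definition of the weak velocity gradient.\<close>

definition test :: "('n::finite kin => real) => ('n kin => real) => bool" where
 "test \<phi> \<psi> \<longleftrightarrow> (\<exists>G H. C1c_with_gradient \<phi> G \<and> (\<forall>i. C1c_with_gradient (%w. snd (snd (G w)) $ i) (H i)) \<and>
   (\<forall>w. \<psi> w = fst (G w) + snd (snd w) \<bullet> fst (snd (G w)) + (\<Sum>i\<in>UNIV. snd (snd (H i w)) $ i)))"

lemma testE:
 assumes "test \<phi> \<psi>"
 obtains G H where "C1c_with_gradient \<phi> G" "!!i. C1c_with_gradient (%w. snd (snd (G w)) $ i) (H i)"
  "!!w. \<psi> w = fst (G w) + snd (snd w) \<bullet> fst (snd (G w)) + (\<Sum>i\<in>UNIV. snd (snd (H i w)) $ i)"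
 using assms unfolding test_def by blast

lemma testI:
 assumes "C1c_with_gradient \<phi> G" "!!i. C1c_with_gradient (%w. snd (snd (G w)) $ i) (H i)"
  "!!w. \<psi> w = fst (G w) + snd (snd w) \<bullet> fst (snd (G w)) + (\<Sum>i\<in>UNIV. snd (snd (H i w)) $ i)"
 shows "test \<phi> \<psi>"
 using assms unfolding test_def by blast

lemma test_props:
 assumes "test \<phi> \<psi>"
 obtains \<rho> where "\<rho> > 0" "!!w. norm w > \<rho> ==> \<phi> w = 0" "!!w. norm w > \<rho> ==> \<psi> w = 0"
  "continuous_on UNIV \<phi>" "continuous_on UNIV \<psi>"
proof -
 obtain G H where a: "C1c_with_gradient \<phi> G" "!!i. C1c_with_gradient (%w. snd (snd (G w)) $ i) (H i)"
  "!!w. \<psi> w = fst (G w) + snd (snd w) \<bullet> fst (snd (G w)) + (\<Sum>i\<in>UNIV. snd (snd (H i w)) $ i)"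
  using testE[OF assms] by blast
 obtain r0 where r0: "!!w. norm w > r0 ==> \<phi> w = 0" "!!w. norm w > r0 ==> G w = 0" using C1c_support[OF a(1)] by blast
 have "\<exists>r. \<forall>w. norm w > r --> H i w = 0" for i using C1c_support[OF a(2)[of i]] by metis
 then obtain r where r: "!!i w. norm w > r i ==> H i w = 0" by metis
 define \<rho> where "\<rho> = Max (insert 1 (insert r0 (range r)))"
 have "1 <= \<rho>" "r0 <= \<rho>" "r i <= \<rho>" for i unfolding \<rho>_def by (intro Max_ge; simp)+
 note \<rho> = this
 show ?thesis
 proof (rule that)
  show "\<rho> > 0" using \<rho>(1) by simp
  show "continuous_on UNIV \<phi>" by (rule C1c_continuous[OF a(1)])
  have "continuous_on UNIV (%w. fst (G w) + snd (snd w) \<bullet> fst (snd (G w)) + (\<Sum>i\<in>UNIV. snd (snd (H i w)) $ i))"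
   by (intro continuous_intros C1c_continuous(2)[OF a(1)] C1c_continuous(2)[OF a(2)])
  then show "continuous_on UNIV \<psi>" by (simp only: a(3)[symmetric])
  fix w :: "'a kin" assume w: "norm w > \<rho>"
  then have "norm w > r0" "!!i. norm w > r i" using \<rho>(2) \<rho>(3) by (auto intro: le_less_trans)
  then show "\<phi> w = 0" "\<psi> w = 0" using r0 r by (auto simp: a(3))
 qed
qed

lemma test_add: "test \<phi> \<psi> ==> test \<phi>' \<psi>' ==> test (%w. \<phi> w + \<phi>' w) (%w. \<psi> w + \<psi>' w)"
proof (elim testE)
 fix G H G' H'
 assume a: "C1c_with_gradient \<phi> G" "!!i. C1c_with_gradient (%w. snd (snd (G w)) $ i) (H i)"
  "!!w. \<psi> w = fst (G w) + snd (snd w) \<bullet> fst (snd (G w)) + (\<Sum>i\<in>UNIV. snd (snd (H i w)) $ i)"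
  "C1c_with_gradient \<phi>' G'" "!!i. C1c_with_gradient (%w. snd (snd (G' w)) $ i) (H' i)"
  "!!w. \<psi>' w = fst (G' w) + snd (snd w) \<bullet> fst (snd (G' w)) + (\<Sum>i\<in>UNIV. snd (snd (H' i w)) $ i)"
 show ?thesis
 proof (rule testI[OF C1c_add[OF a(1,4)]])
  fix i show "C1c_with_gradient (%w. snd (snd (G w + G' w)) $ i) (%w. H i w + H' i w)"
   using C1c_add[OF a(2,5), of i i] by simp
 qed (simp add: a inner_add_right sum.distrib)
qed

lemma kscale_has_derivative: "(kscale r has_derivative kscale r) (at w)"
proof (rule bounded_linear_imp_has_derivative)
 have "linear (kscale r)"
  by (rule linearI) (auto simp: kscale_def algebra_simps)
 then show "bounded_linear (kscale r)" by (simp add: linear_conv_bounded_linear)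
qed

lemma krefl_has_derivative: "(krefl k has_derivative krefl k) (at w)"
proof (rule bounded_linear_imp_has_derivative)
 have "linear (krefl k)"
  by (rule linearI) (auto simp: krefl_def reflect_def vec_eq_iff)
 then show "bounded_linear (krefl k)" by (simp add: linear_conv_bounded_linear)
qed

lemma krefl_krefl [simp]: "krefl k (krefl k w) = w"
 by (cases w) (simp add: krefl_def)

lemma reflect_inner: "reflect k x \<bullet> y = x \<bullet> reflect k y"
 unfolding inner_vec_def by (rule sum.cong) (auto simp: reflect_def)

lemma test_kscale:
 assumes r: "r > 0" and t: "test \<phi> \<psi>"
 shows "test (%w. \<phi> (kscale r w)) (%w. r\<^sup>2 * \<psi> (kscale r w))"
proof -
 obtain G H where a: "C1c_with_gradient \<phi> G" "!!i. C1c_with_gradient (%w. snd (snd (G w)) $ i) (H i)"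
  "!!w. \<psi> w = fst (G w) + snd (snd w) \<bullet> fst (snd (G w)) + (\<Sum>i\<in>UNIV. snd (snd (H i w)) $ i)"
  using testE[OF t] by blast
 have c: "C1c_with_gradient (%w. f (kscale r w)) (%w. kscale r (F (kscale r w)))" if "C1c_with_gradient f F"
  for f :: "'a kin => real" and F
 proof (rule C1c_compose[OF that kscale_has_derivative])
  show "kscale r h \<bullet> g = h \<bullet> kscale r g" for h g :: "'a kin"
   by (cases h; cases g) (simp add: kscale_def)
  show "kscale (1 / r) (kscale r w) = w" for w :: "'a kin" using r by (simp add: kscale_kscale)
  show "continuous_on UNIV (kscale r :: 'a kin => _)" "continuous_on UNIV (kscale (1 / r) :: 'a kin => _)"
   using continuous_on_kscale[OF continuous_on_id] by auto
 qed
 have s: "snd (snd (kscale r w)) = r *\<^sub>R snd (snd w)" "fst (snd (kscale r w)) = r ^ 3 *\<^sub>R fst (snd w)" "fst (kscale r w) = r\<^sup>2 * fst w"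
  for w :: "'a kin" by (cases w; simp add: kscale_def)+
 show ?thesis
 proof (rule testI[OF c[OF a(1)]])
  fix i
  show "C1c_with_gradient (%w. snd (snd (kscale r (G (kscale r w)))) $ i) (%w. r *\<^sub>R kscale r (H i (kscale r w)))"
   using C1c_cmult[OF c[OF a(2)[of i]], of r] by (simp add: s)
 qed (simp add: a(3) s distrib_left sum_distrib_left power2_eq_square power3_eq_cube mult_ac)
qed

lemma test_krefl:
 assumes t: "test \<phi> \<psi>"
 shows "test (%w. \<phi> (krefl k w)) (%w. \<psi> (krefl k w))"
proof -
 obtain G H where a: "C1c_with_gradient \<phi> G" "!!i. C1c_with_gradient (%w. snd (snd (G w)) $ i) (H i)"
  "!!w. \<psi> w = fst (G w) + snd (snd w) \<bullet> fst (snd (G w)) + (\<Sum>i\<in>UNIV. snd (snd (H i w)) $ i)"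
  using testE[OF t] by blast
 have c: "C1c_with_gradient (%w. f (krefl k w)) (%w. krefl k (F (krefl k w)))" if "C1c_with_gradient f F"
  for f :: "'a kin => real" and F
 proof (rule C1c_compose[OF that krefl_has_derivative])
  show "krefl k h \<bullet> g = h \<bullet> krefl k g" for h g :: "'a kin"
   by (cases h; cases g) (simp add: krefl_def reflect_inner)
  show "krefl k (krefl k w) = w" for w :: "'a kin" by simp
  show "continuous_on UNIV (krefl k :: 'a kin => _)" "continuous_on UNIV (krefl k :: 'a kin => _)"
   using continuous_on_krefl(1)[OF continuous_on_id] by auto
 qed
 have s: "snd (snd (krefl k w)) = reflect k (snd (snd w))" "fst (snd (krefl k w)) = reflect k (fst (snd w))" "fst (krefl k w) = fst w"
  for w :: "'a kin" by (cases w; simp add: krefl_def)+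
 define sg where "sg i = (if i = k then -1 else 1 :: real)" for i
 have sg: "sg i * (sg i * x) = x" for i x by (simp add: sg_def)
 have ri: "reflect k x $ i = sg i * x $ i" for x i by (simp add: reflect_def sg_def)
 show ?thesis
 proof (rule testI[OF c[OF a(1)]])
  fix i
  show "C1c_with_gradient (%w. snd (snd (krefl k (G (krefl k w)))) $ i) (%w. sg i *\<^sub>R krefl k (H i (krefl k w)))"
   using C1c_cmult[OF c[OF a(2)[of i]], of "sg i"] by (simp add: s ri)
 qed (simp add: a(3) s ri sg reflect_inner)
qed

text \<open>Invariance under left translations: the derivative in time picks up v0 times the
  position gradient, which is exactly what the shift of the velocity adds to the transport
  term.\<close>

lemma test_kmul:
 assumes t: "test \<phi> \<psi>"
 shows "test (%w. \<phi> (kmul z w)) (%w. \<psi> (kmul z w))"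
proof -
 obtain G H where a: "C1c_with_gradient \<phi> G" "!!i. C1c_with_gradient (%w. snd (snd (G w)) $ i) (H i)"
  "!!w. \<psi> w = fst (G w) + snd (snd w) \<bullet> fst (snd (G w)) + (\<Sum>i\<in>UNIV. snd (snd (H i w)) $ i)"
  using testE[OF t] by blast
 obtain t0 x0 v0 where z: "z = (t0, x0, v0)" by (cases z) auto
 \<comment> \<open>The adjoint of the linear part of \<open>kmul z\<close>; it leaves the velocity
   components of the gradient unchanged, so the Laplacian is unaffected.\<close>
 let ?S = "%g::'a kin. (fst g + v0 \<bullet> fst (snd g), fst (snd g), snd (snd g))"
 have c: "C1c_with_gradient (%w. f (kmul z w)) (%w. ?S (F (kmul z w)))" if "C1c_with_gradient f F"
  for f :: "'a kin => real" and F
 proof (rule C1c_compose[OF that, where L'="%h. (fst h, fst (snd h) + fst h *\<^sub>R v0, snd (snd h))" and Ls="?S" and M="kmul (kinv z)"])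
  show "(kmul z has_derivative (%h. (fst h, fst (snd h) + fst h *\<^sub>R v0, snd (snd h)))) (at w)" for w
   unfolding kmul_def z case_prod_beta prod.sel
   by (auto intro!: derivative_eq_intros)
  show "(fst h, fst (snd h) + fst h *\<^sub>R v0, snd (snd h)) \<bullet> g = h \<bullet> ?S g" for h g :: "'a kin"
   by (cases h; cases g) (simp add: algebra_simps inner_simps)
  show "continuous_on UNIV ?S" by (intro continuous_intros)
  show "continuous_on UNIV (kmul (kinv z))" by (rule continuous_on_kmul[OF continuous_on_const continuous_on_id])
 qed simp
 have s: "snd (snd (kmul z w)) = v0 + snd (snd w)" for w by (cases w) (simp add: kmul_def z)
 show ?thesis
 proof (rule testI[OF c[OF a(1)]])
  fix i
  show "C1c_with_gradient (%w. snd (snd (?S (G (kmul z w)))) $ i) (%w. ?S (H i (kmul z w)))"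
   using c[OF a(2)[of i]] by simp
 qed (simp add: a(3) s inner_add_left)
qed

lemma GDERIV_xk: "GDERIV (xk k) w :> (0, axis k 1, 0)"
proof -
 have e: "xk k = (%h. h \<bullet> (0, axis k 1, 0))" by (auto simp: fun_eq_iff xk_def inner_prod_def inner_axis)
 show ?thesis unfolding gderiv_def e
  by (intro bounded_linear_imp_has_derivative bounded_linear_inner_left)
qed

text \<open>The third power makes the truncated paraboloid twice continuously differentiable, as a
  test function with a velocity Laplacian requires.\<close>

lemma bump_test:
 fixes w0 :: "'n::finite kin"
 assumes r: "r > 0"
 obtains \<psi> where "test (%w. max 0 (r\<^sup>2 - (norm (w - w0))\<^sup>2) ^ 3) \<psi>"
proof -
 define h where "h w = r\<^sup>2 - (norm (w - w0))\<^sup>2" for w :: "'n kin"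
 have gh: "GDERIV h w :> (- 2) *\<^sub>R (w - w0)" for w
  unfolding gderiv_def h_def[abs_def] power2_norm_eq_inner
  by (auto intro!: derivative_eq_intros simp: algebra_simps inner_simps inner_commute)
 have ch: "continuous_on UNIV h" unfolding h_def[abs_def] by (intro continuous_intros)
 have out: "max 0 (h w) = 0" if "norm w > norm w0 + r" for w
 proof -
  have "norm (w - w0) \<ge> r" using that norm_triangle_ineq2[of w w0] by linarith
  then have "r\<^sup>2 <= (norm (w - w0))\<^sup>2" using r by (intro power_mono) auto
  then show ?thesis by (simp add: h_def)
 qed
 have g: "GDERIV (%w. max 0 (h w) ^ Suc (Suc n)) w :> (real (Suc (Suc n)) * max 0 (h w) ^ Suc n) *\<^sub>R ((- 2) *\<^sub>R (w - w0))" for n w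
  by (rule GDERIV_DERIV_compose[OF gh DERIV_max0_power])
 have c: "C1c_with_gradient (%w. max 0 (h w) ^ Suc (Suc n)) (%w. (real (Suc (Suc n)) * max 0 (h w) ^ Suc n) *\<^sub>R ((- 2) *\<^sub>R (w - w0)))" for n
 proof (rule C1c_intro_bounded[where \<rho>="norm w0 + r", OF g])
  fix w :: "'n kin" assume "norm w > norm w0 + r"
  then show "max 0 (h w) ^ Suc (Suc n) = 0" by (simp only: out power_Suc mult_zero_left)
 qed (intro continuous_intros ch)
 let ?G = "%w::'n kin. (real (Suc (Suc 1)) * max 0 (h w) ^ Suc 1) *\<^sub>R ((- 2) *\<^sub>R (w - w0))"
 have lin: "GDERIV (%w::'n kin. snd (snd (w - w0)) $ i) w :> (0, 0, axis i 1)" for i w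
 proof -
  have e: "snd (snd (w - w0)) $ i = (w - w0) \<bullet> (0, 0, axis i 1)" for w :: "'n kin"
   by (simp add: inner_prod_def inner_axis)
  show ?thesis unfolding gderiv_def e by (auto intro!: derivative_eq_intros)
 qed
 have "\<exists>H. C1c_with_gradient (%w. snd (snd (?G w)) $ i) H" for i
 proof
  have e: "snd (snd (?G w)) $ i = (- 6) * (max 0 (h w) ^ Suc (Suc 0) * snd (snd (w - w0)) $ i)" for w
   by (simp add: eval_nat_numeral)
  show "C1c_with_gradient (%w. snd (snd (?G w)) $ i) (%w. (- 6) *\<^sub>R (max 0 (h w) ^ Suc (Suc 0) *\<^sub>R (0, 0, axis i 1)
    + (snd (snd (w - w0)) $ i) *\<^sub>R ((real (Suc (Suc 0)) * max 0 (h w) ^ Suc 0) *\<^sub>R ((- 2) *\<^sub>R (w - w0)))))"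
   unfolding e by (intro C1c_cmult C1c_mult[OF c[of 0] lin]) auto
 qed
 then have "\<forall>i. \<exists>H. C1c_with_gradient (%w. snd (snd (?G w)) $ i) H" by (rule allI)
 from choice[OF this] obtain H where "\<forall>i. C1c_with_gradient (%w. snd (snd (?G w)) $ i) (H i)" by (elim exE)
 note H = spec[OF this]
 have "test (%w. max 0 (h w) ^ Suc (Suc 1)) (%w. fst (?G w) + snd (snd w) \<bullet> fst (snd (?G w)) + (\<Sum>i\<in>UNIV. snd (snd (H i w)) $ i))"
  by (rule testI[OF c[of 1] H]) simp
 then show ?thesis by (intro that) (simp add: h_def eval_nat_numeral)
qed

section \<open>From weak to distributional solutions\<close>

text \<open>All derivatives rest on the test function, and the velocity gradient of the solution has
  disappeared. The reflection condition on \<phi> still encodes the boundary condition.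
  \<open>u\<close> is Borel, so integrals can be transformed in \<open>lborel\<close>.\<close>

definition dist_sol :: "'n::finite => ('n kin => real) => ('n kin => real) => bool" where
 "dist_sol k p u \<longleftrightarrow> u \<in> borel_measurable borel \<and>
   (\<forall>\<rho>. integrable lborel (%w. indicator (half_domain k \<inter> cball 0 \<rho>) w * u w)) \<and>
   (\<forall>\<phi> \<psi>. test \<phi> \<psi> \<and> (\<forall>w. xk k w = 0 --> \<phi> (vrefl k w) = \<phi> w) -->
    (\<integral>w. indicator (half_domain k) w * (u w * \<psi> w + p w * \<phi> w) \<partial>lborel) = 0)"

lemma continuous_lebesgue: 
 fixes f :: "'a::euclidean_space => 'b::euclidean_space"
 assumes "continuous_on UNIV f" shows "f \<in> borel_measurable lebesgue"
proof -
 have "f \<in> borel_measurable borel" by (rule borel_measurable_continuous_onI[OF assms])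
 then have "f \<in> borel_measurable lborel" by simp
 then show ?thesis by (rule measurable_completion)
qed

lemma L2_loc_integrable:
 fixes f :: "'a::euclidean_space => 'b::euclidean_space" and F :: "'a => 'c::euclidean_space"
 assumes f: "L2_loc S f" and S: "closed S" and D: "D \<subseteq> S"
  and F: "(%w. indicator D w *\<^sub>R F w) \<in> borel_measurable lebesgue"
  and bd: "!!w. w \<in> D ==> norm (F w) <= B * norm (f w)" and supp: "!!w. norm w > \<rho> ==> F w = 0"
 shows "integrable lebesgue (%w. indicator D w *\<^sub>R F w)"
proof -
 define K where "K = S \<inter> cball 0 \<rho>"
 have K: "compact K" "K \<subseteq> S" using S by (auto simp: K_def intro: closed_Int_compact)
 have i2: "integrable lebesgue (%w. indicator K w * (norm (f w))\<^sup>2)"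
  using f K unfolding L2_loc_def set_integrable_def by (simp only: real_scaleR_def)
 have "K \<in> lmeasurable" using K(1) by (rule lmeasurable_compact)
 then have i1: "integrable lebesgue (indicator K :: 'a => real)" by (simp add: lmeasurable_iff_integrable)
 have "integrable lebesgue (%w. \<bar>B\<bar> * (indicator K w + indicator K w * (norm (f w))\<^sup>2))"
  by (intro integrable_mult_right Bochner_Integration.integrable_add i1 i2)
 then show ?thesis
 proof (rule Bochner_Integration.integrable_bound[OF _ F], intro AE_I2)
  fix w :: 'a
  show "norm (indicator D w *\<^sub>R F w) <= norm (\<bar>B\<bar> * (indicator K w + indicator K w * (norm (f w))\<^sup>2))"
  proof (cases "w \<in> D \<and> norm w <= \<rho>")
   case True
   then have wK: "w \<in> K" using D by (auto simp: K_def)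
   have "norm (f w) * 2 <= 1 + (norm (f w))\<^sup>2" using zero_le_power2[of "norm (f w) - 1"] by (simp add: power2_diff)
   then have "norm (f w) <= 1 + (norm (f w))\<^sup>2" using norm_ge_zero[of "f w"] by linarith
   then have "\<bar>B\<bar> * norm (f w) <= \<bar>B\<bar> * (1 + (norm (f w))\<^sup>2)" by (rule mult_left_mono) simp
   moreover have "B * norm (f w) <= \<bar>B\<bar> * norm (f w)" by (intro mult_right_mono) auto
   ultimately have "norm (F w) <= \<bar>B\<bar> * (1 + (norm (f w))\<^sup>2)" using bd[of w] True by linarith
   then show ?thesis using True wK by (simp add: abs_mult)
  next
   case False
   then have e: "indicator D w *\<^sub>R F w = 0" using supp[of w] by (cases "w \<in> D") auto
   show ?thesis unfolding e by simp
  qed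
 qed
qed

lemma L2_loc_measurable:
 assumes "L2_loc S f" "D \<subseteq> S" "D \<in> sets borel"
 shows "(%w. indicator D w *\<^sub>R f w) \<in> borel_measurable lebesgue"
proof -
 have D: "D \<in> sets lebesgue" using assms(3) by simp
 have "set_borel_measurable lebesgue S f" using assms(1) by (simp add: L2_loc_def)
 from set_borel_measurable_subset[OF this D assms(2)] show ?thesis by (simp only: set_borel_measurable_def)
qed

text \<open>Vanishes for x <= 1 / m and increases to 1 on the positive axis as m grows; the squares
  make it continuously differentiable.\<close>

definition cutoff :: "nat => real => real" where
 "cutoff m x = max 0 (real m * x - 1) ^ 2 / (1 + max 0 (real m * x - 1) ^ 2)"

lemma cutoff_bounds: "0 <= cutoff m x" "cutoff m x <= 1"
 by (auto simp: cutoff_def divide_simps add_nonneg_eq_0_iff add_pos_nonneg intro: add_pos_nonneg)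

lemma cutoff_tendsto: "x > 0 ==> (%m. cutoff m x) \<longlonglongrightarrow> 1"
proof -
 assume x: "x > 0"
 have 1: "filterlim (%m. real m * x - 1) at_top sequentially"
 proof -
  have "filterlim (%m. real m * x) at_top sequentially"
   by (rule filterlim_at_top_mult_tendsto_pos[OF tendsto_const x filterlim_real_sequentially])
  from filterlim_tendsto_add_at_top[OF tendsto_const[of "-1"] this] show ?thesis by simp
 qed
 have "filterlim (%m. max 0 (real m * x - 1)) at_top sequentially"
  by (rule filterlim_at_top_mono[OF 1]) (auto intro: always_eventually)
 then have "filterlim (%m. max 0 (real m * x - 1) ^ 2) at_top sequentially"
  by (intro filterlim_pow_at_top) auto
 then have "filterlim (%m. 1 + max 0 (real m * x - 1) ^ 2) at_infinity sequentially"
  by (intro filterlim_at_top_imp_at_infinity filterlim_tendsto_add_at_top[OF tendsto_const])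
 then have "(%m. 1 - 1 / (1 + max 0 (real m * x - 1) ^ 2)) \<longlonglongrightarrow> 1 - 0"
  by (intro tendsto_diff tendsto_const tendsto_divide_0[OF tendsto_const])
 moreover have "1 - 1 / (1 + max 0 (real m * x - 1) ^ 2) = cutoff m x" for m
  by (simp add: cutoff_def divide_simps add_nonneg_eq_0_iff)
 ultimately show ?thesis by simp
qed

lemma cutoff_deriv:
 obtains d where "continuous_on UNIV d" "!!x. (cutoff m has_real_derivative d x) (at x)"
proof -
 define e where "e x = real m * (2 * max 0 (real m * x - 1))" for x
 define P where "P x = max 0 (real m * x - 1) ^ 2" for x
 have P: "(P has_real_derivative e x) (at x)" for x
 proof -
  have "((%x. real m * x - 1) has_real_derivative real m) (at x)" by (auto intro!: derivative_eq_intros)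
  from DERIV_chain2[OF DERIV_max0_power[of 0 "real m * x - 1"] this]
  show ?thesis by (simp add: P_def[abs_def] e_def mult.commute eval_nat_numeral)
 qed
 have P0: "1 + P x > 0" for x by (auto simp: P_def intro: add_pos_nonneg)
 have "((%x. P x / (1 + P x)) has_real_derivative (e x * (1 + P x) - P x * e x) / (1 + P x)\<^sup>2) (at x)" for x
  using P0[of x] by (auto intro!: derivative_eq_intros P simp: power2_eq_square)
 moreover have "cutoff m = (%x. P x / (1 + P x))" by (auto simp: cutoff_def P_def)
 moreover have "continuous_on UNIV (%x. (e x * (1 + P x) - P x * e x) / (1 + P x)\<^sup>2)"
  unfolding e_def P_def using P0[unfolded P_def]
  by (intro continuous_intros) (auto simp: less_imp_neq[THEN not_sym])
 ultimately show ?thesis using that[of "%x. (e x * (1 + P x) - P x * e x) / (1 + P x)\<^sup>2"] by simp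
qed

text \<open>The weak gradient is defined with test functions supported inside the open half-domain.
  A cutoff in x_k alone commutes with velocity derivatives, so it can be inserted and then removed
  by dominated convergence.\<close>

lemma weak_v_gradient_boundary:
 fixes f :: "'n::finite kin => real"
 assumes w: "weak_v_gradient (half_domain k) f g"
  and f: "L2_loc (closure (half_domain k)) f" and g: "L2_loc (closure (half_domain k)) g"
  and V: "C1c_with_gradient V H"
 shows "(\<integral>w. indicator (half_domain k) w * (f w * snd (snd (H w)) $ i) \<partial>lebesgue)
   = - (\<integral>w. indicator (half_domain k) w * (V w * g w $ i) \<partial>lebesgue)"
  and "integrable lebesgue (%w. indicator (half_domain k) w * (V w * g w $ i))"
  and "integrable lebesgue (%w. indicator (half_domain k) w * (f w * snd (snd (H w)) $ i))"
proof -
 let ?D = "half_domain k"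
 have D: "?D \<in> sets borel" "?D \<subseteq> closure ?D" by (auto intro: closure_subset[THEN subsetD])
 have Dl: "?D \<in> sets lebesgue" using D(1) by simp
 obtain \<rho> where \<rho>: "!!w. norm w > \<rho> ==> V w = 0" "!!w. norm w > \<rho> ==> H w = 0" using C1c_support[OF V] by metis
 have cV: "continuous_on UNIV V" "continuous_on UNIV H" using C1c_continuous[OF V] by auto
 have bdd: "\<exists>B. \<forall>w. norm (h w) <= B" if h: "continuous_on UNIV h" "!!w. norm w > \<rho> ==> h w = 0"
  for h :: "'n kin => 'b::euclidean_space"
 proof -
  have "bounded (h ` cball 0 \<rho>)" by (intro compact_imp_bounded compact_continuous_image continuous_on_subset[OF h(1)]) auto
  then obtain B where B: "\<forall>y\<in>h ` cball 0 \<rho>. norm y <= B" unfolding bounded_iff by blast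
  have "norm (h w) <= max B 0" for w
   using B h(2)[of w] by (cases "norm w > \<rho>") (auto simp: le_max_iff_disj)
  then show ?thesis by blast
 qed
 have mf: "(%w. indicator ?D w *\<^sub>R f w) \<in> borel_measurable lebesgue" by (rule L2_loc_measurable[OF f D(2,1)])
 have mg: "(%w. indicator ?D w *\<^sub>R g w) \<in> borel_measurable lebesgue" by (rule L2_loc_measurable[OF g D(2,1)])
 have I1: "integrable lebesgue (%w. indicator ?D w *\<^sub>R (f w *\<^sub>R h w))"
  if h: "continuous_on UNIV h" "!!w. norm w > \<rho> ==> h w = 0" for h :: "'n kin => real^'n"
 proof -
  obtain B where B: "!!w. norm (h w) <= B" using bdd[OF h] by blast
  have m: "(%w. (indicator ?D w *\<^sub>R f w) *\<^sub>R h w) \<in> borel_measurable lebesgue"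
   by (intro borel_measurable_scaleR mf continuous_lebesgue h)
  show ?thesis
  proof (rule L2_loc_integrable[OF f closed_closure D(2), of _ B \<rho>])
   show "(%w. indicator ?D w *\<^sub>R (f w *\<^sub>R h w)) \<in> borel_measurable lebesgue" using m by simp
   show "norm (f w *\<^sub>R h w) <= B * norm (f w)" for w
    using mult_left_mono[OF B[of w], of "\<bar>f w\<bar>"] by (simp add: mult.commute)
  qed (simp add: h(2))
 qed
 have I2: "integrable lebesgue (%w. indicator ?D w *\<^sub>R (h w *\<^sub>R g w))"
  if h: "continuous_on UNIV h" "!!w. norm w > \<rho> ==> h w = 0" for h :: "'n kin => real"
 proof -
  obtain B where B: "!!w. norm (h w) <= B" using bdd[OF h] by blast
  have m: "(%w. h w *\<^sub>R (indicator ?D w *\<^sub>R g w)) \<in> borel_measurable lebesgue"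
   by (intro borel_measurable_scaleR mg continuous_lebesgue h)
  show ?thesis
  proof (rule L2_loc_integrable[OF g closed_closure D(2), of _ B \<rho>])
   show "(%w. indicator ?D w *\<^sub>R (h w *\<^sub>R g w)) \<in> borel_measurable lebesgue" using m by (simp add: mult.commute)
   show "norm (h w *\<^sub>R g w) <= B * norm (g w)" for w
    using mult_right_mono[OF B[of w], of "norm (g w)"] by simp
  qed (simp add: h(2))
 qed
 have nth: "integrable lebesgue (%w. F w $ i)" "(\<integral>w. F w \<partial>lebesgue) $ i = (\<integral>w. F w $ i \<partial>lebesgue)"
  if "integrable lebesgue F" for F :: "'n kin => real^'n"
  using integrable_bounded_linear[OF bounded_linear_vec_nth that]
   integral_bounded_linear[OF bounded_linear_vec_nth that] by auto
 show i1: "integrable lebesgue (%w. indicator ?D w * (V w * g w $ i))"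
  using nth(1)[OF I2[OF cV(1) \<rho>(1)]] by (simp add: mult.assoc)
 show i2: "integrable lebesgue (%w. indicator ?D w * (f w * snd (snd (H w)) $ i))"
 proof -
  have "integrable lebesgue (%w. indicator ?D w *\<^sub>R (f w *\<^sub>R snd (snd (H w))))"
   by (rule I1) (intro continuous_intros cV, simp add: \<rho>)
  from nth(1)[OF this] show ?thesis by (simp add: mult.assoc)
 qed
 let ?z = "%m w. cutoff m (xk k w)"
 have eq: "(\<integral>w. ?z m w * (indicator ?D w * (f w * snd (snd (H w)) $ i)) \<partial>lebesgue)
   = - (\<integral>w. ?z m w * (indicator ?D w * (V w * g w $ i)) \<partial>lebesgue)" for m
 proof -
  obtain d where d: "continuous_on UNIV d" "!!x. (cutoff m has_real_derivative d x) (at x)" using cutoff_deriv[of m] by metis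
  have cz: "continuous_on UNIV (cutoff m)" by (rule DERIV_continuous_on[OF has_field_derivative_at_within[OF d(2)]])
  \<comment> \<open>The gradient of the cutoff points in direction x_k and has no velocity part, so
    it does not contribute to the identity however steep the cutoff becomes.\<close>
  have gz: "GDERIV (?z m) w :> d (xk k w) *\<^sub>R (0, axis k 1, 0)" for w
   by (rule GDERIV_DERIV_compose[OF GDERIV_xk d(2)])
  have "continuous_on UNIV (%w::'n kin. d (xk k w) *\<^sub>R (0::real, axis k 1 :: real^'n, 0::real^'n))"
   by (intro continuous_intros continuous_on_compose2[OF d(1)]) auto
  note t = C1c_mult[OF V gz this]
  have sup: "closure {w. V w * ?z m w \<noteq> 0} \<subseteq> ?D"
  proof (cases "m = 0")
   case True
   then have e: "{w. V w * ?z m w \<noteq> 0} = {}" by (auto simp: cutoff_def)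
   show ?thesis unfolding e by simp
  next
   case False
   have "closure {w. V w * ?z m w \<noteq> 0} \<subseteq> {w. xk k w \<ge> 1 / real m}"
   proof (rule closure_minimal)
    show "closed {w. xk k w \<ge> 1 / real m}" by (intro closed_Collect_le continuous_intros)
    show "{w. V w * ?z m w \<noteq> 0} \<subseteq> {w. xk k w \<ge> 1 / real m}"
    proof (rule subsetI, rule CollectI)
     fix w assume "w \<in> {w. V w * ?z m w \<noteq> 0}"
     then have "max 0 (real m * xk k w - 1) \<noteq> 0" by (auto simp: cutoff_def)
     then have "real m * xk k w > 1" by (auto simp: max_def split: if_splits)
     then show "1 / real m <= xk k w" using False by (simp add: field_simps)
    qed
   qed
   also have "\<dots> \<subseteq> ?D" unfolding half_domain_xk
   proof (rule subsetI, rule CollectI)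
    fix w assume "w \<in> {w. xk k w \<ge> 1 / real m}"
    then have "1 / real m <= xk k w" by (rule CollectD)
    moreover have "0 < 1 / real m" using False by simp
    ultimately show "0 < xk k w" by linarith
   qed
   finally show ?thesis .
  qed
  have "(LINT w:?D|lebesgue. f w *\<^sub>R snd (snd (V w *\<^sub>R d (xk k w) *\<^sub>R (0, axis k 1, 0) + ?z m w *\<^sub>R H w)))
    = - (LINT w:?D|lebesgue. (V w * ?z m w) *\<^sub>R g w)"
   using w t sup unfolding weak_v_gradient_def by blast
  then have e: "(\<integral>w. indicator ?D w *\<^sub>R (f w *\<^sub>R (?z m w *\<^sub>R snd (snd (H w)))) \<partial>lebesgue) $ i
    = - (\<integral>w. indicator ?D w *\<^sub>R ((V w * ?z m w) *\<^sub>R g w) \<partial>lebesgue) $ i"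
   by (simp add: set_lebesgue_integral_def)
  have cc: "continuous_on UNIV (?z m)" by (intro continuous_on_compose2[OF cz] continuous_intros) auto
  have j1: "integrable lebesgue (%w. indicator ?D w *\<^sub>R (f w *\<^sub>R (?z m w *\<^sub>R snd (snd (H w)))))"
   by (rule I1) (auto intro!: continuous_intros cc cV simp: \<rho>)
  have j2: "integrable lebesgue (%w. indicator ?D w *\<^sub>R ((V w * ?z m w) *\<^sub>R g w))"
   by (rule I2) (auto intro!: continuous_intros cc cV simp: \<rho>)
  have "(\<integral>w. (indicator ?D w *\<^sub>R (f w *\<^sub>R (?z m w *\<^sub>R snd (snd (H w))))) $ i \<partial>lebesgue)
    = - (\<integral>w. (indicator ?D w *\<^sub>R ((V w * ?z m w) *\<^sub>R g w)) $ i \<partial>lebesgue)"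
   using e unfolding nth(2)[OF j1] nth(2)[OF j2] by simp
  then show ?thesis by (simp add: mult_ac)
 qed
 have lim: "(%m. \<integral>w. ?z m w * (indicator ?D w * h w) \<partial>lebesgue) \<longlonglongrightarrow> (\<integral>w. indicator ?D w * h w \<partial>lebesgue)"
  if h: "integrable lebesgue (%w. indicator ?D w * h w)" for h :: "'n kin => real"
 proof (rule integral_dominated_convergence[where w="%w. \<bar>indicator ?D w * h w\<bar>"])
  show "(%w. indicator ?D w * h w) \<in> borel_measurable lebesgue" using h by (rule borel_measurable_integrable)
  show "integrable lebesgue (%w. \<bar>indicator ?D w * h w\<bar>)" using h by (rule integrable_abs)
  show "(%w. ?z m w * (indicator ?D w * h w)) \<in> borel_measurable lebesgue" for m
  proof (rule borel_measurable_times[OF continuous_lebesgue borel_measurable_integrable[OF h]])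
   obtain d where d: "continuous_on UNIV d" "!!x. (cutoff m has_real_derivative d x) (at x)" using cutoff_deriv[of m] by metis
   have cz: "continuous_on UNIV (cutoff m)" by (rule DERIV_continuous_on[OF has_field_derivative_at_within[OF d(2)]])
   show "continuous_on UNIV (?z m)" by (intro continuous_on_compose2[OF cz] continuous_intros) auto
  qed
  show "AE w in lebesgue. (%m. ?z m w * (indicator ?D w * h w)) \<longlonglongrightarrow> indicator ?D w * h w"
  proof (rule AE_I2)
   fix w
   show "(%m. ?z m w * (indicator ?D w * h w)) \<longlonglongrightarrow> indicator ?D w * h w"
   proof (cases "w \<in> ?D")
    case True
    then have "(%m. ?z m w) \<longlonglongrightarrow> 1" by (intro cutoff_tendsto) (simp add: half_domain_xk)
    from tendsto_mult_right[OF this, of "indicator ?D w * h w"] show ?thesis by simp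
   qed simp
  qed
  show "AE w in lebesgue. norm (?z m w * (indicator ?D w * h w)) <= \<bar>indicator ?D w * h w\<bar>" for m
  proof (rule AE_I2)
   fix w
   have "?z m w * \<bar>indicator ?D w * h w\<bar> <= 1 * \<bar>indicator ?D w * h w\<bar>"
    by (intro mult_right_mono cutoff_bounds) auto
   then show "norm (?z m w * (indicator ?D w * h w)) <= \<bar>indicator ?D w * h w\<bar>"
    unfolding real_norm_def abs_mult[of "?z m w"] abs_of_nonneg[OF cutoff_bounds(1)] by simp
  qed
 qed
 have "(%m. \<integral>w. ?z m w * (indicator ?D w * (f w * snd (snd (H w)) $ i)) \<partial>lebesgue)
   \<longlonglongrightarrow> - (\<integral>w. indicator ?D w * (V w * g w $ i) \<partial>lebesgue)"
  unfolding eq by (rule tendsto_minus[OF lim[OF i1]])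
 then show "(\<integral>w. indicator ?D w * (f w * snd (snd (H w)) $ i) \<partial>lebesgue)
   = - (\<integral>w. indicator ?D w * (V w * g w $ i) \<partial>lebesgue)"
  using LIMSEQ_unique[OF lim[OF i2]] by simp
qed

text \<open>A Borel representative replaces \<open>f\<close>, and the term with the velocity
  gradient is integrated by parts once more, using each velocity derivative of \<phi> as a test
  function.\<close>

lemma weak_solution_dist:
 fixes f :: "'n::finite kin => real"
 assumes w: "weak_solution k p f" and p: "continuous_on UNIV p"
 obtains u where "dist_sol k p u" "AE w in lebesgue. xk k w > 0 --> u w = f w"
proof -
 let ?D = "half_domain k"
 have D: "?D \<in> sets borel" "?D \<subseteq> closure ?D" by (auto intro: closure_subset[THEN subsetD])
 obtain g where f: "L2_loc (closure ?D) f" and wg: "weak_v_gradient ?D f g" and g: "L2_loc (closure ?D) g"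
  and id: "!!\<phi> G. C1c_with_gradient \<phi> G ==> (\<forall>t x v. x $ k = 0 --> \<phi> (t, x, reflect k v) = \<phi> (t, x, v)) ==>
    (LINT z:?D|lebesgue. (case z of (t, x, v) => case G z of (a, X, V) =>
        - f z * (a + v \<bullet> X) + g z \<bullet> V - p z * \<phi> z)) = 0"
  using w unfolding weak_solution_def by blast
 have mf: "(%w. indicator ?D w *\<^sub>R f w) \<in> borel_measurable lebesgue" by (rule L2_loc_measurable[OF f D(2,1)])
 then have "(%w. indicator ?D w * f w) \<in> borel_measurable (completion lborel)" by simp
 from completion_ex_borel_measurable_real[OF this]
 obtain u where u: "u \<in> borel_measurable lborel" "AE w in lborel. indicator ?D w * f w = u w" by blast
 have ub: "u \<in> borel_measurable borel" using u(1) by simp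
 have ae: "AE w in lebesgue. indicator ?D w * f w = u w" using u(2) by (rule AE_completion)
 have If: "integrable lebesgue (%w. indicator ?D w * (f w * h w))"
  if h: "h \<in> borel_measurable borel" "!!w. norm w > \<rho> ==> h w = 0" "!!w. \<bar>h w\<bar> <= B" for h \<rho> B
 proof -
  have "integrable lebesgue (%w. indicator ?D w *\<^sub>R (f w * h w))"
  proof (rule L2_loc_integrable[OF f closed_closure D(2), of _ B \<rho>])
   have "h \<in> borel_measurable lborel" using h(1) by simp
   then have hl: "h \<in> borel_measurable lebesgue" by (rule measurable_completion)
   from borel_measurable_times[OF mf hl]
   show "(%w. indicator ?D w *\<^sub>R (f w * h w)) \<in> borel_measurable lebesgue" by (simp add: mult.assoc)
   show "norm (f w * h w) <= B * norm (f w)" for w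
    using mult_left_mono[OF h(3)[of w], of "\<bar>f w\<bar>"] by (simp add: abs_mult mult.commute)
  qed (simp add: h(2))
  then show ?thesis by simp
 qed
 have "dist_sol k p u"
  unfolding dist_sol_def
 proof (intro conjI allI impI)
  show "u \<in> borel_measurable borel" by (rule ub)
  fix \<rho> :: real
  have i0: "integrable lebesgue (%w. indicator ?D w * (f w * indicator (cball 0 \<rho>) w))"
   by (rule If[of _ \<rho> 1]) (auto simp: indicator_def)
  have mu: "(%w. indicator (cball 0 \<rho>) w * u w) \<in> borel_measurable lborel"
  proof -
   note [measurable] = ub borel_closed[OF closed_cball, of "0 :: 'n kin" \<rho>]
   have "(%w. indicator (cball 0 \<rho>) w * u w) \<in> borel_measurable borel" by measurable
   then show ?thesis by simp
  qed
  have ae2: "AE w in lebesgue. indicator ?D w * (f w * indicator (cball 0 \<rho>) w) = indicator (cball 0 \<rho>) w * u w"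
   using ae
  proof eventually_elim
   case (elim w)
   show ?case unfolding elim[symmetric] by (simp add: mult_ac)
  qed
  have "integrable lebesgue (%w. indicator (cball 0 \<rho>) w * u w)"
   by (rule iffD1[OF integrable_cong_AE[OF borel_measurable_integrable[OF i0] measurable_completion[OF mu] ae2] i0])
  then have "integrable lborel (%w. indicator (cball 0 \<rho>) w * u w)"
   unfolding integrable_completion[OF mu] .
  then have "integrable lborel (%w. indicator ?D w *\<^sub>R (indicator (cball 0 \<rho>) w * u w))"
   by (rule integrable_mult_indicator[rotated]) simp
  then show "integrable lborel (%w. indicator (?D \<inter> cball 0 \<rho>) w * u w)"
   by (simp add: indicator_inter_arith mult.assoc)
 next
  fix \<phi> \<psi> assume "test \<phi> \<psi> \<and> (\<forall>w. xk k w = 0 --> \<phi> (vrefl k w) = \<phi> w)"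
  then have t: "test \<phi> \<psi>" and sym: "!!w. xk k w = 0 ==> \<phi> (vrefl k w) = \<phi> w" by auto
  obtain G H where a: "C1c_with_gradient \<phi> G" "!!i. C1c_with_gradient (%w. snd (snd (G w)) $ i) (H i)"
   "!!w. \<psi> w = fst (G w) + snd (snd w) \<bullet> fst (snd (G w)) + (\<Sum>i\<in>UNIV. snd (snd (H i w)) $ i)"
   using testE[OF t] by blast
  note v = weak_v_gradient_boundary[OF wg f g a(2)]
  define P where "P w = fst (G w) + snd (snd w) \<bullet> fst (snd (G w))" for w
  obtain \<rho> where \<rho>: "!!w. norm w > \<rho> ==> \<phi> w = 0" "!!w. norm w > \<rho> ==> G w = 0" using C1c_support[OF a(1)] by metis
  have cP: "continuous_on UNIV P" unfolding P_def[abs_def] by (intro continuous_intros C1c_continuous[OF a(1)])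
  have P0: "norm w > \<rho> ==> P w = 0" for w by (simp add: P_def \<rho>)
  have "bounded (P ` cball 0 \<rho>)" by (intro compact_imp_bounded compact_continuous_image continuous_on_subset[OF cP]) auto
  then obtain B where B: "\<forall>y\<in>P ` cball 0 \<rho>. norm y <= B" unfolding bounded_iff by blast
  have PB: "\<bar>P w\<bar> <= max B 0" for w
   using B P0[of w] by (cases "norm w > \<rho>") (auto simp: le_max_iff_disj)
  have IP: "integrable lebesgue (%w. indicator ?D w * (f w * P w))"
   by (rule If[OF _ P0 PB]) (rule borel_measurable_continuous_onI[OF cP])
  have Ip: "integrable lebesgue (%w. indicator ?D w * (p w * \<phi> w))"
  proof -
   have c: "continuous_on UNIV (%w. p w * \<phi> w)" by (intro continuous_intros p C1c_continuous[OF a(1)])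
   have "integrable lborel (%w. indicator ?D w *\<^sub>R (p w * \<phi> w))"
    by (rule integrable_compact_support[OF c _ D(1), of \<rho>]) (simp add: \<rho>)
   then show ?thesis by (simp add: integrable_completion)
  qed
  have Ig: "integrable lebesgue (%w. indicator ?D w * (g w \<bullet> snd (snd (G w))))"
   and gV: "(\<integral>w. indicator ?D w * (g w \<bullet> snd (snd (G w))) \<partial>lebesgue)
     = (\<Sum>i\<in>UNIV. \<integral>w. indicator ?D w * (snd (snd (G w)) $ i * g w $ i) \<partial>lebesgue)"
  proof -
   have e: "indicator ?D w * (g w \<bullet> snd (snd (G w))) = (\<Sum>i\<in>UNIV. indicator ?D w * (snd (snd (G w)) $ i * g w $ i))" for w
    unfolding inner_vec_def sum_distrib_left[symmetric] by (simp add: mult.commute)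
   show "integrable lebesgue (%w. indicator ?D w * (g w \<bullet> snd (snd (G w))))"
    unfolding e by (intro Bochner_Integration.integrable_sum v(2))
   show "(\<integral>w. indicator ?D w * (g w \<bullet> snd (snd (G w))) \<partial>lebesgue)
     = (\<Sum>i\<in>UNIV. \<integral>w. indicator ?D w * (snd (snd (G w)) $ i * g w $ i) \<partial>lebesgue)"
    unfolding e by (rule Bochner_Integration.integral_sum) (rule v(2))
  qed
  have "(LINT z:?D|lebesgue. (case z of (t, x, v) => case G z of (a, X, V) =>
        - f z * (a + v \<bullet> X) + g z \<bullet> V - p z * \<phi> z)) = 0"
   by (rule id[OF a(1)]) (use sym in \<open>auto simp: xk_def vrefl_def\<close>)
  then have 1: "(\<integral>w. - (indicator ?D w * (f w * P w)) + indicator ?D w * (g w \<bullet> snd (snd (G w))) - indicator ?D w * (p w * \<phi> w) \<partial>lebesgue) = 0"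
   unfolding set_lebesgue_integral_def
   by (simp add: P_def case_prod_beta algebra_simps)
  have 2: "- (\<integral>w. indicator ?D w * (f w * P w) \<partial>lebesgue) + (\<integral>w. indicator ?D w * (g w \<bullet> snd (snd (G w))) \<partial>lebesgue)
    - (\<integral>w. indicator ?D w * (p w * \<phi> w) \<partial>lebesgue) = 0"
   using 1 IP Ip Ig by simp
  have "(\<integral>w. indicator ?D w * (u w * \<psi> w + p w * \<phi> w) \<partial>lborel) = (\<integral>w. indicator ?D w * (u w * \<psi> w + p w * \<phi> w) \<partial>lebesgue)"
  proof (rule integral_completion[symmetric])
   have [measurable]: "\<psi> \<in> borel_measurable borel" "\<phi> \<in> borel_measurable borel" "p \<in> borel_measurable borel" "u \<in> borel_measurable borel"
    using test_props[OF t] p ub by (metis borel_measurable_continuous_onI)+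
   show "(%w. indicator ?D w * (u w * \<psi> w + p w * \<phi> w)) \<in> borel_measurable lborel" by measurable
  qed
  also have "\<dots> = (\<integral>w. indicator ?D w * (f w * P w) + (\<Sum>i\<in>UNIV. indicator ?D w * (f w * snd (snd (H i w)) $ i))
    + indicator ?D w * (p w * \<phi> w) \<partial>lebesgue)"
  proof (rule integral_cong_AE)
   have "\<psi> \<in> borel_measurable borel" "\<phi> \<in> borel_measurable borel" "p \<in> borel_measurable borel"
    using test_props[OF t] p by (metis borel_measurable_continuous_onI)+
   note [measurable] = this ub
   have "(%w. indicator ?D w * (u w * \<psi> w + p w * \<phi> w)) \<in> borel_measurable lborel" by measurable
   then show "(%w. indicator ?D w * (u w * \<psi> w + p w * \<phi> w)) \<in> borel_measurable lebesgue" by (rule measurable_completion)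
   show "(%w. indicator ?D w * (f w * P w) + (\<Sum>i\<in>UNIV. indicator ?D w * (f w * snd (snd (H i w)) $ i))
    + indicator ?D w * (p w * \<phi> w)) \<in> borel_measurable lebesgue"
    by (intro borel_measurable_add borel_measurable_sum borel_measurable_integrable IP Ip v(3))
   show "AE w in lebesgue. indicator ?D w * (u w * \<psi> w + p w * \<phi> w) = indicator ?D w * (f w * P w)
    + (\<Sum>i\<in>UNIV. indicator ?D w * (f w * snd (snd (H i w)) $ i)) + indicator ?D w * (p w * \<phi> w)"
    using ae
   proof eventually_elim
    case (elim w)
    show ?case
    proof (cases "w \<in> ?D")
     case True
     then have "u w = f w" using elim by simp
     then show ?thesis using True by (simp add: a(3) P_def distrib_left sum_distrib_left)
    next
     case False
     then show ?thesis by simp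
    qed
   qed
  qed
  also have "\<dots> = (\<integral>w. indicator ?D w * (f w * P w) \<partial>lebesgue)
    + (\<Sum>i\<in>UNIV. \<integral>w. indicator ?D w * (f w * snd (snd (H i w)) $ i) \<partial>lebesgue) + (\<integral>w. indicator ?D w * (p w * \<phi> w) \<partial>lebesgue)"
  proof -
   have "(\<integral>w. a w + (\<Sum>i\<in>UNIV. b i w) + c w \<partial>lebesgue) = (\<integral>w. a w \<partial>lebesgue) + (\<Sum>i\<in>UNIV. \<integral>w. b i w \<partial>lebesgue) + (\<integral>w. c w \<partial>lebesgue)"
    if "integrable lebesgue a" "!!i. integrable lebesgue (b i)" "integrable lebesgue c"
    for a c :: "'n kin => real" and b :: "'n => 'n kin => real"
    using that by simp
   from this[OF IP v(3) Ip] show ?thesis .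
  qed
  also have "\<dots> = 0" using 2 unfolding v(1) gV by (simp add: sum_negf)
  finally show "(\<integral>w. indicator ?D w * (u w * \<psi> w + p w * \<phi> w) \<partial>lborel) = 0" .
 qed
 moreover have "AE w in lebesgue. xk k w > 0 --> u w = f w"
  using ae by eventually_elim (auto simp: half_domain_xk)
 ultimately show ?thesis by (rule that)
qed

section \<open>Growth and the degree of the right-hand side\<close>

text \<open>Growth of local L1 norms under the scaling: insensitive to null sets, and implied both
  by an almost-everywhere bound and by homogeneity.\<close>

definition growth :: "'n::finite => real => ('n kin => real) => bool" where
 "growth k \<beta> u \<longleftrightarrow> (\<forall>\<rho>. \<exists>C. \<forall>R\<ge>1.
   (\<integral>w. indicator (half_domain k \<inter> cball 0 \<rho>) w * \<bar>u (kscale R w)\<bar> \<partial>lborel) <= C * R powr \<beta>)"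

abbreviation wsum :: "'n::finite kin list => nat" where "wsum l \<equiv> (\<Sum>b\<leftarrow>l. weight b)"

lemma lincomb_filter_sum:
 assumes "!!c l. (c, l) \<in> set L ==> wsum l <= m"
 shows "lincomb (filter (%(c, l). P (wsum l)) L) w =
  (\<Sum>j\<le>m. if P j then lincomb (filter (%(c, l). wsum l = j) L) w else 0)"
 using assms
proof (induction L)
 case Nil
 show ?case by (simp add: sum.neutral)
next
 case (Cons a L)
 obtain c l where a: "a = (c, l)" by (cases a)
 have IH: "lincomb (filter (%(c, l). P (wsum l)) L) w =
  (\<Sum>j\<le>m. if P j then lincomb (filter (%(c, l). wsum l = j) L) w else 0)"
  using Cons by (meson list.set_intros(2))
 have l: "wsum l <= m" using Cons.prems[of c l] a by simp
 have "(\<Sum>j\<le>m. if P j then lincomb (filter (%(c, l). wsum l = j) (a # L)) w else 0)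
   = (\<Sum>j\<le>m. (if j = wsum l then (if P j then c * mon l w else 0) else 0) + (if P j then lincomb (filter (%(c, l). wsum l = j) L) w else 0))"
  by (rule sum.cong) (auto simp: a)
 also have "\<dots> = (if P (wsum l) then c * mon l w else 0) + lincomb (filter (%(c, l). P (wsum l)) L) w"
  unfolding sum.distrib IH[symmetric] using l by simp
 also have "\<dots> = lincomb (filter (%(c, l). P (wsum l)) (a # L)) w" by (simp add: a)
 finally show ?case by simp
qed

lemma lincomb_kscale:
 assumes "!!c l. (c, l) \<in> set L ==> set l \<subseteq> Basis" "!!c l. (c, l) \<in> set L ==> wsum l = j"
 shows "lincomb L (kscale r w) = r ^ j * lincomb L w"
 using assms
proof (induction L)
 case (Cons a L)
 obtain c l where a: "a = (c, l)" by (cases a)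
 have IH: "lincomb L (kscale r w) = r ^ j * lincomb L w" using Cons by (meson list.set_intros(2))
 have "mon l (kscale r w) = r ^ j * mon l w"
  using mon_kscale[of l r w] Cons.prems(1)[of c l] Cons.prems(2)[of c l] a by simp
 then show ?case by (simp add: a IH distrib_left)
qed simp

lemma xk_kscale: "xk k (kscale r w) = r ^ 3 * xk k w"
 by (cases w) (simp add: xk_def kscale_def)

lemma kscale_half_domain: "r > 0 ==> kscale r w \<in> half_domain k \<longleftrightarrow> w \<in> half_domain k"
 by (simp add: half_domain_xk xk_kscale zero_less_mult_iff)

lemma norm_kin_le: "norm (t, x, v) <= \<bar>t\<bar> + norm x + norm v"
proof -
 have "norm (t, x, v) <= norm t + norm (x, v)" by (rule norm_Pair_le)
 also have "norm (x, v) <= norm x + norm v" by (rule norm_Pair_le)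
 finally show ?thesis by simp
qed

lemma norm_kin_ge: "\<bar>fst w\<bar> <= norm w" "norm (fst (snd w)) <= norm w" "norm (snd (snd w)) <= norm w"
 for w :: "'n::finite kin"
 using norm_fst_le[of "fst w" "snd w"] norm_snd_le[of "snd w" "fst w"]
  norm_fst_le[of "fst (snd w)" "snd (snd w)"] norm_snd_le[of "snd (snd w)" "fst (snd w)"]
 by (auto intro: order_trans)

lemma norm_kscale_le:
 assumes "0 <= r" "r <= R" "1 <= R" shows "norm (kscale r w) <= 3 * R ^ 3 * norm w"
proof -
 have "kscale r w = (r\<^sup>2 * fst w, r ^ 3 *\<^sub>R fst (snd w), r *\<^sub>R snd (snd w))" by (cases w) (simp add: kscale_def)
 then have "norm (kscale r w) <= \<bar>r\<^sup>2 * fst w\<bar> + norm (r ^ 3 *\<^sub>R fst (snd w)) + norm (r *\<^sub>R snd (snd w))"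
  using norm_kin_le[of "r\<^sup>2 * fst w" "r ^ 3 *\<^sub>R fst (snd w)" "r *\<^sub>R snd (snd w)"] by (simp only:)
 also have "\<dots> <= R ^ 3 * norm w + R ^ 3 * norm w + R ^ 3 * norm w"
 proof -
  have p: "r ^ i <= R ^ 3" if "i <= 3" for i
  proof -
   have "r ^ i <= R ^ i" using assms by (intro power_mono) auto
   also have "\<dots> <= R ^ 3" using assms that by (intro power_increasing) auto
   finally show ?thesis .
  qed
  have "\<bar>r\<^sup>2 * fst w\<bar> <= R ^ 3 * norm w" "norm (r ^ 3 *\<^sub>R fst (snd w)) <= R ^ 3 * norm w" "norm (r *\<^sub>R snd (snd w)) <= R ^ 3 * norm w"
   using assms p[of 2] p[of 3] p[of 1] norm_kin_ge[of w]
   by (auto simp: abs_mult intro!: mult_mono)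
  then show ?thesis by linarith
 qed
 also have "\<dots> = 3 * R ^ 3 * norm w" by simp
 finally show ?thesis .
qed

lemma local_integrable_kscale:
 fixes u :: "'n::finite kin => real"
 assumes u: "u \<in> borel_measurable borel" "!!\<rho>. integrable lborel (%w. indicator (half_domain k \<inter> cball 0 \<rho>) w * u w)"
  and R: "R > 0"
 shows "integrable lborel (%w. indicator (half_domain k \<inter> cball 0 \<rho>) w * u (kscale R w))"
proof -
 note [measurable] = u(1)
 have cb: "cball (0::'n kin) r \<in> sets borel" for r by auto
 note [measurable] = cb
 define r where "r = 3 * (max R 1) ^ 3 * \<rho>"
 have "integrable lborel (%w. indicator (half_domain k \<inter> cball 0 r) (kscale R w) * u (kscale R w))"
  using vol_scaling_integral(2)[OF vol_scaling_kscale[OF R], of "%w. indicator (half_domain k \<inter> cball 0 r) w * u w"] u(2)[of r] by simp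
 then show ?thesis
 proof (rule Bochner_Integration.integrable_bound)
  show "AE w in lborel. norm (indicator (half_domain k \<inter> cball 0 \<rho>) w * u (kscale R w))
    <= norm (indicator (half_domain k \<inter> cball 0 r) (kscale R w) * u (kscale R w))"
  proof (rule AE_I2)
   fix w :: "'n kin"
   show "norm (indicator (half_domain k \<inter> cball 0 \<rho>) w * u (kscale R w))
    <= norm (indicator (half_domain k \<inter> cball 0 r) (kscale R w) * u (kscale R w))"
   proof (cases "w \<in> half_domain k \<inter> cball 0 \<rho>")
    case True
    have "norm (kscale R w) <= 3 * (max R 1) ^ 3 * norm w" using R by (intro norm_kscale_le) auto
    also have "\<dots> <= r" unfolding r_def using True by (intro mult_left_mono) auto
    finally have "kscale R w \<in> half_domain k \<inter> cball 0 r" using True kscale_half_domain[OF R, of w k] by simp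
    then show ?thesis using True by simp
   qed simp
  qed
 qed measurable
qed

text \<open>Testing at scale R, the solution contributes at most a multiple of R^\<beta>, whereas
  the part of degree j of the right-hand side contributes a multiple of R^(j + 2); the 2 is the
  order of the operator. For j + 2 > \<beta> this multiple must vanish, and bumps detect that the
  part itself vanishes.\<close>

lemma dist_sol_degree:
 fixes u :: "'n::finite kin => real"
 assumes d: "dist_sol k (lincomb L) u" and L: "!!c l. (c, l) \<in> set L ==> set l \<subseteq> Basis"
  and gr: "growth k \<beta> u" and w: "w \<in> half_domain k"
 shows "lincomb L w = lincomb (filter (%(c, l). real (wsum l) + 2 <= \<beta>) L) w"
proof -
 let ?D = "half_domain k"
 define m where "m = Max (insert 0 ((%(c, l). wsum l) ` set L))"
 have m: "wsum l <= m" if "(c, l) \<in> set L" for c l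
  unfolding m_def using that by (intro Max_ge) (auto intro: rev_image_eqI)
 define p where "p j = lincomb (filter (%(c, l). wsum l = j) L)" for j
 have pc: "continuous_on UNIV (p j)" for j
  unfolding p_def by (intro continuous_on_polymonial_function) (simp add: real_polynomial_function_eq[symmetric] polynomial_lincomb)
 have Lp: "lincomb L w = (\<Sum>j\<le>m. p j w)" for w
  using lincomb_filter_sum[OF m, where P="%_. True" and w=w] by (simp add: p_def)
 have pk: "p j (kscale R w) = R ^ j * p j w" for j R w
  unfolding p_def by (rule lincomb_kscale) (auto dest: L)
 have [measurable]: "u \<in> borel_measurable borel" using d by (simp add: dist_sol_def)
 have loc: "integrable lborel (%w. indicator (?D \<inter> cball 0 \<rho>) w * u w)" for \<rho> using d by (simp add: dist_sol_def)
 have zero: "p j w = 0" if j: "real j + 2 > \<beta>" "j <= m" and w: "w \<in> ?D" for j w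
 proof (rule ccontr)
  assume nz: "p j w \<noteq> 0"
  define e where "e = \<bar>p j w\<bar> / 2"
  have e: "e > 0" using nz by (simp add: e_def)
  have "isCont (p j) w" by (rule continuous_on_interior[OF pc]) simp
  then obtain r1 where r1: "r1 > 0" "!!y. dist y w < r1 ==> dist (p j y) (p j w) < e"
   unfolding continuous_at_eps_delta using e by meson
  obtain r2 where r2: "r2 > 0" "ball w r2 \<subseteq> ?D" using w half_domain_open[of k] open_contains_ball by metis
  define r where "r = min r1 r2"
  have r: "r > 0" using r1 r2 by (simp add: r_def)
  \<comment> \<open>A bump so narrow that \<open>p j\<close> keeps its sign on the support and the
    support stays inside the half-domain, where the reflection condition is void.\<close>
  define \<phi> where "\<phi> y = max 0 (r\<^sup>2 - (norm (y - w))\<^sup>2) ^ 3" for y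
  obtain \<psi> where t: "test \<phi> \<psi>" unfolding \<phi>_def[abs_def] using bump_test[OF r, of w] by metis
  have \<phi>0: "\<phi> y = 0" if "dist y w \<ge> r" for y
  proof -
   have "r\<^sup>2 <= (norm (y - w))\<^sup>2" using that r by (intro power_mono) (auto simp: dist_norm)
   then show ?thesis by (simp add: \<phi>_def)
  qed
  have \<phi>pos: "\<phi> y > 0" if "dist y w < r" for y
  proof -
   have "(norm (y - w))\<^sup>2 < r\<^sup>2" using that by (intro power_strict_mono) (auto simp: dist_norm)
   then show ?thesis by (simp add: \<phi>_def)
  qed
  have \<phi>nn: "\<phi> y \<ge> 0" for y by (simp add: \<phi>_def)
  have \<phi>D: "y \<in> ?D" if "\<phi> y \<noteq> 0" for y
  proof -
   have "dist y w < r2" using \<phi>0[of y] that by (force simp: r_def not_le[symmetric])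
   then show ?thesis using r2(2) by (auto simp: dist_commute)
  qed
  obtain \<rho> where \<rho>: "\<rho> > 0" "!!y. norm y > \<rho> ==> \<phi> y = 0" "!!y. norm y > \<rho> ==> \<psi> y = 0"
   "continuous_on UNIV \<phi>" "continuous_on UNIV \<psi>" using test_props[OF t] by metis
  have [measurable]: "\<phi> \<in> borel_measurable borel" "\<psi> \<in> borel_measurable borel" "!!i. p i \<in> borel_measurable borel"
   using \<rho>(4,5) pc by (auto intro: borel_measurable_continuous_onI)
  have "bounded (\<psi> ` cball 0 \<rho>)" by (intro compact_imp_bounded compact_continuous_image continuous_on_subset[OF \<rho>(5)]) auto
  then obtain B0 where B0: "\<forall>y\<in>\<psi> ` cball 0 \<rho>. norm y <= B0" unfolding bounded_iff by blast
  define B where "B = max B0 0"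
  have B: "\<bar>\<psi> y\<bar> <= B * indicator (cball 0 \<rho>) y" for y
   using B0 \<rho>(3)[of y] by (cases "norm y > \<rho>") (auto simp: B_def le_max_iff_disj)
  have B1: "B \<ge> 0" by (simp add: B_def)
  from gr[unfolded growth_def, THEN spec, of \<rho>]
  obtain C where C: "\<forall>R\<ge>1. (\<integral>y. indicator (?D \<inter> cball 0 \<rho>) y * \<bar>u (kscale R y)\<bar> \<partial>lborel) <= C * R powr \<beta>"
   by (elim exE)
  define c where "c i = (\<integral>y. indicator ?D y * (p i y * \<phi> y) \<partial>lborel)" for i
  have ip: "integrable lborel (%y. indicator ?D y * (p i y * \<phi> y))" for i
  proof -
   have c1: "continuous_on UNIV (%y. p i y * \<phi> y)" by (intro continuous_intros pc \<rho>(4))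
   have c2: "p i y * \<phi> y = 0" if "norm y > \<rho>" for y by (simp only: \<rho>(2)[OF that] mult_zero_right)
   show ?thesis using integrable_compact_support[OF c1 c2 half_domain_borel[of k]] by simp
  qed
  \<comment> \<open>The coefficients are shifted by two places: multiplying by R^2 removes the
    factor that the rescaled adjoint operator carries.\<close>
  have bound: "\<bar>\<Sum>i\<le>m + 2. (if i < 2 then 0 else c (i - 2)) * R ^ i\<bar> <= (B * C) * R powr \<beta>" if R: "R \<ge> 1" for R
  proof -
   have R0: "R > 0" "1 / R > 0" using R by auto
   have tR: "test (%y. \<phi> (kscale (1 / R) y)) (%y. (1 / R)\<^sup>2 * \<psi> (kscale (1 / R) y))" by (rule test_kscale[OF R0(2) t])
   have \<phi>b: "\<phi> y = 0" if "xk k y = 0" for y using \<phi>D[of y] that by (auto simp: half_domain_xk)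
   have "\<phi> (kscale (1 / R) (vrefl k y)) = \<phi> (kscale (1 / R) y)" if "xk k y = 0" for y
    using that by (simp add: \<phi>b xk_kscale)
   then have "(\<integral>y. indicator ?D y * (u y * ((1 / R)\<^sup>2 * \<psi> (kscale (1 / R) y)) + lincomb L y * \<phi> (kscale (1 / R) y)) \<partial>lborel) = 0"
    using d tR unfolding dist_sol_def by blast
   moreover have lm: "lincomb L \<in> borel_measurable borel" by (rule polynomial_borel[OF polynomial_lincomb])
   ultimately have "R ^ (2 + 4 * CARD('n)) * (\<integral>y. indicator ?D (kscale R y) * (u (kscale R y) * ((1 / R)\<^sup>2 * \<psi> (kscale (1 / R) (kscale R y))) + lincomb L (kscale R y) * \<phi> (kscale (1 / R) (kscale R y))) \<partial>lborel) = 0"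
    using vol_scaling_integral(1)[OF vol_scaling_kscale[OF R0(1)], of "%y. indicator ?D y * (u y * ((1 / R)\<^sup>2 * \<psi> (kscale (1 / R) y)) + lincomb L y * \<phi> (kscale (1 / R) y))"]
    by simp
   then have "(\<integral>y. indicator ?D (kscale R y) * (u (kscale R y) * ((1 / R)\<^sup>2 * \<psi> (kscale (1 / R) (kscale R y))) + lincomb L (kscale R y) * \<phi> (kscale (1 / R) (kscale R y))) \<partial>lborel) = 0"
    using R0 by simp
   moreover have "indicator ?D (kscale R y) * (u (kscale R y) * ((1 / R)\<^sup>2 * \<psi> (kscale (1 / R) (kscale R y))) + lincomb L (kscale R y) * \<phi> (kscale (1 / R) (kscale R y)))
     = (1 / R)\<^sup>2 * (indicator ?D y * (u (kscale R y) * \<psi> y)) + (\<Sum>i\<le>m. R ^ i * (indicator ?D y * (p i y * \<phi> y)))" for y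
   proof -
    have i: "(indicator ?D (kscale R y) :: real) = indicator ?D y" using kscale_half_domain[OF R0(1), of y k] by (simp add: indicator_def)
    have kk: "kscale (1 / R) (kscale R y) = y" using R0 by (simp add: kscale_kscale)
    have ll: "lincomb L (kscale R y) = (\<Sum>i\<le>m. R ^ i * p i y)" unfolding Lp pk ..
    show ?thesis unfolding i kk ll
     by (cases "y \<in> ?D") (simp_all add: sum_distrib_right sum_distrib_left distrib_left mult_ac)
   qed
   ultimately have z: "(\<integral>y. (1 / R)\<^sup>2 * (indicator ?D y * (u (kscale R y) * \<psi> y)) + (\<Sum>i\<le>m. R ^ i * (indicator ?D y * (p i y * \<phi> y))) \<partial>lborel) = 0"
    by (simp only:)
   have iu0: "integrable lborel (%y. indicator (?D \<inter> cball 0 \<rho>) y * u (kscale R y))"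
    by (rule local_integrable_kscale[OF _ loc R0(1)]) simp
   have iu: "integrable lborel (%y. B * (indicator (?D \<inter> cball 0 \<rho>) y * \<bar>u (kscale R y)\<bar>))"
    using integrable_mult_right[OF integrable_abs[OF iu0], of B] by (simp add: abs_mult)
   have le: "\<bar>indicator ?D y * (u (kscale R y) * \<psi> y)\<bar> <= B * (indicator (?D \<inter> cball 0 \<rho>) y * \<bar>u (kscale R y)\<bar>)" for y
    using mult_left_mono[OF B[of y], of "indicator ?D y * \<bar>u (kscale R y)\<bar>"]
    by (simp add: abs_mult indicator_inter_arith mult_ac)
   have i1: "integrable lborel (%y. indicator ?D y * (u (kscale R y) * \<psi> y))"
    by (rule Bochner_Integration.integrable_bound[OF iu]) (auto intro!: AE_I2 order_trans[OF le abs_ge_self])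
   have "(1 / R)\<^sup>2 * (\<integral>y. indicator ?D y * (u (kscale R y) * \<psi> y) \<partial>lborel) + (\<Sum>i\<le>m. R ^ i * c i) = 0"
   proof -
    have "(\<integral>y. (1 / R)\<^sup>2 * f y + (\<Sum>i\<le>m. R ^ i * g i y) \<partial>lborel) = (1 / R)\<^sup>2 * (\<integral>y. f y \<partial>lborel) + (\<Sum>i\<le>m. R ^ i * (\<integral>y. g i y \<partial>lborel))"
     if "integrable lborel f" "!!i. integrable lborel (g i)" for f :: "'n kin => real" and g :: "nat => 'n kin => real"
     using that by simp
    from this[OF i1 ip] show ?thesis using z by (simp only: c_def)
   qed
   then have "(\<integral>y. indicator ?D y * (u (kscale R y) * \<psi> y) \<partial>lborel) = - (R\<^sup>2 * (\<Sum>i\<le>m. R ^ i * c i))"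
    using R0 by (simp add: field_simps eq_neg_iff_add_eq_0)
   also have "R\<^sup>2 * (\<Sum>i\<le>m. R ^ i * c i) = (\<Sum>i\<le>m + 2. (if i < 2 then 0 else c (i - 2)) * R ^ i)"
   proof -
    have "(\<Sum>i\<le>m + 2. (if i < 2 then 0 else c (i - 2)) * R ^ i) = (\<Sum>i\<in>{0..m + 2}. (if i < 2 then 0 else c (i - 2)) * R ^ i)"
     by (simp add: atMost_atLeast0)
    also have "\<dots> = (\<Sum>i\<in>{2..m + 2}. (if i < 2 then 0 else c (i - 2)) * R ^ i)"
     by (rule sum.mono_neutral_right) auto
    also have "\<dots> = (\<Sum>i\<in>{0..m}. c i * R ^ (i + 2))"
    proof -
     have sh: "sum g {2..m + 2} = (\<Sum>i=0..m. g (i + 2))" for g :: "nat => real"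
      using sum.shift_bounds_cl_nat_ivl[of g 0 2 m] by (simp only: add_0)
     show ?thesis unfolding sh by (rule sum.cong) auto
    qed
    also have "\<dots> = R\<^sup>2 * (\<Sum>i\<le>m. R ^ i * c i)" by (simp add: sum_distrib_left atMost_atLeast0 power_add power2_eq_square mult_ac)
    finally show ?thesis by simp
   qed
   finally have "\<bar>\<Sum>i\<le>m + 2. (if i < 2 then 0 else c (i - 2)) * R ^ i\<bar> = \<bar>\<integral>y. indicator ?D y * (u (kscale R y) * \<psi> y) \<partial>lborel\<bar>" by simp
   also have "\<dots> <= (\<integral>y. B * (indicator (?D \<inter> cball 0 \<rho>) y * \<bar>u (kscale R y)\<bar>) \<partial>lborel)"
    using integral_abs_bound[of lborel "%y. indicator ?D y * (u (kscale R y) * \<psi> y)"]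
     integral_mono[OF integrable_abs[OF i1] iu le] by linarith
   also have "\<dots> = B * (\<integral>y. indicator (?D \<inter> cball 0 \<rho>) y * \<bar>u (kscale R y)\<bar> \<partial>lborel)" by simp
   also have "\<dots> <= B * (C * R powr \<beta>)" by (rule mult_left_mono[OF C[rule_format, OF R] B1])
   finally show ?thesis by simp
  qed
  have "c j = 0"
   using polynomial_bounded_imp_zero[where c="%i. if i < 2 then 0 else c (i - 2)", OF bound, of "j + 2"] j by simp
  moreover have "c j \<noteq> 0"
  proof -
   \<comment> \<open>Multiplying by the sign at the centre makes the integrand nonnegative, so a
     vanishing integral would make a ball negligible.\<close>
   define s where "s = sgn (p j w)"
   have sp: "s * p j y > 0" if "dist y w < r" for y
   proof -
    have d: "\<bar>p j y - p j w\<bar> < \<bar>p j w\<bar> / 2" using r1(2)[of y] that by (simp add: r_def dist_real_def e_def)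
    show ?thesis
    proof (cases "p j w > 0")
     case True
     then have "p j y > 0" using d by linarith
     then show ?thesis using True by (simp add: s_def)
    next
     case False
     then have "p j w < 0" using nz by simp
     then have "p j y < 0" using d by linarith
     then show ?thesis using \<open>p j w < 0\<close> by (simp add: s_def)
    qed
   qed
   have nn: "0 <= indicator ?D y * (s * p j y * \<phi> y)" for y
    using sp[of y] \<phi>nn[of y] \<phi>0[of y] by (cases "dist y w < r") auto
   have int: "integrable lborel (%y. indicator ?D y * (s * p j y * \<phi> y))"
    using integrable_mult_right[OF ip[of j], of s] by (simp add: mult_ac)
   have "(\<integral>y. indicator ?D y * (s * p j y * \<phi> y) \<partial>lborel) \<noteq> 0"
   proof
    assume "(\<integral>y. indicator ?D y * (s * p j y * \<phi> y) \<partial>lborel) = 0"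
    then have "AE y in lborel. indicator ?D y * (s * p j y * \<phi> y) = 0"
     using integral_nonneg_eq_0_iff_AE[OF int] nn by simp
    then have "AE y in lborel. y \<notin> ball w r"
    proof eventually_elim
     case (elim y)
     show ?case
     proof
      assume "y \<in> ball w r"
      then have dy: "dist y w < r" by (simp add: dist_commute)
      have f: "\<phi> y > 0" by (rule \<phi>pos[OF dy])
      have "y \<in> ?D" by (rule \<phi>D) (use f in linarith)
      then have "indicator ?D y * (s * p j y * \<phi> y) = s * p j y * \<phi> y" by simp
      moreover have "s * p j y * \<phi> y > 0" by (rule mult_pos_pos[OF sp[OF dy] f])
      ultimately show False using elim by linarith
     qed
    qed
    then have "ball w r \<in> null_sets lborel" by (subst AE_iff_null_sets) auto
    then have "negligible (ball w r)" by (simp add: negligible_iff_null_sets null_sets_completionI)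
    then show False using open_not_negligible[of "ball w r"] r by simp
   qed
   moreover have "(\<integral>y. indicator ?D y * (s * p j y * \<phi> y) \<partial>lborel) = s * c j"
    unfolding c_def by (subst integral_mult_right_zero[symmetric]) (simp add: mult_ac)
   ultimately show ?thesis by simp
  qed
  ultimately show False by simp
 qed
 have "lincomb L w = (\<Sum>j\<le>m. if real j + 2 <= \<beta> then p j w else 0)"
  unfolding Lp using zero[OF _ _ w] by (intro sum.cong) auto
 also have "\<dots> = lincomb (filter (%(c, l). real (wsum l) + 2 <= \<beta>) L) w"
  using lincomb_filter_sum[OF m, where P="%j. real j + 2 <= \<beta>" and w=w] by (simp add: p_def cong: if_cong)
 finally show ?thesis .
qed

section \<open>Vanishing almost everywhere, and polynomials by successive coordinates\<close>

text \<open>The positive and the negative part define measures that agree on boxes, an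
  intersection-stable generator, so their densities agree almost everywhere.\<close>

lemma AE_zero_from_boxes:
 fixes h :: "'a::euclidean_space => real"
 assumes [measurable]: "h \<in> borel_measurable borel"
  and int: "!!a b. integrable lborel (%w. indicator (box a b) w * h w)"
  and zero: "!!a b. (\<integral>w. indicator (box a b) w * h w \<partial>lborel) = 0"
 shows "AE w in lborel. h w = 0"
proof -
 let ?P = "density lborel (%w. ennreal (max 0 (h w)))" and ?N = "density lborel (%w. ennreal (max 0 (- h w)))"
 have em: "emeasure ?P (box a b) = ennreal (\<integral>w. indicator (box a b) w * max 0 (h w) \<partial>lborel)"
  "emeasure ?N (box a b) = ennreal (\<integral>w. indicator (box a b) w * max 0 (- h w) \<partial>lborel)"
  "(\<integral>w. indicator (box a b) w * max 0 (h w) \<partial>lborel) = (\<integral>w. indicator (box a b) w * max 0 (- h w) \<partial>lborel)" for a b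
 proof -
  have i1: "integrable lborel (%w. indicator (box a b) w * max 0 (h w))"
   by (rule Bochner_Integration.integrable_bound[OF int[of a b]]) (auto simp: indicator_def intro!: AE_I2)
  have i2: "integrable lborel (%w. indicator (box a b) w * max 0 (- h w))"
   by (rule Bochner_Integration.integrable_bound[OF int[of a b]]) (auto simp: indicator_def intro!: AE_I2)
  have e: "max 0 (h w) * indicator (box a b) w = indicator (box a b) w * max 0 (h w)" for w by (rule mult.commute)
  show "emeasure ?P (box a b) = ennreal (\<integral>w. indicator (box a b) w * max 0 (h w) \<partial>lborel)"
   by (subst emeasure_density, simp, simp, subst nn_integral_eq_integral[OF i1, symmetric])
    (auto intro!: nn_integral_cong AE_I2 simp: indicator_def)
  show "emeasure ?N (box a b) = ennreal (\<integral>w. indicator (box a b) w * max 0 (- h w) \<partial>lborel)"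
   by (subst emeasure_density, simp, simp, subst nn_integral_eq_integral[OF i2, symmetric])
    (auto intro!: nn_integral_cong AE_I2 simp: indicator_def)
  have "(\<integral>w. indicator (box a b) w * max 0 (h w) - indicator (box a b) w * max 0 (- h w) \<partial>lborel) = (\<integral>w. indicator (box a b) w * h w \<partial>lborel)"
   by (intro Bochner_Integration.integral_cong) (auto simp: indicator_def)
  then show "(\<integral>w. indicator (box a b) w * max 0 (h w) \<partial>lborel) = (\<integral>w. indicator (box a b) w * max 0 (- h w) \<partial>lborel)"
   using i1 i2 zero[of a b] by simp
 qed
 have "?P = ?N"
 proof (rule measure_eqI_generator_eq)
  let ?E = "range (%(a, b). box a b :: 'a set)"
  show "Int_stable ?E" by (auto simp: Int_stable_def box_Int_box)
  show "?E \<subseteq> Pow UNIV" by auto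
  show "sets ?P = sigma_sets UNIV ?E" "sets ?N = sigma_sets UNIV ?E" by (simp_all add: borel_eq_box)
  let ?A = "%n::nat. box (- (real n *\<^sub>R One)) (real n *\<^sub>R One) :: 'a set"
  show "range ?A \<subseteq> ?E" by auto
  show "(\<Union>i. ?A i) = UNIV" by (rule UN_box_eq_UNIV)
  show "emeasure ?P (?A i) \<noteq> \<infinity>" for i unfolding em by simp
  show "emeasure ?P X = emeasure ?N X" if "X \<in> ?E" for X using that em by auto
 qed
 then have "AE w in lborel. ennreal (max 0 (h w)) = ennreal (max 0 (- h w))"
  by (intro sigma_finite_measure.density_unique[OF sigma_finite_lborel]) simp_all
 then show ?thesis by eventually_elim (auto simp: max_def split: if_splits)
qed

text \<open>Projection to the coordinate subspace spanned by \<open>A\<close>. It allows a function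
  to be shown polynomial on growing subspaces, one direction at a time.\<close>

definition trunc :: "'a::euclidean_space set => 'a => 'a" where
 "trunc A w = (\<Sum>b\<in>A. (w \<bullet> b) *\<^sub>R b)"

lemma polynomial_trunc:
 assumes "real_polynomial_function q" shows "real_polynomial_function (%w. q (trunc A w))"
proof (rule polynomial_compose[OF assms])
 have "bounded_linear (trunc A)"
  unfolding trunc_def[abs_def] by (intro bounded_linear_sum bounded_linear_scaleR_left[THEN bounded_linear_compose] bounded_linear_inner_left)
 then show "polynomial_function (trunc A)" by (rule polynomial_function_bounded_linear)
qed

lemma polynomial_trunc_insert:
 fixes u :: "'a::euclidean_space => real"
 assumes b: "b \<in> Basis" "b \<notin> A" "finite A" and Q: "real_polynomial_function Q" "!!w. u (trunc A w) = Q w"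
  and p: "real_polynomial_function p"
  and der: "!!w s. ((%s. u (trunc A w + s *\<^sub>R b)) has_real_derivative p (trunc A w + s *\<^sub>R b)) (at s)"
 shows "\<exists>Q'. real_polynomial_function Q' \<and> (\<forall>w. u (trunc (insert b A) w) = Q' w)"
proof -
 obtain q where q: "real_polynomial_function q" "!!w. ((%s. q (w + s *\<^sub>R b)) has_real_derivative p w) (at 0)"
  using polynomial_antiderivative[OF p b(1)] by metis
 have q': "((%s. q (w + s *\<^sub>R b)) has_real_derivative p (w + s *\<^sub>R b)) (at s)" for w s
 proof -
  have "((%h. q (w + (h + s) *\<^sub>R b)) has_real_derivative p (w + s *\<^sub>R b)) (at 0)"
   using q(2)[of "w + s *\<^sub>R b"] by (simp add: algebra_simps)
  then show ?thesis using DERIV_shift[of "%h. q (w + h *\<^sub>R b)" _ 0 s] by simp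
 qed
 have "u (trunc (insert b A) w) = Q w + q (trunc (insert b A) w) - q (trunc A w)" for w
 proof -
  have "((%s. u (trunc A w + s *\<^sub>R b) - q (trunc A w + s *\<^sub>R b)) has_real_derivative 0) (at s)" for s
   using DERIV_diff[OF der[of w s] q'[of "trunc A w" s]] by simp
  from DERIV_isconst_all[OF allI[OF this], of "w \<bullet> b" 0]
  have "u (trunc A w + (w \<bullet> b) *\<^sub>R b) - q (trunc A w + (w \<bullet> b) *\<^sub>R b) = u (trunc A w) - q (trunc A w)" by simp
  moreover have "trunc (insert b A) w = trunc A w + (w \<bullet> b) *\<^sub>R b" using b by (simp add: trunc_def)
  ultimately show ?thesis using Q(2)[of w] by simp
 qed
 then show ?thesis
  using Q(1) q(1) by (intro exI[of _ "%w. Q w + q (trunc (insert b A) w) - q (trunc A w)"])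
   (auto intro!: polynomial_intros polynomial_trunc)
qed

section \<open>The backward Kolmogorov kernel\<close>

text \<open>The exponent of the Kolmogorov kernel seen from the origin at the past time t = - s: it
  equals |v|^2 / s + 3 x.v / s^2 + 3 |x|^2 / s^3, and s^(- 2 n) exp (- \<open>kq\<close>) is
  annihilated by the adjoint operator for t < 0. Below, \<open>kg\<close> is its gradient,
  \<open>kvi\<close> a velocity component of that gradient, and \<open>kvig\<close> the gradient of
  \<open>kvi\<close>.\<close>

definition kq :: "'n::finite kin => real" where
 "kq w = (snd (snd w) \<bullet> snd (snd w)) * (1 / (- fst w)) + (3 * (fst (snd w) \<bullet> snd (snd w))) * (1 / (fst w)\<^sup>2)
   + (3 * (fst (snd w) \<bullet> fst (snd w))) * (1 / (- fst w) ^ 3)"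

definition kg :: "'n::finite kin => 'n kin" where
 "kg w = ((snd (snd w) \<bullet> snd (snd w)) / (fst w)\<^sup>2 - 6 * (fst (snd w) \<bullet> snd (snd w)) / fst w ^ 3
   + 9 * (fst (snd w) \<bullet> fst (snd w)) / fst w ^ 4,
   (3 / (fst w)\<^sup>2) *\<^sub>R snd (snd w) + (6 / (- fst w) ^ 3) *\<^sub>R fst (snd w),
   (2 / (- fst w)) *\<^sub>R snd (snd w) + (3 / (fst w)\<^sup>2) *\<^sub>R fst (snd w))"

definition kvi :: "'n::finite => 'n kin => real" where
 "kvi i w = snd (snd w) $ i * (2 / (- fst w)) + fst (snd w) $ i * (3 / (fst w)\<^sup>2)"

definition kvig :: "'n::finite => 'n kin => 'n kin" where
 "kvig i w = (2 * snd (snd w) $ i / (fst w)\<^sup>2 - 6 * fst (snd w) $ i / fst w ^ 3,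
   axis i (3 / (fst w)\<^sup>2), axis i (2 / (- fst w)))"

lemma GDERIV_fst_compose:
 assumes "DERIV f (fst w) :> d"
 shows "GDERIV (%w::'n::finite kin. f (fst w)) w :> (d, 0, 0)"
proof -
 have e: "fst = (%h::'n kin. h \<bullet> (1, 0, 0))" by (auto simp: fun_eq_iff inner_prod_def)
 have "GDERIV (fst :: 'n kin => real) w :> (1, 0, 0)" unfolding gderiv_def
  by (subst e) (intro bounded_linear_imp_has_derivative bounded_linear_inner_left)
 from GDERIV_DERIV_compose[OF this assms] show ?thesis by simp
qed

lemma GDERIV_quadratic:
 "GDERIV (%w::'n::finite kin. snd (snd w) \<bullet> snd (snd w)) w :> (0, 0, 2 *\<^sub>R snd (snd w))"
 "GDERIV (%w::'n::finite kin. fst (snd w) \<bullet> snd (snd w)) w :> (0, snd (snd w), fst (snd w))"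
 "GDERIV (%w::'n::finite kin. fst (snd w) \<bullet> fst (snd w)) w :> (0, 2 *\<^sub>R fst (snd w), 0)"
 unfolding gderiv_def
 by (auto intro!: derivative_eq_intros simp: inner_prod_def inner_commute)

lemma GDERIV_coord:
 "GDERIV (%w::'n::finite kin. snd (snd w) $ i) w :> (0, 0, axis i 1)"
 "GDERIV (%w::'n::finite kin. fst (snd w) $ i) w :> (0, axis i 1, 0)"
proof -
 have e: "(%h::'n kin. snd (snd h) $ i) = (%h. h \<bullet> (0, 0, axis i 1))" "(%h::'n kin. fst (snd h) $ i) = (%h. h \<bullet> (0, axis i 1, 0))"
  by (auto simp: fun_eq_iff inner_prod_def inner_axis)
 show "GDERIV (%w::'n::finite kin. snd (snd w) $ i) w :> (0, 0, axis i 1)"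
  "GDERIV (%w::'n::finite kin. fst (snd w) $ i) w :> (0, axis i 1, 0)"
  unfolding gderiv_def e by (intro bounded_linear_imp_has_derivative bounded_linear_inner_left)+
qed

lemma DERIV_inverse_powers:
 fixes s :: real assumes "s < 0"
 shows "DERIV (%s. c / (- s)) s :> c / s\<^sup>2" "DERIV (%s. c / s\<^sup>2) s :> - 2 * c / s ^ 3" "DERIV (%s. c / (- s) ^ 3) s :> 3 * c / s ^ 4"
 using assms by (auto intro!: derivative_eq_intros simp: field_simps eval_nat_numeral)

lemma GDERIV_cong: "GDERIV f w :> g ==> g = g' ==> GDERIV f w :> g'"
 by simp

lemma GDERIV_kq:
 assumes w: "fst w < 0" shows "GDERIV kq w :> kg (w :: 'n::finite kin)"
proof -
 note inv = DERIV_inverse_powers[OF w, THEN GDERIV_fst_compose]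
 have c: "GDERIV (%w. 3 * f w) w :> 3 *\<^sub>R g" if "GDERIV f w :> g" for f :: "'n kin => real" and g
  using GDERIV_mult[OF GDERIV_const[of 3] that] by simp
 show ?thesis
  unfolding kq_def[abs_def]
  by (rule GDERIV_cong[OF GDERIV_add[OF GDERIV_add[OF GDERIV_mult[OF GDERIV_quadratic(1) inv(1)]
      GDERIV_mult[OF c[OF GDERIV_quadratic(2)] inv(2)]] GDERIV_mult[OF c[OF GDERIV_quadratic(3)] inv(3)]]])
   (simp add: kg_def algebra_simps)
qed

lemma GDERIV_kvi:
 assumes w: "fst w < 0" shows "GDERIV (kvi i) w :> kvig i (w :: 'n::finite kin)"
proof -
 note inv = DERIV_inverse_powers[OF w, THEN GDERIV_fst_compose]
 show ?thesis
  unfolding kvi_def[abs_def]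
  by (rule GDERIV_cong[OF GDERIV_add[OF GDERIV_mult[OF GDERIV_coord(1) inv(1)] GDERIV_mult[OF GDERIV_coord(2) inv(2)]]])
   (simp add: kvig_def algebra_simps vec_eq_iff axis_def)
qed

lemma kern_continuous:
 "continuous_on {w. fst w < 0} (kq :: 'n::finite kin => real)" "continuous_on {w. fst w < 0} (kg :: 'n kin => _)"
 "continuous_on {w. fst w < 0} (kvi (i::'n))" "continuous_on {w. fst w < 0} (kvig (i::'n))"
proof -
 have a: "continuous_on S (%w. axis i (f w))" if "continuous_on S f" for S :: "'n kin set" and f :: "_ => real" and i :: 'n
  unfolding axis_def
 proof (rule continuous_on_vec_lambda)
  fix j
  show "continuous_on S (%w. if j = i then f w else 0)" using that by (cases "j = i") simp_all
 qed
 let ?S = "{w::'n kin. fst w < 0}"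
 have t: "continuous_on ?S (%w. fst w)" by (rule continuous_on_fst[OF continuous_on_id])
 have x: "continuous_on ?S (%w. fst (snd w))" by (rule continuous_on_fst[OF continuous_on_snd[OF continuous_on_id]])
 have v: "continuous_on ?S (%w. snd (snd w))" by (rule continuous_on_snd[OF continuous_on_snd[OF continuous_on_id]])
 have d: "continuous_on ?S (%w. f w / fst w ^ j)" if "continuous_on ?S f" for f :: "'n kin => real" and j
  by (rule continuous_on_divide[OF that continuous_on_power[OF t]]) auto
 have d': "continuous_on ?S (%w. f w / (- fst w) ^ j)" if "continuous_on ?S f" for f :: "'n kin => real" and j
  by (rule continuous_on_divide[OF that continuous_on_power[OF continuous_on_minus[OF t]]]) auto
 have d1: "continuous_on ?S (%w. f w / (- fst w))" if "continuous_on ?S f" for f :: "'n kin => real"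
  using d'[OF that, of 1] by simp
 note rules = continuous_on_add continuous_on_diff continuous_on_mult continuous_on_scaleR continuous_on_Pair
  continuous_on_inner[OF v v] continuous_on_inner[OF x v] continuous_on_inner[OF x x] d d' d1 a
  continuous_on_component[OF x] continuous_on_component[OF v] continuous_on_const x v
 show "continuous_on ?S kq" unfolding kq_def[abs_def] by (intro rules)
 show "continuous_on ?S kg" unfolding kg_def[abs_def] by (intro rules)
 show "continuous_on ?S (kvi i)" unfolding kvi_def[abs_def] by (intro rules)
 show "continuous_on ?S (kvig i)" unfolding kvig_def[abs_def] by (intro rules)
qed

text \<open>The kernel formulas are regular only for t < 0. A time factor that vanishes beyond - T
  makes everything zero on an overlapping open set, so the singular time 0 never matters.\<close>

lemma glue_continuous:
 fixes f :: "'n::finite kin => 'b::real_normed_vector"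
 assumes "continuous_on {w. fst w < 0} f" "T > 0" "!!w. fst w > - T ==> f w = 0"
 shows "continuous_on UNIV f"
proof -
 have "continuous_on {w. fst w > - T} f"
  by (rule continuous_on_eq[OF continuous_on_const[of _ 0]]) (simp add: assms(3))
 moreover have "open {w::'n kin. fst w < 0}" "open {w::'n kin. fst w > - T}"
  by (intro open_Collect_less continuous_intros)+
 ultimately have "continuous_on ({w. fst w < 0} \<union> {w. fst w > - T}) f"
  using assms(1) by (intro continuous_on_open_Un)
 moreover have "{w::'n kin. fst w < 0} \<union> {w. fst w > - T} = UNIV" using assms(2) by auto
 ultimately show ?thesis by simp
qed

lemma glue_GDERIV:
 fixes f :: "'n::finite kin => real"
 assumes "fst w < 0 ==> GDERIV f w :> g w" "T > 0" "!!w. fst w > - T ==> f w = 0" "!!w. fst w > - T ==> g w = 0"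
 shows "GDERIV f w :> g w"
proof (cases "fst w < 0")
 case False
 then have w: "fst w > - T" using assms(2) by simp
 have "((%_. 0) has_derivative (%h. h \<bullet> g w)) (at w)" using assms(4)[OF w] by simp
 then show ?thesis
  unfolding gderiv_def
 proof (rule has_derivative_transform_within_open)
  show "open {w::'n kin. fst w > - T}" by (intro open_Collect_less continuous_intros)
 qed (use w assms(3) in simp_all)
qed (rule assms(1))

text \<open>With x = s y the numerator is |v|^2 + 3 v.y + 3 |y|^2, a positive definite form because
  its discriminant 9 - 12 is negative.\<close>

lemma kq_lower:
 fixes w :: "'n::finite kin"
 assumes w: "fst w < 0"
 shows "(norm (snd (snd w)))\<^sup>2 / (8 * (- fst w)) + (norm (fst (snd w)))\<^sup>2 / (8 * (- fst w) ^ 3) <= kq w"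
proof -
 define s where "s = - fst w"
 have s: "s > 0" using w by (simp add: s_def)
 define v where "v = snd (snd w)"
 define y where "y = (1 / s) *\<^sub>R fst (snd w)"
 have x: "fst (snd w) = s *\<^sub>R y" using s by (simp add: y_def)
 have e: "kq w = ((v \<bullet> v) + 3 * (v \<bullet> y) + 3 * (y \<bullet> y)) / s"
  unfolding kq_def x v_def[symmetric] using s by (simp add: s_def[symmetric] field_simps eval_nat_numeral inner_commute)
   (simp add: s_def field_simps)
 \<comment> \<open>After removing 1/8 of both squares, completing the square in v needs 12/7 and
   leaves 23/8 - 18/7 = 17/56 > 0.\<close>
 have "0 <= 7/8 * ((v + (12/7) *\<^sub>R y) \<bullet> (v + (12/7) *\<^sub>R y)) + (23/8 - 18/7) * (y \<bullet> y)" by simp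
 also have "\<dots> = ((v \<bullet> v) + 3 * (v \<bullet> y) + 3 * (y \<bullet> y)) - ((v \<bullet> v) + (y \<bullet> y)) / 8"
  by (simp add: inner_add_left inner_add_right inner_commute field_simps)
 finally have "((v \<bullet> v) + (y \<bullet> y)) / 8 / s <= kq w" unfolding e using s by (intro divide_right_mono) auto
 moreover have "(norm (snd (snd w)))\<^sup>2 / (8 * (- fst w)) + (norm (fst (snd w)))\<^sup>2 / (8 * (- fst w) ^ 3) = ((v \<bullet> v) + (y \<bullet> y)) / 8 / s"
  unfolding x v_def[symmetric] s_def[symmetric] using s by (simp add: dot_square_norm field_simps eval_nat_numeral)
 ultimately show ?thesis by simp
qed

lemma kq_nonneg: "fst w < 0 ==> 0 <= kq w"
proof -
 assume w: "fst w < 0"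
 have "0 <= (norm (snd (snd w)))\<^sup>2 / (8 * (- fst w)) + (norm (fst (snd w)))\<^sup>2 / (8 * (- fst w) ^ 3)"
  using w by (intro add_nonneg_nonneg divide_nonneg_pos mult_pos_pos zero_less_power zero_le_power2) simp_all
 then show ?thesis using kq_lower[OF w] by linarith
qed

text \<open>On a bounded interval of past times the exponent controls the full norm. So cutting off
  in \<open>kq\<close> has compact support, and exp (- \<open>kq\<close>) beats every power of the
  norm.\<close>

lemma norm_le_kq:
 fixes w :: "'n::finite kin"
 assumes T: "1 <= T" "- T <= fst w" "fst w < 0"
 shows "1 + norm w <= 20 * T ^ 3 * (1 + kq w)"
proof -
 have p: "0 < 8 * (- fst w)" "0 < 8 * (- fst w) ^ 3" using T by (intro mult_pos_pos zero_less_power; simp)+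
 have a: "(norm (snd (snd w)))\<^sup>2 / (8 * (- fst w)) <= kq w" "(norm (fst (snd w)))\<^sup>2 / (8 * (- fst w) ^ 3) <= kq w"
 proof -
  have "0 <= (norm (snd (snd w)))\<^sup>2 / (8 * (- fst w))" "0 <= (norm (fst (snd w)))\<^sup>2 / (8 * (- fst w) ^ 3)"
   by (intro divide_nonneg_pos p zero_le_power2)+
  then show "(norm (snd (snd w)))\<^sup>2 / (8 * (- fst w)) <= kq w" "(norm (fst (snd w)))\<^sup>2 / (8 * (- fst w) ^ 3) <= kq w"
   using kq_lower[OF T(3)] by linarith+
 qed
 have q: "0 <= kq w" by (rule kq_nonneg[OF T(3)])
 have T3: "T <= T ^ 3" "1 <= T ^ 3" using power_increasing[of 1 3 T] T(1) by auto
 have "(norm (snd (snd w)))\<^sup>2 <= kq w * (8 * (- fst w))" using a(1) p(1) by (simp only: pos_divide_le_eq)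
 also have "\<dots> <= kq w * (8 * T ^ 3)" using T T3 q by (intro mult_left_mono) auto
 finally have v: "(norm (snd (snd w)))\<^sup>2 <= 8 * T ^ 3 * kq w" by (simp add: mult_ac)
 have "(norm (fst (snd w)))\<^sup>2 <= kq w * (8 * (- fst w) ^ 3)" using a(2) p(2) by (simp only: pos_divide_le_eq)
 also have "\<dots> <= kq w * (8 * T ^ 3)" using T q by (intro mult_left_mono power_mono) auto
 finally have x: "(norm (fst (snd w)))\<^sup>2 <= 8 * T ^ 3 * kq w" by (simp add: mult_ac)
 have sq: "a <= 1 + a\<^sup>2" for a :: real
 proof -
  have "1 + a\<^sup>2 - a = ((a - 1)\<^sup>2 + a\<^sup>2 + 1) / 2" by (simp add: power2_diff field_simps)
  moreover have "((a - 1)\<^sup>2 + a\<^sup>2 + 1) / 2 \<ge> 0" by simp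
  ultimately show ?thesis by linarith
 qed
 have "norm w <= \<bar>fst w\<bar> + norm (fst (snd w)) + norm (snd (snd w))"
  using norm_kin_le[of "fst w" "fst (snd w)" "snd (snd w)"] by simp
 also have "\<dots> <= T + (1 + 8 * T ^ 3 * kq w) + (1 + 8 * T ^ 3 * kq w)"
  using sq[of "norm (fst (snd w))"] sq[of "norm (snd (snd w))"] v x T by linarith
 finally have 0: "norm w <= T + (1 + 8 * T ^ 3 * kq w) + (1 + 8 * T ^ 3 * kq w)" .
 have 1: "1 + norm w <= T + 3 + 16 * (T ^ 3 * kq w)" using 0 by (simp add: algebra_simps)
 have 2: "20 * T ^ 3 * (1 + kq w) = 20 * T ^ 3 + 20 * (T ^ 3 * kq w)" by (simp add: algebra_simps)
 have "0 <= T ^ 3 * kq w" using q T by simp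
 then show ?thesis using 1 2 T3 by linarith
qed

lemma exp_power_bound:
 fixes s :: real assumes s: "s \<ge> 0"
 shows "(1 + s) ^ M * exp (- s) <= real M ^ M"
proof (cases "M = 0")
 case True then show ?thesis using s by simp
next
 case False
 have "1 + s <= real M * (1 + s / real M)" using False s by (simp add: field_simps)
 then have "(1 + s) ^ M <= (real M * (1 + s / real M)) ^ M" using s by (intro power_mono) auto
 also have "\<dots> <= real M ^ M * exp s"
  unfolding power_mult_distrib using exp_ge_one_plus_x_over_n_power_n[of M s] False s
  by (intro mult_left_mono) auto
 finally have "(1 + s) ^ M * exp (- s) <= real M ^ M * exp s * exp (- s)" by (intro mult_right_mono) auto
 also have "\<dots> = real M ^ M" by (simp add: exp_minus)
 finally show ?thesis .
qed

lemma kern_norms: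
 fixes w :: "'n::finite kin"
 assumes T: "0 < T1" "fst w <= - T1"
 shows "norm (kg w) <= (30 / T1\<^sup>2 + 30 / T1 ^ 3 + 30 / T1 ^ 4 + 30 / T1) * (1 + norm w)\<^sup>2"
  and "(\<Sum>i\<in>UNIV. (kvi i w)\<^sup>2) = (norm (snd (snd (kg w))))\<^sup>2"
  and "snd (snd (kg w)) $ i = kvi i w"
proof -
 show kv: "snd (snd (kg w)) $ i = kvi i w" for i by (simp add: kg_def kvi_def mult.commute)
 show "(\<Sum>i\<in>UNIV. (kvi i w)\<^sup>2) = (norm (snd (snd (kg w))))\<^sup>2"
  unfolding power2_norm_eq_inner inner_vec_def kv by (simp add: power2_eq_square)
 define m where "m = 1 + norm w"
 have m: "1 <= m" by (simp add: m_def)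
 define v x t where "v = snd (snd w)" and "x = fst (snd w)" and "t = - fst w"
 have n: "norm v <= m" "norm x <= m" using norm_kin_ge[of w] by (simp_all add: m_def v_def x_def)
 have m2: "m <= m\<^sup>2" using m by (simp add: power2_eq_square)
 have t: "T1 <= t" "0 < t" using T by (auto simp: t_def)
 have ft: "fst w = - t" by (simp add: t_def)
 have q: "\<bar>v \<bullet> v\<bar> <= m\<^sup>2" "\<bar>x \<bullet> v\<bar> <= m\<^sup>2" "\<bar>x \<bullet> x\<bar> <= m\<^sup>2"
 proof -
  have "\<bar>a \<bullet> b\<bar> <= m * m" if "norm a <= m" "norm b <= m" for a b :: "real^'n"
   by (rule order_trans[OF Cauchy_Schwarz_ineq2 mult_mono]) (use that m in simp_all)
  then show "\<bar>v \<bullet> v\<bar> <= m\<^sup>2" "\<bar>x \<bullet> v\<bar> <= m\<^sup>2" "\<bar>x \<bullet> x\<bar> <= m\<^sup>2"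
   unfolding power2_eq_square using n by blast+
 qed
 have d: "\<bar>a\<bar> <= K * m\<^sup>2 ==> 0 <= K ==> \<bar>a\<bar> / t ^ j <= K * m\<^sup>2 / T1 ^ j" for a K :: real and j
  using t T m by (intro frac_le power_mono) auto
 have 1: "\<bar>fst (kg w)\<bar> <= 9 * m\<^sup>2 / T1\<^sup>2 + 9 * m\<^sup>2 / T1 ^ 3 + 9 * m\<^sup>2 / T1 ^ 4"
 proof -
  have e: "fst (kg w) = (v \<bullet> v) / t ^ 2 + 6 * (x \<bullet> v) / t ^ 3 + 9 * (x \<bullet> x) / t ^ 4"
   by (simp add: kg_def ft v_def x_def)
  have "\<bar>fst (kg w)\<bar> <= \<bar>v \<bullet> v\<bar> / t ^ 2 + \<bar>6 * (x \<bullet> v)\<bar> / t ^ 3 + \<bar>9 * (x \<bullet> x)\<bar> / t ^ 4"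
   unfolding e using t by (intro order_trans[OF abs_triangle_ineq] add_mono) (auto simp: abs_divide abs_mult)
  moreover have "\<bar>v \<bullet> v\<bar> / t ^ 2 <= 9 * m\<^sup>2 / T1 ^ 2" by (rule d) (use q m zero_le_power2[of m] in linarith, simp)
  moreover have "\<bar>6 * (x \<bullet> v)\<bar> / t ^ 3 <= 9 * m\<^sup>2 / T1 ^ 3" by (rule d) (use q m zero_le_power2[of m] in \<open>simp add: abs_mult\<close>, simp)
  moreover have "\<bar>9 * (x \<bullet> x)\<bar> / t ^ 4 <= 9 * m\<^sup>2 / T1 ^ 4" by (rule d) (use q in \<open>simp add: abs_mult\<close>, simp)
  ultimately show ?thesis by linarith
 qed
 have 2: "norm (fst (snd (kg w))) <= 9 * m\<^sup>2 / T1\<^sup>2 + 9 * m\<^sup>2 / T1 ^ 3"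
 proof -
  have e: "fst (snd (kg w)) = (3 / t\<^sup>2) *\<^sub>R v + (6 / t ^ 3) *\<^sub>R x" by (simp add: kg_def ft v_def x_def)
  have "norm (fst (snd (kg w))) <= norm ((3 / t\<^sup>2) *\<^sub>R v) + norm ((6 / t ^ 3) *\<^sub>R x)" unfolding e by (rule norm_triangle_ineq)
  also have "\<dots> = \<bar>3 * norm v\<bar> / t ^ 2 + \<bar>6 * norm x\<bar> / t ^ 3" using t by (simp add: abs_mult)
  also have "\<dots> <= 9 * m\<^sup>2 / T1 ^ 2 + 9 * m\<^sup>2 / T1 ^ 3"
   using n m2 m by (intro add_mono d) (auto simp: abs_mult)
  finally show ?thesis .
 qed
 have 3: "norm (snd (snd (kg w))) <= 9 * m\<^sup>2 / T1 + 9 * m\<^sup>2 / T1\<^sup>2"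
 proof -
  have e: "snd (snd (kg w)) = (2 / t) *\<^sub>R v + (3 / t\<^sup>2) *\<^sub>R x" by (simp add: kg_def ft v_def x_def)
  have "norm (snd (snd (kg w))) <= norm ((2 / t) *\<^sub>R v) + norm ((3 / t\<^sup>2) *\<^sub>R x)" unfolding e by (rule norm_triangle_ineq)
  also have "\<dots> = \<bar>2 * norm v\<bar> / t ^ 1 + \<bar>3 * norm x\<bar> / t ^ 2" using t by (simp add: abs_mult)
  also have "\<dots> <= 9 * m\<^sup>2 / T1 ^ 1 + 9 * m\<^sup>2 / T1 ^ 2"
   using n m2 m by (intro add_mono d) (auto simp: abs_mult)
  finally show ?thesis by simp
 qed
 have "norm (kg w) <= \<bar>fst (kg w)\<bar> + norm (fst (snd (kg w))) + norm (snd (snd (kg w)))"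
  using norm_kin_le[of "fst (kg w)" "fst (snd (kg w))" "snd (snd (kg w))"] by simp
 also have "\<dots> <= 30 * m\<^sup>2 / T1\<^sup>2 + 30 * m\<^sup>2 / T1 ^ 3 + 30 * m\<^sup>2 / T1 ^ 4 + 30 * m\<^sup>2 / T1"
 proof -
  have "0 <= m\<^sup>2 / T1\<^sup>2" "0 <= m\<^sup>2 / T1 ^ 3" "0 <= m\<^sup>2 / T1 ^ 4" "0 <= m\<^sup>2 / T1" using T by auto
  then show ?thesis using 1 2 3 unfolding times_divide_eq_right[symmetric] by linarith
 qed
 also have "\<dots> = (30 / T1\<^sup>2 + 30 / T1 ^ 3 + 30 / T1 ^ 4 + 30 / T1) * m\<^sup>2" by (simp add: algebra_simps)
 finally show "norm (kg w) <= (30 / T1\<^sup>2 + 30 / T1 ^ 3 + 30 / T1 ^ 4 + 30 / T1) * (1 + norm w)\<^sup>2"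
  by (simp only: m_def)
qed

lemma kern_GDERIV:
 fixes \<gamma> \<gamma>' E E' :: "real => real"
 assumes \<gamma>: "!!t. DERIV \<gamma> t :> \<gamma>' t" "continuous_on UNIV \<gamma>'" and E: "!!s. DERIV E s :> E' s" "continuous_on UNIV E'"
  and T: "T > 0" "!!t. t > - T ==> \<gamma> t = 0" "!!t. t > - T ==> \<gamma>' t = 0"
 shows "GDERIV (%w::'n::finite kin. \<gamma> (fst w) * E (kq w)) w :> (\<gamma>' (fst w) * E (kq w)) *\<^sub>R (1, 0, 0) + (\<gamma> (fst w) * E' (kq w)) *\<^sub>R kg w"
  and "continuous_on UNIV (%w::'n kin. (\<gamma>' (fst w) * E (kq w)) *\<^sub>R (1, 0, 0) + (\<gamma> (fst w) * E' (kq w)) *\<^sub>R kg w)"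
proof -
 have cE: "continuous_on UNIV E" by (rule DERIV_continuous_on[OF has_field_derivative_at_within[OF E(1)]])
 have c\<gamma>: "continuous_on UNIV \<gamma>" by (rule DERIV_continuous_on[OF has_field_derivative_at_within[OF \<gamma>(1)]])
 show "GDERIV (%w::'n::finite kin. \<gamma> (fst w) * E (kq w)) w :> (\<gamma>' (fst w) * E (kq w)) *\<^sub>R (1, 0, 0) + (\<gamma> (fst w) * E' (kq w)) *\<^sub>R kg w"
 proof (rule glue_GDERIV[OF _ T(1)])
  assume w: "fst w < 0"
  show "GDERIV (%w::'n::finite kin. \<gamma> (fst w) * E (kq w)) w :> (\<gamma>' (fst w) * E (kq w)) *\<^sub>R (1, 0, 0) + (\<gamma> (fst w) * E' (kq w)) *\<^sub>R kg w"
   by (rule GDERIV_cong[OF GDERIV_mult[OF GDERIV_fst_compose[OF \<gamma>(1)] GDERIV_DERIV_compose[OF GDERIV_kq[OF w] E(1)]]])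
    (simp add: algebra_simps)
 qed (simp_all add: T zero_prod_def[symmetric])
 show "continuous_on UNIV (%w::'n kin. (\<gamma>' (fst w) * E (kq w)) *\<^sub>R (1, 0, 0) + (\<gamma> (fst w) * E' (kq w)) *\<^sub>R kg w)"
 proof (rule glue_continuous[OF _ T(1)])
  show "continuous_on {w::'n kin. fst w < 0} (%w. (\<gamma>' (fst w) * E (kq w)) *\<^sub>R (1, 0, 0) + (\<gamma> (fst w) * E' (kq w)) *\<^sub>R kg w)"
   by (intro continuous_intros kern_continuous continuous_on_compose2[OF cE kern_continuous(1)] continuous_on_compose2[OF E(2) kern_continuous(1)]
    continuous_on_compose2[OF \<gamma>(2)] continuous_on_compose2[OF c\<gamma>]) auto
 qed (simp add: T zero_prod_def[symmetric])
qed

text \<open>For E composed with \<open>kq\<close> everything rests on two identities: time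
  derivative plus transport of \<open>kq\<close> equals the squared velocity gradient, and the
  velocity Laplacian of \<open>kq\<close> is 2 n / s. The choice E = exp (- q) kills E' + E'', but
  has no compact support, hence the general E.\<close>

lemma kern_test:
 fixes \<gamma> \<gamma>' E E' E'' :: "real => real"
 assumes \<gamma>: "!!t. DERIV \<gamma> t :> \<gamma>' t" "continuous_on UNIV \<gamma>'"
  and E: "!!s. DERIV E s :> E' s" "!!s. DERIV E' s :> E'' s" "continuous_on UNIV E''"
  and T: "T > 0" "!!t. t > - T ==> \<gamma> t = 0" "!!t. t > - T ==> \<gamma>' t = 0"
  and T2: "1 <= T2" "!!t. t < - T2 ==> \<gamma> t = 0"
  and A: "!!s. s \<ge> A ==> E s = 0" "!!s. s \<ge> A ==> E' s = 0"
 shows "test (%w::'n::finite kin. \<gamma> (fst w) * E (kq w)) (%w. \<gamma>' (fst w) * E (kq w)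
   + \<gamma> (fst w) * (E' (kq w) * (2 * CARD('n) / (- fst w)) + (norm (snd (snd (kg w))))\<^sup>2 * (E' (kq w) + E'' (kq w))))"
proof -
 have cE': "continuous_on UNIV E'" by (rule DERIV_continuous_on[OF has_field_derivative_at_within[OF E(2)]])
 have c\<gamma>: "continuous_on UNIV \<gamma>" by (rule DERIV_continuous_on[OF has_field_derivative_at_within[OF \<gamma>(1)]])
 have out: "\<gamma> (fst w) = 0 \<or> kq w \<ge> A" if "norm w > 20 * T2 ^ 3 * (1 + \<bar>A\<bar>)" for w :: "'n kin"
 proof (rule ccontr)
  assume n: "\<not> ?thesis"
  then have t: "fst w <= - T" "- T2 <= fst w" using T(2)[of "fst w"] T2(2)[of "fst w"] by force+
  have "1 + norm w <= 20 * T2 ^ 3 * (1 + kq w)" using t T by (intro norm_le_kq T2) auto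
  also have "\<dots> <= 20 * T2 ^ 3 * (1 + \<bar>A\<bar>)" using n T2 by (intro mult_left_mono) auto
  finally show False using that by linarith
 qed
 let ?G = "%w::'n kin. (\<gamma>' (fst w) * E (kq w)) *\<^sub>R (1, 0, 0) + (\<gamma> (fst w) * E' (kq w)) *\<^sub>R kg w"
 note g1 = kern_GDERIV[OF \<gamma> E(1) cE' T]
 have C1: "C1c_with_gradient (%w::'n kin. \<gamma> (fst w) * E (kq w)) ?G"
 proof (rule C1c_intro_bounded[OF g1])
  fix w :: "'n kin" assume "norm w > 20 * T2 ^ 3 * (1 + \<bar>A\<bar>)"
  from out[OF this] show "\<gamma> (fst w) * E (kq w) = 0" using A by auto
 qed
 let ?H = "%i w::'n kin. (\<gamma> (fst w) * E' (kq w)) *\<^sub>R kvig i w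
   + kvi i w *\<^sub>R ((\<gamma>' (fst w) * E' (kq w)) *\<^sub>R (1, 0, 0) + (\<gamma> (fst w) * E'' (kq w)) *\<^sub>R kg w)"
 note g2 = kern_GDERIV[OF \<gamma> E(2,3) T]
 have C2: "C1c_with_gradient (%w::'n kin. snd (snd (?G w)) $ i) (?H i)" for i
 proof -
  have e: "snd (snd (?G w)) $ i = (\<gamma> (fst w) * E' (kq w)) * kvi i w" for w :: "'n kin"
   by (simp add: kg_def kvi_def mult.commute)
  show ?thesis unfolding e
  proof (rule C1c_intro_bounded)
   show "GDERIV (%w::'n kin. \<gamma> (fst w) * E' (kq w) * kvi i w) w :> ?H i w" for w
   proof (rule glue_GDERIV[OF _ T(1)])
    assume w: "fst w < 0"
    show "GDERIV (%w::'n kin. \<gamma> (fst w) * E' (kq w) * kvi i w) w :> ?H i w"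
     by (rule GDERIV_mult[OF g2(1) GDERIV_kvi[OF w]])
   qed (simp_all add: T zero_prod_def[symmetric])
   show "continuous_on UNIV (?H i)"
   proof (rule glue_continuous[OF _ T(1)])
    show "continuous_on {w::'n kin. fst w < 0} (?H i)"
     by (intro continuous_intros kern_continuous continuous_on_compose2[OF cE' kern_continuous(1)] continuous_on_compose2[OF E(3) kern_continuous(1)]
      continuous_on_compose2[OF \<gamma>(2)] continuous_on_compose2[OF c\<gamma>]) auto
   qed (simp add: T zero_prod_def[symmetric])
   fix w :: "'n kin" assume "norm w > 20 * T2 ^ 3 * (1 + \<bar>A\<bar>)"
   from out[OF this] show "\<gamma> (fst w) * E' (kq w) * kvi i w = 0" using A by auto
  qed
 qed
 show ?thesis
 proof (rule testI[OF C1 C2])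
  fix w :: "'n kin"
  show "\<gamma>' (fst w) * E (kq w) + \<gamma> (fst w) * (E' (kq w) * (2 * CARD('n) / (- fst w)) + (norm (snd (snd (kg w))))\<^sup>2 * (E' (kq w) + E'' (kq w)))
   = fst (?G w) + snd (snd w) \<bullet> fst (snd (?G w)) + (\<Sum>i\<in>UNIV. snd (snd (?H i w)) $ i)"
  proof (cases "fst w < 0")
   case False
   then have "fst w > - T" using T(1) by simp
   then show ?thesis by (simp add: T)
  next
   case True
   have s: "(\<Sum>i\<in>UNIV. snd (snd (?H i w)) $ i) = \<gamma> (fst w) * E' (kq w) * (2 * CARD('n) / (- fst w)) + \<gamma> (fst w) * E'' (kq w) * (norm (snd (snd (kg w))))\<^sup>2"
   proof -
    have "snd (snd (?H i w)) $ i = \<gamma> (fst w) * E' (kq w) * (2 / (- fst w)) + \<gamma> (fst w) * E'' (kq w) * (kvi i w)\<^sup>2" for i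
     using kern_norms(3)[of "- fst w" w i] True by (simp add: kvig_def power2_eq_square algebra_simps)
    then have "(\<Sum>i\<in>UNIV. snd (snd (?H i w)) $ i) = (\<Sum>i\<in>(UNIV::'n set). \<gamma> (fst w) * E' (kq w) * (2 / (- fst w))) + \<gamma> (fst w) * E'' (kq w) * (\<Sum>i\<in>UNIV. (kvi i w)\<^sup>2)"
     by (simp only: sum.distrib sum_distrib_left)
    also have "(\<Sum>i\<in>UNIV. (kvi i w)\<^sup>2) = (norm (snd (snd (kg w))))\<^sup>2" using True by (intro kern_norms(2)[of "- fst w"]) auto
    finally show ?thesis by simp
   qed
   \<comment> \<open>The eikonal identity for the exponent: it turns the first-order part of the
     operator into a multiple of the same square that the second derivatives produce.\<close>
   have k: "fst (kg w) + snd (snd w) \<bullet> fst (snd (kg w)) = (norm (snd (snd (kg w))))\<^sup>2"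
    unfolding power2_norm_eq_inner kg_def prod.sel inner_add_left inner_add_right inner_scaleR_left inner_scaleR_right
    using True by (simp add: inner_commute field_simps eval_nat_numeral)
   have "fst (?G w) + snd (snd w) \<bullet> fst (snd (?G w)) = \<gamma>' (fst w) * E (kq w) + \<gamma> (fst w) * E' (kq w) * (fst (kg w) + snd (snd w) \<bullet> fst (snd (kg w)))"
    by (simp add: algebra_simps)
   then show ?thesis unfolding s k by (simp add: algebra_simps)
  qed
 qed
qed

section \<open>Whole-space solutions and the kernel identity\<close>

text \<open>Solutions of the homogeneous equation on the whole space. The weighted integrability
  allows compactly supported tests to be replaced by rapidly decaying ones.\<close>

definition wsol :: "('n::finite kin => real) => bool" where
 "wsol U \<longleftrightarrow> U \<in> borel_measurable borel \<and> (\<exists>N. integrable lborel (%w. U w / (1 + norm w) ^ N)) \<and>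
   (\<forall>\<phi> \<psi>. test \<phi> \<psi> --> (\<integral>w. U w * \<psi> w \<partial>lborel) = 0)"

lemma wsolD:
 assumes "wsol U"
 shows "U \<in> borel_measurable borel" "test \<phi> \<psi> ==> (\<integral>w. U w * \<psi> w \<partial>lborel) = 0"
 using assms unfolding wsol_def by blast+

lemma kern_decay:
 fixes w :: "'n::finite kin"
 assumes "1 <= T" "- T <= fst w" "fst w < 0"
 shows "(1 + norm w) ^ b * exp (- kq w) <= (20 * T ^ 3) ^ b * real b ^ b"
proof -
 have "(1 + norm w) ^ b <= (20 * T ^ 3 * (1 + kq w)) ^ b" by (intro power_mono norm_le_kq assms) simp
 then have "(1 + norm w) ^ b * exp (- kq w) <= (20 * T ^ 3 * (1 + kq w)) ^ b * exp (- kq w)"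
  by (intro mult_right_mono) auto
 also have "\<dots> = (20 * T ^ 3) ^ b * ((1 + kq w) ^ b * exp (- kq w))" by (simp add: power_mult_distrib mult_ac)
 also have "\<dots> <= (20 * T ^ 3) ^ b * real b ^ b"
  using assms by (intro mult_left_mono exp_power_bound kq_nonneg) auto
 finally show ?thesis .
qed

text \<open>Compactly supported approximations of exp (- s) of class C^2, hence the cube. The cutoff
  varies on the scale m, so E' + E'' is of order 1 / m instead of 0.\<close>

definition cutE :: "nat => real => real" where "cutE m s = exp (- s) * max 0 (1 - s / Suc m) ^ 3"
definition cutE' :: "nat => real => real" where
 "cutE' m s = exp (- s) * (- (max 0 (1 - s / Suc m) ^ 3) - 3 / Suc m * max 0 (1 - s / Suc m) ^ 2)"
definition cutE'' :: "nat => real => real" where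
 "cutE'' m s = exp (- s) * (max 0 (1 - s / Suc m) ^ 3 + 6 / Suc m * max 0 (1 - s / Suc m) ^ 2 + 6 / (Suc m)\<^sup>2 * max 0 (1 - s / Suc m))"

lemma cutE_deriv: "DERIV (cutE m) s :> cutE' m s" "DERIV (cutE' m) s :> cutE'' m s"
proof -
 have l: "DERIV (%s. 1 - s / real (Suc m)) s :> - 1 / real (Suc m)" by (auto intro!: derivative_eq_intros)
 have p3: "DERIV (%s. max 0 (1 - s / real (Suc m)) ^ 3) s :> - 3 / Suc m * max 0 (1 - s / Suc m) ^ 2"
  using DERIV_chain2[OF DERIV_max0_power[of 1 "1 - s / real (Suc m)"] l] by (simp add: eval_nat_numeral)
 have p2: "DERIV (%s. max 0 (1 - s / real (Suc m)) ^ 2) s :> - 2 / Suc m * max 0 (1 - s / Suc m)"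
  using DERIV_chain2[OF DERIV_max0_power[of 0 "1 - s / real (Suc m)"] l] by (simp add: eval_nat_numeral)
 have e: "DERIV (%s. exp (- s)) s :> - exp (- s)" by (auto intro!: derivative_eq_intros)
 show "DERIV (cutE m) s :> cutE' m s"
  unfolding cutE_def[abs_def] cutE'_def
  by (rule DERIV_cong[OF DERIV_mult[OF e p3]]) (simp add: algebra_simps)
 show "DERIV (cutE' m) s :> cutE'' m s"
  unfolding cutE'_def[abs_def] cutE''_def
  by (rule DERIV_cong[OF DERIV_mult[OF e DERIV_diff[OF DERIV_minus[OF p3] DERIV_cmult[OF p2, of "3 / Suc m"]]]])
   (simp add: algebra_simps power2_eq_square)
qed

lemma cutE''_continuous: "continuous_on UNIV (cutE'' m)"
 unfolding cutE''_def[abs_def] by (intro continuous_intros) auto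

lemma cutE_zero: "s \<ge> real (Suc m) ==> cutE m s = 0" "s \<ge> real (Suc m) ==> cutE' m s = 0"
 by (auto simp: cutE_def cutE'_def field_simps)

lemma cutE_bounds:
 assumes s: "s \<ge> 0"
 shows "\<bar>cutE m s\<bar> <= exp (- s)" "\<bar>cutE' m s\<bar> <= 4 * exp (- s)" "\<bar>cutE' m s + cutE'' m s\<bar> <= 9 / Suc m * exp (- s)"
proof -
 define c where "c = max 0 (1 - s / real (Suc m))"
 define d where "d = 1 / real (Suc m)"
 have c: "0 <= c" "c <= 1" using s by (auto simp: c_def)
 have d: "0 < d" "d <= 1" by (auto simp: d_def)
 have cp: "c ^ j <= 1" "0 <= c ^ j" for j using c by (auto intro: power_le_one)
 have dd: "d * d <= d" using d by (simp add: mult_left_le)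
 show "\<bar>cutE m s\<bar> <= exp (- s)" unfolding cutE_def c_def[symmetric] abs_mult using cp[of 3] by (simp add: mult_left_le)
 have "\<bar>- (c ^ 3) - 3 * d * c ^ 2\<bar> <= 4"
 proof -
  have "d * c ^ 2 <= 1 * 1" using d cp[of 2] by (intro mult_mono) auto
  moreover have "0 <= d * c ^ 2" using d cp[of 2] by simp
  ultimately show ?thesis using cp[of 3] by linarith
 qed
 then have "exp (- s) * \<bar>- (c ^ 3) - 3 * d * c ^ 2\<bar> <= exp (- s) * 4" by (intro mult_left_mono) auto
 moreover have eq: "cutE' m s = exp (- s) * (- (c ^ 3) - 3 * d * c ^ 2)"
  by (simp only: cutE'_def c_def d_def times_divide_eq_right mult_1_right)
 ultimately show "\<bar>cutE' m s\<bar> <= 4 * exp (- s)" unfolding eq abs_mult abs_exp_cancel by (simp only: mult.commute)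
 have e: "cutE' m s + cutE'' m s = exp (- s) * (3 * (d * c ^ 2) + 6 * (d * d * c))"
  unfolding cutE'_def cutE''_def c_def[symmetric] by (simp add: d_def algebra_simps power2_eq_square)
 have "d * c ^ 2 <= d * 1" "d * d * c <= d * 1" using d cp[of 2] c dd by (auto intro!: mult_left_mono mult_mono simp: mult_left_le order_trans[OF mult_left_le])
 moreover have "0 <= d * c ^ 2" "0 <= d * d * c" using d cp c by simp_all
 ultimately have "\<bar>3 * (d * c ^ 2) + 6 * (d * d * c)\<bar> <= 9 * d" by linarith
 then have "exp (- s) * \<bar>3 * (d * c ^ 2) + 6 * (d * d * c)\<bar> <= exp (- s) * (9 * d)" by (intro mult_left_mono) auto
 then show "\<bar>cutE' m s + cutE'' m s\<bar> <= 9 / Suc m * exp (- s)"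
  unfolding e abs_mult by (simp add: d_def mult.commute)
qed

lemma cutE_limits: "(%m. cutE m s) \<longlonglongrightarrow> exp (- s)" "(%m. cutE' m s) \<longlonglongrightarrow> - exp (- s)"
proof -
 have i: "(%m. 1 / real (Suc m)) \<longlonglongrightarrow> 0" using LIMSEQ_inverse_real_of_nat by (simp add: inverse_eq_divide)
 have j: "(%m. s / real (Suc m)) \<longlonglongrightarrow> 0" using tendsto_mult_right_zero[OF i, of s] by simp
 have c: "(%m. max 0 (1 - s / real (Suc m))) \<longlonglongrightarrow> max 0 (1 - 0)" by (intro tendsto_max tendsto_diff tendsto_const j)
 have "(%m. cutE m s) \<longlonglongrightarrow> exp (- s) * max 0 (1 - 0) ^ 3"
  unfolding cutE_def by (intro tendsto_mult tendsto_const tendsto_power c)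
 then show "(%m. cutE m s) \<longlonglongrightarrow> exp (- s)" by simp
 have "(%m. exp (- s) * (- (max 0 (1 - s / real (Suc m)) ^ 3) - 3 * (1 / real (Suc m)) * max 0 (1 - s / real (Suc m)) ^ 2))
   \<longlonglongrightarrow> exp (- s) * (- (max 0 (1 - 0) ^ 3) - 3 * 0 * max 0 (1 - 0) ^ 2)"
  by (intro tendsto_mult tendsto_const tendsto_power c tendsto_diff tendsto_minus i)
 then show "(%m. cutE' m s) \<longlonglongrightarrow> - exp (- s)" by (simp add: cutE'_def)
qed

lemma wsol_weight_integrable:
 fixes U :: "'n::finite kin => real"
 assumes U: "U \<in> borel_measurable borel" "integrable lborel (%w. U w / (1 + norm w) ^ N)"
  and h: "h \<in> borel_measurable borel" "!!w. \<bar>h w\<bar> * (1 + norm w) ^ N <= C"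
 shows "integrable lborel (%w. U w * h w)" "\<bar>U w * h w\<bar> <= C * \<bar>U w / (1 + norm w) ^ N\<bar>"
proof -
 have b: "\<bar>U w * h w\<bar> <= C * \<bar>U w / (1 + norm w) ^ N\<bar>" for w
 proof -
  have p: "(1 + norm w) ^ N > 0" by (intro zero_less_power add_pos_nonneg) auto
  have "\<bar>h w\<bar> <= C / (1 + norm w) ^ N" using h(2)[of w] p by (simp add: pos_le_divide_eq)
  then have "\<bar>U w\<bar> * \<bar>h w\<bar> <= \<bar>U w\<bar> * (C / (1 + norm w) ^ N)" by (rule mult_left_mono) simp
  then show ?thesis using p by (simp add: abs_mult abs_divide mult_ac)
 qed
 show "\<bar>U w * h w\<bar> <= C * \<bar>U w / (1 + norm w) ^ N\<bar>" by (rule b)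
 have "0 <= \<bar>h 0\<bar> * (1 + norm (0 :: 'n kin)) ^ N" by simp
 then have C: "C \<ge> 0" using h(2)[of 0] by (rule order_trans)
 show "integrable lborel (%w. U w * h w)"
 proof (rule Bochner_Integration.integrable_bound[OF integrable_mult_right[OF integrable_abs[OF U(2)], of C]])
  show "(%w. U w * h w) \<in> borel_measurable lborel" using U(1) h(1) by simp
  show "AE w in lborel. norm (U w * h w) <= norm (C * \<bar>U w / (1 + norm w) ^ N\<bar>)"
   using b C by (intro AE_I2) (simp add: abs_mult)
 qed
qed

text \<open>Testing with \<gamma> (t) E (\<open>kq\<close>) and letting the cutoff in E go to
  infinity removes the terms with E' + E''. What remains would vanish identically for \<gamma> (t) =
  (- t)^(- 2 n), the normalisation of the kernel.\<close>

lemma kernel_identity: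
 fixes U :: "'n::finite kin => real"
 assumes U: "wsol U"
  and \<gamma>: "!!t. DERIV \<gamma> t :> \<gamma>' t" "continuous_on UNIV \<gamma>'"
  and T: "T > 0" "!!t. t > - T ==> \<gamma> t = 0" "!!t. t > - T ==> \<gamma>' t = 0"
  and T2: "1 <= T2" "!!t. t < - T2 ==> \<gamma> t = 0" "!!t. t < - T2 ==> \<gamma>' t = 0"
 shows "(\<integral>w. U w * ((\<gamma>' (fst w) - \<gamma> (fst w) * (2 * CARD('n) / (- fst w))) * exp (- kq w)) \<partial>lborel) = 0"
proof -
 obtain N where N: "integrable lborel (%w. U w / (1 + norm w) ^ N)" using U unfolding wsol_def by blast
 note Ub = wsolD(1)[OF U]
 let ?c = "real (2 * CARD('n))"
 define \<psi> where "\<psi> m w = \<gamma>' (fst w) * cutE m (kq w) + \<gamma> (fst w) * (cutE' m (kq w) * (?c / (- fst w))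
   + (norm (snd (snd (kg w))))\<^sup>2 * (cutE' m (kq w) + cutE'' m (kq w)))" for m and w :: "'n kin"
 have t: "test (%w::'n kin. \<gamma> (fst w) * cutE m (kq w)) (\<psi> m)" for m
  unfolding \<psi>_def[abs_def]
  by (rule kern_test[OF \<gamma> cutE_deriv cutE''_continuous T T2(1,2) cutE_zero])
 have z: "(\<integral>w. U w * \<psi> m w \<partial>lborel) = 0" for m by (rule wsolD(2)[OF U t])
 have \<psi>b: "\<psi> m \<in> borel_measurable borel" for m
  using test_props[OF t[of m]] by (metis borel_measurable_continuous_onI)
 have c\<gamma>: "continuous_on UNIV \<gamma>" by (rule DERIV_continuous_on[OF has_field_derivative_at_within[OF \<gamma>(1)]])
 have bd: "\<exists>B\<ge>0. \<forall>t. \<bar>f t\<bar> <= B" if f: "continuous_on UNIV f" "!!t. t > - T ==> f t = 0" "!!t. t < - T2 ==> f t = 0" for f :: "real => real"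
 proof -
  have "bounded (f ` {- T2..0})" by (intro compact_imp_bounded compact_continuous_image continuous_on_subset[OF f(1)]) auto
  then obtain B where B: "\<forall>y\<in>f ` {- T2..0}. norm y <= B" unfolding bounded_iff by blast
  have "\<bar>f t\<bar> <= max B 0" for t
  proof (cases "t \<in> {- T2..0}")
   case True then have "norm (f t) <= B" using B by blast
   then show ?thesis by simp
  next
   case False
   then have "f t = 0" using f(2)[of t] f(3)[of t] T(1) by force
   then show ?thesis by simp
  qed
  then show ?thesis by (intro exI[of _ "max B 0"]) simp
 qed
 obtain G0 where G0: "G0 \<ge> 0" "\<forall>t. \<bar>\<gamma> t\<bar> <= G0" using bd[OF c\<gamma> T(2) T2(2)] by metis
 obtain G1 where G1: "G1 \<ge> 0" "\<forall>t. \<bar>\<gamma>' t\<bar> <= G1" using bd[OF \<gamma>(2) T(3) T2(3)] by metis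
 define K where "K = 30 / T\<^sup>2 + 30 / T ^ 3 + 30 / T ^ 4 + 30 / T"
 have K: "K \<ge> 0" using T(1) by (simp add: K_def)
 define C0 where "C0 = G1 + G0 * (4 * (?c / T) + K\<^sup>2 * 9)"
 have C0: "C0 \<ge> 0" using G0 G1 K T(1) by (simp add: C0_def)
 have sup: "\<gamma> (fst w) = 0 \<and> \<gamma>' (fst w) = 0" if "\<not> (- T2 <= fst w \<and> fst w <= - T)" for w :: "'n kin"
  using that T(2)[of "fst w"] T(3)[of "fst w"] T2(2)[of "fst w"] T2(3)[of "fst w"] by force
 \<comment> \<open>The fourth power comes from the squared velocity gradient of \<open>kq\<close>,
   itself bounded by a multiple of the square of 1 + norm w while t stays below - T.\<close>
 have \<psi>bd: "\<bar>\<psi> m w\<bar> <= C0 * ((1 + norm w) ^ 4 * exp (- kq w))" for m w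
 proof (cases "- T2 <= fst w \<and> fst w <= - T")
  case False
  then have "\<psi> m w = 0" using sup[OF False] by (simp add: \<psi>_def)
  then show ?thesis using C0 by simp
 next
  case True
  define M where "M = (1 + norm w) ^ 4"
  have M: "1 <= M" by (simp add: M_def)
  have w0: "fst w < 0" using True T(1) by linarith
  note q = cutE_bounds[OF kq_nonneg[OF w0], of m]
  define e where "e = exp (- kq w)"
  have e: "e > 0" by (simp add: e_def)
  have kg2: "(norm (snd (snd (kg w))))\<^sup>2 <= K\<^sup>2 * M"
  proof -
   have "norm (snd (snd (kg w))) <= K * (1 + norm w)\<^sup>2"
    using norm_kin_ge(3)[of "kg w"] kern_norms(1)[OF T(1), of w] True unfolding K_def by linarith
   then have "(norm (snd (snd (kg w))))\<^sup>2 <= (K * (1 + norm w)\<^sup>2)\<^sup>2" by (rule power_mono) simp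
   then show ?thesis by (simp add: power_mult_distrib M_def power_mult[symmetric])
  qed
  have 1: "\<bar>\<gamma>' (fst w) * cutE m (kq w)\<bar> <= G1 * e"
   unfolding abs_mult e_def using G1 q by (intro mult_mono) auto
  have 2: "\<bar>cutE' m (kq w) * (?c / (- fst w))\<bar> <= (4 * e) * (?c / T)"
  proof -
   have "\<bar>?c / (- fst w)\<bar> = ?c / (- fst w)"
    by (rule abs_of_nonneg, rule divide_nonneg_nonneg) (use w0 in simp_all)
   also have "\<dots> <= ?c / T" by (rule frac_le) (use True T(1) in simp_all)
   finally have "\<bar>?c / (- fst w)\<bar> <= ?c / T" .
   then show ?thesis unfolding abs_mult e_def using q by (intro mult_mono) auto
  qed
  have 3: "\<bar>(norm (snd (snd (kg w))))\<^sup>2 * (cutE' m (kq w) + cutE'' m (kq w))\<bar> <= (K\<^sup>2 * M) * (9 * e)"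
  proof -
   have "9 / real (Suc m) * exp (- kq w) <= 9 * exp (- kq w)" by (intro mult_right_mono) (auto simp: field_simps)
   then have "\<bar>cutE' m (kq w) + cutE'' m (kq w)\<bar> <= 9 * e" using q(3) unfolding e_def by linarith
   then show ?thesis unfolding abs_mult using kg2 M by (intro mult_mono) auto
  qed
  have 4: "\<bar>\<gamma> (fst w) * (cutE' m (kq w) * (?c / (- fst w)) + (norm (snd (snd (kg w))))\<^sup>2 * (cutE' m (kq w) + cutE'' m (kq w)))\<bar>
    <= G0 * ((4 * e) * (?c / T) + (K\<^sup>2 * M) * (9 * e))"
  proof -
   have "\<bar>cutE' m (kq w) * (?c / (- fst w)) + (norm (snd (snd (kg w))))\<^sup>2 * (cutE' m (kq w) + cutE'' m (kq w))\<bar> <= (4 * e) * (?c / T) + (K\<^sup>2 * M) * (9 * e)"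
    by (rule order_trans[OF abs_triangle_ineq add_mono[OF 2 3]])
   then show ?thesis unfolding abs_mult[of "\<gamma> (fst w)"] using G0 by (intro mult_mono) auto
  qed
  have "\<bar>\<psi> m w\<bar> <= G1 * e + G0 * ((4 * e) * (?c / T) + (K\<^sup>2 * M) * (9 * e))"
   unfolding \<psi>_def using 1 4 by (intro order_trans[OF abs_triangle_ineq] add_mono)
  also have "\<dots> <= (G1 * M) * e + G0 * ((4 * e) * (?c / T) * M + (K\<^sup>2 * M) * (9 * e))"
  proof -
   have "G1 * 1 * e <= G1 * M * e" using M G1 e by (intro mult_right_mono mult_left_mono) auto
   moreover have "(4 * e) * (?c / T) * 1 <= (4 * e) * (?c / T) * M"
    by (rule mult_left_mono[OF M]) (use e T(1) in simp)
   ultimately show ?thesis by (intro add_mono mult_left_mono[OF _ G0(1)]) (simp_all only: mult_1_right order_refl)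
  qed
  also have "\<dots> = C0 * (M * e)" by (simp add: C0_def algebra_simps)
  finally show ?thesis by (simp add: M_def e_def)
 qed
 define C1 where "C1 = C0 * ((20 * T2 ^ 3) ^ (4 + N) * real (4 + N) ^ (4 + N))"
 have \<psi>N: "\<bar>\<psi> m w\<bar> * (1 + norm w) ^ N <= C1" for m w
 proof (cases "- T2 <= fst w \<and> fst w <= - T")
  case False
  then have "\<psi> m w = 0" using sup[OF False] by (simp add: \<psi>_def)
  then show ?thesis using C0 T2 by (simp add: C1_def)
 next
  case True
  have "\<bar>\<psi> m w\<bar> * (1 + norm w) ^ N <= C0 * ((1 + norm w) ^ 4 * exp (- kq w)) * (1 + norm w) ^ N"
   by (intro mult_right_mono \<psi>bd) simp
  also have "\<dots> = C0 * ((1 + norm w) ^ (4 + N) * exp (- kq w))" by (simp add: power_add mult_ac)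
  also have "\<dots> <= C1" unfolding C1_def using True T(1) C0 by (intro mult_left_mono kern_decay T2(1)) auto
  finally show ?thesis .
 qed
 have lim: "(%m. \<psi> m w) \<longlonglongrightarrow> (\<gamma>' (fst w) - \<gamma> (fst w) * (?c / (- fst w))) * exp (- kq w)" for w
 proof (cases "fst w < 0")
  case False
  then have "fst w > - T" using T(1) by simp
  then show ?thesis by (simp add: \<psi>_def T)
 next
  case True
  have "(%m. cutE' m (kq w) + cutE'' m (kq w)) \<longlonglongrightarrow> 0"
  proof (rule Lim_null_comparison)
   show "eventually (%m. norm (cutE' m (kq w) + cutE'' m (kq w)) <= 9 * exp (- kq w) * (1 / real (Suc m))) sequentially"
    using cutE_bounds(3)[OF kq_nonneg[OF True]] by (intro always_eventually allI) simp
   have i: "(%m. 1 / real (Suc m)) \<longlonglongrightarrow> 0" using LIMSEQ_inverse_real_of_nat by (simp add: inverse_eq_divide)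
   show "(%m. 9 * exp (- kq w) * (1 / real (Suc m))) \<longlonglongrightarrow> 0" by (rule tendsto_mult_right_zero[OF i])
  qed
  then have "(%m. \<psi> m w) \<longlonglongrightarrow> \<gamma>' (fst w) * exp (- kq w) + \<gamma> (fst w) * (- exp (- kq w) * (?c / (- fst w)) + (norm (snd (snd (kg w))))\<^sup>2 * 0)"
   unfolding \<psi>_def by (intro tendsto_add tendsto_mult tendsto_const cutE_limits)
  then show ?thesis by (simp add: algebra_simps)
 qed
 have "(%m. \<integral>w. U w * \<psi> m w \<partial>lborel) \<longlonglongrightarrow> (\<integral>w. U w * ((\<gamma>' (fst w) - \<gamma> (fst w) * (?c / (- fst w))) * exp (- kq w)) \<partial>lborel)"
 proof (rule integral_dominated_convergence[where w="%w. C1 * \<bar>U w / (1 + norm w) ^ N\<bar>"])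
  have m: "(%w. U w * \<psi> m w) \<in> borel_measurable lborel" for m using Ub \<psi>b[of m] by simp
  show "(%w. U w * \<psi> m w) \<in> borel_measurable lborel" for m by (rule m)
  have l: "(%m. U w * \<psi> m w) \<longlonglongrightarrow> U w * ((\<gamma>' (fst w) - \<gamma> (fst w) * (?c / (- fst w))) * exp (- kq w))" for w
   by (intro tendsto_mult tendsto_const lim)
  show "AE w in lborel. (%m. U w * \<psi> m w) \<longlonglongrightarrow> U w * ((\<gamma>' (fst w) - \<gamma> (fst w) * (?c / (- fst w))) * exp (- kq w))"
   by (rule AE_I2) (rule l)
  show "(%w. U w * ((\<gamma>' (fst w) - \<gamma> (fst w) * (?c / (- fst w))) * exp (- kq w))) \<in> borel_measurable lborel"
   by (rule borel_measurable_LIMSEQ_real[OF l m])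
  show "integrable lborel (%w. C1 * \<bar>U w / (1 + norm w) ^ N\<bar>)" by (intro integrable_mult_right integrable_abs N)
  show "AE w in lborel. norm (U w * \<psi> m w) <= C1 * \<bar>U w / (1 + norm w) ^ N\<bar>" for m
   using wsol_weight_integrable(2)[OF Ub N \<psi>b \<psi>N] by (intro AE_I2) simp
 qed
 then have "(%m::nat. 0::real) \<longlonglongrightarrow> (\<integral>w. U w * ((\<gamma>' (fst w) - \<gamma> (fst w) * (?c / (- fst w))) * exp (- kq w)) \<partial>lborel)"
  by (simp only: z)
 from LIMSEQ_unique[OF this tendsto_const] show ?thesis by simp
qed

lemma norm_kmul: "1 + norm (kmul z w) <= (1 + norm z) * (1 + norm w) * 3"
proof -
 obtain t' x' v' where z: "z = (t', x', v')" by (cases z) auto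
 obtain t x v where w: "w = (t, x, v)" by (cases w) auto
 have zz: "\<bar>t'\<bar> <= norm z" "norm x' <= norm z" "norm v' <= norm z" using norm_kin_ge[of z] by (simp_all add: z)
 have ww: "\<bar>t\<bar> <= norm w" "norm x <= norm w" "norm v <= norm w" using norm_kin_ge[of w] by (simp_all add: w)
 have tv: "norm (t *\<^sub>R v') <= norm w * norm z" unfolding norm_scaleR using zz ww by (intro mult_mono) auto
 have "norm (kmul z w) <= \<bar>t' + t\<bar> + norm (x' + x + t *\<^sub>R v') + norm (v' + v)"
  unfolding z w kmul_def by simp (rule norm_kin_le)
 also have "norm (x' + x + t *\<^sub>R v') <= norm x' + norm x + norm (t *\<^sub>R v')"
  by (intro order_trans[OF norm_triangle_ineq] add_mono norm_triangle_ineq order_refl)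
 also have "norm (v' + v) <= norm v' + norm v" by (rule norm_triangle_ineq)
 finally have "norm (kmul z w) <= 3 * norm z + 3 * norm w + norm w * norm z" using zz ww tv by linarith
 moreover have "(1 + norm z) * (1 + norm w) * 3 = 3 + 3 * norm z + 3 * norm w + 3 * (norm w * norm z)" by (simp add: algebra_simps)
 moreover have "0 <= norm w * norm z" by simp
 ultimately show ?thesis by linarith
qed

text \<open>Left invariance of the equation: after a change of variables the translation falls on
  the test function, where \<open>test_kmul\<close> applies.\<close>

lemma wsol_kmul:
 fixes U :: "'n::finite kin => real"
 assumes U: "wsol U" shows "wsol (%w. U (kmul z w))"
 unfolding wsol_def
proof (intro conjI allI impI)
 note Ub[measurable] = wsolD(1)[OF U]
 obtain N where N: "integrable lborel (%w. U w / (1 + norm w) ^ N)" using U unfolding wsol_def by blast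
 show m: "(%w. U (kmul z w)) \<in> borel_measurable borel" by measurable
 have i: "integrable lborel (%w. U (kmul z w) / (1 + norm (kmul z w)) ^ N)"
  using vol_scaling_integral(2)[OF vol_scaling_kmul, of "%w. U w / (1 + norm w) ^ N" z] N by simp
 have "integrable lborel (%w. U (kmul z w) / (1 + norm w) ^ N)"
 proof (rule Bochner_Integration.integrable_bound[OF integrable_mult_right[OF i, of "((1 + norm z) * 3) ^ N"]])
  show "(%w. U (kmul z w) / (1 + norm w) ^ N) \<in> borel_measurable lborel" using m by measurable
  show "AE w in lborel. norm (U (kmul z w) / (1 + norm w) ^ N) <= norm (((1 + norm z) * 3) ^ N * (U (kmul z w) / (1 + norm (kmul z w)) ^ N))"
  proof (rule AE_I2)
   fix w :: "'n kin"
   have "(1 + norm (kmul z w)) ^ N <= ((1 + norm z) * 3 * (1 + norm w)) ^ N"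
   proof (rule power_mono)
    show "1 + norm (kmul z w) <= (1 + norm z) * 3 * (1 + norm w)"
     using norm_kmul[of z w] by (simp only: mult_ac)
   qed simp
   then have a: "(1 + norm (kmul z w)) ^ N <= ((1 + norm z) * 3) ^ N * (1 + norm w) ^ N" by (simp only: power_mult_distrib)
   have p: "(1 + norm w) ^ N > 0" "(1 + norm (kmul z w)) ^ N > 0" by (intro zero_less_power add_pos_nonneg; simp)+
   have "1 / (1 + norm w) ^ N <= ((1 + norm z) * 3) ^ N / (1 + norm (kmul z w)) ^ N"
    using a p by (simp add: divide_simps mult_ac)
   then have "\<bar>U (kmul z w)\<bar> * (1 / (1 + norm w) ^ N) <= \<bar>U (kmul z w)\<bar> * (((1 + norm z) * 3) ^ N / (1 + norm (kmul z w)) ^ N)"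
    by (rule mult_left_mono) simp
   then show "norm (U (kmul z w) / (1 + norm w) ^ N) <= norm (((1 + norm z) * 3) ^ N * (U (kmul z w) / (1 + norm (kmul z w)) ^ N))"
    by (simp add: abs_mult abs_divide mult_ac)
  qed
 qed
 then show "\<exists>N. integrable lborel (%w. U (kmul z w) / (1 + norm w) ^ N)" by blast
 fix \<phi> \<psi> :: "'n kin => real" assume t: "test \<phi> \<psi>"
 obtain \<rho> where "continuous_on UNIV \<psi>" using test_props[OF t] by metis
 then have [measurable]: "\<psi> \<in> borel_measurable borel" by (rule borel_measurable_continuous_onI)
 have "(\<integral>w. U w * \<psi> (kmul (kinv z) w) \<partial>lborel) = 0" by (rule wsolD(2)[OF U test_kmul[OF t]])
 then show "(\<integral>w. U (kmul z w) * \<psi> w \<partial>lborel) = 0"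
  using vol_scaling_integral(1)[OF vol_scaling_kmul, of "%w. U w * \<psi> (kmul (kinv z) w)" z] by simp
qed

section \<open>The averaging kernel and its scale invariance\<close>

definition eta :: "real => real" where "eta s = max 0 (s - 1) ^ 2 * max 0 (2 - s) ^ 2"
definition eta' :: "real => real" where
 "eta' s = max 0 (s - 1) ^ 2 * (- 2 * max 0 (2 - s)) + 2 * max 0 (s - 1) * max 0 (2 - s) ^ 2"

lemma eta_deriv: "DERIV eta s :> eta' s"
proof -
 have 1: "DERIV (%s. max 0 (s - 1) ^ 2) s :> 2 * max 0 (s - 1)"
 proof -
  have "DERIV (%s. s - 1) s :> 1" by (auto intro!: derivative_eq_intros)
  from DERIV_chain2[OF DERIV_max0_power[of 0 "s - 1"] this] show ?thesis by (simp add: eval_nat_numeral)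
 qed
 have 2: "DERIV (%s. max 0 (2 - s) ^ 2) s :> - 2 * max 0 (2 - s)"
 proof -
  have "DERIV (%s. 2 - s) s :> - 1" by (auto intro!: derivative_eq_intros)
  from DERIV_chain2[OF DERIV_max0_power[of 0 "2 - s"] this] show ?thesis by (simp add: eval_nat_numeral)
 qed
 show ?thesis unfolding eta_def[abs_def] eta'_def
  by (rule DERIV_cong[OF DERIV_mult[OF 1 2]]) simp
qed

lemma eta'_continuous: "continuous_on UNIV eta'"
 unfolding eta'_def[abs_def] by (intro continuous_intros)

lemma eta_continuous: "continuous_on UNIV eta"
 unfolding eta_def[abs_def] by (intro continuous_intros)

lemma eta_zero: "s <= 1 \<or> s \<ge> 2 ==> eta s = 0" "s <= 1 \<or> s \<ge> 2 ==> eta' s = 0"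
 by (auto simp: eta_def eta'_def)

lemma eta_nonneg: "eta s \<ge> 0"
 by (simp add: eta_def)

text \<open>The factor (- t)^(- k) with k = 2 n is the integrating factor for the ordinary
  differential expression in the kernel identity. Since f vanishes for t > - T, the quotient is
  harmless at t = 0.\<close>

lemma time_quotient:
 fixes f f' :: "real => real"
 assumes f: "!!t. DERIV f t :> f' t" "continuous_on UNIV f'"
  and T: "T > 0" "!!t. t > - T ==> f t = 0" "!!t. t > - T ==> f' t = 0"
 shows "DERIV (%t. f t * inverse (- t) ^ k) t :> f' t * inverse (- t) ^ k + f t * (real k * inverse (- t) ^ Suc k)"
  and "continuous_on UNIV (%t. f' t * inverse (- t) ^ k + f t * (real k * inverse (- t) ^ Suc k))"
proof -
 have cf: "continuous_on UNIV f" by (rule DERIV_continuous_on[OF has_field_derivative_at_within[OF f(1)]])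
 show "DERIV (%t. f t * inverse (- t) ^ k) t :> f' t * inverse (- t) ^ k + f t * (real k * inverse (- t) ^ Suc k)"
 proof (cases "t < 0")
  case True
  have i: "DERIV (%t. inverse (- t) ^ k) t :> real k * inverse (- t) ^ Suc k"
  proof (cases k)
   case (Suc j)
   have "DERIV (%t. inverse (- t)) t :> inverse (- t) ^ 2"
    using True by (auto intro!: derivative_eq_intros simp: power2_eq_square field_simps)
   from DERIV_power[OF this, of k] show ?thesis by (rule DERIV_cong) (simp add: Suc power2_eq_square)
  qed simp
  show ?thesis by (rule DERIV_cong[OF DERIV_mult[OF f(1) i]]) (simp add: mult_ac)
 next
  case False
  then have t: "t > - T" using T(1) by simp
  have "DERIV (%t. f t * inverse (- t) ^ k) t :> 0"
  proof (rule has_field_derivative_transform_within_open[of "%_. 0" 0 t "{- T<..}"])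
   fix s assume "s \<in> {- T<..}"
   then show "0 = f s * inverse (- s) ^ k" using T(2)[of s] by simp
  qed (use t in auto)
  then show ?thesis using T(2,3)[OF t] by simp
 qed
 let ?g = "%t. f' t * inverse (- t) ^ k + f t * (real k * inverse (- t) ^ Suc k)"
 have 1: "continuous_on {..<0} ?g"
  by (intro continuous_on_add continuous_on_mult continuous_on_power continuous_on_inverse continuous_on_minus
    continuous_on_id continuous_on_const continuous_on_subset[OF f(2)] continuous_on_subset[OF cf]) auto
 have 2: "continuous_on {- T<..} ?g"
  by (rule continuous_on_eq[OF continuous_on_const[of _ 0]]) (simp add: T)
 have "continuous_on ({..<0} \<union> {- T<..}) ?g" by (intro continuous_on_open_Un 1 2) auto
 moreover have "{..<0} \<union> {- T<..} = (UNIV::real set)" using T(1) by auto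
 ultimately show "continuous_on UNIV ?g" by simp
qed

definition kb :: "nat => real => real" where "kb n t = eta (- t) * inverse (- t) ^ (2 * n)"
definition kb' :: "nat => real => real" where
 "kb' n t = - eta' (- t) * inverse (- t) ^ (2 * n) + eta (- t) * (real (2 * n) * inverse (- t) ^ Suc (2 * n))"

lemma kb_props: "DERIV (kb n) t :> kb' n t" "continuous_on UNIV (kb' n)"
 "t > - 1 \<or> t < - 2 ==> kb n t = 0" "t > - 1 \<or> t < - 2 ==> kb' n t = 0"
proof -
 have d: "DERIV (%t. eta (- t)) t :> - eta' (- t)" for t
  using DERIV_chain2[OF eta_deriv DERIV_minus[OF DERIV_ident]] by simp
 have c: "continuous_on UNIV (%t. - eta' (- t))"
  by (intro continuous_on_minus continuous_on_compose2[OF eta'_continuous] continuous_on_id) auto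
 have z: "t > - 1 ==> eta (- t) = 0" "t > - 1 ==> - eta' (- t) = 0" for t by (simp_all add: eta_zero)
 note q = time_quotient[OF d c zero_less_one z, of "2 * n"]
 show "DERIV (kb n) t :> kb' n t" unfolding kb_def[abs_def] kb'_def by (rule q(1))
 show "continuous_on UNIV (kb' n)" unfolding kb'_def[abs_def] by (rule q(2))
 show "t > - 1 \<or> t < - 2 ==> kb n t = 0" "t > - 1 \<or> t < - 2 ==> kb' n t = 0"
  by (auto simp: kb_def kb'_def eta_zero)
qed

text \<open>The Kolmogorov kernel weighted with a bump in time supported in [-2, -1]: away from its
  singularity, continuously differentiable, and decaying faster than every power of the
  norm.\<close>

definition kap :: "'n::finite kin => real" where "kap w = kb CARD('n) (fst w) * exp (- kq w)"
definition kapg :: "'n::finite kin => 'n kin" where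
 "kapg w = (kb' CARD('n) (fst w) * exp (- kq w)) *\<^sub>R (1, 0, 0) + (kb CARD('n) (fst w) * - exp (- kq w)) *\<^sub>R kg w"

lemma kap_GDERIV: "GDERIV (kap :: 'n::finite kin => real) w :> kapg w"
 and kapg_continuous: "continuous_on UNIV (kapg :: 'n kin => _)"
proof -
 have e: "DERIV (%s. exp (- s)) s :> - exp (- s)" for s :: real by (auto intro!: derivative_eq_intros)
 have c: "continuous_on UNIV (%s::real. - exp (- s))" by (intro continuous_intros)
 note k = kern_GDERIV[OF kb_props(1,2) e c zero_less_one]
 show "GDERIV (kap :: 'n::finite kin => real) w :> kapg w"
  unfolding kap_def[abs_def] kapg_def by (rule k(1)) (simp_all add: kb_props)
 show "continuous_on UNIV (kapg :: 'n kin => _)"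
  unfolding kapg_def[abs_def] by (rule k(2)) (simp_all add: kb_props)
qed

lemma kap_continuous: "continuous_on UNIV (kap :: 'n::finite kin => real)"
 using kap_GDERIV by (intro has_derivative_continuous_on[of UNIV]) (auto simp: gderiv_def intro: has_derivative_at_withinI)

lemma kap_borel [measurable]: "kap \<in> borel_measurable borel"
 by (rule borel_measurable_continuous_onI[OF kap_continuous])

lemma kapg_borel [measurable]: "kapg \<in> borel_measurable borel"
 by (rule borel_measurable_continuous_onI[OF kapg_continuous])

lemma kap_nonneg: "kap w \<ge> 0"
proof (cases "fst w < 0")
 case True
 then show ?thesis unfolding kap_def kb_def by (intro mult_nonneg_nonneg eta_nonneg zero_le_power) auto
qed (simp add: kap_def kb_def eta_zero)

text \<open>The exponential absorbs any power of the norm; \<open>kapg\<close> costs two more powers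
  because of the gradient of \<open>kq\<close>.\<close>

lemma kap_decay:
 obtains C where "C \<ge> 0" "!!w::'n::finite kin. \<bar>kap w\<bar> * (1 + norm w) ^ B <= C"
  "!!w::'n kin. norm (kapg w) * (1 + norm w) ^ B <= C"
proof -
 let ?n = "CARD('n)"
 have bd: "\<exists>b\<ge>0. \<forall>t. \<bar>f t\<bar> <= b" if f: "continuous_on UNIV f" "!!t. t > - 1 \<or> t < - 2 ==> f t = 0" for f :: "real => real"
 proof -
  have "bounded (f ` {- 2..0})" by (intro compact_imp_bounded compact_continuous_image continuous_on_subset[OF f(1)]) auto
  then obtain b where b: "\<forall>y\<in>f ` {- 2..0}. norm y <= b" unfolding bounded_iff by blast
  have "\<bar>f t\<bar> <= max b 0" for t
  proof (cases "t \<in> {- 2..0}")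
   case True then have "norm (f t) <= b" using b by blast
   then show ?thesis by simp
  next
   case False
   then have "f t = 0" using f(2)[of t] by force
   then show ?thesis by simp
  qed
  then show ?thesis by (intro exI[of _ "max b 0"]) simp
 qed
 have ckb: "continuous_on UNIV (kb ?n)" by (rule DERIV_continuous_on[OF has_field_derivative_at_within[OF kb_props(1)]])
 obtain G0 where G0: "G0 \<ge> 0" "\<forall>t. \<bar>kb ?n t\<bar> <= G0" using bd[OF ckb kb_props(3)] by metis
 obtain G1 where G1: "G1 \<ge> 0" "\<forall>t. \<bar>kb' ?n t\<bar> <= G1" using bd[OF kb_props(2) kb_props(4)] by metis
 define D where "D = (20 * 2 ^ 3) ^ (B + 2) * real (B + 2) ^ (B + 2)"
 define C where "C = (G0 + G1 + G0 * 120) * D"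
 have D: "D \<ge> 0" by (simp add: D_def)
 have C: "C \<ge> 0" using G0 G1 D by (simp add: C_def)
 have main: "\<bar>kap w\<bar> * (1 + norm w) ^ B <= C \<and> norm (kapg w) * (1 + norm w) ^ B <= C" for w :: "'n kin"
 proof (cases "- 2 <= fst w \<and> fst w <= - 1")
  case False
  then have "fst w > - 1 \<or> fst w < - 2" by linarith
  then have "kap w = 0" "kapg w = 0" by (simp_all add: kap_def kapg_def kb_props zero_prod_def)
  then show ?thesis using C by simp
 next
  case True
  define e where "e = exp (- kq w)"
  define m where "m = 1 + norm w"
  have m: "m \<ge> 1" and e: "e > 0" by (auto simp: m_def e_def)
  have dec: "m ^ (B + 2) * e <= D"
   unfolding D_def m_def e_def by (rule kern_decay) (use True in auto)
  have mB: "m ^ B * e <= D"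
  proof -
   have "m ^ B * e <= m ^ (B + 2) * e" using m e by (intro mult_right_mono power_increasing) auto
   then show ?thesis using dec by linarith
  qed
  have kg: "norm (kg w) <= 120 * m\<^sup>2" using kern_norms(1)[of 1 w] True by (simp add: m_def)
  have "\<bar>kap w\<bar> * m ^ B <= G0 * e * m ^ B"
   unfolding kap_def abs_mult e_def using G0 m by (intro mult_right_mono) auto
  also have "\<dots> = G0 * (m ^ B * e)" by (simp add: mult_ac)
  also have "\<dots> <= G0 * D" using G0 mB by (intro mult_left_mono) auto
  also have "\<dots> <= C" using G0 G1 D unfolding C_def by (intro mult_right_mono) auto
  finally have 1: "\<bar>kap w\<bar> * m ^ B <= C" .
  have "norm (kapg w) <= norm ((kb' ?n (fst w) * e) *\<^sub>R ((1, 0, 0) :: 'n kin)) + norm ((kb ?n (fst w) * - e) *\<^sub>R kg w)"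
   unfolding kapg_def e_def by (rule norm_triangle_ineq)
  also have "\<dots> = \<bar>kb' ?n (fst w)\<bar> * e + \<bar>kb ?n (fst w)\<bar> * e * norm (kg w)"
   using e by (simp add: abs_mult norm_Pair)
  also have "\<dots> <= G1 * e + G0 * e * (120 * m\<^sup>2)"
   using G0 G1 e kg by (intro add_mono mult_mono) auto
  also have "\<dots> <= G1 * e * m\<^sup>2 + G0 * e * (120 * m\<^sup>2)"
  proof (rule add_right_mono)
   have "G1 * e * 1 <= G1 * e * m\<^sup>2" using G1 e m by (intro mult_left_mono) auto
   then show "G1 * e <= G1 * e * m\<^sup>2" by simp
  qed
  also have "\<dots> = (G1 + G0 * 120) * (e * m\<^sup>2)" by (simp add: algebra_simps)
  finally have "norm (kapg w) * m ^ B <= (G1 + G0 * 120) * (e * m\<^sup>2) * m ^ B" using m by (intro mult_right_mono) auto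
  also have "\<dots> = (G1 + G0 * 120) * (m ^ (B + 2) * e)" by (simp add: power_add power2_eq_square mult_ac)
  also have "\<dots> <= (G1 + G0 * 120) * D" using G0 G1 dec by (intro mult_left_mono) auto
  also have "\<dots> <= C" using G0 D unfolding C_def by (intro mult_right_mono) auto
  finally show ?thesis using 1 by (simp only: m_def)
 qed
 then show ?thesis using that C by blast
qed

lemma weight_integrable_power:
 fixes h :: "'n::finite kin => real"
 assumes h: "h \<in> borel_measurable borel" "!!w. \<bar>h w\<bar> * (1 + norm w) ^ (2 * DIM('n kin)) <= C"
 shows "integrable lborel h"
proof (rule Bochner_Integration.integrable_bound[OF integrable_mult_right[OF integrable_weight, of C]])
 show "h \<in> borel_measurable lborel" using h by simp
 show "AE w in lborel. norm (h w) <= norm (C * (1 / (1 + norm w) ^ (2 * DIM('n kin))))"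
 proof (rule AE_I2)
  fix w :: "'n kin"
  define p where "p = (1 + norm w) ^ (2 * DIM('n kin))"
  have p: "p > 0" unfolding p_def by (intro zero_less_power add_pos_nonneg) auto
  have "\<bar>h w\<bar> <= C / p" using h(2)[of w] p by (simp only: pos_le_divide_eq p_def)
  also have "\<dots> <= \<bar>C / p\<bar>" by (rule abs_ge_self)
  finally show "norm (h w) <= norm (C * (1 / (1 + norm w) ^ (2 * DIM('n kin))))" unfolding p_def[symmetric] by simp
 qed
qed

lemma kap_weight_integrable: "integrable lborel (%w::'n::finite kin. kap w * (1 + norm w) ^ N)"
proof -
 obtain C where C: "C \<ge> 0" "!!w::'n kin. \<bar>kap w\<bar> * (1 + norm w) ^ (N + 2 * DIM('n kin)) <= C" using kap_decay by metis
 show ?thesis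
 proof (rule weight_integrable_power)
  show "(%w::'n kin. kap w * (1 + norm w) ^ N) \<in> borel_measurable borel" by measurable
  show "\<bar>kap w * (1 + norm w) ^ N\<bar> * (1 + norm w) ^ (2 * DIM('n kin)) <= C" for w :: "'n kin"
  proof -
   have "\<bar>kap w * (1 + norm w) ^ N\<bar> = \<bar>kap w\<bar> * (1 + norm w) ^ N" by (simp add: abs_mult)
   then show ?thesis using C(2)[of w] by (simp only: power_add mult.assoc)
  qed
 qed
qed

definition kmass :: "'n::finite itself => real" where "kmass T = integral\<^sup>L lborel (kap :: 'n kin => real)"

lemma kmass_pos: "kmass TYPE('n::finite) > 0"
proof -
 have int: "integrable lborel (kap :: 'n kin => real)" using kap_weight_integrable[of 0] by simp
 have "kmass TYPE('n) \<noteq> 0"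
 proof
  assume "kmass TYPE('n) = 0"
  then have "AE w::'n kin in lborel. kap w = 0"
   unfolding kmass_def by (rule iffD1[OF integral_nonneg_eq_0_iff_AE[OF int AE_I2[OF kap_nonneg]]])
  then have "AE w::'n kin in lborel. w \<notin> {w. - 2 < fst w} \<inter> {w. fst w < - 1}"
  proof eventually_elim
   case (elim w)
   show ?case
   proof
    assume "w \<in> {w. - 2 < fst w} \<inter> {w. fst w < - 1}"
    then have "eta (- fst w) > 0" "inverse (- fst w) > 0" by (auto simp: eta_def)
    then have "kap w > 0" unfolding kap_def kb_def by (intro mult_pos_pos zero_less_power) auto
    then show False using elim by simp
   qed
  qed
  moreover have o: "open ({w::'n kin. - 2 < fst w} \<inter> {w. fst w < - 1})"
   by (intro open_Int open_Collect_less continuous_on_fst continuous_on_id continuous_on_const)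
  ultimately have "{w::'n kin. - 2 < fst w} \<inter> {w. fst w < - 1} \<in> null_sets lborel"
   by (subst AE_iff_null_sets) (auto intro: borel_open)
  then have "negligible ({w::'n kin. - 2 < fst w} \<inter> {w. fst w < - 1})" by (simp add: negligible_iff_null_sets null_sets_completionI)
  moreover have "((- 3/2, 0, 0) :: 'n kin) \<in> {w. - 2 < fst w} \<inter> {w. fst w < - 1}" by simp
  ultimately show False using open_not_negligible[OF o] by blast
 qed
 moreover have "kmass TYPE('n) \<ge> 0" unfolding kmass_def by (intro integral_nonneg_AE AE_I2 kap_nonneg)
 ultimately show ?thesis by simp
qed

lemma kq_kscale: "r > 0 ==> kq (kscale r w) = kq w"
 by (cases w) (simp add: kq_def kscale_def field_simps eval_nat_numeral)

text \<open>Both sides average over time the integrals of U against kernel slices, with bumps of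
  equal mass placed at different times. The difference of the two bumps has a compactly supported
  primitive, and the kernel identity applies to it.\<close>

lemma kernel_scale_invariance:
 fixes U :: "'n::finite kin => real"
 assumes U: "wsol U" and r: "r > 0"
 shows "(\<integral>w. U (kscale r w) * kap w \<partial>lborel) = (\<integral>w. U w * kap w \<partial>lborel)"
proof -
 let ?n = "CARD('n)"
 note Ub[measurable] = wsolD(1)[OF U]
 obtain N where N: "integrable lborel (%w. U w / (1 + norm w) ^ N)" using U unfolding wsol_def by blast
 obtain \<Theta> where \<Theta>: "!!s. DERIV \<Theta> s :> eta s"
 proof -
  have "\<exists>F::real=>real. \<forall>x::real. -\<infinity> < ereal x --> ereal x < \<infinity> --> (F has_vector_derivative eta x) (at x)"
   by (rule einterval_antiderivative) (auto intro: continuous_on_interior[OF eta_continuous])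
  then show ?thesis using that by (auto simp: has_real_derivative_iff_has_vector_derivative)
 qed
 have T1: "\<Theta> s = \<Theta> 1" if "s <= 1" for s
 proof (cases "s = 1")
  case False
  have "\<exists>z. s < z \<and> z < 1 \<and> \<Theta> 1 - \<Theta> s = (1 - s) * eta z"
   by (rule MVT2) (use False that \<Theta> in auto)
  then show ?thesis by (auto simp: eta_zero)
 qed simp
 have T2: "\<Theta> s = \<Theta> 2" if "s \<ge> 2" for s
 proof (cases "s = 2")
  case False
  have "\<exists>z. 2 < z \<and> z < s \<and> \<Theta> s - \<Theta> 2 = (s - 2) * eta z"
   by (rule MVT2) (use False that \<Theta> in auto)
  then show ?thesis by (auto simp: eta_zero)
 qed simp
 \<comment> \<open>\<Theta> is constant on either side of [1, 2], so the two terms cancel for times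
   near 0 and for times far in the past: f has compact support in t < 0.\<close>
 define f where "f t = \<Theta> (- t / r\<^sup>2) - \<Theta> (- t)" for t
 define f' where "f' t = - eta (- t / r\<^sup>2) / r\<^sup>2 + eta (- t)" for t
 have r2: "r\<^sup>2 > 0" using r by simp
 have f: "DERIV f t :> f' t" for t
 proof -
  have a: "DERIV (%t. - t / r\<^sup>2) t :> - 1 / r\<^sup>2" by (rule DERIV_cdivide[OF DERIV_minus[OF DERIV_ident]])
  have b: "DERIV (%t. - t) t :> - 1" by (auto intro!: derivative_eq_intros)
  show ?thesis unfolding f_def[abs_def] f'_def
   by (rule DERIV_cong[OF DERIV_diff[OF DERIV_chain2[OF \<Theta> a] DERIV_chain2[OF \<Theta> b]]]) simp
 qed
 have cf': "continuous_on UNIV f'"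
  unfolding f'_def[abs_def]
  by (intro continuous_on_add continuous_on_divide continuous_on_minus continuous_on_const
    continuous_on_compose2[OF eta_continuous] continuous_on_id) (use r in auto)
 define T where "T = min 1 (r\<^sup>2)"
 have T: "T > 0" using r2 by (simp add: T_def)
 have z1: "f t = 0" "f' t = 0" if "t > - T" for t
 proof -
  have a: "- t <= 1" "- t <= r\<^sup>2" using that by (auto simp: T_def)
  have b: "- t / r\<^sup>2 <= 1" using a(2) by (simp only: divide_le_eq_1_pos[OF r2])
  show "f t = 0" unfolding f_def T1[OF a(1)] T1[OF b] by simp
  show "f' t = 0" unfolding f'_def eta_zero(1)[OF disjI1[OF a(1)]] eta_zero(1)[OF disjI1[OF b]] by simp
 qed
 define S where "S = max 2 (2 * r\<^sup>2)"
 have z2: "f t = 0" "f' t = 0" if "t < - S" for t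
 proof -
  have a: "2 <= - t" "2 * r\<^sup>2 <= - t" using that by (auto simp: S_def)
  have b: "2 <= - t / r\<^sup>2" using a(2) by (simp only: pos_le_divide_eq[OF r2])
  show "f t = 0" unfolding f_def T2[OF a(1)] T2[OF b] by simp
  show "f' t = 0" unfolding f'_def eta_zero(1)[OF disjI2[OF a(1)]] eta_zero(1)[OF disjI2[OF b]] by simp
 qed
 \<comment> \<open>With \<gamma> = f (- t)^(- 2 n) the kernel identity loses its zeroth-order term
   and only f' remains.\<close>
 note q = time_quotient[OF f cf' T z1(1) z1(2), of "2 * ?n"]
 have "(\<integral>w. U w * (((f' (fst w) * inverse (- fst w) ^ (2 * ?n) + f (fst w) * (real (2 * ?n) * inverse (- fst w) ^ Suc (2 * ?n)))
   - (f (fst w) * inverse (- fst w) ^ (2 * ?n)) * (2 * ?n / (- fst w))) * exp (- kq w)) \<partial>lborel) = 0"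
  by (rule kernel_identity[OF U q T, of S]) (simp_all add: z1 z2 S_def)
 moreover have "((f' t * inverse (- t) ^ (2 * ?n) + f t * (real (2 * ?n) * inverse (- t) ^ Suc (2 * ?n)))
   - (f t * inverse (- t) ^ (2 * ?n)) * (2 * ?n / (- t))) = f' t * inverse (- t) ^ (2 * ?n)" for t
  by (simp add: divide_inverse algebra_simps)
 ultimately have z: "(\<integral>w. U w * (f' (fst w) * inverse (- fst w) ^ (2 * ?n) * exp (- kq w)) \<partial>lborel) = 0" by (simp only:)
 define J where "J = r ^ (2 + 4 * ?n)"
 have J: "J > 0" using r by (simp add: J_def)
 \<comment> \<open>The Jacobian r^(2 + 4 n) splits as r^(4 n) from the normalisation (- t)^(- 2 n)
   and r^2 from the chain rule in time.\<close>
 have eq: "f' (fst w) * inverse (- fst w) ^ (2 * ?n) * exp (- kq w) = kap w - kap (kscale (1 / r) w) / J" for w :: "'n kin"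
 proof -
  have k: "kq (kscale (1 / r) w) = kq w" by (rule kq_kscale) (use r in simp)
  have t: "fst (kscale (1 / r) w) = fst w / r\<^sup>2" by (cases w) (simp add: kscale_def power_divide)
  have "inverse (- (fst w / r\<^sup>2)) ^ (2 * ?n) = (r\<^sup>2) ^ (2 * ?n) * inverse (- fst w) ^ (2 * ?n)"
   by (simp add: power_mult_distrib[symmetric] divide_inverse mult.commute)
  also have "(r\<^sup>2) ^ (2 * ?n) = J / r\<^sup>2"
  proof (rule nonzero_eq_divide_eq[THEN iffD2])
   show "r\<^sup>2 \<noteq> 0" using r2 by simp
   show "(r\<^sup>2) ^ (2 * ?n) * r\<^sup>2 = J" by (simp add: J_def power_add power_mult[symmetric]) (simp add: power2_eq_square)
  qed
  finally have i: "inverse (- (fst w / r\<^sup>2)) ^ (2 * ?n) = J / r\<^sup>2 * inverse (- fst w) ^ (2 * ?n)" .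
  have alg: "(- A / q + B) * X * e = B * X * e - A * (J / q * X) * e / J" if "J > 0" "q > 0" for A B q X e J :: real
   using that by (simp add: field_simps)
  show ?thesis unfolding kap_def kb_def k t i f'_def by (simp only: minus_divide_left alg[OF J r2])
 qed
 have kd: "\<exists>C. \<forall>w::'n kin. \<bar>kap w\<bar> * (1 + norm w) ^ N <= C" using kap_decay[where B=N] by metis
 then obtain C where C: "!!w::'n kin. \<bar>kap w\<bar> * (1 + norm w) ^ N <= C" by blast
 have i1: "integrable lborel (%w. U w * kap w)" by (rule wsol_weight_integrable(1)[OF Ub N kap_borel C])
 have i2: "integrable lborel (%w. U w * kap (kscale (1 / r) w))"
 proof (rule wsol_weight_integrable(1)[OF Ub N])
  show "(%w::'n kin. kap (kscale (1 / r) w)) \<in> borel_measurable borel" by measurable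
  define R where "R = max r 1"
  fix w :: "'n kin"
  have w: "w = kscale r (kscale (1 / r) w)" using r by (simp add: kscale_kscale)
  have "norm w <= 3 * R ^ 3 * norm (kscale (1 / r) w)"
   by (subst w) (rule norm_kscale_le, use r in \<open>auto simp: R_def\<close>)
  moreover have "1 <= R ^ 3" by (simp add: R_def one_le_power)
  ultimately have "1 + norm w <= 3 * R ^ 3 * (1 + norm (kscale (1 / r) w))" by (simp add: distrib_left)
  then have "(1 + norm w) ^ N <= (3 * R ^ 3 * (1 + norm (kscale (1 / r) w))) ^ N" by (rule power_mono) simp
  then have "\<bar>kap (kscale (1 / r) w)\<bar> * (1 + norm w) ^ N <= \<bar>kap (kscale (1 / r) w)\<bar> * (3 * R ^ 3 * (1 + norm (kscale (1 / r) w))) ^ N"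
   by (rule mult_left_mono) simp
  also have "\<dots> = (3 * R ^ 3) ^ N * (\<bar>kap (kscale (1 / r) w)\<bar> * (1 + norm (kscale (1 / r) w)) ^ N)"
   by (simp add: power_mult_distrib mult_ac)
  also have "\<dots> <= (3 * R ^ 3) ^ N * C" by (intro mult_left_mono C) (simp add: R_def)
  finally show "\<bar>kap (kscale (1 / r) w)\<bar> * (1 + norm w) ^ N <= (3 * R ^ 3) ^ N * C" .
 qed
 have "(\<integral>w. U w * kap w - U w * kap (kscale (1 / r) w) / J \<partial>lborel) = 0"
  using z unfolding eq by (simp add: right_diff_distrib)
 then have "(\<integral>w. U w * kap w \<partial>lborel) = (\<integral>w. U w * kap (kscale (1 / r) w) \<partial>lborel) / J"
  using i1 i2 by simp
 also have "(\<integral>w. U w * kap (kscale (1 / r) w) \<partial>lborel) = J * (\<integral>w. U (kscale r w) * kap (kscale (1 / r) (kscale r w)) \<partial>lborel)"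
  unfolding J_def by (rule vol_scaling_integral(1)[OF vol_scaling_kscale[OF r]]) measurable
 also have "(%w::'n kin. U (kscale r w) * kap (kscale (1 / r) (kscale r w))) = (%w. U (kscale r w) * kap w)"
  using r by (simp add: kscale_kscale)
 finally show ?thesis using J by simp
qed

section \<open>Averages recover the solution\<close>

lemma kmul_measurable2 [measurable (raw)]:
 "f \<in> M \<rightarrow>\<^sub>M borel ==> g \<in> M \<rightarrow>\<^sub>M borel ==> (%x. kmul (f x) (g x :: 'n::finite kin)) \<in> M \<rightarrow>\<^sub>M borel"
proof -
 assume f: "f \<in> M \<rightarrow>\<^sub>M borel" and g: "g \<in> M \<rightarrow>\<^sub>M borel"
 have "continuous_on UNIV (%p. kmul (fst p) (snd p) :: 'n kin)" by (intro continuous_intros)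
 from borel_measurable_continuous_Pair[OF f g this] show ?thesis .
qed

lemma power_le_mult: "0 <= x ==> x <= a * b ==> x ^ N <= a ^ N * b ^ N" for x a b :: real
 by (metis power_mono power_mult_distrib)

lemma left_decay:
 fixes h :: "'n::finite kin => real"
 assumes h: "!!w. \<bar>h w\<bar> * (1 + norm w) ^ N <= C"
 shows "\<bar>h (kmul (kinv z) w)\<bar> * (1 + norm w) ^ N <= C * (3 * (1 + norm z)) ^ N"
proof -
 define y where "y = kmul (kinv z) w"
 have w: "w = kmul z y" by (simp add: y_def)
 have "1 + norm w <= (3 * (1 + norm z)) * (1 + norm y)" using norm_kmul[of z y] unfolding w by (simp only: mult_ac)
 then have "(1 + norm w) ^ N <= (3 * (1 + norm z)) ^ N * (1 + norm y) ^ N" by (rule power_le_mult[rotated]) simp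
 then have "\<bar>h y\<bar> * (1 + norm w) ^ N <= \<bar>h y\<bar> * ((3 * (1 + norm z)) ^ N * (1 + norm y) ^ N)" by (rule mult_left_mono) simp
 also have "\<dots> = (\<bar>h y\<bar> * (1 + norm y) ^ N) * (3 * (1 + norm z)) ^ N" by (simp only: mult_ac)
 also have "\<dots> <= C * (3 * (1 + norm z)) ^ N" by (intro mult_right_mono h) simp
 finally show ?thesis by (simp only: y_def)
qed

definition avg :: "('n::finite kin => real) => 'n kin => real" where
 "avg U z = (\<integral>w. U (kmul z w) * kap w \<partial>lborel)"

lemma avg_scale:
 assumes "wsol U" "r > 0"
 shows "(\<integral>w. U (kmul z (kscale r w)) * kap w \<partial>lborel) = avg U z"
 unfolding avg_def by (rule kernel_scale_invariance[OF wsol_kmul[OF assms(1)] assms(2)])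

lemma avg_borel:
 assumes [measurable]: "U \<in> borel_measurable borel" shows "avg U \<in> borel_measurable borel"
 unfolding avg_def[abs_def] by (rule lborel.borel_measurable_lebesgue_integral) measurable

lemma avg_bound:
 fixes U :: "'n::finite kin => real"
 assumes U: "wsol U" shows "\<exists>M N. \<forall>z. \<bar>avg U z\<bar> <= M * (1 + norm z) ^ N"
proof -
 note Ub[measurable] = wsolD(1)[OF U]
 obtain N where N: "integrable lborel (%w. U w / (1 + norm w) ^ N)" using U unfolding wsol_def by blast
 have "\<exists>C. \<forall>w::'n kin. \<bar>kap w\<bar> * (1 + norm w) ^ N <= C" using kap_decay[where B=N] by metis
 then obtain C where C: "!!w::'n kin. \<bar>kap w\<bar> * (1 + norm w) ^ N <= C" by blast
 define I where "I = (\<integral>w. \<bar>U w / (1 + norm w) ^ N\<bar> \<partial>lborel)"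
 have "\<bar>avg U z\<bar> <= (C * 3 ^ N * I) * (1 + norm z) ^ N" for z
 proof -
  have km: "(%w. kap (kmul (kinv z) w)) \<in> borel_measurable borel" by measurable
  note d = wsol_weight_integrable[OF Ub N km left_decay[OF C]]
  have "avg U z = (\<integral>w. U w * kap (kmul (kinv z) w) \<partial>lborel)"
   unfolding avg_def using vol_scaling_integral(1)[OF vol_scaling_kmul, of "%w. U w * kap (kmul (kinv z) w)" z] by simp
  also have "\<bar>\<dots>\<bar> <= (\<integral>w. C * (3 * (1 + norm z)) ^ N * \<bar>U w / (1 + norm w) ^ N\<bar> \<partial>lborel)"
   by (rule integral_abs_bound_integral[OF d(1) integrable_mult_right[OF integrable_abs[OF N]] d(2)])
  also have "\<dots> = C * (3 * (1 + norm z)) ^ N * I" unfolding I_def by (rule integral_mult_right_zero)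
  finally show ?thesis by (simp only: power_mult_distrib mult_ac)
 qed
 then show ?thesis by blast
qed

text \<open>The average at z has the same value at every scale r, and as r tends to 0 it
  concentrates at z. For a merely integrable function the limit is taken after integrating z over a
  box: a right change of variables moves the shrinking translation to the indicator, which converges
  off the boundary of the box.\<close>

lemma avg_AE:
 fixes U :: "'n::finite kin => real"
 assumes U: "wsol U" shows "AE z in lborel. avg U z = kmass TYPE('n) * U z"
proof -
 note Ub[measurable] = wsolD(1)[OF U]
 note Ab[measurable] = avg_borel[OF Ub]
 obtain N where N: "integrable lborel (%w. U w / (1 + norm w) ^ N)" using U unfolding wsol_def by blast
 define I where "I = (\<integral>w. \<bar>U w / (1 + norm w) ^ N\<bar> \<partial>lborel)"
 have I: "I \<ge> 0" unfolding I_def by (intro integral_nonneg_AE AE_I2) simp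
 have box: "integrable lborel (%w. indicator (box a b) w * (avg U w - kmass TYPE('n) * U w)) \<and>
   (\<integral>w. indicator (box a b) w * (avg U w - kmass TYPE('n) * U w) \<partial>lborel) = 0" for a b :: "'n kin"
 proof -
  let ?B = "box a b"
  obtain \<rho> where \<rho>: "\<rho> \<ge> 0" "!!y. y \<in> ?B ==> norm y <= \<rho>"
  proof -
   obtain c where "\<forall>y\<in>?B. norm y <= c" using bounded_box[of a b] unfolding bounded_iff by blast
   then have "!!y. y \<in> ?B ==> norm y <= max c 0" by (meson max.coboundedI1)
   then show ?thesis using that[of "max c 0"] by simp
  qed
  define K where "K s = ((1 + \<rho>) * (1 + norm s) * 3) ^ N" for s :: "'n kin"
  have pt: "\<bar>indicator ?B (kmul z (kinv s)) * U z\<bar> <= K s * \<bar>U z / (1 + norm z) ^ N\<bar>" for z s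
  proof (cases "kmul z (kinv s) \<in> ?B")
   case True
   define y where "y = kmul z (kinv s)"
   have z: "z = kmul y s" unfolding y_def by (simp add: kmul_assoc) (cases z; cases s; simp add: kmul_def kinv_def)
   have "1 + norm z <= (1 + norm y) * (1 + norm s) * 3" unfolding z by (rule norm_kmul)
   also have "\<dots> <= (1 + \<rho>) * (1 + norm s) * 3" using \<rho>(2)[of y] True by (intro mult_right_mono) (auto simp: y_def)
   finally have k: "(1 + norm z) ^ N <= K s" unfolding K_def by (rule power_mono) simp
   have p: "(1 + norm z) ^ N > 0" by (intro zero_less_power add_pos_nonneg) auto
   have "\<bar>U z\<bar> = q * \<bar>U z / q\<bar>" if "q > 0" for q :: real using that by (simp add: abs_divide)
   then have "\<bar>U z\<bar> = (1 + norm z) ^ N * \<bar>U z / (1 + norm z) ^ N\<bar>" using p by blast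
   also have "\<dots> <= K s * \<bar>U z / (1 + norm z) ^ N\<bar>" by (intro mult_right_mono k) simp
   finally show ?thesis using True by simp
  next
   case False
   have "0 <= K s * \<bar>U z / (1 + norm z) ^ N\<bar>" unfolding K_def using \<rho>(1) by (intro mult_nonneg_nonneg zero_le_power) auto
   then show ?thesis using False by simp
  qed
  have pI: "integrable lborel (%z. indicator ?B (kmul z (kinv s)) * U z)"
   and pB: "(\<integral>z. \<bar>indicator ?B (kmul z (kinv s)) * U z\<bar> \<partial>lborel) <= K s * I" for s
  proof -
   have bi: "integrable lborel (%z. K s * \<bar>U z / (1 + norm z) ^ N\<bar>)" by (intro integrable_mult_right integrable_abs N)
   show i: "integrable lborel (%z. indicator ?B (kmul z (kinv s)) * U z)"
   proof (rule Bochner_Integration.integrable_bound[OF bi])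
    show "(%z. indicator ?B (kmul z (kinv s)) * U z) \<in> borel_measurable lborel" by measurable
    show "AE z in lborel. norm (indicator ?B (kmul z (kinv s)) * U z) <= norm (K s * \<bar>U z / (1 + norm z) ^ N\<bar>)"
     unfolding real_norm_def by (intro AE_I2 order_trans[OF pt abs_ge_self])
   qed
   have "(\<integral>z. \<bar>indicator ?B (kmul z (kinv s)) * U z\<bar> \<partial>lborel) <= (\<integral>z. K s * \<bar>U z / (1 + norm z) ^ N\<bar> \<partial>lborel)"
    by (intro integral_mono integrable_abs i bi pt)
   also have "\<dots> = K s * I" unfolding I_def by (rule integral_mult_right_zero)
   finally show "(\<integral>z. \<bar>indicator ?B (kmul z (kinv s)) * U z\<bar> \<partial>lborel) <= K s * I" .
  qed
  \<comment> \<open>The integral of U over the box translated from the right by \<open>s\<close>.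
    Its limit as \<open>s\<close> shrinks replaces the missing continuity of U.\<close>
  define J where "J s = (\<integral>z. indicator ?B z * U (kmul z s) \<partial>lborel)" for s
  have Jeq: "J s = (\<integral>z. indicator ?B (kmul z (kinv s)) * U z \<partial>lborel)"
   and Jint: "integrable lborel (%z. indicator ?B z * U (kmul z s))"
   and Jabs: "(\<integral>z. \<bar>indicator ?B z * U (kmul z s)\<bar> \<partial>lborel) <= K s * I" for s
  proof -
   have fm: "(%z. indicator ?B (kmul z (kinv s)) * U z) \<in> borel_measurable borel" by measurable
   then have fa: "(%z. \<bar>indicator ?B (kmul z (kinv s)) * U z\<bar>) \<in> borel_measurable borel" by measurable
   note v = vol_scaling_kmul_right[of s]
   show "J s = (\<integral>z. indicator ?B (kmul z (kinv s)) * U z \<partial>lborel)"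
    unfolding J_def vol_scaling_integral(1)[OF v fm] by simp
   show "integrable lborel (%z. indicator ?B z * U (kmul z s))"
    using vol_scaling_integral(2)[OF v fm] pI by simp
   have "(\<integral>z. \<bar>indicator ?B z * U (kmul z s)\<bar> \<partial>lborel) = (\<integral>z. \<bar>indicator ?B (kmul z (kinv s)) * U z\<bar> \<partial>lborel)"
    unfolding vol_scaling_integral(1)[OF v fa] by simp
   then show "(\<integral>z. \<bar>indicator ?B z * U (kmul z s)\<bar> \<partial>lborel) <= K s * I" using pB by (simp only:)
  qed
  have Jb: "\<bar>J s\<bar> <= K s * I" for s
   unfolding J_def by (rule order_trans[OF integral_abs_bound Jabs])
  have Kr: "K (kscale r w) <= K0 * (1 + norm w) ^ N" if "0 <= r" "r <= 1" "K0 = ((1 + \<rho>) * 9) ^ N" for r w K0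
  proof -
   have "norm (kscale r w) <= 3 * norm w" using norm_kscale_le[of r 1 w] that by simp
   then have "1 + norm (kscale r w) <= 3 * (1 + norm w)" by simp
   then have "(1 + \<rho>) * (1 + norm (kscale r w)) * 3 <= (1 + \<rho>) * (3 * (1 + norm w)) * 3" using \<rho>(1) by (intro mult_right_mono mult_left_mono) auto
   also have "\<dots> = ((1 + \<rho>) * 9) * (1 + norm w)" by (simp add: algebra_simps)
   finally show ?thesis unfolding K_def that(3) by (rule power_le_mult[rotated]) (use \<rho>(1) in simp)
  qed
  define K0 where "K0 = ((1 + \<rho>) * 9) ^ N"
  have K0: "K0 \<ge> 0" using \<rho>(1) by (simp add: K0_def)
  note Kr = Kr[OF _ _ K0_def]
  have kw: "integrable lborel (%w::'n kin. kap w * (1 + norm w) ^ N * (K0 * I))" by (intro integrable_mult_left kap_weight_integrable)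
  \<comment> \<open>The scale r appears only on the right; on the left it has gone, by scale
    invariance of the average.\<close>
  have fub: "integrable lborel (%z. indicator ?B z * avg U z) \<and> (\<integral>z. indicator ?B z * avg U z \<partial>lborel) = (\<integral>w. kap w * J (kscale r w) \<partial>lborel)"
   if r: "0 < r" "r <= 1" for r
  proof -
   let ?f = "%(w, z). indicator ?B z * (U (kmul z (kscale r w)) * kap w)"
   have fm[measurable]: "?f \<in> borel_measurable (lborel \<Otimes>\<^sub>M lborel)" by measurable
   have fi: "integrable (lborel \<Otimes>\<^sub>M lborel) ?f"
   proof (rule lborel_pair.Fubini_integrable[OF fm])
    have eq: "(\<integral>z. norm (?f (w, z)) \<partial>lborel) = kap w * (\<integral>z. \<bar>indicator ?B z * U (kmul z (kscale r w))\<bar> \<partial>lborel)" for w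
     using kap_nonneg[of w] by (subst integral_mult_right_zero[symmetric]) (simp add: abs_mult mult_ac)
    show "integrable lborel (%w. \<integral>z. norm (?f (w, z)) \<partial>lborel)"
    proof (rule Bochner_Integration.integrable_bound[OF kw])
     show "(%w. \<integral>z. norm (?f (w, z)) \<partial>lborel) \<in> borel_measurable lborel"
      by (rule lborel.borel_measurable_lebesgue_integral) measurable
     have "norm (\<integral>z. norm (?f (w, z)) \<partial>lborel) <= norm (kap w * (1 + norm w) ^ N * (K0 * I))" for w
     proof -
      have k: "K (kscale r w) * I <= K0 * (1 + norm w) ^ N * I" using Kr[of r w] r I by (intro mult_right_mono) auto
      have "0 <= (\<integral>z. \<bar>indicator ?B z * U (kmul z (kscale r w))\<bar> \<partial>lborel)" by (intro integral_nonneg_AE AE_I2) simp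
      then have "norm (\<integral>z. norm (?f (w, z)) \<partial>lborel) = kap w * (\<integral>z. \<bar>indicator ?B z * U (kmul z (kscale r w))\<bar> \<partial>lborel)"
       unfolding eq using kap_nonneg[of w] by simp
      also have "\<dots> <= kap w * (K0 * (1 + norm w) ^ N * I)"
       by (intro mult_left_mono order_trans[OF Jabs k] kap_nonneg)
      also have "\<dots> = kap w * (1 + norm w) ^ N * (K0 * I)" by (simp only: mult_ac)
      finally show ?thesis unfolding real_norm_def by (rule order_trans) simp
     qed
     then show "AE w in lborel. norm (\<integral>z. norm (?f (w, z)) \<partial>lborel) <= norm (kap w * (1 + norm w) ^ N * (K0 * I))" by (rule AE_I2)
    qed
    have "integrable lborel (%z. indicator ?B z * U (kmul z (kscale r w)) * kap w)" for w by (intro integrable_mult_left Jint)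
    then show "AE w in lborel. integrable lborel (%z. ?f (w, z))" by (simp add: mult.assoc)
   qed
   have e: "(\<integral>w. indicator ?B z * (U (kmul z (kscale r w)) * kap w) \<partial>lborel) = indicator ?B z * avg U z" for z
    unfolding integral_mult_right_zero avg_scale[OF U r(1)] ..
   have e': "(\<integral>z. indicator ?B z * (U (kmul z (kscale r w)) * kap w) \<partial>lborel) = kap w * J (kscale r w)" for w
    unfolding J_def by (subst integral_mult_right_zero[symmetric]) (simp add: mult_ac)
   show ?thesis using lborel_pair.integrable_snd[OF fi] lborel_pair.Fubini_integral[OF fi] unfolding e e' by blast
  qed
  let ?r = "%m. 1 / real (Suc m)"
  have r: "0 < ?r m" "?r m <= 1" for m by auto
  have rl: "?r \<longlonglongrightarrow> 0" using LIMSEQ_inverse_real_of_nat by (simp add: inverse_eq_divide)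
  have nul: "AE z in lborel. z \<notin> cbox a b - ?B"
   by (rule AE_not_in[OF null_sets_cbox_Diff_box])
  have J0: "(%m. J (kscale (?r m) w)) \<longlonglongrightarrow> (\<integral>z. indicator ?B z * U z \<partial>lborel)" for w
   unfolding Jeq
  proof (rule integral_dominated_convergence[where w="%z. (K0 * (1 + norm w) ^ N) * \<bar>U z / (1 + norm z) ^ N\<bar>"])
   show "integrable lborel (%z. (K0 * (1 + norm w) ^ N) * \<bar>U z / (1 + norm z) ^ N\<bar>)" by (intro integrable_mult_right integrable_abs N)
   have "norm (indicator ?B (kmul z (kinv (kscale (?r m) w))) * U z) <= (K0 * (1 + norm w) ^ N) * \<bar>U z / (1 + norm z) ^ N\<bar>" for z m
    unfolding real_norm_def by (rule order_trans[OF pt mult_right_mono[OF Kr]]) (use r[of m] in auto)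
   then show "AE z in lborel. norm (indicator ?B (kmul z (kinv (kscale (?r m) w))) * U z) <= (K0 * (1 + norm w) ^ N) * \<bar>U z / (1 + norm z) ^ N\<bar>" for m
    by (rule AE_I2)
   show "AE z in lborel. (%m. indicator ?B (kmul z (kinv (kscale (?r m) w))) * U z) \<longlonglongrightarrow> indicator ?B z * U z"
    using nul
   proof eventually_elim
    case (elim z)
    have c: "continuous_on UNIV (%r. kmul z (kinv (kscale r w)))" by (intro continuous_intros)
    have "kmul z (kinv (kscale 0 w)) = z" by (cases z; cases w) (simp add: kmul_def kinv_def kscale_def)
    then have l: "(%m. kmul z (kinv (kscale (?r m) w))) \<longlonglongrightarrow> z"
     using continuous_on_tendsto_compose[OF c rl] by simp
    \<comment> \<open>Off the boundary of the box its indicator is locally constant, so the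
      translated indicators are eventually equal to their limit.\<close>
    have "\<exists>S. open S \<and> z \<in> S \<and> (\<forall>y\<in>S. indicator ?B y = (indicator ?B z :: real))"
    proof (cases "z \<in> ?B")
     case True then show ?thesis by (intro exI[of _ ?B]) (simp add: open_box)
    next
     case False
     then have "z \<in> - cbox a b" using elim by simp
     moreover have "y \<notin> ?B" if "y \<in> - cbox a b" for y using that box_subset_cbox by blast
     ultimately show ?thesis using False by (intro exI[of _ "- cbox a b"]) (simp add: open_Compl closed_cbox)
    qed
    then obtain S where S: "open S" "z \<in> S" "!!y. y \<in> S ==> indicator ?B y = (indicator ?B z :: real)" by blast
    have "eventually (%m. kmul z (kinv (kscale (?r m) w)) \<in> S) sequentially" by (rule topological_tendstoD[OF l S(1,2)])
    then have "eventually (%m. indicator ?B (kmul z (kinv (kscale (?r m) w))) * U z = indicator ?B z * U z) sequentially"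
     by eventually_elim (simp only: S(3))
    then show ?case by (rule tendsto_eventually)
   qed
   show "(%z. indicator ?B z * U z) \<in> borel_measurable lborel" by measurable
   show "(%z. indicator ?B (kmul z (kinv (kscale (?r m) w))) * U z) \<in> borel_measurable lborel" for m by measurable
  qed
  have lim: "(%m. \<integral>w. kap w * J (kscale (?r m) w) \<partial>lborel) \<longlonglongrightarrow> integral\<^sup>L lborel (%w::'n kin. kap w * (\<integral>z. indicator ?B z * U z \<partial>lborel))"
  proof (rule integral_dominated_convergence[where w="%w::'n kin. kap w * (1 + norm w) ^ N * (K0 * I)"])
   show "integrable lborel (%w::'n kin. kap w * (1 + norm w) ^ N * (K0 * I))" by (rule kw)
   show "AE w::'n kin in lborel. (%m. kap w * J (kscale (?r m) w)) \<longlonglongrightarrow> kap w * (\<integral>z. indicator ?B z * U z \<partial>lborel)"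
    by (intro AE_I2 tendsto_mult tendsto_const J0)
   show "(%w::'n kin. kap w * (\<integral>z. indicator ?B z * U z \<partial>lborel)) \<in> borel_measurable lborel" by measurable
   have Jm[measurable]: "J \<in> borel_measurable borel"
    unfolding J_def[abs_def] by (rule lborel.borel_measurable_lebesgue_integral) measurable
   show "(%w. kap w * J (kscale (?r m) w)) \<in> borel_measurable lborel" for m by measurable
   have "norm (kap w * J (kscale (?r m) w)) <= kap w * (1 + norm w) ^ N * (K0 * I)" for m w
   proof -
    have "K (kscale (?r m) w) * I <= K0 * (1 + norm w) ^ N * I" using Kr[of "?r m" w] r[of m] I by (intro mult_right_mono) auto
    then have "\<bar>J (kscale (?r m) w)\<bar> <= K0 * (1 + norm w) ^ N * I" by (rule order_trans[OF Jb])
    then have "kap w * \<bar>J (kscale (?r m) w)\<bar> <= kap w * (K0 * (1 + norm w) ^ N * I)" by (intro mult_left_mono kap_nonneg)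
    also have "\<dots> = kap w * (1 + norm w) ^ N * (K0 * I)" by (simp only: mult_ac)
    finally show ?thesis using kap_nonneg[of w] by (simp add: abs_mult)
   qed
   then show "AE w in lborel. norm (kap w * J (kscale (?r m) w)) <= kap w * (1 + norm w) ^ N * (K0 * I)" for m by (rule AE_I2)
  qed
  have "(\<integral>w. kap w * J (kscale (?r m) w) \<partial>lborel) = (\<integral>z. indicator ?B z * avg U z \<partial>lborel)" for m
   using fub[OF r] by metis
  then have "(%m::nat. \<integral>z. indicator ?B z * avg U z \<partial>lborel) \<longlonglongrightarrow> integral\<^sup>L lborel (%w::'n kin. kap w * (\<integral>z. indicator ?B z * U z \<partial>lborel))"
   using lim by (simp only:)
  from LIMSEQ_unique[OF tendsto_const this]
  have eq: "(\<integral>z. indicator ?B z * avg U z \<partial>lborel) = kmass TYPE('n) * (\<integral>z. indicator ?B z * U z \<partial>lborel)"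
   unfolding kmass_def by simp
  have i1: "integrable lborel (%z. indicator ?B z * avg U z)" using fub[OF r] by blast
  have i2: "integrable lborel (%z. kmass TYPE('n) * (indicator ?B z * U z))"
  proof -
   have "integrable lborel (%z. indicator ?B z * U (kmul z 0))" by (rule Jint)
   moreover have "kmul z 0 = z" for z :: "'n kin" by (cases z) (simp add: kmul_def zero_prod_def)
   ultimately show ?thesis by simp
  qed
  have "(%w. indicator ?B w * (avg U w - kmass TYPE('n) * U w)) = (%w. indicator ?B w * avg U w - kmass TYPE('n) * (indicator ?B w * U w))"
   by (simp add: algebra_simps)
  then show ?thesis using i1 i2 eq by simp
 qed
 have "AE w in lborel. avg U w - kmass TYPE('n) * U w = 0"
 proof (rule AE_zero_from_boxes)
  show "(%w. avg U w - kmass TYPE('n) * U w) \<in> borel_measurable borel" by measurable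
  show "integrable lborel (%w. indicator (box a b) w * (avg U w - kmass TYPE('n) * U w))" for a b using box by blast
  show "(\<integral>w. indicator (box a b) w * (avg U w - kmass TYPE('n) * U w) \<partial>lborel) = 0" for a b using box by blast
 qed
 then show ?thesis by simp
qed

section \<open>The mean value formula\<close>

text \<open>The formula holds at every point and every scale, not just almost everywhere. This
  pointwise form and the polynomial bound are all that the smoothness argument uses.\<close>

definition repro :: "('n::finite kin => real) => bool" where
 "repro u \<longleftrightarrow> u \<in> borel_measurable borel \<and> (\<exists>M N. \<forall>w. \<bar>u w\<bar> <= M * (1 + norm w) ^ N) \<and>
   (\<forall>z. \<forall>r>0. (\<integral>w. u (kmul z (kscale r w)) * kap w \<partial>lborel) = kmass TYPE('n) * u z)"

text \<open>The normalised average is the good representative: it agrees with U almost everywhere,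
  so it may replace U inside the average, which then reproduces it everywhere.\<close>

lemma wsol_repro:
 fixes U :: "'n::finite kin => real"
 assumes U: "wsol U"
 obtains u where "repro u" "AE z in lborel. u z = U z"
proof -
 let ?m = "kmass TYPE('n)"
 have m: "?m > 0" by (rule kmass_pos)
 note Ub[measurable] = wsolD(1)[OF U]
 note Ab[measurable] = avg_borel[OF Ub]
 define u where "u z = avg U z / ?m" for z
 have um[measurable]: "u \<in> borel_measurable borel" unfolding u_def[abs_def] by measurable
 have ae: "AE z in lborel. u z = U z" using avg_AE[OF U]
 proof eventually_elim
  case (elim z) then show ?case using m by (simp add: u_def)
 qed
 have "repro u" unfolding repro_def
 proof (intro conjI allI impI)
  show "u \<in> borel_measurable borel" by (rule um)
  obtain M N where MN: "!!z. \<bar>avg U z\<bar> <= M * (1 + norm z) ^ N" using avg_bound[OF U] by blast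
  have "\<bar>u z\<bar> <= (M / ?m) * (1 + norm z) ^ N" for z
   using MN[of z] m by (simp add: u_def abs_divide divide_right_mono)
  then show "\<exists>M N. \<forall>z. \<bar>u z\<bar> <= M * (1 + norm z) ^ N" by blast
  fix z :: "'n kin" and r :: real assume r: "r > 0"
  have "AE w in lborel. u (kmul z (kscale r w)) = U (kmul z (kscale r w))"
   by (rule vol_scaling_AE[OF vol_scaling_comp[OF vol_scaling_kmul vol_scaling_kscale[OF r]] ae])
  then have a: "AE w in lborel. u (kmul z (kscale r w)) * kap w = U (kmul z (kscale r w)) * kap w"
   by eventually_elim simp
  have "(\<integral>w. u (kmul z (kscale r w)) * kap w \<partial>lborel) = (\<integral>w. U (kmul z (kscale r w)) * kap w \<partial>lborel)"
   by (rule integral_cong_AE[OF _ _ a]) measurable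
  also have "\<dots> = avg U z" by (rule avg_scale[OF U r])
  also have "\<dots> = ?m * u z" using m by (simp add: u_def)
  finally show "(\<integral>w. u (kmul z (kscale r w)) * kap w \<partial>lborel) = ?m * u z" .
 qed
 then show ?thesis using ae that by blast
qed

lemma reproD:
 fixes u :: "'n::finite kin => real"
 assumes "repro u"
 shows "u \<in> borel_measurable borel" "r > 0 ==> (\<integral>w. u (kmul z (kscale r w)) * kap w \<partial>lborel) = kmass TYPE('n) * u z"
 using assms unfolding repro_def by blast+

lemma repro_kscale:
 fixes u :: "'n::finite kin => real"
 assumes u: "repro u" and R: "R > 0" shows "repro (%w. u (kscale R w))"
 unfolding repro_def
proof (intro conjI allI impI)
 note [measurable] = reproD(1)[OF u]
 show "(%w. u (kscale R w)) \<in> borel_measurable borel" by measurable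
 obtain M N where MN: "!!z. \<bar>u z\<bar> <= M * (1 + norm z) ^ N" using u unfolding repro_def by blast
 have M: "M \<ge> 0" using order_trans[OF abs_ge_zero MN[of 0]] by simp
 define S where "S = max 1 R"
 have "\<bar>u (kscale R z)\<bar> <= (M * (3 * S ^ 3) ^ N) * (1 + norm z) ^ N" for z
 proof -
  have S: "1 <= S ^ 3" by (simp add: S_def one_le_power)
  have "norm (kscale R z) <= 3 * S ^ 3 * norm z" by (rule norm_kscale_le) (use R in \<open>auto simp: S_def\<close>)
  then have "1 + norm (kscale R z) <= (3 * S ^ 3) * (1 + norm z)" using S by (simp add: distrib_left)
  then have "(1 + norm (kscale R z)) ^ N <= (3 * S ^ 3) ^ N * (1 + norm z) ^ N" by (rule power_le_mult[rotated]) simp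
  then have "M * (1 + norm (kscale R z)) ^ N <= M * ((3 * S ^ 3) ^ N * (1 + norm z) ^ N)" using M by (rule mult_left_mono)
  then show ?thesis using MN[of "kscale R z"] by (simp only: mult.assoc)
 qed
 then show "\<exists>M N. \<forall>z. \<bar>u (kscale R z)\<bar> <= M * (1 + norm z) ^ N" by blast
 fix z :: "'n kin" and r :: real assume "r > 0"
 then have "R * r > 0" using R by simp
 from reproD(2)[OF u this, of "kscale R z"]
 show "(\<integral>w. u (kscale R (kmul z (kscale r w))) * kap w \<partial>lborel) = kmass TYPE('n) * u (kscale R z)"
  by (simp only: kscale_mul kscale_kscale)
qed

text \<open>The vector fields generating left translations; they commute with the equation and have
 positive degree \<open>j\<close> under the kinetic scaling.\<close>

definition gen_field :: "('n::finite kin => 'n kin) => nat => bool" where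
 "gen_field d j \<longleftrightarrow> continuous_on UNIV d \<and> (\<exists>C\<ge>0. \<forall>w. norm (d w) <= C * (1 + norm w)) \<and> j \<ge> 1 \<and>
   (\<forall>z w h. kmul (z + h *\<^sub>R d z) w = kmul z w + h *\<^sub>R d (kmul z w)) \<and>
   (\<forall>w h. d (w + h *\<^sub>R d w) = d w) \<and>
   (\<forall>R z h. kscale R (z + h *\<^sub>R d z) = kscale R z + (R ^ j * h) *\<^sub>R d (kscale R z))"

section \<open>Derivatives along the generators of left translations\<close>

text \<open>The linear part of \<open>kmul a\<close>: it sends a displacement p before the
  translation to the displacement after it.\<close>

definition klin :: "'n::finite kin => 'n kin => 'n kin" where
 "klin a p = (fst p, fst (snd p) + fst p *\<^sub>R snd (snd a), snd (snd p))"

lemma kmul_klin: "kmul a (w + s *\<^sub>R p) = kmul a w + s *\<^sub>R klin a p"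
 by (cases a; cases w; cases p) (simp add: kmul_def klin_def algebra_simps)

lemma norm_klin: "norm (klin (kinv z) p) <= 3 * (1 + norm z) * norm p"
proof -
 have "snd (snd (kinv z)) = - snd (snd z)" by (cases z) (simp add: kinv_def)
 then have v: "norm (snd (snd (kinv z))) <= norm z" using norm_kin_ge(3)[of z] by simp
 note p = norm_kin_ge[of p]
 have "norm (klin (kinv z) p) <= \<bar>fst p\<bar> + norm (fst (snd p) + fst p *\<^sub>R snd (snd (kinv z))) + norm (snd (snd p))"
  unfolding klin_def by (rule norm_kin_le)
 also have "norm (fst (snd p) + fst p *\<^sub>R snd (snd (kinv z))) <= norm (fst (snd p)) + norm (fst p *\<^sub>R snd (snd (kinv z)))"
  by (rule norm_triangle_ineq)
 also have "norm (fst p *\<^sub>R snd (snd (kinv z))) <= norm p * norm z" unfolding norm_scaleR using p v by (intro mult_mono) auto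
 finally have "norm (klin (kinv z) p) <= 3 * norm p + norm p * norm z" using p by linarith
 moreover have "3 * (1 + norm z) * norm p = 3 * norm p + 3 * (norm p * norm z)" by (simp add: algebra_simps)
 moreover have "0 <= norm p * norm z" by simp
 ultimately show ?thesis by linarith
qed

text \<open>Following the straight integral line of the field is a left translation by a fixed
  element, and therefore preserves volume.\<close>

lemma gen_field_shift:
 assumes d: "gen_field d j"
 shows "w + h *\<^sub>R d w = kmul (h *\<^sub>R d 0) w"
proof -
 have "kmul (0 + h *\<^sub>R d 0) w = kmul 0 w + h *\<^sub>R d (kmul 0 w)" using d unfolding gen_field_def by blast
 moreover have "kmul 0 w = w" by (cases w) (simp add: kmul_def zero_prod_def)
 ultimately show ?thesis by simp
qed

text \<open>The derivative falls on the smooth kernel, so \<open>u\<close> need not be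
  differentiable beforehand. \<open>A\<close> and \<open>N'\<close> are chosen before u and M, and
  the estimate is linear in M: it is going to be applied to all rescalings of one function at
  once.\<close>

lemma gen_field_derivative:
 fixes d :: "'n::finite kin => 'n kin"
 assumes d: "gen_field d j"
 shows "\<exists>A N'. \<forall>u M. repro u \<and> (\<forall>w. \<bar>u w\<bar> <= M * (1 + norm w) ^ N) -->
   (\<exists>X. repro X \<and> (\<forall>z. \<bar>X z\<bar> <= A * M * (1 + norm z) ^ N') \<and>
    (\<forall>z. ((%h. u (z + h *\<^sub>R d z)) has_real_derivative X z) (at 0)))"
proof -
 let ?m = "kmass TYPE('n)"
 let ?D = "2 * DIM('n kin)"
 have m: "?m > 0" by (rule kmass_pos)
 have dc: "continuous_on UNIV d" and d1: "!!z w h. kmul (z + h *\<^sub>R d z) w = kmul z w + h *\<^sub>R d (kmul z w)"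
  and d2: "!!w h. d (w + h *\<^sub>R d w) = d w" using d unfolding gen_field_def by blast+
 obtain Cd where Cd: "Cd \<ge> 0" "!!w. norm (d w) <= Cd * (1 + norm w)" using d unfolding gen_field_def by blast
 have [measurable]: "d \<in> borel_measurable borel" by (rule borel_measurable_continuous_onI[OF dc])
 have nS: "1 + norm (w + h *\<^sub>R d w) <= (1 + Cd) * (1 + norm w)" if "\<bar>h\<bar> <= 1" for w h
 proof -
  have "norm (w + h *\<^sub>R d w) <= norm w + \<bar>h\<bar> * norm (d w)" using norm_triangle_ineq[of w "h *\<^sub>R d w"] by simp
  also have "\<bar>h\<bar> * norm (d w) <= 1 * (Cd * (1 + norm w))" using that Cd by (intro mult_mono) auto
  finally show ?thesis by (simp add: algebra_simps)
 qed
 have inv: "(w - h *\<^sub>R d w) + h *\<^sub>R d (w - h *\<^sub>R d w) = w" for w h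
 proof -
  have "d (w - h *\<^sub>R d w) = d w" using d2[of w "- h"] by simp
  then show ?thesis by simp
 qed
 \<comment> \<open>Powers of the norm to be absorbed by the decay of the kernel: N for u, one for
   the linear growth of the field, and the rest to make the integral converge.\<close>
 define B where "B = N + 1 + ?D"
 obtain C where C: "C \<ge> 0" "!!w::'n kin. norm (kapg w) * (1 + norm w) ^ B <= C" using kap_decay[where B=B] by metis
 define W where "W = integral\<^sup>L lborel (%w::'n kin. 1 / (1 + norm w) ^ ?D)"
 define K where "K = (1 + Cd) * 3"
 define A where "A = C * K ^ B * 3 * Cd * W / ?m"
 have K: "K \<ge> 0" using Cd(1) by (simp add: K_def)
 have main: "\<exists>X. repro X \<and> (\<forall>z. \<bar>X z\<bar> <= A * M * (1 + norm z) ^ (B + 1)) \<and>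
    (\<forall>z. ((%h. u (z + h *\<^sub>R d z)) has_real_derivative X z) (at 0))"
  if u: "repro u" and M: "!!w. \<bar>u w\<bar> <= M * (1 + norm w) ^ N" for u M
 proof -
  note um[measurable] = reproD(1)[OF u]
  have M0: "M \<ge> 0" using order_trans[OF abs_ge_zero M[of 0]] by simp
  define l where "l z w = klin (kinv z) (d w)" for z w
  have [measurable]: "l z \<in> borel_measurable borel" for z
   unfolding l_def[abs_def] klin_def by (intro borel_measurable_continuous_onI continuous_intros dc)
  have yl: "kmul (kinv z) (w - h *\<^sub>R d w) = kmul (kinv z) w - h *\<^sub>R l z w" for z w h
   using kmul_klin[of "kinv z" w "- h" "d w"] by (simp add: l_def)
  \<comment> \<open>The shift of z is a left translation of the integration variable. The field is
    constant along its own integral lines, so the inverse shift is subtraction of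
    \<open>h *\<^sub>R d w\<close>.\<close>
  have shift: "?m * u (z + h *\<^sub>R d z) = (\<integral>w. u w * kap (kmul (kinv z) w - h *\<^sub>R l z w) \<partial>lborel)" for z h
  proof -
   let ?g = "kmul (h *\<^sub>R d 0)"
   let ?f = "%w. u w * kap (kmul (kinv z) (w - h *\<^sub>R d w))"
   have "?m * u (z + h *\<^sub>R d z) = (\<integral>w. u (kmul (z + h *\<^sub>R d z) w) * kap w \<partial>lborel)"
    using reproD(2)[OF u zero_less_one, of "z + h *\<^sub>R d z"] by simp
   also have "\<dots> = (\<integral>w. ?f (kmul (h *\<^sub>R d 0) (kmul z w)) \<partial>lborel)"
   proof (intro Bochner_Integration.integral_cong refl)
    fix w
    have s: "kmul (h *\<^sub>R d 0) (kmul z w) = kmul z w + h *\<^sub>R d (kmul z w)" by (rule gen_field_shift[OF d, symmetric])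
    show "u (kmul (z + h *\<^sub>R d z) w) * kap w = ?f (kmul (h *\<^sub>R d 0) (kmul z w))" by (simp add: s d1 d2)
   qed
   also have "\<dots> = (\<integral>w. ?f w \<partial>lborel)"
   proof -
    have fm: "?f \<in> borel_measurable borel" by measurable
    show ?thesis
     using vol_scaling_integral(1)[OF vol_scaling_comp[OF vol_scaling_kmul[of "h *\<^sub>R d 0"] vol_scaling_kmul[of z]] fm] by simp
   qed
   finally show ?thesis by (simp only: yl)
  qed
  define F' where "F' z w = - (u w * (kapg (kmul (kinv z) w) \<bullet> l z w))" for z w
  define Bd where "Bd z w = (M * C * K ^ B * 3 * Cd * (1 + norm z) ^ (B + 1)) * (1 / (1 + norm w) ^ ?D)" for z w :: "'n kin"
  have Bdi: "integrable lborel (Bd z)" for z unfolding Bd_def[abs_def] by (intro integrable_mult_right integrable_weight)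
  have pb: "\<bar>u w * (kapg (kmul (kinv z) w - h *\<^sub>R l z w) \<bullet> l z w)\<bar> <= Bd z w" if h: "\<bar>h\<bar> <= 1" for z w h
  proof -
   define y where "y = kmul (kinv z) w - h *\<^sub>R l z w"
   define a where "a = 1 + norm w" define b where "b = 1 + norm z" define c where "c = 1 + norm y"
   have pos: "a > 0" "b > 0" "c > 0" unfolding a_def b_def c_def by (intro add_pos_nonneg; simp)+
   have zy: "kmul z y = w - h *\<^sub>R d w" unfolding y_def yl[symmetric] by simp
   have "a <= (1 + Cd) * (1 + norm (w - h *\<^sub>R d w))" using nS[OF h, of "w - h *\<^sub>R d w"] unfolding inv a_def .
   also have "\<dots> <= (1 + Cd) * (b * c * 3)" unfolding zy[symmetric] b_def c_def using Cd(1) by (intro mult_left_mono norm_kmul) auto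
   also have "\<dots> = (K * b) * c" by (simp add: K_def mult_ac)
   finally have "a ^ B <= (K * b) ^ B * c ^ B" by (rule power_le_mult[rotated]) (use pos in simp)
   then have "norm (kapg y) * a ^ B <= norm (kapg y) * ((K * b) ^ B * c ^ B)" by (rule mult_left_mono) simp
   also have "\<dots> = (norm (kapg y) * c ^ B) * (K * b) ^ B" by (simp only: mult_ac)
   also have "\<dots> <= C * (K * b) ^ B" unfolding c_def using K pos by (intro mult_right_mono C(2)) simp
   finally have k: "norm (kapg y) * a ^ B <= C * (K * b) ^ B" .
   have "norm (l z w) <= 3 * (1 + norm z) * norm (d w)" unfolding l_def by (rule norm_klin)
   also have "\<dots> <= 3 * b * (Cd * a)" unfolding a_def b_def by (rule mult_left_mono[OF Cd(2)]) simp
   finally have ln: "norm (l z w) <= 3 * b * (Cd * a)" .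
   have "\<bar>u w * (kapg y \<bullet> l z w)\<bar> <= (M * a ^ N) * (norm (kapg y) * (3 * b * (Cd * a)))"
    unfolding abs_mult
   proof (intro mult_mono)
    show "\<bar>u w\<bar> <= M * a ^ N" unfolding a_def by (rule M)
    show "\<bar>kapg y \<bullet> l z w\<bar> <= norm (kapg y) * (3 * b * (Cd * a))"
     by (rule order_trans[OF Cauchy_Schwarz_ineq2 mult_left_mono[OF ln norm_ge_zero]])
   qed (use M0 pos in auto)
   also have "\<dots> = (norm (kapg y) * a ^ B) * (M * (3 * Cd * b) / a ^ ?D)"
   proof -
    have alg: "(M * p) * (n * (3 * b * (Cd * a))) = (n * (p * a * x)) * (M * (3 * Cd * b) / x)" if "x > 0" for n p x :: real
     using that by simp
    have "a ^ B = a ^ N * a * a ^ ?D" by (simp only: B_def power_add power_one_right)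
    then show ?thesis using alg[of "a ^ ?D" "a ^ N"] pos(1) by (simp only: zero_less_power)
   qed
   also have "\<dots> <= (C * (K * b) ^ B) * (M * (3 * Cd * b) / a ^ ?D)"
    by (rule mult_right_mono[OF k]) (use M0 Cd pos in auto)
   also have "\<dots> = Bd z w" unfolding Bd_def a_def[symmetric] b_def[symmetric] by (simp add: power_mult_distrib mult_ac)
   finally show ?thesis unfolding y_def .
  qed
  have der: "((%h. u w * kap (kmul (kinv z) w - h *\<^sub>R l z w)) has_real_derivative - (u w * (kapg (kmul (kinv z) w - s *\<^sub>R l z w) \<bullet> l z w))) (at s)"
   for z w s
  proof -
   define y where "y = kmul (kinv z) w" 
   have g: "(kap has_derivative (%p. p \<bullet> kapg (y - s *\<^sub>R l z w))) (at (y - s *\<^sub>R l z w))"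
    using kap_GDERIV by (simp add: gderiv_def)
   have "((%h. y - h *\<^sub>R l z w) has_derivative (%h. - (h *\<^sub>R l z w))) (at s)" by (auto intro!: derivative_eq_intros)
   from has_derivative_compose[OF this g]
   have "((%h. kap (y - h *\<^sub>R l z w)) has_derivative (%h. (- (h *\<^sub>R l z w)) \<bullet> kapg (y - s *\<^sub>R l z w))) (at s)" by simp
   then have "((%h. kap (y - h *\<^sub>R l z w)) has_real_derivative - (kapg (y - s *\<^sub>R l z w) \<bullet> l z w)) (at s)"
    by (rule has_derivative_imp_has_field_derivative) (simp add: inner_commute)
   from DERIV_cmult[OF this, of "u w"] show ?thesis by (simp add: y_def)
  qed
  have D: "integrable lborel (F' z) \<and> ((%h. \<integral>w. u w * kap (kmul (kinv z) w - h *\<^sub>R l z w) \<partial>lborel) has_real_derivative (\<integral>w. F' z w \<partial>lborel)) (at 0)" for z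
  proof -
   have bnd: "\<bar>u w * kap (kmul (kinv z) w - h *\<^sub>R l z w) - u w * kap (kmul (kinv z) w - 0 *\<^sub>R l z w)\<bar> <= \<bar>h\<bar> * Bd z w" if h: "\<bar>h\<bar> <= 1" for h w
   proof (rule mvt_line[of h "%h. u w * kap (kmul (kinv z) w - h *\<^sub>R l z w)"])
    fix s assume "\<bar>s\<bar> <= \<bar>h\<bar>"
    then have s: "\<bar>s\<bar> <= 1" using h by simp
    show "((%h. u w * kap (kmul (kinv z) w - h *\<^sub>R l z w)) has_real_derivative - (u w * (kapg (kmul (kinv z) w - s *\<^sub>R l z w) \<bullet> l z w))) (at s)"
     by (rule der)
    show "\<bar>- (u w * (kapg (kmul (kinv z) w - s *\<^sub>R l z w) \<bullet> l z w))\<bar> <= Bd z w" using pb[OF s, of w z] by simp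
   qed
   have base: "\<exists>Q. \<forall>w. \<bar>kap (kmul (kinv z) w)\<bar> * (1 + norm w) ^ (N + ?D) <= Q"
   proof -
    have "\<exists>Q. \<forall>w::'n kin. \<bar>kap w\<bar> * (1 + norm w) ^ (N + ?D) <= Q" using kap_decay[where B="N + ?D"] by metis
    then obtain Q where "!!w::'n kin. \<bar>kap w\<bar> * (1 + norm w) ^ (N + ?D) <= Q" by blast
    from left_decay[OF this] show ?thesis by blast
   qed
   then obtain Q where Q: "!!w. \<bar>kap (kmul (kinv z) w)\<bar> * (1 + norm w) ^ (N + ?D) <= Q" by blast
   have i0: "integrable lborel (%w. u w * kap (kmul (kinv z) w))"
   proof (rule weight_integrable_power)
    show "(%w. u w * kap (kmul (kinv z) w)) \<in> borel_measurable borel" by measurable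
    fix w :: "'n kin"
    have "\<bar>u w * kap (kmul (kinv z) w)\<bar> * (1 + norm w) ^ ?D <= (M * (1 + norm w) ^ N * \<bar>kap (kmul (kinv z) w)\<bar>) * (1 + norm w) ^ ?D"
     unfolding abs_mult by (intro mult_right_mono M) auto
    also have "\<dots> = M * (\<bar>kap (kmul (kinv z) w)\<bar> * (1 + norm w) ^ (N + ?D))" by (simp only: power_add mult_ac)
    also have "\<dots> <= M * Q" by (rule mult_left_mono[OF Q M0])
    finally show "\<bar>u w * kap (kmul (kinv z) w)\<bar> * (1 + norm w) ^ ?D <= M * Q" .
   qed
   have int: "integrable lborel (%w. u w * kap (kmul (kinv z) w - h *\<^sub>R l z w))" if h: "\<bar>h\<bar> <= 1" for h
   proof (rule Bochner_Integration.integrable_bound[OF Bochner_Integration.integrable_add[OF integrable_abs[OF i0] Bdi[of z]]])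
    show "(%w. u w * kap (kmul (kinv z) w - h *\<^sub>R l z w)) \<in> borel_measurable lborel" by measurable
    have "norm (u w * kap (kmul (kinv z) w - h *\<^sub>R l z w)) <= norm (\<bar>u w * kap (kmul (kinv z) w)\<bar> + Bd z w)" for w
    proof -
     have B0: "0 <= Bd z w" by (rule order_trans[OF abs_ge_zero pb[of 0 w z]]) simp
     have "\<bar>h\<bar> * Bd z w <= 1 * Bd z w" by (rule mult_right_mono[OF h B0])
     moreover have b0: "kmul (kinv z) w - 0 *\<^sub>R l z w = kmul (kinv z) w" by simp
     ultimately have "\<bar>u w * kap (kmul (kinv z) w - h *\<^sub>R l z w)\<bar> <= \<bar>u w * kap (kmul (kinv z) w)\<bar> + Bd z w"
      using bnd[OF h, of w] unfolding b0 by linarith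
     then show ?thesis unfolding real_norm_def by (rule order_trans[OF _ abs_ge_self])
    qed
    then show "AE w in lborel. norm (u w * kap (kmul (kinv z) w - h *\<^sub>R l z w)) <= norm (\<bar>u w * kap (kmul (kinv z) w)\<bar> + Bd z w)" by (rule AE_I2)
   qed
   have F'm: "F' z \<in> borel_measurable lborel" unfolding F'_def[abs_def] by measurable
   have der0: "AE w in lborel. ((%h. u w * kap (kmul (kinv z) w - h *\<^sub>R l z w)) has_real_derivative F' z w) (at 0)"
    using der[of _ z 0] by (intro AE_I2) (simp add: F'_def)
   have bnd': "AE w in lborel. \<forall>h. \<bar>h\<bar> <= 1 --> \<bar>u w * kap (kmul (kinv z) w - h *\<^sub>R l z w) - u w * kap (kmul (kinv z) w - 0 *\<^sub>R l z w)\<bar> <= \<bar>h\<bar> * Bd z w"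
    by (intro AE_I2 allI impI bnd)
   show ?thesis using has_real_derivative_integral[of lborel "%h w. u w * kap (kmul (kinv z) w - h *\<^sub>R l z w)", OF int der0 bnd' Bdi F'm] by blast
  qed
  define X where "X z = (\<integral>w. F' z w \<partial>lborel) / ?m" for z
  have dX: "((%h. u (z + h *\<^sub>R d z)) has_real_derivative X z) (at 0)" for z
  proof -
   have "u (z + h *\<^sub>R d z) = (\<integral>w. u w * kap (kmul (kinv z) w - h *\<^sub>R l z w) \<partial>lborel) / ?m" for h
    unfolding shift[of z h, symmetric] using m by simp
   then show ?thesis unfolding X_def using DERIV_cdivide[OF conjunct2[OF D[of z]], of ?m] by (simp only:)
  qed
  have Xb: "\<bar>X z\<bar> <= A * M * (1 + norm z) ^ (B + 1)" for z
  proof -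
   have "\<bar>F' z w\<bar> <= Bd z w" for w using pb[of 0 w z] by (simp add: F'_def)
   then have "\<bar>\<integral>w. F' z w \<partial>lborel\<bar> <= (\<integral>w. Bd z w \<partial>lborel)"
    by (intro integral_abs_bound_integral Bdi conjunct1[OF D])
   also have "\<dots> = (M * C * K ^ B * 3 * Cd * (1 + norm z) ^ (B + 1)) * W"
    unfolding Bd_def W_def by (rule integral_mult_right_zero)
   finally have "\<bar>\<integral>w. F' z w \<partial>lborel\<bar> / ?m <= (M * C * K ^ B * 3 * Cd * (1 + norm z) ^ (B + 1)) * W / ?m"
    using m by (intro divide_right_mono) auto
   moreover have "A * M * (1 + norm z) ^ (B + 1) = (M * C * K ^ B * 3 * Cd * (1 + norm z) ^ (B + 1)) * W / ?m"
    by (simp add: A_def mult_ac)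
   moreover have "\<bar>X z\<bar> = \<bar>\<integral>w. F' z w \<partial>lborel\<bar> / ?m" using m by (simp add: X_def)
   ultimately show ?thesis by (simp only:)
  qed
  have dX': "((%h. u (z + h *\<^sub>R d z)) has_real_derivative X (z + s *\<^sub>R d z)) (at s)" for z s
  proof -
   have "((%h. u (z + s *\<^sub>R d z + h *\<^sub>R d (z + s *\<^sub>R d z))) has_real_derivative X (z + s *\<^sub>R d z)) (at 0)" by (rule dX)
   then have "((%h. u (z + (h + s) *\<^sub>R d z)) has_real_derivative X (z + s *\<^sub>R d z)) (at 0)"
    by (simp add: d2 scaleR_add_left add_ac)
   then show ?thesis using DERIV_shift[of "%h. u (z + h *\<^sub>R d z)" "X (z + s *\<^sub>R d z)" 0 s] by simp
  qed
  have AM: "A * M \<ge> 0" using order_trans[OF abs_ge_zero Xb[of 0]] by simp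
  have Xm[measurable]: "X \<in> borel_measurable borel"
  proof (rule borel_measurable_LIMSEQ_real)
   show "(%z. (u (z + (1 / real (Suc n)) *\<^sub>R d z) - u z) / (1 / real (Suc n))) \<in> borel_measurable borel" for n by measurable
   fix z :: "'n kin"
   have a: "((%h. (u (z + h *\<^sub>R d z) - u z) / h) \<longlongrightarrow> X z) (at 0)" using dX[of z] by (simp add: DERIV_def)
   have b: "filterlim (%n. 1 / real (Suc n)) (at 0) sequentially"
    unfolding filterlim_at using LIMSEQ_inverse_real_of_nat by (simp add: inverse_eq_divide)
   show "(%n. (u (z + (1 / real (Suc n)) *\<^sub>R d z) - u z) / (1 / real (Suc n))) \<longlonglongrightarrow> X z"
    by (rule filterlim_compose[OF a b])
  qed
  \<comment> \<open>Shifting z along the field shifts every point \<open>kmul z (kscale r w)\<close>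
    along the field by the same parameter. Differentiating the mean value formula of u in that
    parameter therefore gives the one for X.\<close>
  have Xr: "(\<integral>w. X (kmul z (kscale r w)) * kap w \<partial>lborel) = ?m * X z" if r: "r > 0" for z r
  proof -
   let ?y = "%w. kmul z (kscale r w)"
   define S where "S = max 1 r"
   define Q where "Q = (1 + norm z) * (3 * S ^ 3) * 3"
   have yb: "1 + norm (?y w) <= Q * (1 + norm w)" for w
   proof -
    have S: "1 <= S ^ 3" by (simp add: S_def one_le_power)
    have "norm (kscale r w) <= 3 * S ^ 3 * norm w" by (rule norm_kscale_le) (use r in \<open>auto simp: S_def\<close>)
    then have a: "1 + norm (kscale r w) <= (3 * S ^ 3) * (1 + norm w)" using S by (simp add: distrib_left)
    have "1 + norm (?y w) <= (1 + norm z) * (1 + norm (kscale r w)) * 3" by (rule norm_kmul)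
    also have "\<dots> <= (1 + norm z) * ((3 * S ^ 3) * (1 + norm w)) * 3" by (intro mult_right_mono mult_left_mono a) auto
    also have "\<dots> = Q * (1 + norm w)" unfolding Q_def by (simp only: mult_ac)
    finally show ?thesis .
   qed
   have Q: "Q \<ge> 0" unfolding Q_def S_def by (intro mult_nonneg_nonneg) auto
   let ?F = "%h w. u (?y w + h *\<^sub>R d (?y w)) * kap w"
   have Sb: "(1 + norm (?y w + h *\<^sub>R d (?y w))) ^ n <= ((1 + Cd) * Q) ^ n * (1 + norm w) ^ n" if "\<bar>h\<bar> <= 1" for h w n
   proof (rule power_le_mult)
    have "1 + norm (?y w + h *\<^sub>R d (?y w)) <= (1 + Cd) * (1 + norm (?y w))" by (rule nS[OF that])
    also have "\<dots> <= (1 + Cd) * (Q * (1 + norm w))" using Cd(1) by (intro mult_left_mono yb) auto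
    finally show "1 + norm (?y w + h *\<^sub>R d (?y w)) <= (1 + Cd) * Q * (1 + norm w)" by (simp only: mult.assoc)
   qed simp
   define BB where "BB w = (A * M * ((1 + Cd) * Q) ^ (B + 1)) * (kap w * (1 + norm w) ^ (B + 1))" for w :: "'n kin"
   have BBi: "integrable lborel BB" unfolding BB_def[abs_def] by (intro integrable_mult_right kap_weight_integrable)
   have int: "integrable lborel (?F h)" if h: "\<bar>h\<bar> <= 1" for h
   proof (rule Bochner_Integration.integrable_bound[OF integrable_mult_right[OF kap_weight_integrable[of N], of "M * ((1 + Cd) * Q) ^ N"]])
    show "?F h \<in> borel_measurable lborel" by measurable
    have "norm (?F h w) <= norm (M * ((1 + Cd) * Q) ^ N * (kap w * (1 + norm w) ^ N))" for w
    proof -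
     have "\<bar>u (?y w + h *\<^sub>R d (?y w))\<bar> <= M * (((1 + Cd) * Q) ^ N * (1 + norm w) ^ N)"
      by (rule order_trans[OF M mult_left_mono[OF Sb[OF h] M0]])
     then have "\<bar>u (?y w + h *\<^sub>R d (?y w))\<bar> * kap w <= M * (((1 + Cd) * Q) ^ N * (1 + norm w) ^ N) * kap w"
      by (rule mult_right_mono[OF _ kap_nonneg])
     also have "\<dots> = M * ((1 + Cd) * Q) ^ N * (kap w * (1 + norm w) ^ N)" by (simp only: mult_ac)
     finally have "\<bar>u (?y w + h *\<^sub>R d (?y w))\<bar> * kap w <= \<bar>M * ((1 + Cd) * Q) ^ N * (kap w * (1 + norm w) ^ N)\<bar>"
      by (rule order_trans[OF _ abs_ge_self])
     moreover have "norm (?F h w) = \<bar>u (?y w + h *\<^sub>R d (?y w))\<bar> * kap w" using kap_nonneg[of w] by (simp add: abs_mult)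
     ultimately show ?thesis by (simp only: real_norm_def)
    qed
    then show "AE w in lborel. norm (?F h w) <= norm (M * ((1 + Cd) * Q) ^ N * (kap w * (1 + norm w) ^ N))" by (rule AE_I2)
   qed
   have der: "((%h. ?F h w) has_real_derivative X (?y w + s *\<^sub>R d (?y w)) * kap w) (at s)" for w s
    by (rule DERIV_cmult_right[OF dX'])
   have der0: "AE w in lborel. ((%h. ?F h w) has_real_derivative X (?y w) * kap w) (at 0)"
    using der[of _ 0] by (intro AE_I2) simp
   have bnd: "\<bar>?F h w - ?F 0 w\<bar> <= \<bar>h\<bar> * BB w" if h: "\<bar>h\<bar> <= 1" for h w
   proof (rule mvt_line[of h "%h. ?F h w"])
    fix s assume "\<bar>s\<bar> <= \<bar>h\<bar>"
    then have s: "\<bar>s\<bar> <= 1" using h by simp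
    show "((%h. ?F h w) has_real_derivative X (?y w + s *\<^sub>R d (?y w)) * kap w) (at s)" by (rule der)
    have "\<bar>X (?y w + s *\<^sub>R d (?y w))\<bar> <= A * M * (((1 + Cd) * Q) ^ (B + 1) * (1 + norm w) ^ (B + 1))"
     by (rule order_trans[OF Xb mult_left_mono[OF Sb[OF s] AM]])
    then have "\<bar>X (?y w + s *\<^sub>R d (?y w))\<bar> * kap w <= A * M * (((1 + Cd) * Q) ^ (B + 1) * (1 + norm w) ^ (B + 1)) * kap w"
     by (rule mult_right_mono[OF _ kap_nonneg])
    also have "\<dots> = BB w" unfolding BB_def by (simp only: mult_ac)
    finally show "\<bar>X (?y w + s *\<^sub>R d (?y w)) * kap w\<bar> <= BB w" using kap_nonneg[of w] by (simp add: abs_mult)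
   qed
   have bnd': "AE w in lborel. \<forall>h. \<bar>h\<bar> <= 1 --> \<bar>?F h w - ?F 0 w\<bar> <= \<bar>h\<bar> * BB w" by (intro AE_I2 allI impI bnd)
   have Fm: "(%w. X (?y w) * kap w) \<in> borel_measurable lborel" by measurable
   have 1: "((%h. \<integral>w. ?F h w \<partial>lborel) has_real_derivative (\<integral>w. X (?y w) * kap w \<partial>lborel)) (at 0)"
    using has_real_derivative_integral(2)[of lborel ?F, OF int der0 bnd' BBi Fm] by blast
   have "(\<integral>w. ?F h w \<partial>lborel) = ?m * u (z + h *\<^sub>R d z)" for h
    unfolding d1[symmetric] by (rule reproD(2)[OF u r])
   then have "((%h. ?m * u (z + h *\<^sub>R d z)) has_real_derivative (\<integral>w. X (?y w) * kap w \<partial>lborel)) (at 0)" using 1 by (simp only:)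
   from DERIV_unique[OF this DERIV_cmult[OF dX]] show ?thesis .
  qed
  have "repro X" unfolding repro_def using Xm Xb Xr by blast
  then show ?thesis using Xb dX by blast
 qed
 show ?thesis using main by blast
qed

section \<open>A Liouville theorem\<close>

text \<open>Growth of order n - 1 under the scaling. The extra factor R on the left lets the
  exponent - 1 be reached with natural n, so that n = 0 means decay and stops the induction.\<close>

definition gr :: "nat => ('n::finite kin => real) => bool" where
 "gr n u \<longleftrightarrow> (\<exists>M N. \<forall>R\<ge>1. \<forall>w. R * \<bar>u (kscale R w)\<bar> <= M * R ^ n * (1 + norm w) ^ N)"

text \<open>The derivative of the rescaled function is R^j times the rescaled derivative. Applying
  the linear estimate to the rescaled function and dividing by R^j, with j at least 1, gains one
  power of R.\<close>

lemma gen_field_gr: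
 fixes u :: "'n::finite kin => real"
 assumes d: "gen_field d j" and u: "repro u" and g: "gr (Suc n) u"
 shows "\<exists>X. repro X \<and> gr n X \<and> (\<forall>z. ((%h. u (z + h *\<^sub>R d z)) has_real_derivative X z) (at 0))"
proof -
 obtain M N where MN: "\<forall>R\<ge>1. \<forall>w. R * \<bar>u (kscale R w)\<bar> <= M * R ^ Suc n * (1 + norm w) ^ N" using g unfolding gr_def by blast
 from gen_field_derivative[OF d, of N] obtain A N' where A: "\<forall>u M. repro u \<and> (\<forall>w. \<bar>u w\<bar> <= M * (1 + norm w) ^ N) -->
   (\<exists>X. repro X \<and> (\<forall>z. \<bar>X z\<bar> <= A * M * (1 + norm z) ^ N') \<and>
    (\<forall>z. ((%h. u (z + h *\<^sub>R d z)) has_real_derivative X z) (at 0)))" by blast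
 have MN': "\<bar>u (kscale R w)\<bar> <= (M * R ^ n) * (1 + norm w) ^ N" if R: "R \<ge> 1" for R w
 proof -
  have "R * \<bar>u (kscale R w)\<bar> <= M * R ^ Suc n * (1 + norm w) ^ N" using MN R by blast
  also have "\<dots> = R * ((M * R ^ n) * (1 + norm w) ^ N)" by (simp add: mult_ac)
  finally show ?thesis by (rule mult_left_le_imp_le) (use R in simp)
 qed
 have "\<forall>w. \<bar>u w\<bar> <= M * (1 + norm w) ^ N" using MN'[of 1] by simp
 then obtain X where X: "repro X" "!!z. ((%h. u (z + h *\<^sub>R d z)) has_real_derivative X z) (at 0)" using A u by blast
 have "R * \<bar>X (kscale R z)\<bar> <= (A * M) * R ^ n * (1 + norm z) ^ N'" if R: "R \<ge> 1" for R z
 proof -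
  have R0: "R > 0" using R by simp
  have "\<forall>w. \<bar>u (kscale R w)\<bar> <= (M * R ^ n) * (1 + norm w) ^ N" using MN'[OF R] by blast
  then obtain Y where Y: "\<bar>Y z\<bar> <= A * (M * R ^ n) * (1 + norm z) ^ N'"
   "((%h. u (kscale R (z + h *\<^sub>R d z))) has_real_derivative Y z) (at 0)"
   using A[rule_format, of "%w. u (kscale R w)" "M * R ^ n"] repro_kscale[OF u R0] by blast
  have k: "kscale R (z + h *\<^sub>R d z) = kscale R z + (R ^ j * h) *\<^sub>R d (kscale R z)" for h using d unfolding gen_field_def by blast
  have l: "DERIV (%h. R ^ j * h) 0 :> R ^ j" by (auto intro!: derivative_eq_intros)
  have "((%h. u (kscale R z + h *\<^sub>R d (kscale R z))) has_real_derivative X (kscale R z)) (at (R ^ j * 0))"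
   using X(2)[of "kscale R z"] by simp
  from DERIV_chain2[OF this l]
  have "((%h. u (kscale R (z + h *\<^sub>R d z))) has_real_derivative X (kscale R z) * R ^ j) (at 0)" unfolding k .
  from DERIV_unique[OF this Y(2)] have Ye: "X (kscale R z) * R ^ j = Y z" .
  have "j \<ge> 1" using d unfolding gen_field_def by blast
  then have "R <= R ^ j" using R by (intro self_le_power) auto
  then have "R * \<bar>X (kscale R z)\<bar> <= R ^ j * \<bar>X (kscale R z)\<bar>" by (rule mult_right_mono) simp
  also have "\<dots> = \<bar>Y z\<bar>" unfolding Ye[symmetric] using R by (simp add: abs_mult mult.commute)
  finally show ?thesis using Y(1) by (simp only: mult.assoc)
 qed
 then have "gr n X" unfolding gr_def by blast
 then show ?thesis using X by blast
qed

lemma gr_0_zero: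
 fixes u :: "'n::finite kin => real"
 assumes "gr 0 u" shows "u z = 0"
proof (rule ccontr)
 assume nz: "u z \<noteq> 0"
 obtain M N where MN: "\<forall>R\<ge>1. \<forall>w. R * \<bar>u (kscale R w)\<bar> <= M * R ^ 0 * (1 + norm w) ^ N" using assms unfolding gr_def by blast
 have "1 * \<bar>u (kscale 1 0)\<bar> <= M * 1 ^ 0 * (1 + norm (0 :: 'n kin)) ^ N" using MN order_refl by blast
 then have M: "M \<ge> 0" by simp
 define Q where "Q = M * (1 + 3 * norm z) ^ N"
 \<comment> \<open>Large enough that R |u z| exceeds the bound Q, which does not depend on
   R.\<close>
 define R where "R = 1 + \<bar>Q\<bar> / \<bar>u z\<bar>"
 have R: "R \<ge> 1" by (simp add: R_def)
 have "R * \<bar>u (kscale R (kscale (1 / R) z))\<bar> <= M * R ^ 0 * (1 + norm (kscale (1 / R) z)) ^ N" using MN R by blast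
 also have "\<dots> <= M * R ^ 0 * (1 + 3 * norm z) ^ N"
 proof (intro mult_left_mono power_mono)
  have "norm (kscale (1 / R) z) <= 3 * 1 ^ 3 * norm z" by (rule norm_kscale_le) (use R in auto)
  then show "1 + norm (kscale (1 / R) z) <= 1 + 3 * norm z" by simp
 qed (use M in auto)
 also have "\<dots> = Q" by (simp add: Q_def)
 also have "kscale R (kscale (1 / R) z) = z" using R by (simp add: kscale_kscale)
 finally have "R * \<bar>u z\<bar> <= Q" .
 moreover have "R * \<bar>u z\<bar> = \<bar>u z\<bar> + \<bar>Q\<bar>" using nz by (simp add: R_def distrib_right)
 ultimately show False using nz by linarith
qed

lemma gen_fields:
 fixes e :: "real^'n::finite"
 shows "gen_field (%_. (1, 0, 0) :: 'n kin) 2" "gen_field (%_. (0, e, 0) :: 'n kin) 3"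
  "gen_field (%w. (0, fst w *\<^sub>R e, e) :: 'n kin) 1"
proof -
 have c: "\<exists>C\<ge>0. \<forall>w::'n kin. norm a <= C * (1 + norm w)" for a :: "'n kin"
  by (rule exI[of _ "norm a"]) (simp add: mult_le_cancel_left1 distrib_left)
 show "gen_field (%_. (1, 0, 0) :: 'n kin) 2"
  unfolding gen_field_def
 proof (intro conjI c continuous_on_const allI)
  fix z w :: "'n kin" and h :: real
  show "kmul (z + h *\<^sub>R (1, 0, 0)) w = kmul z w + h *\<^sub>R (1, 0, 0)" by (cases z; cases w) (simp add: kmul_def algebra_simps)
 next
  fix R h :: real and z :: "'n kin"
  show "kscale R (z + h *\<^sub>R (1, 0, 0)) = kscale R z + (R ^ 2 * h) *\<^sub>R (1, 0, 0)" by (cases z) (simp add: kscale_def algebra_simps)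
 qed simp_all
 show "gen_field (%_. (0, e, 0) :: 'n kin) 3"
  unfolding gen_field_def
 proof (intro conjI c continuous_on_const allI)
  fix z w :: "'n kin" and h :: real
  show "kmul (z + h *\<^sub>R (0, e, 0)) w = kmul z w + h *\<^sub>R (0, e, 0)" by (cases z; cases w) (simp add: kmul_def algebra_simps)
 next
  fix R h :: real and z :: "'n kin"
  show "kscale R (z + h *\<^sub>R (0, e, 0)) = kscale R z + (R ^ 3 * h) *\<^sub>R (0, e, 0)" by (cases z) (simp add: kscale_def algebra_simps)
 qed simp_all
 show "gen_field (%w. (0, fst w *\<^sub>R e, e) :: 'n kin) 1"
  unfolding gen_field_def
 proof (intro conjI allI)
  show "continuous_on UNIV (%w::'n kin. (0::real, fst w *\<^sub>R e, e))" by (intro continuous_intros)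
  have "norm (0::real, fst w *\<^sub>R e, e) <= norm e * (1 + norm w)" for w :: "'n kin"
  proof -
   have "norm (0::real, fst w *\<^sub>R e, e) <= \<bar>0\<bar> + norm (fst w *\<^sub>R e) + norm e" by (rule norm_kin_le)
   also have "norm (fst w *\<^sub>R e) <= norm w * norm e" unfolding norm_scaleR by (rule mult_right_mono) (use norm_kin_ge(1)[of w] in auto)
   finally show ?thesis by (simp add: algebra_simps)
  qed
  then show "\<exists>C\<ge>0. \<forall>w::'n kin. norm (0::real, fst w *\<^sub>R e, e) <= C * (1 + norm w)" by (intro exI[of _ "norm e"]) simp
  show "(1::nat) <= 1" by simp
  fix z w :: "'n kin" and h :: real
  show "kmul (z + h *\<^sub>R (0, fst z *\<^sub>R e, e)) w = kmul z w + h *\<^sub>R (0, fst (kmul z w) *\<^sub>R e, e)"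
   by (cases z; cases w) (simp add: kmul_def algebra_simps)
  show "(0::real, fst (w + h *\<^sub>R (0, fst w *\<^sub>R e, e)) *\<^sub>R e, e) = (0, fst w *\<^sub>R e, e)" by simp
 next
  fix R h :: real and z :: "'n kin"
  show "kscale R (z + h *\<^sub>R (0, fst z *\<^sub>R e, e)) = kscale R z + (R ^ 1 * h) *\<^sub>R (0, fst (kscale R z) *\<^sub>R e, e)"
   by (cases z) (simp add: kscale_def algebra_simps power3_eq_cube power2_eq_square)
 qed
qed

lemma trunc_inner_zero:
 assumes "A \<subseteq> Basis" "c \<in> Basis" "c \<notin> A" shows "trunc A w \<bullet> c = 0"
 unfolding trunc_def inner_sum_left using assms
 by (intro sum.neutral) (auto simp: inner_Basis subset_iff)

text \<open>The derivative in direction \<open>b\<close> needs to be polynomial only along the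
  subspace reached so far and the new directions. This is what permits generators that are constant
  only on such a subspace.\<close>

lemma polynomial_trunc_union:
 fixes u :: "'a::euclidean_space => real"
 assumes B: "finite B" "B \<subseteq> Basis" "A \<subseteq> Basis" "A \<inter> B = {}"
  and Q: "\<exists>Q. real_polynomial_function Q \<and> (\<forall>w. u (trunc A w) = Q w)"
  and der: "!!b. b \<in> B ==> \<exists>p. real_polynomial_function p \<and>
    (\<forall>y s. (\<forall>c\<in>Basis - (A \<union> B). y \<bullet> c = 0) --> ((%s. u (y + s *\<^sub>R b)) has_real_derivative p (y + s *\<^sub>R b)) (at s))"
 shows "\<exists>Q. real_polynomial_function Q \<and> (\<forall>w. u (trunc (A \<union> B) w) = Q w)"
proof -
 have fA: "finite A" using B(3) finite_Basis by (rule finite_subset)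
 have "C \<subseteq> B ==> \<exists>Q. real_polynomial_function Q \<and> (\<forall>w. u (trunc (A \<union> C) w) = Q w)" if "finite C" for C
  using that
 proof (induction C rule: finite_induct)
  case empty
  then show ?case using Q by simp
 next
  case (insert b C)
  then obtain Q where Q: "real_polynomial_function Q" "!!w. u (trunc (A \<union> C) w) = Q w" by blast
  have b: "b \<in> B" using insert by blast
  then obtain p where p: "real_polynomial_function p"
   "!!y s. (\<forall>c\<in>Basis - (A \<union> B). y \<bullet> c = 0) ==> ((%s. u (y + s *\<^sub>R b)) has_real_derivative p (y + s *\<^sub>R b)) (at s)"
   using der[OF b] by blast
  have ac: "A \<union> C \<subseteq> Basis" using insert B by blast
  have t: "\<forall>c\<in>Basis - (A \<union> B). trunc (A \<union> C) w \<bullet> c = 0" for w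
   using insert by (intro ballI trunc_inner_zero ac) auto
  have "\<exists>Q'. real_polynomial_function Q' \<and> (\<forall>w. u (trunc (insert b (A \<union> C)) w) = Q' w)"
  proof (rule polynomial_trunc_insert[OF _ _ _ Q p(1) p(2)[OF t]])
   show "b \<in> Basis" "b \<notin> A \<union> C" using b B insert by auto
   show "finite (A \<union> C)" using fA insert by simp
  qed
  then show ?case by simp
 qed
 then show ?thesis using B(1) by blast
qed

text \<open>By induction all derivatives along the generators are polynomials, and u is recovered by
  integrating along velocity, then position, then time. The order matters: the velocity generator
  has a position component proportional to t, which vanishes as long as t = 0.\<close>

lemma repro_gr_polynomial:
 fixes u :: "'n::finite kin => real"
 assumes "repro u" "gr n u" shows "real_polynomial_function u"
 using assms
proof (induction n arbitrary: u)
 case 0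
 then have "u = (%_. 0)" using gr_0_zero by blast
 then show ?case by (simp add: real_polynomial_function.intros(2))
next
 case (Suc n)
 have D: "\<exists>p. real_polynomial_function p \<and> (\<forall>z. ((%h. u (z + h *\<^sub>R d z)) has_real_derivative p z) (at 0))"
  if "gen_field d j" for d j
  using gen_field_gr[OF that Suc.prems] Suc.IH by blast
 have D': "\<exists>p. real_polynomial_function p \<and> (\<forall>y s. P y --> ((%s. u (y + s *\<^sub>R b)) has_real_derivative p (y + s *\<^sub>R b)) (at s))"
  if g: "gen_field d j" and P: "!!y s. P y ==> d (y + s *\<^sub>R b) = b" for d j b and P :: "'n kin => bool"
 proof -
  obtain p where p: "real_polynomial_function p" "\<forall>z. ((%h. u (z + h *\<^sub>R d z)) has_real_derivative p z) (at 0)" using D[OF g] by blast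
  have "((%s. u (y + s *\<^sub>R b)) has_real_derivative p (y + s *\<^sub>R b)) (at s)" if y: "P y" for y s
  proof -
   have "((%h. u (y + s *\<^sub>R b + h *\<^sub>R d (y + s *\<^sub>R b))) has_real_derivative p (y + s *\<^sub>R b)) (at 0)" using p(2) by blast
   then have "((%h. u (y + (h + s) *\<^sub>R b)) has_real_derivative p (y + s *\<^sub>R b)) (at 0)"
    unfolding P[OF y] by (simp add: scaleR_add_left add_ac)
   then show ?thesis using DERIV_shift[of "%h. u (y + h *\<^sub>R b)" "p (y + s *\<^sub>R b)" 0 s] by simp
  qed
  then show ?thesis using p(1) by blast
 qed
 define V where "V = range (%i. (0, 0, axis i 1) :: 'n kin)"
 define X where "X = range (%i. (0, axis i 1, 0) :: 'n kin)"
 define T where "T = {(1, 0, 0) :: 'n kin}"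
 have bas: "Basis = V \<union> X \<union> T"
 proof (rule set_eqI)
  fix b :: "'n kin"
  show "b \<in> Basis \<longleftrightarrow> b \<in> V \<union> X \<union> T" unfolding Basis_kin V_def X_def T_def by blast
 qed
 have fin: "finite V" "finite X" "finite T" by (simp_all add: V_def X_def T_def)
 have sub: "V \<subseteq> Basis" "X \<subseteq> Basis" "T \<subseteq> Basis" "{} \<subseteq> (Basis :: 'n kin set)" "V \<union> X \<subseteq> Basis" unfolding bas by blast+
 have dis: "{} \<inter> V = {}" "V \<inter> X = {}" "(V \<union> X) \<inter> T = {}" by (auto simp: V_def X_def T_def axis_eq_0_iff)
 have tV: "(1, 0, 0) \<in> Basis - ({} \<union> V)" unfolding bas by (auto simp: V_def T_def)
 \<comment> \<open>On the span of the velocity directions time is 0, so the velocity generator is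
   there the constant field \<open>b\<close>.\<close>
 have "\<exists>Q. real_polynomial_function Q \<and> (\<forall>w. u (trunc ({} \<union> V) w) = Q w)"
 proof (rule polynomial_trunc_union[OF fin(1) sub(1) sub(4) dis(1)])
  show "\<exists>Q. real_polynomial_function Q \<and> (\<forall>w. u (trunc {} w) = Q w)"
   by (rule exI[of _ "%_. u 0"]) (simp add: trunc_def real_polynomial_function.intros(2))
  fix b assume "b \<in> V"
  then obtain i where b: "b = (0, 0, axis i 1)" unfolding V_def by blast
  show "\<exists>p. real_polynomial_function p \<and> (\<forall>y s. (\<forall>c\<in>Basis - ({} \<union> V). y \<bullet> c = 0) --> ((%s. u (y + s *\<^sub>R b)) has_real_derivative p (y + s *\<^sub>R b)) (at s))"
  proof (rule D'[OF gen_fields(3)[of "axis i 1"]])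
   fix y :: "'n kin" and s :: real
   assume "\<forall>c\<in>Basis - ({} \<union> V). y \<bullet> c = 0"
   from bspec[OF this tV] have "fst y = 0" by (simp add: inner_prod_def)
   then show "(0, fst (y + s *\<^sub>R b) *\<^sub>R axis i 1, axis i 1) = b" by (simp add: b)
  qed
 qed
 then have v: "\<exists>Q. real_polynomial_function Q \<and> (\<forall>w. u (trunc V w) = Q w)" by (simp only: Un_empty_left)
 have x: "\<exists>Q. real_polynomial_function Q \<and> (\<forall>w. u (trunc (V \<union> X) w) = Q w)"
 proof (rule polynomial_trunc_union[OF fin(2) sub(2) sub(1) dis(2) v])
  fix b assume "b \<in> X"
  then obtain i where b: "b = (0, axis i 1, 0)" unfolding X_def by blast
  show "\<exists>p. real_polynomial_function p \<and> (\<forall>y s. (\<forall>c\<in>Basis - (V \<union> X). y \<bullet> c = 0) --> ((%s. u (y + s *\<^sub>R b)) has_real_derivative p (y + s *\<^sub>R b)) (at s))"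
   by (rule D'[OF gen_fields(2)[of "axis i 1"]]) (rule b[symmetric])
 qed
 have "\<exists>Q. real_polynomial_function Q \<and> (\<forall>w. u (trunc (V \<union> X \<union> T) w) = Q w)"
 proof (rule polynomial_trunc_union[OF fin(3) sub(3) sub(5) dis(3) x])
  fix b assume "b \<in> T"
  then have b: "b = (1, 0, 0)" unfolding T_def by blast
  show "\<exists>p. real_polynomial_function p \<and> (\<forall>y s. (\<forall>c\<in>Basis - (V \<union> X \<union> T). y \<bullet> c = 0) --> ((%s. u (y + s *\<^sub>R b)) has_real_derivative p (y + s *\<^sub>R b)) (at s))"
   by (rule D'[OF gen_fields(1)]) (rule b[symmetric])
 qed
 then obtain Q where Q: "real_polynomial_function Q" "!!w. u (trunc Basis w) = Q w" unfolding bas[symmetric] by blast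
 have "u = Q"
 proof
  fix w show "u w = Q w" using Q(2)[of w] by (simp add: trunc_def euclidean_representation)
 qed
 then show ?case using Q(1) by simp
qed

text \<open>Polynomial growth in the Euclidean norm is growth of some order under the scaling; the
  factor 3 in the exponent comes from the position, the coordinate of highest weight.\<close>

lemma wsol_polynomial:
 fixes U :: "'n::finite kin => real"
 assumes "wsol U"
 obtains q where "real_polynomial_function q" "AE w in lborel. U w = q w"
proof -
 obtain u where u: "repro u" "AE z in lborel. u z = U z" using wsol_repro[OF assms] by blast
 obtain M N where MN: "!!w. \<bar>u w\<bar> <= M * (1 + norm w) ^ N" using u(1) unfolding repro_def by blast
 have M: "M \<ge> 0" using order_trans[OF abs_ge_zero MN[of 0]] by simp
 have "R * \<bar>u (kscale R w)\<bar> <= (M * 3 ^ N) * R ^ (3 * N + 1) * (1 + norm w) ^ N" if R: "R \<ge> 1" for R w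
 proof -
  have "1 <= R ^ 3" using R by (rule one_le_power)
  moreover have "norm (kscale R w) <= 3 * R ^ 3 * norm w" by (rule norm_kscale_le) (use R in auto)
  ultimately have "1 + norm (kscale R w) <= (3 * R ^ 3) * (1 + norm w)" by (simp add: distrib_left)
  then have "(1 + norm (kscale R w)) ^ N <= (3 * R ^ 3) ^ N * (1 + norm w) ^ N" by (rule power_le_mult[rotated]) simp
  then have "\<bar>u (kscale R w)\<bar> <= M * ((3 * R ^ 3) ^ N * (1 + norm w) ^ N)" by (rule order_trans[OF MN mult_left_mono[OF _ M]])
  then have "R * \<bar>u (kscale R w)\<bar> <= R * (M * ((3 * R ^ 3) ^ N * (1 + norm w) ^ N))" by (rule mult_left_mono) (use R in simp)
  moreover have "R ^ (3 * N + 1) = (R ^ 3) ^ N * R" by (simp only: power_add power_mult power_one_right)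
  ultimately show ?thesis by (simp only: power_mult_distrib mult_ac)
 qed
 then have "gr (3 * N + 1) u" unfolding gr_def by blast
 then have "real_polynomial_function u" by (rule repro_gr_polynomial[OF u(1)])
 moreover have "AE w in lborel. U w = u w" using u(2) by eventually_elim simp
 ultimately show ?thesis using that by blast
qed

section \<open>Reflection to the whole space\<close>

lemma norm_krefl: "norm (krefl k w) = norm (w :: 'n::finite kin)"
proof -
 have "norm (reflect k x $ i) = norm (x $ i)" for x :: "real^'n" and i by (simp add: reflect_def)
 then have "norm (reflect k x) = norm x" for x :: "real^'n" unfolding norm_vec_def by (simp only:)
 then show ?thesis by (cases w) (simp add: krefl_def norm_Pair)
qed

lemma boundary_refl:
 assumes "xk k w = 0" shows "krefl k w = vrefl k w" "krefl k (vrefl k w) = w"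
 using assms by (cases w; simp add: krefl_def vrefl_def xk_def reflect_def vec_eq_iff)+

lemma compactly_supported_bounded:
 fixes f :: "'a::euclidean_space => real"
 assumes f: "continuous_on UNIV f" "!!w. norm w > \<rho> ==> f w = 0"
 shows "\<exists>B\<ge>0. \<forall>w. \<bar>f w\<bar> <= B"
proof -
 have "bounded (f ` cball 0 \<rho>)" by (intro compact_imp_bounded compact_continuous_image continuous_on_subset[OF f(1)]) auto
 then obtain b where b: "\<forall>y\<in>f ` cball 0 \<rho>. norm y <= b" unfolding bounded_iff by blast
 have "\<bar>f w\<bar> <= max b 0" for w
 proof (cases "w \<in> cball 0 \<rho>")
  case True then have "norm (f w) <= b" using b by blast
  then show ?thesis by simp
 next
  case False
  then have "f w = 0" using f(2)[of w] by simp
  then show ?thesis by simp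
 qed
 then show ?thesis by (intro exI[of _ "max b 0"]) simp
qed

lemma compactly_supported_decay:
 fixes f :: "'a::euclidean_space => real"
 assumes f: "continuous_on UNIV f" "!!w. norm w > \<rho> ==> f w = 0"
 shows "\<exists>B. \<forall>w. \<bar>f w\<bar> * (1 + norm w) ^ N <= B"
proof -
 have "continuous_on UNIV (%w. \<bar>f w\<bar> * (1 + norm w) ^ N)" by (intro continuous_intros f(1))
 from compactly_supported_bounded[OF this, of \<rho>] obtain B where "\<forall>w. \<bar>\<bar>f w\<bar> * (1 + norm w) ^ N\<bar> <= B" using f(2) by auto
 then show ?thesis using order_trans[OF abs_ge_self] by blast
qed

lemma dist_solD:
 assumes "dist_sol k p u"
 shows "u \<in> borel_measurable borel" "integrable lborel (%w. indicator (half_domain k \<inter> cball 0 \<rho>) w * u w)"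
 using assms unfolding dist_sol_def by blast+

lemma dist_sol_integrable:
 fixes u :: "'n::finite kin => real"
 assumes d: "dist_sol k p u" and p: "continuous_on UNIV p" and t: "test \<phi> \<psi>"
 shows "integrable lborel (%w. indicator (half_domain k) w * (u w * \<psi> w + p w * \<phi> w))"
proof -
 let ?D = "half_domain k"
 note [measurable] = dist_solD(1)[OF d]
 have [measurable]: "p \<in> borel_measurable borel" using p by (rule borel_measurable_continuous_onI)
 obtain \<rho> where \<rho>: "!!w. norm w > \<rho> ==> \<phi> w = 0" "!!w. norm w > \<rho> ==> \<psi> w = 0" "continuous_on UNIV \<phi>" "continuous_on UNIV \<psi>"
  using test_props[OF t] by metis
 have [measurable]: "\<phi> \<in> borel_measurable borel" "\<psi> \<in> borel_measurable borel" using \<rho> by (auto intro: borel_measurable_continuous_onI)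
 obtain B where B: "B \<ge> 0" "!!w. \<bar>\<psi> w\<bar> <= B" using compactly_supported_bounded[OF \<rho>(4,2)] by blast
 have 1: "integrable lborel (%w. indicator ?D w * (u w * \<psi> w))"
 proof (rule Bochner_Integration.integrable_bound[OF integrable_mult_right[OF dist_solD(2)[OF d, of \<rho>], of B]])
  show "(%w. indicator ?D w * (u w * \<psi> w)) \<in> borel_measurable lborel" by measurable
  have "norm (indicator ?D w * (u w * \<psi> w)) <= norm (B * (indicator (?D \<inter> cball 0 \<rho>) w * u w))" for w
  proof (cases "w \<in> ?D \<inter> cball 0 \<rho>")
   case True
   have "\<bar>u w\<bar> * \<bar>\<psi> w\<bar> <= \<bar>u w\<bar> * B" by (rule mult_left_mono[OF B(2)]) simp
   then show ?thesis using True B(1) by (simp add: abs_mult mult.commute)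
  next
   case False
   then have "w \<notin> ?D \<or> \<psi> w = 0" using \<rho>(2)[of w] by auto
   then show ?thesis by auto
  qed
  then show "AE w in lborel. norm (indicator ?D w * (u w * \<psi> w)) <= norm (B * (indicator (?D \<inter> cball 0 \<rho>) w * u w))" by (rule AE_I2)
 qed
 have 2: "integrable lborel (%w. indicator ?D w * (p w * \<phi> w))"
 proof -
  have "continuous_on UNIV (%w. p w * \<phi> w)" by (intro continuous_intros p \<rho>)
  then obtain C where C: "!!w. \<bar>p w * \<phi> w\<bar> * (1 + norm w) ^ (2 * DIM('n kin)) <= C"
   using compactly_supported_decay[of "%w. p w * \<phi> w" \<rho>] \<rho>(1) by (metis mult_zero_right)
  show ?thesis
  proof (rule weight_integrable_power)
   show "(%w. indicator ?D w * (p w * \<phi> w)) \<in> borel_measurable borel" by measurable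
   fix w :: "'n kin"
   have "\<bar>indicator ?D w * (p w * \<phi> w)\<bar> <= \<bar>p w * \<phi> w\<bar>" by (cases "w \<in> ?D") auto
   then show "\<bar>indicator ?D w * (p w * \<phi> w)\<bar> * (1 + norm w) ^ (2 * DIM('n kin)) <= C"
    by (rule order_trans[OF mult_right_mono C]) simp
  qed
 qed
 show ?thesis using Bochner_Integration.integrable_add[OF 1 2] by (simp add: distrib_left)
qed

lemma dist_sol_diff:
 fixes u :: "'n::finite kin => real"
 assumes d: "dist_sol k p u" "dist_sol k p' u'" and p: "continuous_on UNIV p" "continuous_on UNIV p'"
 shows "dist_sol k (%w. p w - p' w) (%w. u w - u' w)"
 unfolding dist_sol_def
proof (intro conjI allI impI)
 note [measurable] = dist_solD(1)[OF d(1)] dist_solD(1)[OF d(2)]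
 show "(%w. u w - u' w) \<in> borel_measurable borel" by measurable
 show "integrable lborel (%w. indicator (half_domain k \<inter> cball 0 \<rho>) w * (u w - u' w))" for \<rho>
  using Bochner_Integration.integrable_diff[OF dist_solD(2)[OF d(1), of \<rho>] dist_solD(2)[OF d(2), of \<rho>]] by (simp add: right_diff_distrib)
 fix \<phi> \<psi> assume t: "test \<phi> \<psi> \<and> (\<forall>w. xk k w = 0 --> \<phi> (vrefl k w) = \<phi> w)"
 let ?f = "%p u w. indicator (half_domain k) w * (u w * \<psi> w + p w * \<phi> w)"
 have z: "(\<integral>w. ?f p u w \<partial>lborel) = 0" "(\<integral>w. ?f p' u' w \<partial>lborel) = 0" using d t unfolding dist_sol_def by blast+
 have e: "indicator (half_domain k) w * ((u w - u' w) * \<psi> w + (p w - p' w) * \<phi> w) = ?f p u w - ?f p' u' w" for w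
  by (simp add: algebra_simps)
 show "(\<integral>w. indicator (half_domain k) w * ((u w - u' w) * \<psi> w + (p w - p' w) * \<phi> w) \<partial>lborel) = 0"
  unfolding e Bochner_Integration.integral_diff[OF dist_sol_integrable[OF d(1) p(1) conjunct1[OF t]] dist_sol_integrable[OF d(2) p(2) conjunct1[OF t]]] z by simp
qed

text \<open>The half-domain counterpart of the integrability required of whole-space solutions.
  Unlike a growth order it is easily seen to be stable under differences.\<close>

definition wint :: "'n::finite => ('n kin => real) => bool" where
 "wint k u \<longleftrightarrow> (\<exists>N. integrable lborel (%w. indicator (half_domain k) w * (u w / (1 + norm w) ^ N)))"

lemma wint_lin:
 fixes u :: "'n::finite kin => real"
 assumes u: "wint k u" "wint k u'" and [measurable]: "u \<in> borel_measurable borel" "u' \<in> borel_measurable borel"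
 shows "wint k (%w. u w + c * u' w)"
proof -
 obtain N M where i: "integrable lborel (%w. indicator (half_domain k) w * (u w / (1 + norm w) ^ N))"
  "integrable lborel (%w. indicator (half_domain k) w * (u' w / (1 + norm w) ^ M))" using u unfolding wint_def by blast
 have m: "integrable lborel (%w. indicator (half_domain k) w * (f w / (1 + norm w) ^ (N + M)))"
  if f: "integrable lborel (%w. indicator (half_domain k) w * (f w / (1 + norm w) ^ n))" "n <= N + M" and [measurable]: "f \<in> borel_measurable borel" for f :: "'n kin => real" and n
 proof (rule Bochner_Integration.integrable_bound[OF f(1)])
  show "(%w. indicator (half_domain k) w * (f w / (1 + norm w) ^ (N + M))) \<in> borel_measurable lborel" by measurable
  have "norm (indicator (half_domain k) w * (f w / (1 + norm w) ^ (N + M))) <= norm (indicator (half_domain k) w * (f w / (1 + norm w) ^ n))" for w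
  proof -
   have p: "0 < (1 + norm w) ^ m" for m by (intro zero_less_power add_pos_nonneg) auto
   have "(1 + norm w) ^ n <= (1 + norm w) ^ (N + M)" by (rule power_increasing[OF f(2)]) simp
   then have "\<bar>f w\<bar> / (1 + norm w) ^ (N + M) <= \<bar>f w\<bar> / (1 + norm w) ^ n" by (rule divide_left_mono[OF _ abs_ge_zero mult_pos_pos[OF p p]])
   then show ?thesis by (cases "w \<in> half_domain k") (auto simp: abs_divide)
  qed
  then show "AE w in lborel. norm (indicator (half_domain k) w * (f w / (1 + norm w) ^ (N + M))) <= norm (indicator (half_domain k) w * (f w / (1 + norm w) ^ n))"
   by (rule AE_I2)
 qed
 have "integrable lborel (%w. indicator (half_domain k) w * (u w / (1 + norm w) ^ (N + M)) + c * (indicator (half_domain k) w * (u' w / (1 + norm w) ^ (N + M))))"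
  by (intro Bochner_Integration.integrable_add integrable_mult_right m[OF i(1)] m[OF i(2)]) auto
 moreover have "(%w. indicator (half_domain k) w * (u w / (1 + norm w) ^ (N + M)) + c * (indicator (half_domain k) w * (u' w / (1 + norm w) ^ (N + M))))
   = (%w. indicator (half_domain k) w * ((u w + c * u' w) / (1 + norm w) ^ (N + M)))" by (simp add: add_divide_distrib algebra_simps)
 ultimately show ?thesis unfolding wint_def by (intro exI[of _ "N + M"]) simp
qed

lemma wint_AE:
 fixes u :: "'n::finite kin => real"
 assumes u: "wint k u" and [measurable]: "u \<in> borel_measurable borel" "u' \<in> borel_measurable borel"
  and ae: "AE w in lborel. xk k w > 0 --> u w = u' w"
 shows "wint k u'"
proof -
 obtain N where i: "integrable lborel (%w. indicator (half_domain k) w * (u w / (1 + norm w) ^ N))" using u unfolding wint_def by blast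
 have "AE w in lborel. indicator (half_domain k) w * (u w / (1 + norm w) ^ N) = indicator (half_domain k) w * (u' w / (1 + norm w) ^ N)"
  using ae by eventually_elim (auto simp: half_domain_xk indicator_def)
 then have "integrable lborel (%w. indicator (half_domain k) w * (u' w / (1 + norm w) ^ N))"
  by (rule iffD1[OF integrable_cong_AE, rotated 2, OF _ i]) measurable
 then show ?thesis unfolding wint_def by blast
qed

lemma wint_polynomial:
 fixes q :: "'n::finite kin => real"
 assumes q: "real_polynomial_function q" shows "wint k q"
proof -
 obtain C N where C: "C \<ge> 0" "!!w. \<bar>q w\<bar> <= C * (1 + norm w) ^ N" using polynomial_growth[OF q] by metis
 note [measurable] = polynomial_borel[OF q]
 let ?D = "2 * DIM('n kin)"
 have "integrable lborel (%w. indicator (half_domain k) w * (q w / (1 + norm w) ^ (N + ?D)))"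
 proof (rule weight_integrable_power)
  show "(%w. indicator (half_domain k) w * (q w / (1 + norm w) ^ (N + ?D))) \<in> borel_measurable borel" by measurable
  fix w :: "'n kin"
  define a where "a = 1 + norm w"
  have a: "a > 0" unfolding a_def by (intro add_pos_nonneg) auto
  have "\<bar>indicator (half_domain k) w * (q w / a ^ (N + ?D))\<bar> <= \<bar>q w\<bar> / a ^ (N + ?D)"
   using a by (cases "w \<in> half_domain k") (auto simp: abs_divide)
  also have "\<dots> <= C * a ^ N / a ^ (N + ?D)" using C(2)[of w] a by (intro divide_right_mono) (auto simp: a_def)
  also have "\<dots> = C / a ^ ?D" using a by (simp only: power_add) (simp add: field_simps)
  finally have "\<bar>indicator (half_domain k) w * (q w / a ^ (N + ?D))\<bar> * a ^ ?D <= C"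
   by (subst (asm) pos_le_divide_eq) (use a in auto)
  then show "\<bar>indicator (half_domain k) w * (q w / (1 + norm w) ^ (N + ?D))\<bar> * (1 + norm w) ^ ?D <= C" unfolding a_def .
 qed
 then show ?thesis unfolding wint_def by blast
qed

text \<open>For any whole-space test function, \<phi> plus its full reflection is admissible in the
  half-domain, because on the boundary full reflection and velocity reflection coincide. Testing u
  with this sum is the same as testing its even extension with \<phi>.\<close>

lemma dist_sol_polynomial:
 fixes u :: "'n::finite kin => real"
 assumes d: "dist_sol k p u" and p: "!!w. w \<in> half_domain k ==> p w = 0" and i: "wint k u"
 obtains q where "real_polynomial_function q" "AE w in lborel. xk k w > 0 --> u w = q w"
proof -
 let ?D = "half_domain k"
 note um[measurable] = dist_solD(1)[OF d]
 define g where "g w = indicator ?D w * u w" for w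
 have gm[measurable]: "g \<in> borel_measurable borel" unfolding g_def[abs_def] by measurable
 \<comment> \<open>The two summands live on opposite sides of the boundary hyperplane, so in the
   half-domain U is u itself.\<close>
 define U where "U w = g w + g (krefl k w)" for w
 note v = vol_scaling_krefl[of k]
 obtain N where "integrable lborel (%w. indicator ?D w * (u w / (1 + norm w) ^ N))" using i unfolding wint_def by blast
 then have gi: "integrable lborel (%w. g w / (1 + norm w) ^ N)" by (simp add: g_def)
 have "wsol U" unfolding wsol_def
 proof (intro conjI allI impI)
  show "U \<in> borel_measurable borel" unfolding U_def[abs_def] by measurable
  have m: "(%w. g w / (1 + norm w) ^ N) \<in> borel_measurable borel" by measurable
  have "integrable lborel (%w. g (krefl k w) / (1 + norm w) ^ N)"
   using vol_scaling_integral(2)[OF v m] gi by (simp add: norm_krefl)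
  from Bochner_Integration.integrable_add[OF gi this]
  have "integrable lborel (%w. U w / (1 + norm w) ^ N)" by (simp add: U_def add_divide_distrib)
  then show "\<exists>N. integrable lborel (%w. U w / (1 + norm w) ^ N)" by blast
  fix \<phi> \<psi> :: "'n kin => real" assume t: "test \<phi> \<psi>"
  obtain \<rho> where \<rho>: "!!w. norm w > \<rho> ==> \<psi> w = 0" "continuous_on UNIV \<psi>" using test_props[OF t] by metis
  have c': "continuous_on UNIV (%w. \<psi> (krefl k w))" by (rule continuous_on_compose2[OF \<rho>(2)]) (auto intro: continuous_intros)
  have [measurable]: "\<psi> \<in> borel_measurable borel" by (rule borel_measurable_continuous_onI[OF \<rho>(2)])
  obtain B1 where B1: "!!w. \<bar>\<psi> w\<bar> * (1 + norm w) ^ N <= B1" using compactly_supported_decay[OF \<rho>(2,1)] by blast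
  have i1: "integrable lborel (%w. g w * \<psi> w)" by (rule wsol_weight_integrable(1)[OF gm gi _ B1]) measurable
  have B2: "\<bar>\<psi> (krefl k w)\<bar> * (1 + norm w) ^ N <= B1" for w using B1[of "krefl k w"] by (simp add: norm_krefl)
  have i2: "integrable lborel (%w. g w * \<psi> (krefl k w))" by (rule wsol_weight_integrable(1)[OF gm gi _ B2]) measurable
  have m2: "(%w. g w * \<psi> (krefl k w)) \<in> borel_measurable borel" by measurable
  have i3: "integrable lborel (%w. g (krefl k w) * \<psi> w)" using vol_scaling_integral(2)[OF v m2] i2 by simp
  have "(\<integral>w. U w * \<psi> w \<partial>lborel) = (\<integral>w. g w * \<psi> w \<partial>lborel) + (\<integral>w. g (krefl k w) * \<psi> w \<partial>lborel)"
   unfolding Bochner_Integration.integral_add[OF i1 i3, symmetric] by (simp add: U_def distrib_right)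
  also have "(\<integral>w. g (krefl k w) * \<psi> w \<partial>lborel) = (\<integral>w. g w * \<psi> (krefl k w) \<partial>lborel)"
   using vol_scaling_integral(1)[OF v m2] by simp
  also have "(\<integral>w. g w * \<psi> w \<partial>lborel) + (\<integral>w. g w * \<psi> (krefl k w) \<partial>lborel)
    = (\<integral>w. indicator ?D w * (u w * (\<psi> w + \<psi> (krefl k w)) + p w * (\<phi> w + \<phi> (krefl k w))) \<partial>lborel)"
   unfolding Bochner_Integration.integral_add[OF i1 i2, symmetric]
  proof (intro Bochner_Integration.integral_cong refl)
   fix w
   have "indicator ?D w * p w = 0" using p[of w] by (cases "w \<in> ?D") auto
   then show "g w * \<psi> w + g w * \<psi> (krefl k w) = indicator ?D w * (u w * (\<psi> w + \<psi> (krefl k w)) + p w * (\<phi> w + \<phi> (krefl k w)))"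
    by (cases "w \<in> ?D") (auto simp: g_def algebra_simps)
  qed
  also have "\<dots> = 0"
  proof -
   have "test (%w. \<phi> w + \<phi> (krefl k w)) (%w. \<psi> w + \<psi> (krefl k w))" by (rule test_add[OF t test_krefl[OF t]])
   moreover have "\<forall>w. xk k w = 0 --> \<phi> (vrefl k w) + \<phi> (krefl k (vrefl k w)) = \<phi> w + \<phi> (krefl k w)"
    using boundary_refl by (metis add.commute)
   ultimately show ?thesis using d unfolding dist_sol_def by blast
  qed
  finally show "(\<integral>w. U w * \<psi> w \<partial>lborel) = 0" .
 qed
 from wsol_polynomial[OF this] obtain q where q: "real_polynomial_function q" "AE w in lborel. U w = q w" by blast
 have "AE w in lborel. xk k w > 0 --> u w = q w" using q(2)
 proof eventually_elim
  case (elim w)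
  have "xk k (krefl k w) = - xk k w" by (cases w) (simp add: krefl_def xk_def reflect_def)
  then show ?case using elim by (auto simp: U_def g_def half_domain_xk)
 qed
 then show ?thesis using that q(1) by blast
qed

section \<open>From growth to weighted integrability\<close>

lemma norm_kscale_small:
 assumes "0 <= r" "r <= 1" shows "norm (kscale r w) <= 3 * r * norm (w :: 'n::finite kin)"
proof -
 have r: "r\<^sup>2 <= r" "r ^ 3 <= r" using power_decreasing[of 1 2 r] power_decreasing[of 1 3 r] assms by auto
 have "kscale r w = (r\<^sup>2 * fst w, r ^ 3 *\<^sub>R fst (snd w), r *\<^sub>R snd (snd w))" by (cases w) (simp add: kscale_def)
 then have "norm (kscale r w) <= \<bar>r\<^sup>2 * fst w\<bar> + norm (r ^ 3 *\<^sub>R fst (snd w)) + norm (r *\<^sub>R snd (snd w))"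
  using norm_kin_le[of "r\<^sup>2 * fst w" "r ^ 3 *\<^sub>R fst (snd w)" "r *\<^sub>R snd (snd w)"] by (simp only:)
 also have "\<dots> = r\<^sup>2 * \<bar>fst w\<bar> + r ^ 3 * norm (fst (snd w)) + r * norm (snd (snd w))" using assms by (simp add: abs_mult)
 also have "\<dots> <= r * norm w + r * norm w + r * norm w"
  using r assms norm_kin_ge[of w] by (intro add_mono mult_mono) auto
 finally show ?thesis by simp
qed

text \<open>A dyadic decomposition: on the ball of radius 2^j the growth condition bounds the
  integral of |u| by a power of 2^j, and a sufficiently negative power as weight makes the sum over
  j geometric.\<close>

lemma growth_wint:
 fixes u :: "'n::finite kin => real"
 assumes u: "u \<in> borel_measurable borel" "!!\<rho>. integrable lborel (%w. indicator (half_domain k \<inter> cball 0 \<rho>) w * u w)"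
  and g: "growth k \<beta> u"
 shows "wint k u"
proof -
 let ?D = "half_domain k"
 note um[measurable] = u(1)
 have [measurable]: "cball (0::'n kin) r \<in> sets borel" for r by auto
 \<comment> \<open>Radius 3 because scaling by 1 / R with R at least 1 maps the ball of radius R
   into the ball of radius 3.\<close>
 obtain C where C: "!!R. R \<ge> 1 ==> (\<integral>w. indicator (?D \<inter> cball 0 3) w * \<bar>u (kscale R w)\<bar> \<partial>lborel) <= C * R powr \<beta>"
  using g unfolding growth_def by blast
 have C0: "C \<ge> 0"
 proof -
  have "0 <= (\<integral>w. indicator (?D \<inter> cball 0 3) w * \<bar>u (kscale 1 w)\<bar> \<partial>lborel)" by (intro integral_nonneg_AE AE_I2) simp
  also have "\<dots> <= C * 1 powr \<beta>" by (rule C) simp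
  finally show ?thesis by simp
 qed
 define d where "d = 2 + 4 * CARD('n)"
 \<comment> \<open>Beats the growth exponent and the Jacobian of the scaling, with one power to
   spare for convergence.\<close>
 define N where "N = nat \<lceil>\<bar>\<beta>\<bar>\<rceil> + d + 1"
 define R where "R j = (2::real) ^ j" for j :: nat
 have R1: "R j \<ge> 1" for j by (simp add: R_def)
 have R0: "R j > 0" for j by (simp add: R_def)
 define a where "a j w = indicator (?D \<inter> cball 0 (R j)) w * \<bar>u w\<bar> * (2 / R j) ^ N" for j w
 have ai: "integrable lborel (a j)" for j
 proof -
  have "integrable lborel (%w. \<bar>indicator (?D \<inter> cball 0 (R j)) w * u w\<bar> * (2 / R j) ^ N)" by (intro integrable_mult_left integrable_abs u(2))
  then show ?thesis unfolding a_def[abs_def] by (simp add: abs_mult)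
 qed
 have an: "a j w \<ge> 0" for j w using R0[of j] by (simp add: a_def)
 have aint: "(\<integral>w. norm (a j w) \<partial>lborel) <= 2 ^ N * C * (1 / 2) ^ j" for j
 proof -
  have J: "0 < R j ^ d" using R0 by simp
  have m: "(%w. indicator ?D w * indicator (cball 0 3) (kscale (1 / R j) w) * \<bar>u w\<bar>) \<in> borel_measurable borel" by measurable
  have li: "integrable lborel (%w. indicator (?D \<inter> cball 0 3) w * \<bar>u (kscale (R j) w)\<bar>)"
   using integrable_abs[OF local_integrable_kscale[OF u R0, of 3 j]] by (simp add: abs_mult)
  have e: "indicator ?D (kscale (R j) w) * indicator (cball 0 3) (kscale (1 / R j) (kscale (R j) w)) * \<bar>u (kscale (R j) w)\<bar>
    = indicator (?D \<inter> cball 0 3) w * \<bar>u (kscale (R j) w)\<bar>" for w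
  proof -
   have "R j \<noteq> 0" using R0[of j] by simp
   then have "kscale (1 / R j) (kscale (R j) w) = w" by (simp add: kscale_kscale)
   then show ?thesis using kscale_half_domain[OF R0[of j], of w k] by (simp add: indicator_def)
  qed
  note vs = vol_scaling_kscale[OF R0[of j], where 'n='n, folded d_def]
  have i2: "integrable lborel (%w. indicator ?D w * indicator (cball 0 3) (kscale (1 / R j) w) * \<bar>u w\<bar>)"
   using vol_scaling_integral(2)[OF vs m] li unfolding e by blast
  have "(\<integral>w. indicator (?D \<inter> cball 0 (R j)) w * \<bar>u w\<bar> \<partial>lborel) <= (\<integral>w. indicator ?D w * indicator (cball 0 3) (kscale (1 / R j) w) * \<bar>u w\<bar> \<partial>lborel)"
  proof (rule integral_mono[OF _ i2])
   show "integrable lborel (%w. indicator (?D \<inter> cball 0 (R j)) w * \<bar>u w\<bar>)" using integrable_abs[OF u(2)[of "R j"]] by (simp add: abs_mult)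
   fix w :: "'n kin"
   have "kscale (1 / R j) w \<in> cball 0 3" if "norm w <= R j"
   proof -
    have "norm (kscale (1 / R j) w) <= 3 * (1 / R j) * norm w" using R1[of j] by (intro norm_kscale_small) auto
    also have "\<dots> <= 3 * (1 / R j) * R j" using that R0[of j] by (intro mult_left_mono) auto
    finally show ?thesis using R0[of j] by simp
   qed
   then show "indicator (?D \<inter> cball 0 (R j)) w * \<bar>u w\<bar> <= indicator ?D w * indicator (cball 0 3) (kscale (1 / R j) w) * \<bar>u w\<bar>"
    by (auto simp: indicator_def)
  qed
  also have "\<dots> = R j ^ d * (\<integral>w. indicator (?D \<inter> cball 0 3) w * \<bar>u (kscale (R j) w)\<bar> \<partial>lborel)"
   unfolding vol_scaling_integral(1)[OF vs m] e ..
  also have "\<dots> <= R j ^ d * (C * R j powr \<beta>)" using J by (intro mult_left_mono C R1) auto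
  also have "\<dots> <= R j ^ d * (C * R j ^ nat \<lceil>\<bar>\<beta>\<bar>\<rceil>)"
  proof -
   have "R j powr \<beta> <= R j powr real (nat \<lceil>\<bar>\<beta>\<bar>\<rceil>)" using R1[of j] by (intro powr_mono) (auto, linarith)
   also have "\<dots> = R j ^ nat \<lceil>\<bar>\<beta>\<bar>\<rceil>" using R0[of j] by (rule powr_realpow)
   finally show ?thesis using J C0 by (intro mult_left_mono) auto
  qed
  finally have b: "(\<integral>w. indicator (?D \<inter> cball 0 (R j)) w * \<bar>u w\<bar> \<partial>lborel) <= R j ^ d * (C * R j ^ nat \<lceil>\<bar>\<beta>\<bar>\<rceil>)" .
  have "(\<integral>w. norm (a j w) \<partial>lborel) = (\<integral>w. indicator (?D \<inter> cball 0 (R j)) w * \<bar>u w\<bar> * (2 / R j) ^ N \<partial>lborel)"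
   using an[of j] by (simp add: a_def)
  also have "\<dots> = (\<integral>w. indicator (?D \<inter> cball 0 (R j)) w * \<bar>u w\<bar> \<partial>lborel) * (2 / R j) ^ N" by (rule integral_mult_left_zero)
  also have "\<dots> <= R j ^ d * (C * R j ^ nat \<lceil>\<bar>\<beta>\<bar>\<rceil>) * (2 / R j) ^ N" using R0[of j] by (intro mult_right_mono b) auto
  also have "\<dots> = 2 ^ N * C * (R j ^ (nat \<lceil>\<bar>\<beta>\<bar>\<rceil> + d) / R j ^ N)" by (simp add: power_divide power_add)
  also have "R j ^ (nat \<lceil>\<bar>\<beta>\<bar>\<rceil> + d) / R j ^ N = 1 / R j" using R0[of j] by (simp add: N_def)
  also have "1 / R j = (1 / 2) ^ j" by (simp add: R_def power_one_over)
  finally show ?thesis .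
 qed
 have geo: "summable (%j. c * (1 / 2) ^ j)" for c :: real by (intro summable_mult summable_geometric) simp
 have sa: "summable (%j. norm (a j w))" for w
 proof (rule summable_comparison_test'[OF geo[of "\<bar>u w\<bar> * 2 ^ N"], of 0])
  fix j :: nat
  have "(2 / R j) ^ N <= 2 ^ N * (1 / 2) ^ j"
  proof -
   have "R j ^ 1 <= R j ^ N" using R1[of j] by (intro power_increasing) (auto simp: N_def)
   then have "1 / R j ^ N <= 1 / R j" using R0[of j] by (intro divide_left_mono) auto
   then have "2 ^ N * (1 / R j ^ N) <= 2 ^ N * (1 / R j)" by (rule mult_left_mono) simp
   then show ?thesis by (simp add: power_divide R_def power_one_over)
  qed
  then have "indicator (?D \<inter> cball 0 (R j)) w * \<bar>u w\<bar> * (2 / R j) ^ N <= 1 * \<bar>u w\<bar> * (2 ^ N * (1 / 2) ^ j)"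
   using R0[of j] by (intro mult_mono) (auto simp: indicator_def)
  then show "norm (norm (a j w)) <= \<bar>u w\<bar> * 2 ^ N * (1 / 2) ^ j" using an[of j w] by (simp add: a_def mult.assoc)
 qed
 have si: "summable (%j. \<integral>w. norm (a j w) \<partial>lborel)"
  by (rule summable_comparison_test'[OF geo[of "2 ^ N * C"], of 0]) (use aint in simp)
 have int: "integrable lborel (%w. \<Sum>j. a j w)"
  by (rule integrable_suminf[OF ai _ si]) (use sa in simp)
 have "integrable lborel (%w. indicator ?D w * (u w / (1 + norm w) ^ N))"
 proof (rule Bochner_Integration.integrable_bound[OF int])
  show "(%w. indicator ?D w * (u w / (1 + norm w) ^ N)) \<in> borel_measurable lborel" by measurable
  have "norm (indicator ?D w * (u w / (1 + norm w) ^ N)) <= norm (\<Sum>j. a j w)" for w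
  proof (cases "w \<in> ?D")
   case True
   \<comment> \<open>The dyadic index for which 2^j lies between 1 + norm w and twice that; this
     single term already dominates the weighted function.\<close>
   define j where "j = nat \<lceil>log 2 (1 + norm w)\<rceil>"
   have p: "1 + norm w > 0" by (intro add_pos_nonneg) auto
   have l0: "log 2 (1 + norm w) \<ge> 0" by (subst zero_le_log_cancel_iff) (use p in auto)
   have pl: "2 powr log 2 (1 + norm w) = 1 + norm w" by (rule powr_log_cancel) (use p in auto)
   have j1: "log 2 (1 + norm w) <= real j" unfolding j_def by (rule real_nat_ceiling_ge)
   have "0 <= \<lceil>log 2 (1 + norm w)\<rceil>" by (rule order_trans[OF _ ceiling_mono[OF l0]]) simp
   then have "real j = of_int \<lceil>log 2 (1 + norm w)\<rceil>" by (simp only: j_def of_nat_nat)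
   then have j2: "real j <= log 2 (1 + norm w) + 1" using ceiling_correct[of "log 2 (1 + norm w)"] by linarith
   have "2 powr log 2 (1 + norm w) <= 2 powr real j" using j1 by (intro powr_mono) auto
   then have r1: "1 + norm w <= R j" unfolding pl by (simp add: R_def powr_realpow)
   have "2 powr real j <= 2 powr (log 2 (1 + norm w) + 1)" using j2 by (intro powr_mono) auto
   then have r2: "R j <= 2 * (1 + norm w)" unfolding powr_add pl by (simp add: R_def powr_realpow)
   have g: "2 / (2 * x) = 1 / x" for x :: real by simp
   have "2 / (2 * (1 + norm w)) <= 2 / R j" by (rule divide_left_mono[OF r2 _ mult_pos_pos]) (use p R0[of j] in auto)
   then have "1 / (1 + norm w) <= 2 / R j" unfolding g .
   then have "(1 / (1 + norm w)) ^ N <= (2 / R j) ^ N" using p by (intro power_mono) auto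
   then have "\<bar>u w\<bar> * (1 / (1 + norm w)) ^ N <= \<bar>u w\<bar> * (2 / R j) ^ N" by (rule mult_left_mono) simp
   also have "\<dots> = a j w" using True r1 by (simp add: a_def)
   also have "\<dots> = (\<Sum>i\<in>{j}. a i w)" by simp
   also have "\<dots> <= (\<Sum>j. a j w)" by (rule sum_le_suminf[OF summable_norm_cancel[OF sa]]) (use an in auto)
   finally have "\<bar>u w\<bar> * (1 / (1 + norm w)) ^ N <= \<bar>\<Sum>j. a j w\<bar>" by (rule order_trans[OF _ abs_ge_self])
   moreover have "norm (indicator ?D w * (u w / (1 + norm w) ^ N)) = \<bar>u w\<bar> * (1 / (1 + norm w)) ^ N"
   proof -
    have q: "\<bar>x / a ^ N\<bar> = \<bar>x\<bar> * (1 / a) ^ N" if "a > 0" for a x :: real using that by (simp add: abs_divide power_one_over)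
    have ind: "indicator ?D w = (1::real)" using True by simp
    show ?thesis unfolding ind mult_1_left real_norm_def by (rule q[OF p])
   qed
   ultimately show ?thesis by (simp only: real_norm_def)
  qed simp
  then show "AE w in lborel. norm (indicator ?D w * (u w / (1 + norm w) ^ N)) <= norm (\<Sum>j. a j w)" by (rule AE_I2)
 qed
 then show ?thesis unfolding wint_def by blast
qed

lemma AE_lebesgue: "(AE w in lebesgue. P w) \<longleftrightarrow> (AE w in lborel. P w)" for P :: "'a::euclidean_space => bool"
 by (rule AE_completion_iff)

lemma powr_le_one_plus: "x powr a <= 1 + x" if "0 <= x" "0 <= a" "a <= 1" for x a :: real
proof (cases "x <= 1")
 case True
 then have "x powr a <= 1 powr a" using that by (intro powr_mono2) auto
 then show ?thesis using that by simp
next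
 case False
 then have "x powr a <= x powr 1" using that by (intro powr_mono) auto
 then show ?thesis using False by simp
qed

lemma scaled_powr: "(R ^ n * y) powr (1 / real n) = R * y powr (1 / real n)" if "R > 0" "y \<ge> 0" "n > 0" for R y :: real
proof -
 have "(R ^ n) powr (1 / real n) = (R powr real n) powr (1 / real n)" using that by (simp only: powr_realpow)
 also have "\<dots> = R" using that by (simp add: powr_powr)
 finally show ?thesis using that by (simp add: powr_mult)
qed

text \<open>The gauge in the growth condition is homogeneous of degree 1 apart from its constant 1,
  so for R at least 1 scaling multiplies it by at most R, and its power \<beta> by at most
  R^\<beta>.\<close>

lemma growth_bound_growth:
 fixes u :: "'n::finite kin => real"
 assumes gb: "growth_bound k \<beta> f" and \<beta>: "\<beta> \<ge> 0" and d: "dist_sol k p u" and ae: "AE w in lborel. xk k w > 0 --> u w = f w"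
 shows "growth k \<beta> u"
 unfolding growth_def
proof (intro allI)
 fix \<rho> :: real
 let ?D = "half_domain k"
 note [measurable] = dist_solD(1)[OF d]
 have [measurable]: "cball (0::'n kin) r \<in> sets borel" for r by auto
 define kn where "kn w = 1 + \<bar>fst w\<bar> powr (1/2) + norm (fst (snd w)) powr (1/3) + norm (snd (snd w))" for w :: "'n kin"
 obtain C where "AE (t, x, v) in lebesgue. x $ k > 0 -->
    \<bar>f (t, x, v)\<bar> <= C * (1 + \<bar>t\<bar> powr (1/2) + norm x powr (1/3) + norm v) powr \<beta>" using gb unfolding growth_bound_def by blast
 then have "AE w in lborel. xk k w > 0 --> \<bar>f w\<bar> <= C * kn w powr \<beta>"
  unfolding AE_lebesgue by eventually_elim (simp add: kn_def xk_def split: prod.splits)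
 then have C: "AE w in lborel. xk k w > 0 --> \<bar>u w\<bar> <= C * kn w powr \<beta>"
  using ae by eventually_elim simp
 have kn0: "kn w \<ge> 0" for w by (simp add: kn_def)
 have kn1: "kn w <= 4 * (1 + norm w)" for w :: "'n kin"
  using powr_le_one_plus[of "\<bar>fst w\<bar>" "1/2"] powr_le_one_plus[of "norm (fst (snd w))" "1/3"] norm_kin_ge[of w] norm_ge_zero[of w]
  unfolding kn_def by simp
 have kn2: "kn (kscale R w) <= R * kn w" if R: "R \<ge> 1" for R w
 proof -
  have R0: "R > 0" using R by simp
  have k: "kscale R w = (R\<^sup>2 * fst w, R ^ 3 *\<^sub>R fst (snd w), R *\<^sub>R snd (snd w))" by (cases w) (simp add: kscale_def)
  have "\<bar>R\<^sup>2 * fst w\<bar> = R ^ 2 * \<bar>fst w\<bar>" "norm (R ^ 3 *\<^sub>R fst (snd w)) = R ^ 3 * norm (fst (snd w))" "norm (R *\<^sub>R snd (snd w)) = R * norm (snd (snd w))"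
   using R0 by (simp_all add: abs_mult)
  then have "kn (kscale R w) = 1 + (R ^ 2 * \<bar>fst w\<bar>) powr (1 / real 2) + (R ^ 3 * norm (fst (snd w))) powr (1 / real 3) + R * norm (snd (snd w))"
   unfolding kn_def k by (simp only: fst_conv snd_conv of_nat_numeral)
  also have "\<dots> = 1 + R * \<bar>fst w\<bar> powr (1 / real 2) + R * norm (fst (snd w)) powr (1 / real 3) + R * norm (snd (snd w))"
   using scaled_powr[OF R0, of "\<bar>fst w\<bar>" 2] scaled_powr[OF R0, of "norm (fst (snd w))" 3] by simp
  also have "\<dots> <= R * kn w" using R by (simp add: kn_def algebra_simps)
  finally show ?thesis .
 qed
 define c where "c = \<bar>C\<bar> * (4 * (1 + \<bar>\<rho>\<bar>)) powr \<beta>"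
 have "(\<integral>w. indicator (?D \<inter> cball 0 \<rho>) w * \<bar>u (kscale R w)\<bar> \<partial>lborel) <= (measure lborel (?D \<inter> cball (0::'n kin) \<rho>) * c) * R powr \<beta>" if R: "R \<ge> 1" for R
 proof -
  have R0: "R > 0" using R by simp
  have fin: "emeasure lborel (?D \<inter> cball (0::'n kin) \<rho>) < \<infinity>"
   by (rule emeasure_bounded_finite) (rule bounded_subset[OF bounded_cball], auto)
  have i1: "integrable lborel (%w. indicator (?D \<inter> cball 0 \<rho>) w * \<bar>u (kscale R w)\<bar>)"
   using integrable_abs[OF local_integrable_kscale[OF dist_solD[OF d] R0, of \<rho>]] by (simp add: abs_mult)
  have i2: "integrable lborel (%w::'n kin. indicator (?D \<inter> cball 0 \<rho>) w * (c * R powr \<beta>))"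
   by (rule integrable_mult_left) (use fin in \<open>auto intro!: integrable_real_indicator\<close>)
  have "AE w in lborel. xk k (kscale R w) > 0 --> \<bar>u (kscale R w)\<bar> <= C * kn (kscale R w) powr \<beta>"
   by (rule vol_scaling_AE[OF vol_scaling_kscale[OF R0] C])
  then have "AE w in lborel. indicator (?D \<inter> cball 0 \<rho>) w * \<bar>u (kscale R w)\<bar> <= indicator (?D \<inter> cball 0 \<rho>) w * (c * R powr \<beta>)"
  proof eventually_elim
   case (elim w)
   show ?case
   proof (cases "w \<in> ?D \<inter> cball 0 \<rho>")
    case True
    then have "xk k (kscale R w) > 0" using R0 by (simp add: half_domain_xk xk_kscale)
    then have "\<bar>u (kscale R w)\<bar> <= C * kn (kscale R w) powr \<beta>" using elim by blast
    also have "\<dots> <= \<bar>C\<bar> * kn (kscale R w) powr \<beta>" by (intro mult_right_mono) auto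
    also have "\<dots> <= \<bar>C\<bar> * (4 * (1 + \<bar>\<rho>\<bar>) * R) powr \<beta>"
    proof (intro mult_left_mono powr_mono2 \<beta> kn0)
     have "norm w <= \<rho>" using True by simp
     then have "norm w <= \<bar>\<rho>\<bar>" by (rule order_trans[OF _ abs_ge_self])
     then have "4 * (1 + norm w) <= 4 * (1 + \<bar>\<rho>\<bar>)" by (intro mult_left_mono add_left_mono) simp_all
     then have "kn w <= 4 * (1 + \<bar>\<rho>\<bar>)" by (rule order_trans[OF kn1])
     then have "R * kn w <= R * (4 * (1 + \<bar>\<rho>\<bar>))" using R0 by (intro mult_left_mono) auto
     then show "kn (kscale R w) <= 4 * (1 + \<bar>\<rho>\<bar>) * R" using kn2[OF R, of w] by (simp only: mult.commute) 
    qed simp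
    also have "\<dots> = c * R powr \<beta>" using R0 by (simp add: c_def powr_mult)
    finally show ?thesis using True by simp
   qed simp
  qed
  from integral_mono_AE[OF i1 i2 this]
  have "(\<integral>w. indicator (?D \<inter> cball 0 \<rho>) w * \<bar>u (kscale R w)\<bar> \<partial>lborel) <= integral\<^sup>L lborel (%w::'n kin. indicator (?D \<inter> cball 0 \<rho>) w * (c * R powr \<beta>))" .
  also have "\<dots> = (measure lborel (?D \<inter> cball (0::'n kin) \<rho>) * c) * R powr \<beta>" by simp
  finally show ?thesis .
 qed
 then show "\<exists>C. \<forall>R\<ge>1. (\<integral>w. indicator (?D \<inter> cball 0 \<rho>) w * \<bar>u (kscale R w)\<bar> \<partial>lborel) <= C * R powr \<beta>" by blast
qed

text \<open>Homogeneity makes the scaled local L1 norm exactly R^5 times the unscaled one. No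
  pointwise bound is needed, which matters for an arbitrary homogeneous profile.\<close>

lemma homogeneous_growth:
 fixes u :: "'n::finite kin => real"
 assumes d: "dist_sol k p u" and ae: "AE w in lborel. xk k w > 0 --> u w = F w"
  and hom: "!!r w. r > 0 ==> xk k w > 0 ==> F (kscale r w) = r ^ 5 * F w"
 shows "growth k 5 u"
 unfolding growth_def
proof (intro allI)
 fix \<rho> :: real
 let ?D = "half_domain k"
 note [measurable] = dist_solD(1)[OF d]
 have [measurable]: "cball (0::'n kin) r \<in> sets borel" for r by auto
 define C where "C = (\<integral>w. indicator (?D \<inter> cball 0 \<rho>) w * \<bar>u w\<bar> \<partial>lborel)"
 have "(\<integral>w. indicator (?D \<inter> cball 0 \<rho>) w * \<bar>u (kscale R w)\<bar> \<partial>lborel) <= C * R powr 5" if R: "R \<ge> 1" for R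
 proof -
  have R0: "R > 0" using R by simp
  have a: "AE w in lborel. xk k (kscale R w) > 0 --> u (kscale R w) = F (kscale R w)"
   by (rule vol_scaling_AE[OF vol_scaling_kscale[OF R0] ae])
  have "AE w in lborel. indicator (?D \<inter> cball 0 \<rho>) w * \<bar>u (kscale R w)\<bar> = R ^ 5 * (indicator (?D \<inter> cball 0 \<rho>) w * \<bar>u w\<bar>)"
   using a ae
  proof eventually_elim
   case (elim w)
   show ?case
   proof (cases "w \<in> ?D \<inter> cball 0 \<rho>")
    case True
    then have x: "xk k w > 0" by (simp add: half_domain_xk)
    then have "u (kscale R w) = R ^ 5 * u w" using elim hom[OF R0 x] R0 by (simp add: xk_kscale)
    then show ?thesis using True R0 by (simp add: abs_mult)
   qed simp
  qed
  then have "(\<integral>w. indicator (?D \<inter> cball 0 \<rho>) w * \<bar>u (kscale R w)\<bar> \<partial>lborel) = (\<integral>w. R ^ 5 * (indicator (?D \<inter> cball 0 \<rho>) w * \<bar>u w\<bar>) \<partial>lborel)"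
   by (rule integral_cong_AE[rotated 2]) measurable
  also have "\<dots> = C * R powr 5" using R0 by (simp add: C_def mult.commute)
  finally show ?thesis by simp
 qed
 then show "\<exists>C. \<forall>R\<ge>1. (\<integral>w. indicator (?D \<inter> cball 0 \<rho>) w * \<bar>u (kscale R w)\<bar> \<partial>lborel) <= C * R powr 5" by blast
qed

section \<open>The representation of solutions\<close>

definition Tk :: "'n::finite => 'n kin => real" where "Tk k w = Tric (fst (snd w) $ k) (snd (snd w) $ k)"

lemma Tk_classical:
 obtains X V H where "classical (Tk k) (%_. 0) X V H" "!!w. xk k w > 0 ==> kop (%_. 0) X H w = Jinf * xk k w"
proof -
 have e: "(%(t, x, v). Tric (x $ k) (v $ k)) = Tk k" by (auto simp: Tk_def)
 let ?X = "%(t::real, x::real^'a, v::real^'a). axis k (Tx (x $ k) (v $ k)) :: real^'a" 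
 let ?H = "%(t::real, x::real^'a, v::real^'a). axis k (Tvv (x $ k) (v $ k)) :: real^'a"
 have s: "(\<Sum>i\<in>UNIV. axis k a $ i) = a" for a :: real by (simp add: axis_def)
 have "kop (%_. 0) ?X ?H w = Jinf * xk k w" if "xk k w > 0" for w
  using that Tric_pde[of "xk k w" "snd (snd w) $ k"] by (cases w) (simp add: kop_def s inner_axis xk_def)
 then show ?thesis using that classical_Tric[of k, unfolded e] by blast
qed

lemma Tk_boundary: "xk k w = 0 ==> Tk k (vrefl k w) = Tk k w"
 using Tric_even[of 0 "snd (snd w) $ k"] by (cases w) (simp add: Tk_def vrefl_def xk_def reflect_def)

lemma Tk_weak_solution: "weak_solution k (%w. Jinf * xk k w) (Tk k)"
proof -
 obtain X V H where c: "classical (Tk k) (%_. 0) X V H" "!!w. xk k w > 0 ==> kop (%_. 0) X H w = Jinf * xk k w"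
  using Tk_classical by blast
 show ?thesis by (rule classical_weak_solution[OF c(1)]) (simp_all add: c(2) Tk_boundary)
qed

lemma Tk_kscale: "r > 0 ==> Tk k (kscale r w) = r ^ 5 * Tk k w"
 using Tric_homogeneous[of r "fst (snd w) $ k" "snd (snd w) $ k"] by (cases w) (simp add: Tk_def kscale_def)

lemma polynomial_continuous: "real_polynomial_function p ==> continuous_on S p" for p :: "'a::euclidean_space => real"
 by (intro continuous_on_polymonial_function) (simp add: real_polynomial_function_eq)

lemma polynomial_xk: "real_polynomial_function (%w. c * xk k w)"
 unfolding xk_def by (intro polynomial_intros)

text \<open>The growth hypothesis speaks about every Borel representative that solves the equation,
  so that one statement serves both the solutions of the theorem and competing homogeneous profiles,
  for which no pointwise bound is assumed.\<close>

lemma representation: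
 fixes f :: "'n::finite kin => real"
 assumes w: "weak_solution k p f" and p: "real_polynomial_function p"
  and g: "!!u. dist_sol k p u ==> (AE w in lborel. xk k w > 0 --> u w = f w) ==> growth k \<beta> u" and b: "\<beta> <= 5"
 shows "\<exists>q c. real_polynomial_function q \<and> (AE w in lborel. xk k w > 0 --> f w = q w + c * Tk k w) \<and> (\<beta> < 5 --> c = 0)"
proof -
 obtain u where u: "dist_sol k p u" "AE w in lborel. xk k w > 0 --> u w = f w"
  using weak_solution_dist[OF w polynomial_continuous[OF p]] unfolding AE_lebesgue by blast
 have gu: "growth k \<beta> u" by (rule g[OF u])
 obtain L where L: "!!c l. (c, l) \<in> set L ==> set l \<subseteq> Basis" "p = lincomb L" using polynomial_lincombE[OF p] by metis
 \<comment> \<open>The monomials that growth allows: degree at most \<beta> - 2, hence at most 3,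
   and at most 2 when \<beta> < 5. The right-hand side agrees with this part in the
   half-domain.\<close>
 define L' where "L' = filter (%(c, l). real (wsum l) + 2 <= \<beta>) L"
 have pL: "p w = lincomb L' w" if "w \<in> half_domain k" for w
  unfolding L'_def using dist_sol_degree[OF u(1)[unfolded L(2)] L(1) gu that] L(2) by simp
 have L1: "!!c l. (c, l) \<in> set L' ==> set l \<subseteq> Basis" using L(1) by (auto simp: L'_def)
 have L2: "wsum l <= 3" "\<beta> < 5 ==> wsum l <= 2" if "(c, l) \<in> set L'" for c l
 proof -
  have "real (wsum l) + 2 <= \<beta>" using that by (simp add: L'_def)
  then show "wsum l <= 3" "\<beta> < 5 ==> wsum l <= 2" using b by linarith+
 qed
 obtain c0 where c0: "solvable k (lincomb L') c0" "(\<forall>(c, l)\<in>set L'. wsum l <= 2) --> c0 = 0"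
 proof -
  have "\<exists>c. solvable k (lincomb L') c \<and> ((\<forall>(c, l)\<in>set L'. wsum l <= 2) --> c = 0)"
  proof (rule lincomb_solvable)
   show "set l \<subseteq> Basis" if "(c, l) \<in> set L'" for c l using L1[OF that] .
   show "wsum l <= 3" if "(c, l) \<in> set L'" for c l using L2(1)[OF that] .
  qed
  then show ?thesis using that by blast
 qed
 obtain q V where q: "csol q V (%w. lincomb L' w + c0 * xk k w)" "real_polynomial_function q" "!!w. xk k w = 0 ==> q (vrefl k w) = q w"
  using c0(1) unfolding solvable_def by blast
 obtain A X H where cq: "classical q A X V H" "!!w. kop A X H w = lincomb L' w + c0 * xk k w" using q(1) unfolding csol_def by blast
 obtain X' V' H' where cT: "classical (Tk k) (%_. 0) X' V' H'" "!!w. xk k w > 0 ==> kop (%_. 0) X' H' w = Jinf * xk k w"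
  using Tk_classical by blast
 \<comment> \<open>The profile has right-hand side \<open>Jinf * xk k w\<close>, so this multiple
   cancels the defect of the polynomial solution.\<close>
 define c1 where "c1 = - c0 / Jinf"
 have s: "weak_solution k (lincomb L') (%w. q w + c1 * Tk k w)"
 proof (rule classical_weak_solution[OF classical_add[OF cq(1) classical_cmult[OF cT(1), of c1]]])
  fix w :: "'n kin"
  show "q (vrefl k w) + c1 * Tk k (vrefl k w) = q w + c1 * Tk k w" if "xk k w = 0" using q(3)[OF that] Tk_boundary[OF that] by simp
  assume x: "xk k w > 0"
  have "kop (%w. A w + c1 * 0) (%w. X w + c1 *\<^sub>R X' w) (%w. H w + c1 *\<^sub>R H' w) w = kop A X H w + c1 * kop (%_. 0) X' H' w"
   by (simp add: kop_def inner_add_right sum.distrib sum_distrib_left algebra_simps)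
  also have "\<dots> = lincomb L' w + c0 * xk k w + c1 * (Jinf * xk k w)" unfolding cq(2) cT(2)[OF x] ..
  also have "\<dots> = lincomb L' w" using Jinf_pos by (simp add: c1_def)
  finally show "kop (%w. A w + c1 * 0) (%w. X w + c1 *\<^sub>R X' w) (%w. H w + c1 *\<^sub>R H' w) w = lincomb L' w" .
 qed
 obtain u' where u': "dist_sol k (lincomb L') u'" "AE w in lborel. xk k w > 0 --> u' w = q w + c1 * Tk k w"
  using weak_solution_dist[OF s polynomial_continuous[OF polynomial_lincomb]] unfolding AE_lebesgue by blast
 \<comment> \<open>The profile is homogeneous and solves the equation on its own, so its
   representative has growth of order 5 and hence weighted integrability; the latter passes to the
   particular solution.\<close>
 obtain uT where uT: "dist_sol k (%w. Jinf * xk k w) uT" "AE w in lborel. xk k w > 0 --> uT w = Tk k w"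
  using weak_solution_dist[OF Tk_weak_solution polynomial_continuous[OF polynomial_xk]] unfolding AE_lebesgue by blast
 have wT: "wint k uT" by (rule growth_wint[OF dist_solD[OF uT(1)] homogeneous_growth[OF uT Tk_kscale]])
 note qb = polynomial_borel[OF q(2)]
 have "wint k u'"
 proof (rule wint_AE[OF wint_lin[OF wint_polynomial[OF q(2)] wT qb dist_solD(1)[OF uT(1)]] _ dist_solD(1)[OF u'(1)]])
  show "(%w. q w + c1 * uT w) \<in> borel_measurable borel" using qb dist_solD(1)[OF uT(1)] by measurable
  show "AE w in lborel. xk k w > 0 --> q w + c1 * uT w = u' w" using u'(2) uT(2) by eventually_elim simp
 qed
 from wint_lin[OF growth_wint[OF dist_solD[OF u(1)] gu] this dist_solD(1)[OF u(1)] dist_solD(1)[OF u'(1)], of "- 1"]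
 have i: "wint k (%w. u w - u' w)" by simp
 have dd: "dist_sol k (%w. p w - lincomb L' w) (%w. u w - u' w)"
  by (rule dist_sol_diff[OF u(1) u'(1) polynomial_continuous[OF p] polynomial_continuous[OF polynomial_lincomb]])
 obtain q2 where q2: "real_polynomial_function q2" "AE w in lborel. xk k w > 0 --> u w - u' w = q2 w"
  using dist_sol_polynomial[OF dd _ i] pL by auto
 show ?thesis
 proof (intro exI conjI impI)
  show "real_polynomial_function (%w. q w + q2 w)" by (rule real_polynomial_function.intros(3)[OF q(2) q2(1)])
  show "AE w in lborel. xk k w > 0 --> f w = (q w + q2 w) + c1 * Tk k w" using q2(2) u(2) u'(2) by eventually_elim auto
  assume "\<beta> < 5"
  then have "\<forall>(c, l)\<in>set L'. wsum l <= 2" using L2(2) by blast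
  then show "c1 = 0" using c0(2) by (simp add: c1_def)
 qed
qed

section \<open>The profile is not a polynomial, and is unique\<close>

text \<open>An almost-everywhere equality of continuous functions holds everywhere in the open
  half-space and extends to its boundary, where the profile is a positive multiple of |v|^5 and so
  not a polynomial.\<close>

lemma Tric_not_polynomial:
 fixes k :: "'n::finite"
 assumes q: "real_polynomial_function q" and ae: "AE (x, v) in lebesgue. x $ k > 0 --> Tric (x $ k) (v $ k) = q (x, v)"
 shows False
proof -
 let ?T = "%z::(real^'n) \<times> (real^'n). Tric (fst z $ k) (snd z $ k)"
 have cT: "continuous_on UNIV ?T"
  using continuous_on_compose2[OF Tric_continuous(1), of UNIV "%z::(real^'n) \<times> (real^'n). (fst z $ k, snd z $ k)"]
  by (simp add: continuous_intros)
 note cq = polynomial_continuous[OF q, of UNIV]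
 let ?S = "{z::(real^'n) \<times> (real^'n). 0 < fst z $ k} \<inter> {z. ?T z \<noteq> q z}"
 have o: "open ?S" by (intro open_Int open_Collect_less open_Collect_neq cT cq continuous_intros)
 have "AE z in lborel. z \<notin> ?S" using ae unfolding AE_lebesgue by eventually_elim (simp split: prod.splits)
 then have "?S \<in> null_sets lborel" by (subst AE_iff_null_sets) (use o in \<open>auto intro: borel_open\<close>)
 then have "negligible ?S" by (simp add: negligible_iff_null_sets null_sets_completionI)
 then have "?S = {}" using open_not_negligible[OF o] by blast
 then have eq: "?T z = q z" if "0 < fst z $ k" for z using that by blast
 let ?a = "axis k 1 :: real^'n"
 define P where "P b = q (0, b *\<^sub>R ?a)" for b
 have PT: "P b = Tric 0 b" for b
 proof -
  have i: "(%m. 1 / real (Suc m)) \<longlonglongrightarrow> 0" using LIMSEQ_inverse_real_of_nat by (simp add: inverse_eq_divide)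
  have c1: "continuous_on UNIV (%e. q (e *\<^sub>R ?a, b *\<^sub>R ?a))" by (rule continuous_on_compose2[OF cq]) (auto intro!: continuous_intros)
  have c2: "continuous_on UNIV (%e. ?T (e *\<^sub>R ?a, b *\<^sub>R ?a))" by (rule continuous_on_compose2[OF cT]) (auto intro!: continuous_intros)
  have l1: "(%m. q ((1 / real (Suc m)) *\<^sub>R ?a, b *\<^sub>R ?a)) \<longlonglongrightarrow> q (0 *\<^sub>R ?a, b *\<^sub>R ?a)"
   by (rule continuous_on_tendsto_compose[OF c1 i]) auto
  have l2: "(%m. ?T ((1 / real (Suc m)) *\<^sub>R ?a, b *\<^sub>R ?a)) \<longlonglongrightarrow> ?T (0 *\<^sub>R ?a, b *\<^sub>R ?a)"
   by (rule continuous_on_tendsto_compose[OF c2 i]) auto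
  have e: "?T ((1 / real (Suc m)) *\<^sub>R ?a, b *\<^sub>R ?a) = q ((1 / real (Suc m)) *\<^sub>R ?a, b *\<^sub>R ?a)" for m by (rule eq) simp
  have "q (0 *\<^sub>R ?a, b *\<^sub>R ?a) = ?T (0 *\<^sub>R ?a, b *\<^sub>R ?a)" by (rule LIMSEQ_unique[OF l1 l2[unfolded e]])
  then show ?thesis by (simp add: P_def)
 qed
 have "bounded_linear (%b. (0 :: real^'n, b *\<^sub>R ?a))" by (intro bounded_linear_Pair bounded_linear_zero bounded_linear_scaleR_left)
 then have P: "real_polynomial_function P" unfolding P_def[abs_def] by (intro polynomial_compose[OF q] polynomial_function_bounded_linear)
 have "real_polynomial_function (%b. P b - Tric 0 1 * b ^ 5)"
  by (rule real_polynomial_function_diff[OF P real_polynomial_function.intros(4)[OF real_polynomial_function.intros(2)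
    real_polynomial_function_power[OF real_polynomial_function.intros(1)[OF bounded_linear_ident]]]])
 then obtain a n where an: "!!b. P b - Tric 0 1 * b ^ 5 = (\<Sum>i\<le>n. a i * b ^ i)"
  unfolding real_polynomial_function_iff_sum by meson
 \<comment> \<open>On the positive axis the trace is a multiple of b^5, so the polynomial P would
   equal that multiple everywhere; at b = - 1 the sign is wrong.\<close>
 have "P b - Tric 0 1 * b ^ 5 = 0" if "b > 0" for b using that PT[of b] Tric_at_0[of b] by simp
 then have "{0<..} \<subseteq> {b. (\<Sum>i\<le>n. a i * b ^ i) = 0}" unfolding an by blast
 then have "infinite {b. (\<Sum>i\<le>n. a i * b ^ i) = 0}" using infinite_Ioi infinite_super by blast
 then have "\<forall>i\<le>n. a i = 0" using polyfun_finite_roots[of a n] by blast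
 then have "P (- 1) - Tric 0 1 * (- 1) ^ 5 = 0" unfolding an by simp
 then show False using PT[of "- 1"] Tric_at_0[of "- 1"] Tric_0_pos by simp
qed

lemma homogeneous_profile_Tric: "homogeneous_profile k (%x v. Tric (x $ k) (v $ k))"
 unfolding homogeneous_profile_def
proof (intro conjI allI impI)
 show "\<not> (\<exists>q. real_polynomial_function q \<and> (AE (x, v) in lebesgue. x $ k > 0 --> Tric (x $ k) (v $ k) = q (x, v)))"
  using Tric_not_polynomial by blast
 have "(%(t, x, v). Tric (x $ k) (v $ k)) = Tk k" by (auto simp: Tk_def)
 then show "\<exists>p. real_polynomial_function p \<and> weak_solution k p (%(t, x, v). Tric (x $ k) (v $ k))"
  using Tk_weak_solution[of k] polynomial_xk[of Jinf k] by auto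
 fix r :: real and x v :: "real^'a" assume "r > 0"
 then show "Tric ((r ^ 3 *\<^sub>R x) $ k) ((r *\<^sub>R v) $ k) = r ^ 5 * Tric (x $ k) (v $ k)" using Tric_homogeneous by simp
qed

text \<open>Homogeneity of degree 5 supplies the growth needed for the representation with \<beta> =
  5. Its coefficient cannot vanish, since the competing profile is not a polynomial.\<close>

lemma profile_unique:
 fixes k :: "'n::finite"
 assumes T': "homogeneous_profile k T'"
 shows "\<exists>c q. c \<noteq> 0 \<and> real_polynomial_function q \<and> (AE (x, v) in lebesgue. x $ k > 0 --> T' x v = c * Tric (x $ k) (v $ k) + q (x, v))"
proof -
 let ?F = "%(t::real, x, v). T' x v"
 obtain p where p: "real_polynomial_function p" "weak_solution k p ?F" using T' unfolding homogeneous_profile_def by blast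
 have hom: "?F (kscale r w) = r ^ 5 * ?F w" if "r > 0" "xk k w > 0" for r w
 proof -
  have h: "\<forall>r>0. \<forall>x v. x $ k > 0 --> T' (r ^ 3 *\<^sub>R x) (r *\<^sub>R v) = r ^ 5 * T' x v"
   using T' unfolding homogeneous_profile_def by (elim conjE)
  obtain t x v where w: "w = (t, x, v)" by (cases w) auto
  have "T' (r ^ 3 *\<^sub>R x) (r *\<^sub>R v) = r ^ 5 * T' x v" using h that by (simp add: w xk_def)
  then show ?thesis by (simp add: w kscale_def)
 qed
 have "\<exists>q c. real_polynomial_function q \<and> (AE w in lborel. xk k w > 0 --> ?F w = q w + c * Tk k w) \<and> (5 < (5::real) --> c = 0)"
 proof (rule representation[OF p(2,1)])
  fix u assume "dist_sol k p u" "AE w in lborel. xk k w > 0 --> u w = ?F w"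
  then show "growth k 5 u" by (rule homogeneous_growth) (rule hom)
 qed simp
 then obtain q c where q: "real_polynomial_function q" "AE w in lborel. xk k w > 0 --> ?F w = q w + c * Tk k w" by (elim exE conjE)
 \<comment> \<open>Neither profile depends on time, so by Fubini the polynomial can be frozen at a
   suitable time at which the identity holds for almost all (x, v).\<close>
 have ae: "AE t in lborel. AE z in lborel. xk k (t, z) > 0 --> ?F (t, z) = q (t, z) + c * Tk k (t, z)"
  by (rule lborel_pair.AE_pair) ((subst lborel_prod, rule q(2)) | (insert q(2), unfold lborel_prod, assumption))
 have nb: "ae_filter (lborel :: real measure) \<noteq> bot" by (simp add: ae_filter_eq_bot_iff)
 obtain t where t: "AE z in lborel. xk k (t, z) > 0 --> ?F (t, z) = q (t, z) + c * Tk k (t, z)"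
  using eventually_happens'[OF nb ae] by (elim exE)
 define Q where "Q z = q (t, z)" for z
 have "polynomial_function (%z::(real^'n) \<times> (real^'n). (t, 0) + (0::real, z))"
  by (intro polynomial_function_add polynomial_function_const polynomial_function_bounded_linear bounded_linear_Pair bounded_linear_zero bounded_linear_ident)
 then have Q: "real_polynomial_function Q" unfolding Q_def[abs_def] using polynomial_compose[OF q(1)] by simp
 have ae: "AE (x, v) in lebesgue. x $ k > 0 --> T' x v = c * Tric (x $ k) (v $ k) + Q (x, v)"
  unfolding AE_lebesgue using t by eventually_elim (auto simp: xk_def Tk_def Q_def)
 moreover have "c \<noteq> 0"
 proof
  assume "c = 0"
  then have "AE (x, v) in lebesgue. x $ k > 0 --> T' x v = Q (x, v)" using ae by simp
  then show False using T' Q unfolding homogeneous_profile_def by blast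
 qed
 ultimately show ?thesis using Q by blast
qed

theorem theorem1p2:
  fixes k :: "'n::finite"
  shows "\<exists>T :: real^'n \<Rightarrow> real^'n \<Rightarrow> real.
    homogeneous_profile k T \<and>
    (\<forall>T'. homogeneous_profile k T' \<longrightarrow>
       (\<exists>c q. c \<noteq> 0 \<and> real_polynomial_function q \<and>
          (AE (x, v) in lebesgue. x $ k > 0 \<longrightarrow> T' x v = c * T x v + q (x, v)))) \<and>
    (\<forall>\<beta> p f. \<beta> \<ge> 0 \<and> real_polynomial_function p \<and> weak_solution k p f \<and> growth_bound k \<beta> f \<longrightarrow>
       (\<beta> < 5 \<longrightarrow>
          (\<exists>q. real_polynomial_function q \<and>
             (AE (t, x, v) in lebesgue. x $ k > 0 \<longrightarrow> f (t, x, v) = q (t, x, v)))) \<and>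
       (\<beta> = 5 \<longrightarrow>
          (\<exists>q c. real_polynomial_function q \<and>
             (AE (t, x, v) in lebesgue. x $ k > 0 \<longrightarrow>
                f (t, x, v) = q (t, x, v) + c * T x v))))"
proof (rule exI[of _ "%x v. Tric (x $ k) (v $ k)"], intro conjI allI impI homogeneous_profile_Tric profile_unique, assumption)
 fix \<beta> :: real and p f :: "'n kin => real"
 assume a: "\<beta> \<ge> 0 \<and> real_polynomial_function p \<and> weak_solution k p f \<and> growth_bound k \<beta> f"
 \<comment> \<open>Both growth ranges are covered by one representation: for \<beta> < 5 it also
   gives the coefficient 0.\<close>
 have rep: "\<exists>q c. real_polynomial_function q \<and> (AE w in lborel. xk k w > 0 --> f w = q w + c * Tk k w) \<and> (\<beta> < 5 --> c = 0)" if "\<beta> <= 5"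
 proof -
  have a': "\<beta> \<ge> 0" "real_polynomial_function p" "weak_solution k p f" "growth_bound k \<beta> f" using a by blast+
  show ?thesis
  proof (rule representation[OF a'(3,2) _ that])
   fix u assume "dist_sol k p u" "AE w in lborel. xk k w > 0 --> u w = f w"
   then show "growth k \<beta> u" by (rule growth_bound_growth[OF a'(4,1)])
  qed
 qed
 {
  assume b: "\<beta> < 5"
  then obtain q where q: "real_polynomial_function q" "AE w in lborel. xk k w > 0 --> f w = q w + 0 * Tk k w" using rep[OF less_imp_le[OF b]] by blast
  have "AE (t, x, v) in lebesgue. x $ k > 0 --> f (t, x, v) = q (t, x, v)"
   unfolding AE_lebesgue using q(2) by eventually_elim (auto simp: xk_def)
  then show "\<exists>q. real_polynomial_function q \<and> (AE (t, x, v) in lebesgue. x $ k > 0 --> f (t, x, v) = q (t, x, v))" using q(1) by blast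
 next
  assume b: "\<beta> = 5"
  then obtain q c where q: "real_polynomial_function q" "AE w in lborel. xk k w > 0 --> f w = q w + c * Tk k w" using rep[OF eq_refl[OF b]] by blast
  have "AE (t, x, v) in lebesgue. x $ k > 0 --> f (t, x, v) = q (t, x, v) + c * Tric (x $ k) (v $ k)"
   unfolding AE_lebesgue using q(2) by eventually_elim (auto simp: xk_def Tk_def)
  then show "\<exists>q c. real_polynomial_function q \<and> (AE (t, x, v) in lebesgue. x $ k > 0 --> f (t, x, v) = q (t, x, v) + c * Tric (x $ k) (v $ k))"
   using q(1) by blast
 }
qed

end
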